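(* Let $N^+_{\varphi}(x)=\#\{n\le x:\ n=k+\varphi(k)\text{ for some positive integer }k\}$. Then there exist constants $c>0$ and $x_0$ such that $N^+_\varphi(x)\ge cx$ for all $x\ge x_0$, and, as $x\to\infty$, $$N^+_{\varphi}(x)\ \le\ \left(\frac12+\int_0^1\frac{\Phi(t)\,dt}{(1+t)^2}+o(1)\right)x.$$
   Context: $\varphi$ is Euler's totient function. For $\lambda\in[0,1]$ and $x\ge1$ let $\Phi_x(\lambda)=\frac1x\#\{k\le x:\ \varphi(k)/k\le\lambda\}$, and let $\Phi(\lambda)=\lim_{x\to\infty}\Phi_x(\lambda)$ (this limit is known to exist for every $\lambda\in[0,1]$, and $\Phi$ is increasing). *)

theory Defs
  imports
    "HOL-Number_Theory.Totient"
    "HOL-Analysis.Analysis"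
    "HOL-Library.Landau_Symbols"
begin

(* The positivity of k matters: 0 = 0 + totient 0 in the library's convention totient 0 = 0. *)
definition N_plus :: "real \<Rightarrow> nat" where
  "N_plus x = card {n::nat. real n \<le> x \<and> (\<exists>k::nat. 0 < k \<and> n = k + totient k)}"

definition Phi_upto :: "real \<Rightarrow> real \<Rightarrow> real" where
  "Phi_upto x u =
     real (card {k::nat. 0 < k \<and> real k \<le> x \<and> real (totient k) / real k \<le> u}) / x"

(* The limit exists for every u in [0,1] by Schoenberg's theorem on the distribution of
   totient k / k; this is not built into the definition, since Lim is a total operator. *)
definition Phi :: "real \<Rightarrow> real" where
  "Phi u = Lim at_top (\<lambda>x. Phi_upto x u)"

end

theory Submission
  imports Defs "HOL-Number_Theory.Cong" "HOL-Computational_Algebra.Squarefree"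
begin

text \<open>
For the lower bound put \<open>y = x^(1/1000)\<close> and consider the integers \<open>k = p q r s\<close> with \<open>s \<le> y\<close>
squarefree and \<open>r\<close>, \<open>q\<close>, \<open>p\<close> primes in \<open>(y^20, y^30]\<close>, \<open>(y^200, y^300]\<close> and \<open>(y^332, x/(2qrs)]\<close>.
There are at least a constant times \<open>x\<close> of them, and for \<open>m = q r s\<close> the value
\<open>k + \<phi>(k) = p (m + \<phi>(m)) - \<phi>(m)\<close> is linear in \<open>p\<close>. By Cauchy--Schwarz it suffices to show that
\<open>O(x)\<close> pairs share a value. For fixed \<open>m \<noteq> m'\<close> Selberg's sieve in dimension two bounds the number of
pairs \<open>(p, p')\<close> by \<open>x / (ln x)^2\<close> times \<open>gcd(m + \<phi>(m), m' + \<phi>(m')) / (m m')\<close> and a product over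
small primes. Averaging over \<open>q, q'\<close> and then over \<open>r, r'\<close>, with upper bounds for primes in residue
classes as the only input, removes the gcd up to factors depending on \<open>s, s'\<close>. The remaining sum over
\<open>s, s'\<close> is \<open>O((ln y)^2)\<close>: a prime dividing both \<open>\<phi>(s)\<close> and \<open>\<phi>(s')\<close> divides \<open>s\<close> if and only if it
divides \<open>s'\<close>, and this condition lets one sum the Euler factors one prime at a time, starting from the
smallest.

For the upper bound, \<open>k + \<phi>(k) \<le> x\<close> says that \<open>\<phi>(k)/k \<le> x/k - 1\<close>. Cutting the range of \<open>k\<close> according
to the size of \<open>x/k - 1\<close> turns the count into a Riemann sum for \<open>1/2 + \<integral> \<Phi>(t)/(1 + t)^2 dt\<close>. The
distribution functions converge off a countable set because the mean of a Lipschitz function of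
\<open>\<phi>(k)/k\<close> changes little when \<open>\<phi>(k)/k\<close> is replaced by its periodic truncation to primes at most \<open>z\<close>.
\<close>

section \<open>Selberg's sieve\<close>

text \<open>The logarithms decide the shape. For given \<open>m\<close> there are at least a
  multiple of \<open>x / (m ln x)\<close> primes \<open>p\<close>; the reciprocals of
  \<open>q\<close> and \<open>r\<close> have sums bounded below by constants, those of
  \<open>s\<close> a sum of order \<open>ln y\<close>. So the tuples number at least a multiple of
  \<open>x\<close>. For pairs the sieve saves \<open>(ln x)^2\<close>, and the sum over
  \<open>s\<close>, \<open>s'\<close> may cost exactly as much. The obstacle is the gcd factor. What
  divides both \<open>r s\<close> and its totient divides the value for every \<open>q\<close>, and
  the other common divisors divide a quantity \<open>Delta\<close> free of \<open>q\<close>,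
  \<open>q'\<close>. After the average over \<open>q\<close>, \<open>q'\<close> a product over
  primes of \<open>Delta\<close> is left, which nothing controls for given \<open>s\<close>,
  \<open>s'\<close>. This is the purpose of the second prime \<open>r\<close>: \<open>Delta\<close>
  is quadratic in \<open>r\<close>, so it can be averaged as well. When \<open>r s = r' s'\<close>
  the quantity \<open>Delta\<close> vanishes. These pairs are bounded crudely with the loss of a
  power of \<open>y\<close>, which the sum of \<open>1 / r^2\<close>, of order
  \<open>y^(-20)\<close>, recovers.\<close>

lemma sum_alternating_between:
  assumes "finite K" "N \<subseteq> K"
  shows "(\<Sum>D | N \<subseteq> D \<and> D \<subseteq> K. (-1 :: real) ^ card D) = (if N = K then (-1) ^ card K else 0)"
proof -
  have fin: "finite N" using assms finite_subset by auto
  have "(\<Sum>D | N \<subseteq> D \<and> D \<subseteq> K. (-1 :: real) ^ card D) = (\<Sum>E\<in>Pow (K - N). (-1) ^ (card N + card E))"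
  proof (rule sum.reindex_bij_witness[of _ "\<lambda>E. N \<union> E" "\<lambda>D. D - N"])
    fix D assume D: "D \<in> {D. N \<subseteq> D \<and> D \<subseteq> K}"
    then have "finite D" using assms finite_subset by auto
    then have "card N + card (D - N) = card D" using D fin
      by (metis (mono_tags, lifting) card_Diff_subset card_mono le_add_diff_inverse mem_Collect_eq)
    then show "(- 1 :: real) ^ (card N + card (D - N)) = (- 1) ^ card D" by simp
  qed (use assms in auto)
  also have "\<dots> = (-1) ^ card N * (\<Sum>E\<in>Pow (K - N). (-1) ^ card E)"
    by (simp add: power_add sum_distrib_left)
  also have "(\<Sum>E\<in>Pow (K - N). (-1 :: real) ^ card E) = (\<Prod>x\<in>K - N. 1 - 1)"
    using prod_diff_conv_sum[of "K - N" "\<lambda>_. 1 :: real" "\<lambda>_. 1"] assms by simp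
  also have "\<dots> = (if N = K then 1 else 0)" using assms by auto
  finally show ?thesis by auto
qed

text \<open>Squarefree moduli appear as finite sets of primes, with union for the lcm and
  \<open>\<D>\<close> for the moduli below the level. The weights are those that minimise Selberg's
  quadratic form; what is recorded is the value \<open>1 / L\<close> of the form and a crude bound
  on the weights.\<close>

lemma selberg_weights:
  fixes \<rho> :: "'a \<Rightarrow> real"
  assumes finP: "finite P" and \<rho>: "\<And>l. l \<in> P \<Longrightarrow> 0 < \<rho> l \<and> \<rho> l < 1"
    and sub: "\<D> \<subseteq> Pow P" and empty: "{} \<in> \<D>"
    and down: "\<And>D E. D \<in> \<D> \<Longrightarrow> E \<subseteq> D \<Longrightarrow> E \<in> \<D>"
  defines "L \<equiv> \<Sum>D\<in>\<D>. \<Prod>l\<in>D. \<rho> l / (1 - \<rho> l)"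
  shows "\<exists>w. w {} = 1 \<and> (\<forall>D\<in>\<D>. \<bar>w D\<bar> \<le> 1 / (\<Prod>l\<in>D. \<rho> l)) \<and>
     (\<Sum>D\<in>\<D>. \<Sum>E\<in>\<D>. w D * w E * (\<Prod>l\<in>D \<union> E. \<rho> l)) = 1 / L"
proof -
  define h where "h D = (\<Prod>l\<in>D. \<rho> l / (1 - \<rho> l))" for D
  define r where "r D = (\<Prod>l\<in>D. \<rho> l)" for D
  have fin\<D>: "finite \<D>" using finP sub by (meson finite_Pow_iff finite_subset)
  have finD: "finite D" if "D \<in> \<D>" for D using that sub finP by (meson PowD finite_subset subsetD)
  have inP: "l \<in> P" if "D \<in> \<D>" "l \<in> D" for D l using that sub by auto
  have hpos: "h D > 0" if "D \<in> \<D>" for D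
    unfolding h_def using \<rho> inP[OF that] by (intro prod_pos) auto
  have rpos: "r D > 0" if "D \<in> \<D>" for D
    unfolding r_def using \<rho> inP[OF that] by (intro prod_pos) auto
  have L: "L = (\<Sum>D\<in>\<D>. h D)" by (simp add: L_def h_def)
  have "h {} \<le> L" unfolding L using hpos by (intro member_le_sum fin\<D> empty) (auto intro: less_imp_le)
  then have Lpos: "L > 0" by (simp add: h_def)
  \<comment> \<open>Up to sign and the factor \<open>r D\<close>, the weight at \<open>D\<close> is
    the share of \<open>L\<close> carried by the members of \<open>\<D>\<close> containing
    \<open>D\<close>. This gives \<open>lam {} = 1\<close> and the bound \<open>1 / r D\<close> at
    once.\<close>
  define S where "S D = (\<Sum>K | K \<in> \<D> \<and> D \<subseteq> K. h K)" for D
  define lam where "lam D = (-1) ^ card D / r D / L * S D" for D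
  have S_empty: "S {} = L" by (simp add: S_def L)
  have lam_empty: "lam {} = 1" using Lpos by (simp add: lam_def S_empty r_def)
  have S_le: "0 \<le> S D" "S D \<le> L" for D
    unfolding S_def L using hpos fin\<D> by (auto intro!: sum_nonneg sum_mono2 simp: less_imp_le)
  have bound: "\<bar>lam D\<bar> \<le> 1 / r D" if "D \<in> \<D>" for D
  proof -
    have "\<bar>lam D\<bar> = S D / L / r D"
      using rpos[OF that] Lpos S_le[of D] by (simp add: lam_def abs_mult)
    also have "\<dots> \<le> 1 / r D"
      using rpos[OF that] Lpos S_le[of D] by (intro divide_right_mono) auto
    finally show ?thesis .
  qed
  \<comment> \<open>Writing \<open>1 / r\<close> of an intersection as a sum over its subsets
    separates \<open>D\<close> from \<open>E\<close> and turns the form into a sum of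
    squares.\<close>
  have inv: "1 / r K = (\<Sum>N\<in>Pow K. 1 / h N)" if "K \<in> \<D>" for K
  proof -
    have "(\<Sum>N\<in>Pow K. 1 / h N) = (\<Sum>N\<in>Pow K. (\<Prod>l\<in>N. (1 - \<rho> l) / \<rho> l) * (\<Prod>l\<in>K-N. 1))"
      unfolding h_def by (intro sum.cong refl) (simp add: prod_dividef)
    also have "\<dots> = (\<Prod>l\<in>K. (1 - \<rho> l) / \<rho> l + 1)"
      by (subst prod_add) (use finD[OF that] in auto)
    also have "\<dots> = (\<Prod>l\<in>K. 1 / \<rho> l)"
      using \<rho> inP[OF that] by (intro prod.cong refl) (simp add: field_simps less_imp_neq[THEN not_sym])
    finally show ?thesis by (simp add: r_def prod_dividef)
  qed
  have union: "r (D \<union> E) = r D * r E * (1 / r (D \<inter> E))" if "D \<in> \<D>" "E \<in> \<D>" for D E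
  proof -
    have "r (D \<union> E) * r (D \<inter> E) = r D * r E"
      unfolding r_def using finD that by (simp add: prod.union_inter)
    moreover have "r (D \<inter> E) > 0" by (rule rpos) (use down that in blast)
    ultimately show ?thesis by (simp add: field_simps)
  qed
  \<comment> \<open>The coordinates in which the form is diagonal. Inserting \<open>lam\<close> and
    exchanging the sums leaves an alternating sum between \<open>N\<close> and \<open>K\<close>,
    which vanishes unless \<open>N = K\<close>.\<close>
  define y where "y N = (\<Sum>D | D \<in> \<D> \<and> N \<subseteq> D. lam D * r D)" for N
  have yN: "y N = (-1) ^ card N * h N / L" if N: "N \<in> \<D>" for N
  proof -
    have "y N = (\<Sum>D | D \<in> \<D> \<and> N \<subseteq> D. \<Sum>K | K \<in> \<D> \<and> D \<subseteq> K. (-1) ^ card D * h K / L)"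
      unfolding y_def
    proof (intro sum.cong refl)
      fix D assume "D \<in> {D \<in> \<D>. N \<subseteq> D}"
      then have "r D > 0" using rpos by auto
      then show "lam D * r D = (\<Sum>K | K \<in> \<D> \<and> D \<subseteq> K. (-1) ^ card D * h K / L)"
        by (simp add: lam_def flip: sum_divide_distrib sum_distrib_left S_def)
    qed
    also have "\<dots> = (\<Sum>K\<in>\<D>. \<Sum>D | D \<in> {D \<in> \<D>. N \<subseteq> D} \<and> D \<subseteq> K. (-1) ^ card D * h K / L)"
      using sum.swap_restrict[of "{D \<in> \<D>. N \<subseteq> D}" \<D> "\<lambda>D K. (-1) ^ card D * h K / L" "\<lambda>D K. D \<subseteq> K"] fin\<D>
      by simp
    also have "\<dots> = (\<Sum>K\<in>\<D>. if N = K then (-1) ^ card K * h K / L else 0)"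
    proof (rule sum.cong[OF refl])
      fix K assume K: "K \<in> \<D>"
      have eq: "{D. D \<in> {D \<in> \<D>. N \<subseteq> D} \<and> D \<subseteq> K} = {D. N \<subseteq> D \<and> D \<subseteq> K}" using down K by auto
      show "(\<Sum>D | D \<in> {D \<in> \<D>. N \<subseteq> D} \<and> D \<subseteq> K. (-1) ^ card D * h K / L) = (if N = K then (-1) ^ card K * h K / L else 0)"
      proof (cases "N \<subseteq> K")
        case True
        have "(\<Sum>D | N \<subseteq> D \<and> D \<subseteq> K. (-1) ^ card D * h K / L) = (\<Sum>D | N \<subseteq> D \<and> D \<subseteq> K. (-1) ^ card D) * h K / L"
          by (simp add: sum_distrib_right sum_divide_distrib)
        then show ?thesis unfolding eq using sum_alternating_between[OF finD[OF K] True] by auto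
      next
        case False
        then have "{D. N \<subseteq> D \<and> D \<subseteq> K} = {}" "N \<noteq> K" by auto
        then show ?thesis unfolding eq by (simp only: sum.empty if_False)
      qed
    qed
    also have "\<dots> = (-1) ^ card N * h N / L" using N fin\<D> by simp
    finally show ?thesis .
  qed
  have "(\<Sum>D\<in>\<D>. \<Sum>E\<in>\<D>. lam D * lam E * r (D \<union> E)) =
     (\<Sum>D\<in>\<D>. \<Sum>E\<in>\<D>. \<Sum>N | N \<in> \<D> \<and> N \<subseteq> D \<and> N \<subseteq> E. (lam D * r D) * (lam E * r E) / h N)"
  proof (intro sum.cong refl)
    fix D E assume DE: "D \<in> \<D>" "E \<in> \<D>"
    have "D \<inter> E \<in> \<D>" using down DE by blast
    moreover have "{N. N \<in> \<D> \<and> N \<subseteq> D \<and> N \<subseteq> E} = Pow (D \<inter> E)" using down DE by auto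
    ultimately show "lam D * lam E * r (D \<union> E) = (\<Sum>N | N \<in> \<D> \<and> N \<subseteq> D \<and> N \<subseteq> E. (lam D * r D) * (lam E * r E) / h N)"
      using union[OF DE] inv by (simp add: sum_distrib_left mult_ac)
  qed
  also have "\<dots> = (\<Sum>D\<in>\<D>. \<Sum>E\<in>\<D>. \<Sum>N\<in>\<D>. if N \<subseteq> D \<and> N \<subseteq> E then (lam D * r D) * (lam E * r E) / h N else 0)"
    by (rule sum.cong[OF refl], rule sum.cong[OF refl], rule sum.inter_filter[OF fin\<D>])
  also have "\<dots> = (\<Sum>D\<in>\<D>. \<Sum>N\<in>\<D>. \<Sum>E\<in>\<D>. if N \<subseteq> D \<and> N \<subseteq> E then (lam D * r D) * (lam E * r E) / h N else 0)"
    by (rule sum.cong[OF refl], rule sum.swap)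
  also have "\<dots> = (\<Sum>N\<in>\<D>. \<Sum>D\<in>\<D>. \<Sum>E\<in>\<D>. if N \<subseteq> D \<and> N \<subseteq> E then (lam D * r D) * (lam E * r E) / h N else 0)"
    by (rule sum.swap)
  also have "\<dots> = (\<Sum>N\<in>\<D>. y N * y N / h N)"
  proof (intro sum.cong refl)
    fix N
    have yy: "y N = (\<Sum>D\<in>\<D>. if N \<subseteq> D then lam D * r D else 0)"
      unfolding y_def using fin\<D> by (simp add: sum.If_cases Int_def)
    show "(\<Sum>D\<in>\<D>. \<Sum>E\<in>\<D>. if N \<subseteq> D \<and> N \<subseteq> E then (lam D * r D) * (lam E * r E) / h N else 0) = y N * y N / h N"
      unfolding yy sum_product sum_divide_distrib by (intro sum.cong refl) auto
  qed
  also have "\<dots> = (\<Sum>N\<in>\<D>. h N / L\<^sup>2)"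
  proof (intro sum.cong refl)
    fix N assume N: "N \<in> \<D>"
    have "((-1) ^ card N :: real) * (-1) ^ card N = 1" by (simp flip: power_mult_distrib)
    then have "y N * y N = h N * h N / L\<^sup>2"
      unfolding yN[OF N] by (simp add: power2_eq_square mult_ac)
    then show "y N * y N / h N = h N / L\<^sup>2"
      using hpos[OF N] by simp
  qed
  also have "\<dots> = 1 / L" using Lpos by (simp add: L[symmetric] power2_eq_square flip: sum_divide_distrib)
  finally show ?thesis using lam_empty bound unfolding r_def by (intro exI[of _ lam]) auto
qed

section \<open>Periodic counts and the Chinese remainder theorem\<close>

lemma periodic_count_add:
  fixes P :: "nat \<Rightarrow> bool"
  assumes "\<And>t. P (t + Q) = P t"
  shows "card {t. t < Q + M \<and> P t} = card {t. t < Q \<and> P t} + card {t. t < M \<and> P t}"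
proof -
  have "{t. t < Q + M \<and> P t} = {t. t < Q \<and> P t} \<union> (\<lambda>t. t + Q) ` {t. t < M \<and> P t}" (is "?A = ?B \<union> ?C")
  proof (intro equalityI subsetI)
    fix t assume t: "t \<in> ?A"
    show "t \<in> ?B \<union> ?C"
    proof (cases "t < Q")
      case False
      then have "t = (t - Q) + Q" "t - Q < M" "P (t - Q)" using t assms[of "t - Q"] by auto
      then show ?thesis by blast
    qed (use t in auto)
  qed (use assms in auto)
  moreover have "card (?B \<union> ?C) = card ?B + card ?C" by (intro card_Un_disjoint) auto
  moreover have "card ?C = card {t. t < M \<and> P t}" by (intro card_image) auto
  ultimately show ?thesis by simp
qed

lemma periodic_count_mult:
  fixes P :: "nat \<Rightarrow> bool"
  assumes "\<And>t. P (t + Q) = P t"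
  shows "card {t. t < a * Q + b \<and> P t} = a * card {t. t < Q \<and> P t} + card {t. t < b \<and> P t}"
proof (induction a)
  case (Suc a)
  show ?case using periodic_count_add[of P Q "a * Q + b", OF assms] Suc by (simp add: add.assoc)
qed simp

lemma card_filter_less_le: "card {t::nat. t < b \<and> P t} \<le> b"
  using card_mono[of "{..<b}" "{t. t < b \<and> P t}"] by auto

lemma periodic_count_approx:
  fixes P :: "nat \<Rightarrow> bool"
  assumes "\<And>t. P (t + Q) = P t" "Q > 0"
  shows "\<bar>real (card {t. t < N \<and> P t}) - real N * real (card {t. t < Q \<and> P t}) / real Q\<bar> \<le> real Q"
proof -
  define a b where "a = N div Q" and "b = N mod Q"
  define c where "c = card {t. t < Q \<and> P t}"
  have N: "N = a * Q + b" and b: "b < Q" using assms by (auto simp: a_def b_def)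
  have "c \<le> Q" unfolding c_def by (rule card_filter_less_le)
  have fb: "card {t. t < b \<and> P t} \<le> b" by (rule card_filter_less_le)
  have "real (card {t. t < N \<and> P t}) - real N * real c / real Q = real (card {t. t < b \<and> P t}) - real b * (real c / real Q)"
    unfolding N periodic_count_mult[of P, OF assms(1)] c_def[symmetric] using assms(2) by (simp add: field_simps)
  moreover have "real b * (real c / real Q) \<le> real b * 1"
    using \<open>c \<le> Q\<close> assms(2) by (intro mult_left_mono) auto
  moreover have "real b * (real c / real Q) \<ge> 0" by simp
  ultimately show ?thesis using fb b unfolding c_def by linarith
qed

lemma coprime_prod_prime_distinct:
  fixes U :: "nat set"
  assumes "\<And>l. l \<in> U \<Longrightarrow> prime l" "prime q" "q \<notin> U"
  shows "coprime q (\<Prod>U)"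
  using assms by (intro prod_coprime_right) (metis primes_coprime)

lemma count_residue_classes:
  fixes U :: "nat set"
  assumes fin: "finite U" and pr: "\<And>l. l \<in> U \<Longrightarrow> prime l" and \<Omega>: "\<And>l. l \<in> U \<Longrightarrow> \<Omega> l \<subseteq> {..<l}"
  shows "card {t. t < \<Prod>U \<and> (\<forall>l\<in>U. t mod l \<in> \<Omega> l)} = (\<Prod>l\<in>U. card (\<Omega> l))"
proof -
  let ?S = "{t. t < \<Prod>U \<and> (\<forall>l\<in>U. t mod l \<in> \<Omega> l)}"
  have cop: "\<forall>i\<in>U. \<forall>j\<in>U. i \<noteq> j \<longrightarrow> coprime i j" using pr primes_coprime by blast
  have nz: "\<forall>i\<in>U. i \<noteq> 0" using pr by (metis not_prime_0)
  have "bij_betw (\<lambda>t. \<lambda>l\<in>U. t mod l) ?S (Pi\<^sub>E U \<Omega>)"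
  proof (rule bij_betwI')
    fix t t' assume t: "t \<in> ?S" and t': "t' \<in> ?S"
    show "((\<lambda>l\<in>U. t mod l) = (\<lambda>l\<in>U. t' mod l)) = (t = t')"
    proof
      assume "(\<lambda>l\<in>U. t mod l) = (\<lambda>l\<in>U. t' mod l)"
      then have eq: "t mod l = t' mod l" if "l \<in> U" for l using that by (metis restrict_apply)
      have "\<exists>!x. x < (\<Prod>i\<in>U. i) \<and> (\<forall>i\<in>U. [x = t] (mod i))"
        by (rule chinese_remainder_unique_nat[OF fin nz cop])
      moreover have "\<forall>i\<in>U. [t' = t] (mod i)" by (intro ballI) (simp add: Cong.cong_def eq)
      ultimately show "t = t'" using t t' by auto
    qed simp
  next
    fix t assume "t \<in> ?S" then show "(\<lambda>l\<in>U. t mod l) \<in> Pi\<^sub>E U \<Omega>" by auto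
  next
    fix f assume f: "f \<in> Pi\<^sub>E U \<Omega>"
    obtain x where x: "x < (\<Prod>i\<in>U. i)" "\<forall>i\<in>U. [x = f i] (mod i)"
      using chinese_remainder_unique_nat[OF fin nz cop, of f] by auto
    have xm: "x mod i = f i" if "i \<in> U" for i
    proof -
      have "f i < i" using f \<Omega>[OF that] that by auto
      then show ?thesis using x that by (simp add: Cong.cong_def)
    qed
    then have "f = (\<lambda>l\<in>U. x mod l)" using f by (intro PiE_ext[of f U \<Omega>]) (auto simp: PiE_iff)
    moreover have "x \<in> ?S" using x xm f by (auto simp: PiE_iff)
    ultimately show "\<exists>x\<in>?S. f = (\<lambda>l\<in>U. x mod l)" by blast
  qed
  then have "card ?S = card (Pi\<^sub>E U \<Omega>)" by (rule bij_betw_same_card)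
  then show ?thesis using fin by (simp add: card_PiE)
qed

lemma sum_if_const_card:
  "(\<Sum>t<N. if P t then a else 0) = a * real (card {t. t < (N::nat) \<and> P t})"
proof -
  have "(\<Sum>t<N. if P t then a else 0) = (\<Sum>t\<in>{t. t < N \<and> P t}. a)"
    by (rule sum.mono_neutral_cong_right) auto
  then show ?thesis by simp
qed

lemma sum_sum_affine:
  fixes N K :: real
  shows "(\<Sum>D\<in>A. \<Sum>E\<in>A. N * q D E + K) =
    N * (\<Sum>D\<in>A. \<Sum>E\<in>A. q D E) + real (card A) * (real (card A) * K)"
  by (simp add: sum.distrib sum_distrib_left)

text \<open>On \<open>T\<close> only the empty set contributes to the weighted count, whose square
  is then 1; elsewhere the square is nonnegative. The error \<open>R ^ 6\<close> consists of
  \<open>R ^ 2\<close> each for the number of pairs of moduli, the product of two weights and the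
  period of a pair.\<close>

theorem selberg_sieve:
  fixes P :: "nat set" and R :: nat
  assumes finP: "finite P" and pr: "\<And>l. l \<in> P \<Longrightarrow> prime l" and R: "R \<ge> 1"
    and \<Omega>: "\<And>l. l \<in> P \<Longrightarrow> \<Omega> l \<subseteq> {..<l} \<and> 1 \<le> card (\<Omega> l) \<and> card (\<Omega> l) < l"
    and T: "T \<subseteq> {..<N}" and avoid: "\<And>t l. t \<in> T \<Longrightarrow> l \<in> P \<Longrightarrow> t mod l \<notin> \<Omega> l"
  defines "L \<equiv> \<Sum>D | D \<subseteq> P \<and> \<Prod>D \<le> R. \<Prod>l\<in>D. real (card (\<Omega> l)) / (real l - real (card (\<Omega> l)))"
  shows "real (card T) \<le> real N / L + real R ^ 6"
proof -
  define \<D> where "\<D> = {D. D \<subseteq> P \<and> \<Prod>D \<le> R}"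
  define \<rho> where "\<rho> l = real (card (\<Omega> l)) / real l" for l
  have \<rho>: "0 < \<rho> l \<and> \<rho> l < 1" if "l \<in> P" for l
    using \<Omega>[OF that] prime_gt_0_nat[OF pr[OF that]] by (auto simp: \<rho>_def)
  have fin\<D>: "finite \<D>" unfolding \<D>_def using finP by auto
  have finD: "finite D" if "D \<in> \<D>" for D using that finP finite_subset by (auto simp: \<D>_def)
  have primeD: "prime l" if "D \<in> \<D>" "l \<in> D" for D l using that pr by (auto simp: \<D>_def)
  have prod_inj: "inj_on (\<lambda>D. \<Prod>D) \<D>"
  proof (rule inj_onI)
    fix D E assume DE: "D \<in> \<D>" "E \<in> \<D>" "\<Prod>D = \<Prod>E"
    have "prime_factors (\<Prod>D) = D" if "D \<in> \<D>" for D
      using that finD primeD by (subst prime_factors_prod) (auto simp: prime_prime_factors dest: prime_gt_0_nat)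
    then show "D = E" using DE by metis
  qed
  have prodpos: "\<Prod>D > 0" if "D \<in> \<D>" for D
    using primeD[OF that] by (intro prod_pos) (auto simp: prime_gt_0_nat)
  have card\<D>: "card \<D> \<le> R"
  proof -
    have "card \<D> = card ((\<lambda>D. \<Prod>D) ` \<D>)" by (rule card_image[OF prod_inj, symmetric])
    also have "(\<lambda>D. \<Prod>D) ` \<D> \<subseteq> {1..R}" using prodpos by (auto simp: \<D>_def Suc_le_eq)
    then have "card ((\<lambda>D. \<Prod>D) ` \<D>) \<le> card {1..R}" by (intro card_mono) auto
    finally show ?thesis by simp
  qed
  have down: "E \<in> \<D>" if "D \<in> \<D>" "E \<subseteq> D" for D E
  proof -
    have "\<Prod>E dvd \<Prod>D" using that finD by (intro prod_dvd_prod_subset) auto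
    then have "\<Prod>E \<le> \<Prod>D" using prodpos[OF that(1)] by (rule dvd_imp_le)
    then show ?thesis using that by (auto simp: \<D>_def)
  qed
  have L_eq: "L = (\<Sum>D\<in>\<D>. \<Prod>l\<in>D. \<rho> l / (1 - \<rho> l))"
    unfolding L_def \<D>_def[symmetric]
  proof (intro sum.cong prod.cong refl)
    fix D l assume "D \<in> \<D>" "l \<in> D"
    then have "l > 0" using primeD prime_gt_0_nat by blast
    then show "real (card (\<Omega> l)) / (real l - real (card (\<Omega> l))) = \<rho> l / (1 - \<rho> l)"
      by (simp add: \<rho>_def field_simps)
  qed
  obtain lam where lam0: "lam {} = (1::real)" and lam_le: "\<And>D. D \<in> \<D> \<Longrightarrow> \<bar>lam D\<bar> \<le> 1 / (\<Prod>l\<in>D. \<rho> l)"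
    and quad: "(\<Sum>D\<in>\<D>. \<Sum>E\<in>\<D>. lam D * lam E * (\<Prod>l\<in>D \<union> E. \<rho> l)) = 1 / L"
  proof -
    have "\<exists>w. w {} = 1 \<and> (\<forall>D\<in>\<D>. \<bar>w D\<bar> \<le> 1 / (\<Prod>l\<in>D. \<rho> l)) \<and>
        (\<Sum>D\<in>\<D>. \<Sum>E\<in>\<D>. w D * w E * (\<Prod>l\<in>D \<union> E. \<rho> l)) = 1 / L"
      unfolding L_eq
    proof (rule selberg_weights[OF finP])
      show "\<D> \<subseteq> Pow P" "{} \<in> \<D>" using R by (auto simp: \<D>_def)
    qed (fact \<rho> down)+
    then obtain w where w: "w {} = 1"
        "\<forall>D\<in>\<D>. \<bar>w D\<bar> \<le> 1 / (\<Prod>l\<in>D. \<rho> l)"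
        "(\<Sum>D\<in>\<D>. \<Sum>E\<in>\<D>. w D * w E * (\<Prod>l\<in>D \<union> E. \<rho> l)) = 1 / L"
      by (elim exE conjE)
    show thesis by (rule that[OF w(1) bspec[OF w(2)] w(3)])
  qed
  \<comment> \<open>Each \<open>\<Omega> l\<close> is nonempty, so \<open>1 / \<rho> l\<close> is at
    most \<open>l\<close> and the product at most \<open>\<Prod>D\<close>.\<close>
  have lamR: "\<bar>lam D\<bar> \<le> R" if D: "D \<in> \<D>" for D
  proof -
    have "1 / (\<Prod>l\<in>D. \<rho> l) = (\<Prod>l\<in>D. 1 / \<rho> l)" by (simp add: prod_dividef)
    also have "\<dots> \<le> (\<Prod>l\<in>D. real l)"
    proof (intro prod_mono conjI)
      fix l assume l: "l \<in> D"
      then have "card (\<Omega> l) \<ge> 1" "l \<in> P" using \<Omega> D by (auto simp: \<D>_def)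
      then show "1 / \<rho> l \<le> real l" "0 \<le> 1 / \<rho> l" by (auto simp: \<rho>_def divide_le_eq mult_le_cancel_left1)
    qed
    also have "\<dots> = real (\<Prod>D)" by simp
    also have "real (\<Prod>D) \<le> real R"
    proof (rule of_nat_mono)
      show "\<Prod>D \<le> R" using D by (simp add: \<D>_def)
    qed
    finally show ?thesis using lam_le[OF D] by simp
  qed
  define c where "c D t \<longleftrightarrow> (\<forall>l\<in>D. t mod l \<in> \<Omega> l)" for D t
  have cU: "c D t \<and> c E t \<longleftrightarrow> c (D \<union> E) t" for D E t by (auto simp: c_def)
  have count: "\<bar>real (card {t. t < N \<and> c (D \<union> E) t}) - real N * (\<Prod>l\<in>D \<union> E. \<rho> l)\<bar> \<le> real R ^ 2"
    if DE: "D \<in> \<D>" "E \<in> \<D>" for D E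
  proof -
    define Q where "Q = \<Prod>(D \<union> E)"
    have finU: "finite (D \<union> E)" using finD DE by auto
    have prU: "prime l" if "l \<in> D \<union> E" for l using that primeD DE by blast
    have Qpos: "Q > 0" unfolding Q_def using prU by (intro prod_pos) (auto simp: prime_gt_0_nat)
    have "c (D \<union> E) (t + Q) = c (D \<union> E) t" for t
    proof -
      have "(t + Q) mod l = t mod l" if "l \<in> D \<union> E" for l
      proof -
        have "l dvd Q" unfolding Q_def using finU that by (rule dvd_prodI)
        then show ?thesis by (metis mod_add_right_eq dvd_imp_mod_0 add_0_right)
      qed
      then show ?thesis unfolding c_def by auto
    qed
    from periodic_count_approx[of "c (D \<union> E)", OF this Qpos]
    have "\<bar>real (card {t. t < N \<and> c (D \<union> E) t}) - real N * real (card {t. t < Q \<and> c (D \<union> E) t}) / real Q\<bar> \<le> real Q" .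
    moreover have "card {t. t < Q \<and> c (D \<union> E) t} = (\<Prod>l\<in>D \<union> E. card (\<Omega> l))"
      unfolding Q_def c_def using finU prU \<Omega> DE by (intro count_residue_classes) (auto simp: \<D>_def)
    then have "real N * real (card {t. t < Q \<and> c (D \<union> E) t}) / real Q = real N * (\<Prod>l\<in>D \<union> E. \<rho> l)"
      by (simp add: \<rho>_def Q_def prod_dividef)
    moreover have "real Q \<le> real R ^ 2"
    proof -
      have "Q * \<Prod>(D \<inter> E) = \<Prod>D * \<Prod>E" unfolding Q_def using finD DE by (simp add: prod.union_inter)
      then have "Q dvd \<Prod>D * \<Prod>E" by (intro dvdI) (rule sym)
      then have "Q \<le> \<Prod>D * \<Prod>E" using prodpos DE by (intro dvd_imp_le) auto
      also have "\<dots> \<le> R * R" using DE by (intro mult_mono) (auto simp: \<D>_def)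
      finally have "real Q \<le> real (R * R)" by (rule of_nat_mono)
      then show ?thesis by (simp add: power2_eq_square)
    qed
    ultimately show ?thesis by linarith
  qed
  have cT: "(\<Sum>D\<in>\<D>. if c D t then lam D else 0)\<^sup>2 = 1" if "t \<in> T" for t
  proof -
    have "c D t \<longleftrightarrow> D = {}" if "D \<in> \<D>" for D
    proof
      assume c: "c D t"
      show "D = {}"
      proof (rule ccontr)
        assume "D \<noteq> {}"
        then obtain l where "l \<in> D" by blast
        moreover from this have "l \<in> P" using \<open>D \<in> \<D>\<close> unfolding \<D>_def by blast
        ultimately show False using c avoid[OF \<open>t \<in> T\<close>] unfolding c_def by blast
      qed
    qed (simp add: c_def)
    then have "(\<Sum>D\<in>\<D>. if c D t then lam D else 0) = (\<Sum>D\<in>\<D>. if D = {} then lam D else 0)"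
      by (intro sum.cong) auto
    also have "\<dots> = 1" using fin\<D> lam0 R by (simp add: \<D>_def)
    finally show ?thesis by simp
  qed
  have "real (card T) = (\<Sum>t\<in>T. (\<Sum>D\<in>\<D>. if c D t then lam D else 0)\<^sup>2)" using cT by simp
  also have "\<dots> \<le> (\<Sum>t<N. (\<Sum>D\<in>\<D>. if c D t then lam D else 0)\<^sup>2)"
    using T by (intro sum_mono2) auto
  also have "\<dots> = (\<Sum>t<N. \<Sum>D\<in>\<D>. \<Sum>E\<in>\<D>. if c (D \<union> E) t then lam D * lam E else 0)"
    unfolding power2_eq_square sum_product by (intro sum.cong refl) (auto simp flip: cU)
  also have "\<dots> = (\<Sum>D\<in>\<D>. \<Sum>t<N. \<Sum>E\<in>\<D>. if c (D \<union> E) t then lam D * lam E else 0)"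
    by (rule sum.swap)
  also have "\<dots> = (\<Sum>D\<in>\<D>. \<Sum>E\<in>\<D>. \<Sum>t<N. if c (D \<union> E) t then lam D * lam E else 0)"
    by (rule sum.cong[OF refl], rule sum.swap)
  also have "\<dots> = (\<Sum>D\<in>\<D>. \<Sum>E\<in>\<D>. lam D * lam E * real (card {t. t < N \<and> c (D \<union> E) t}))"
    by (rule sum.cong[OF refl], rule sum.cong[OF refl], rule sum_if_const_card)
  also have "\<dots> \<le> (\<Sum>D\<in>\<D>. \<Sum>E\<in>\<D>. real N * (lam D * lam E * (\<Prod>l\<in>D \<union> E. \<rho> l)) + real R ^ 4)"
  proof (intro sum_mono)
    fix D E assume DE: "D \<in> \<D>" "E \<in> \<D>"
    let ?e = "real (card {t. t < N \<and> c (D \<union> E) t}) - real N * (\<Prod>l\<in>D \<union> E. \<rho> l)"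
    have "lam D * lam E * ?e \<le> \<bar>lam D\<bar> * \<bar>lam E\<bar> * \<bar>?e\<bar>"
      using abs_ge_self[of "lam D * lam E * ?e"] unfolding abs_mult .
    also have "\<dots> \<le> real R * real R * real R ^ 2"
      using lamR DE count[OF DE] by (intro mult_mono) auto
    also have "\<dots> = real R ^ 4" by (simp add: power2_eq_square power4_eq_xxxx mult.assoc)
    finally have "lam D * lam E * ?e \<le> real R ^ 4" .
    moreover have "lam D * lam E * real (card {t. t < N \<and> c (D \<union> E) t}) =
        real N * (lam D * lam E * (\<Prod>l\<in>D \<union> E. \<rho> l)) + lam D * lam E * ?e"
      unfolding right_diff_distrib by (simp only: mult.assoc mult.left_commute)
    ultimately show "lam D * lam E * real (card {t. t < N \<and> c (D \<union> E) t}) \<le> real N * (lam D * lam E * (\<Prod>l\<in>D \<union> E. \<rho> l)) + real R ^ 4"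
      by linarith
  qed
  also have "\<dots> = real N / L + real (card \<D>) * (real (card \<D>) * real R ^ 4)"
    unfolding sum_sum_affine quad by (simp only: mult_1_right times_divide_eq_right)
  also have "\<dots> \<le> real N / L + real R * (real R * real R ^ 4)"
    by (intro add_left_mono mult_mono order_refl) (simp_all add: card\<D>)
  also have "real R * (real R * real R ^ 4) = real R ^ 6"
    by (simp add: eval_nat_numeral)
  finally show ?thesis .
qed

section \<open>Sieve bounds in dimensions one and two\<close>

definition primes_upto :: "nat \<Rightarrow> nat set" where
  "primes_upto n = {p. prime p \<and> p \<le> n}"

text \<open>With sets of primes standing for squarefree integers this is a sum of reciprocals of
  integers, the usual lower bound for the quantity \<open>L\<close> of the sieve with one class per
  prime.\<close>

definition sqf_sum :: "nat set \<Rightarrow> nat \<Rightarrow> real" where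
  "sqf_sum P n = (\<Sum>U | U \<subseteq> P \<and> \<Prod>U \<le> n. 1 / real (\<Prod>U))"

lemma sum_le_inj:
  fixes g :: "'a \<Rightarrow> real"
  assumes "finite T" "inj_on f S" "\<And>x. x \<in> S \<Longrightarrow> f x \<in> T" "\<And>x. x \<in> S \<Longrightarrow> g x \<le> h (f x)" "\<And>t. t \<in> T \<Longrightarrow> h t \<ge> 0"
  shows "sum g S \<le> sum h T"
proof -
  have "sum g S \<le> sum (h \<circ> f) S" using assms(4) by (intro sum_mono) auto
  also have "\<dots> = sum h (f ` S)" using assms(2) by (simp add: sum.reindex)
  also have "\<dots> \<le> sum h T" using assms(1,3,5) by (intro sum_mono2) auto
  finally show ?thesis .
qed

lemma finite_primes_upto [simp]: "finite (primes_upto n)"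
  by (rule finite_subset[of _ "{..n}"]) (auto simp: primes_upto_def)

lemma prime_of_primes_upto: "p \<in> primes_upto n \<Longrightarrow> prime p"
  by (simp add: primes_upto_def)

lemma finite_subsets_bounded [simp]: "finite P \<Longrightarrow> finite {U. U \<subseteq> P \<and> Q U}"
  by (rule finite_subset[of _ "Pow P"]) auto

lemma prod_primes_pos: "(\<And>p. p \<in> U \<Longrightarrow> prime p) \<Longrightarrow> \<Prod>U > (0::nat)"
  by (intro prod_pos) (auto simp: prime_gt_0_nat)

lemma prime_factors_prod_primes:
  assumes "finite U" "\<And>p. p \<in> U \<Longrightarrow> prime (p::nat)"
  shows "prime_factors (\<Prod>U) = U"
proof -
  have "prime_factors (\<Prod>U) = \<Union>(prime_factors ` U)"
    using assms by (subst prime_factors_prod) (auto simp: dest: prime_gt_0_nat)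
  also have "\<dots> = \<Union>((\<lambda>p. {p}) ` U)"
    using assms by (intro SUP_cong refl) (simp add: prime_prime_factors)
  finally show ?thesis by auto
qed

lemma prod_prime_factors_squarefree:
  assumes "squarefree (n::nat)"
  shows "\<Prod>(prime_factors n) = n"
proof -
  have n: "n > 0" using assms by (auto intro!: Nat.gr0I)
  have "n = (\<Prod>p\<in>prime_factors n. p ^ multiplicity p n)" using n by (rule prime_factorization_nat)
  also have "\<dots> = (\<Prod>p\<in>prime_factors n. p)"
  proof (intro prod.cong refl)
    fix p assume p: "p \<in> prime_factors n"
    have "multiplicity p n \<le> 1"
      using assms p n squarefree_factorial_semiring''[of n] by (simp add: in_prime_factors_imp_prime)
    moreover have "multiplicity p n > 0" using p by (simp add: prime_factors_multiplicity)
    ultimately have "multiplicity p n = 1" by linarith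
    then show "p ^ multiplicity p n = p" by simp
  qed
  finally show ?thesis by simp
qed

lemma sum_inverse_squares_le: "(\<Sum>j=1..n. 1 / real j ^ 2) \<le> 2"
proof -
  have "(\<Sum>j=1..n. 1 / real j ^ 2) \<le> 2 - 1 / real n" if "n \<ge> 1" for n
    using that
  proof (induction n rule: nat_induct_at_least)
    case (Suc n)
    have n: "real n > 0" using Suc.hyps by simp
    have "1 / real (Suc n) ^ 2 \<le> 1 / (real n * real (Suc n))"
      unfolding power2_eq_square using n by (intro divide_left_mono mult_right_mono) auto
    also have "\<dots> = 1 / real n - 1 / real (Suc n)" using n by (simp add: divide_simps)
    finally show ?case using Suc.IH by simp
  qed simp
  note bound = this[of n]
  show ?thesis
  proof (cases "n \<ge> 1")
    case True
    have "1 / real n \<ge> 0" by simp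
    with bound[OF True] show ?thesis by linarith
  qed simp
qed

text \<open>Every \<open>k\<close> up to \<open>n\<close> is a squarefree number times a square, so
  the harmonic sum is at most \<open>sqf_sum P n\<close> times the sum of the inverse squares, which
  is at most 2.\<close>

lemma harm_le_sqf_sum:
  assumes "primes_upto n \<subseteq> P" "finite P" "\<And>p. p \<in> P \<Longrightarrow> prime p"
  shows "ln (real n + 1) \<le> 2 * sqf_sum P n"
proof -
  let ?U = "\<lambda>k::nat. prime_factors (squarefree_part k)"
  let ?I = "{U. U \<subseteq> P \<and> \<Prod>U \<le> n}"
  have inj: "inj_on (\<lambda>k. (?U k, square_part k)) {1..n}"
  proof (rule inj_onI)
    fix k l assume "(?U k, square_part k) = (?U l, square_part l)"
    then show "k = l"
      using prod_prime_factors_squarefree[OF squarefree_squarefree_part]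
      by (metis prod.inject squarefree_decomposition_unique)
  qed
  have pos: "\<Prod>U > 0" if "U \<in> ?I" for U using that assms(3) by (intro prod_primes_pos) auto
  have val: "1 / real k = 1 / real (\<Prod>(?U k)) * (1 / real (square_part k) ^ 2)" for k
  proof -
    have "real k = real (squarefree_part k) * real (square_part k) ^ 2"
      by (metis of_nat_mult of_nat_power squarefree_decompose)
    then show ?thesis by (simp add: prod_prime_factors_squarefree del: of_nat_prod)
  qed
  have mem: "?U k \<in> ?I \<and> square_part k \<in> {1..n}" if k: "k \<in> {1..n}" for k
  proof -
    have d: "squarefree_part k dvd k" by (metis dvd_triv_left squarefree_decompose)
    have k0: "k \<noteq> 0" using k by auto
    have le: "squarefree_part k \<le> n" using dvd_imp_le[OF d] k by auto
    have "square_part k dvd k" by (metis dvd_mult dvd_triv_left power2_eq_square squarefree_decompose)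
    then have "square_part k \<le> n" using dvd_imp_le[of "square_part k" k] k by auto
    moreover have "square_part k \<noteq> 0" using k0 by (metis square_part_0_iff)
    then have "square_part k \<ge> 1" by linarith
    moreover have "?U k \<subseteq> P"
    proof
      fix p assume "p \<in> ?U k"
      then have "prime p" "p dvd squarefree_part k" by auto
      then have "p \<le> squarefree_part k" using squarefree_part_nonzero[of k]
        by (meson dvd_imp_le gr0I)
      then have "p \<le> n" using le by linarith
      then show "p \<in> P" using assms(1) \<open>prime p\<close> by (auto simp: primes_upto_def)
    qed
    ultimately show ?thesis using le by (simp add: prod_prime_factors_squarefree)
  qed
  have "ln (real n + 1) \<le> harm n" by (rule ln_le_harm)
  also have "\<dots> = (\<Sum>k=1..n. 1 / real k)" by (simp add: harm_def inverse_eq_divide)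
  also have "\<dots> \<le> (\<Sum>(U, j)\<in>?I \<times> {1..n}. 1 / real (\<Prod>U) * (1 / real j ^ 2))"
  proof (rule sum_le_inj[OF _ inj])
    show "finite (?I \<times> {1..n})" using assms(2) by simp
    show "1 / real k \<le> (case (?U k, square_part k) of (U, j) \<Rightarrow> 1 / real (\<Prod>U) * (1 / real j ^ 2))" for k
      unfolding split_conv using val[of k] by (rule eq_refl)
    show "(?U k, square_part k) \<in> ?I \<times> {1..n}" if "k \<in> {1..n}" for k using mem[OF that] by blast
  qed (auto simp: prod_nonneg)
  also have "\<dots> = sqf_sum P n * (\<Sum>j=1..n. 1 / real j ^ 2)"
    by (simp add: sqf_sum_def sum_product sum.cartesian_product)
  also have "\<dots> \<le> sqf_sum P n * 2"
    using sum_inverse_squares_le by (intro mult_left_mono) (auto simp: sqf_sum_def intro!: sum_nonneg prod_nonneg)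
  finally show ?thesis by simp
qed

text \<open>A squarefree number splits into a part prime to \<open>D\<close> and a part made of
  primes of \<open>D\<close>; the reciprocals of the latter parts sum to the Euler product.\<close>

lemma sqf_sum_le_coprime:
  assumes "finite P" "\<And>p. p \<in> P \<Longrightarrow> prime p"
  shows "sqf_sum P n \<le> sqf_sum {p \<in> P. \<not> p dvd D} n * (\<Prod>p | p \<in> P \<and> p dvd D. 1 + 1 / real p)"
proof -
  let ?P' = "{p \<in> P. \<not> p dvd D}" and ?Q = "{p. p \<in> P \<and> p dvd D}"
  let ?I = "{U. U \<subseteq> P \<and> \<Prod>U \<le> n}" and ?J = "{U. U \<subseteq> ?P' \<and> \<Prod>U \<le> n}"
  have split: "U = (U \<inter> ?P') \<union> (U \<inter> ?Q)" if "U \<subseteq> P" for U using that by auto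
  have inj: "inj_on (\<lambda>U. (U \<inter> ?P', U \<inter> ?Q)) ?I"
    by (rule inj_onI) (metis (no_types, lifting) mem_Collect_eq prod.inject split)
  have prodsplit: "\<Prod>U = \<Prod>(U \<inter> ?P') * \<Prod>(U \<inter> ?Q)" if "U \<subseteq> P" for U
    by (subst split[OF that], rule prod.union_disjoint) (use that assms(1) finite_subset in auto)
  have mem: "U \<inter> ?P' \<in> ?J" if "U \<in> ?I" for U
  proof -
    have "\<Prod>(U \<inter> ?Q) > 0" "\<Prod>(U \<inter> ?P') > 0" using assms(2) by (auto intro!: prod_primes_pos)
    then have "\<Prod>(U \<inter> ?P') \<le> \<Prod>U" using prodsplit that by auto
    then show ?thesis using that by auto
  qed
  have "sqf_sum P n \<le> (\<Sum>(V, W)\<in>?J \<times> Pow ?Q. 1 / real (\<Prod>V) * (1 / real (\<Prod>W)))"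
    unfolding sqf_sum_def
  proof (rule sum_le_inj[OF _ inj])
    show "finite (?J \<times> Pow ?Q)" using assms(1) by simp
    show "(U \<inter> ?P', U \<inter> ?Q) \<in> ?J \<times> Pow ?Q" if "U \<in> ?I" for U using mem[OF that] by blast
    show "1 / real (\<Prod>U) \<le> (case (U \<inter> ?P', U \<inter> ?Q) of (V, W) \<Rightarrow> 1 / real (\<Prod>V) * (1 / real (\<Prod>W)))" if "U \<in> ?I" for U
    proof -
      have "U \<subseteq> P" using that by blast
      then show ?thesis unfolding split_conv by (subst prodsplit) (simp_all del: of_nat_prod)
    qed
  qed (auto simp: prod_nonneg)
  also have "\<dots> = sqf_sum ?P' n * (\<Sum>W\<in>Pow ?Q. 1 / real (\<Prod>W))"
    by (simp add: sqf_sum_def sum_product sum.cartesian_product)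
  also have "(\<Sum>W\<in>Pow ?Q. 1 / real (\<Prod>W)) = (\<Prod>p\<in>?Q. 1 / real p + 1)"
    by (subst prod_add) (use assms(1) in \<open>auto simp: prod_dividef\<close>)
  finally show ?thesis by (simp add: add.commute)
qed

lemma sqf_sum_nonneg: "sqf_sum P n \<ge> 0"
  unfolding sqf_sum_def by (intro sum_nonneg) (auto simp: prod_nonneg)

text \<open>This passes from one class per prime to two. A pair \<open>(A, B)\<close> is recovered
  from \<open>A \<inter> B\<close>, the symmetric difference \<open>V\<close> and
  \<open>A - B\<close>. A given \<open>V\<close> allows \<open>2 ^ card (V \<inter> P')\<close>
  choices of \<open>A - B\<close>, and the intersections contribute inverse squares, hence the
  factor 2.\<close>

lemma sqf_sum_product_le:
  assumes fin: "finite P" and pr: "\<And>p. p \<in> P \<Longrightarrow> prime p" and sub: "P' \<subseteq> P"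
  shows "sqf_sum P n * sqf_sum P' n \<le>
    2 * (\<Sum>V | V \<subseteq> P \<and> \<Prod>V \<le> n * n. \<Prod>p\<in>V. (if p \<in> P' then 2 else 1) / real p)"
proof -
  let ?I = "{U. U \<subseteq> P \<and> \<Prod>U \<le> n}" and ?I' = "{U. U \<subseteq> P' \<and> \<Prod>U \<le> n}"
  let ?J = "{V. V \<subseteq> P \<and> \<Prod>V \<le> n * n}"
  let ?K = "SIGMA V:?J. {X. X \<subseteq> V \<and> V - X \<subseteq> P'}"
  let ?f = "\<lambda>(A, B). (A \<inter> B, (A \<union> B - A \<inter> B, A - B))"
  have finJ: "finite ?J" using fin by auto
  have finsub: "finite V" if "V \<subseteq> P" for V using that fin finite_subset by auto
  have pos: "\<Prod>U > 0" if "U \<subseteq> P" for U using that pr by (intro prod_primes_pos) auto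
  have inj: "inj_on ?f (?I \<times> ?I')"
  proof (rule inj_onI)
    fix x x' assume "?f x = ?f x'"
    obtain A B A' B' where x: "x = (A, B)" "x' = (A', B')" by (cases x, cases x')
    have "A \<inter> B = A' \<inter> B'" "A \<union> B - A \<inter> B = A' \<union> B' - A' \<inter> B'" "A - B = A' - B'"
      using \<open>?f x = ?f x'\<close> unfolding x split_conv prod.inject by blast+
    moreover have "A = (A - B) \<union> (A \<inter> B)" "B = ((A \<union> B - A \<inter> B) - (A - B)) \<union> (A \<inter> B)"
      "A' = (A' - B') \<union> (A' \<inter> B')" "B' = ((A' \<union> B' - A' \<inter> B') - (A' - B')) \<union> (A' \<inter> B')" by blast+
    ultimately show "x = x'" unfolding x by (metis (no_types))
  qed
  have mem: "?f ` (?I \<times> ?I') \<subseteq> ?I \<times> ?K"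
  proof (rule image_subsetI)
    fix x assume "x \<in> ?I \<times> ?I'"
    then obtain A B where x: "x = (A, B)" and A: "A \<subseteq> P" "\<Prod>A \<le> n" and B: "B \<subseteq> P'" "\<Prod>B \<le> n"
      by blast
    have BP: "B \<subseteq> P" using B sub by auto
    have "\<Prod>(A \<inter> B) \<le> \<Prod>A"
      using A finsub[OF A(1)] pos[OF A(1)] by (intro dvd_imp_le prod_dvd_prod_subset) auto
    moreover have "\<Prod>(A \<union> B - A \<inter> B) dvd \<Prod>A * \<Prod>B"
    proof -
      have "\<Prod>(A \<union> B - A \<inter> B) dvd \<Prod>(A \<union> B)"
        using finsub[OF A(1)] finsub[OF BP] by (intro prod_dvd_prod_subset) auto
      also have "\<Prod>(A \<union> B) dvd \<Prod>A * \<Prod>B"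
        using prod.union_inter[OF finsub[OF A(1)] finsub[OF BP], of id] by (simp add: id_def) (metis dvd_triv_left)
      finally show ?thesis .
    qed
    then have "\<Prod>(A \<union> B - A \<inter> B) \<le> \<Prod>A * \<Prod>B" using pos[OF A(1)] pos[OF BP] by (intro dvd_imp_le) auto
    then have "\<Prod>(A \<union> B - A \<inter> B) \<le> n * n" using A B by (meson le_trans mult_le_mono)
    moreover have "A \<inter> B \<subseteq> P" "A \<union> B - A \<inter> B \<subseteq> P" "A - B \<subseteq> A \<union> B - A \<inter> B"
      "(A \<union> B - A \<inter> B) - (A - B) \<subseteq> P'" using A B BP by blast+
    ultimately show "?f x \<in> ?I \<times> ?K" unfolding x split_conv using A(2) by (intro SigmaI CollectI conjI) linarith+
  qed
  have val: "1 / real (\<Prod>A) * (1 / real (\<Prod>B)) =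
      1 / real (\<Prod>(A \<inter> B)) ^ 2 * (1 / real (\<Prod>(A \<union> B - A \<inter> B)))" if "A \<subseteq> P" "B \<subseteq> P'" for A B
  proof -
    have fA: "finite A" "finite B" using finsub that sub by auto
    have "\<Prod>A * \<Prod>B = \<Prod>(A \<union> B) * \<Prod>(A \<inter> B)"
      using prod.union_inter[OF fA, of id] by (simp add: id_def)
    also have "\<Prod>(A \<union> B) = \<Prod>(A \<union> B - A \<inter> B) * \<Prod>(A \<inter> B)"
      using fA by (intro prod.subset_diff) auto
    finally have "real (\<Prod>A) * real (\<Prod>B) = real (\<Prod>(A \<union> B - A \<inter> B)) * real (\<Prod>(A \<inter> B)) ^ 2"
      by (simp only: of_nat_mult[symmetric] of_nat_power[symmetric] power2_eq_square mult.assoc)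
    then show ?thesis by (simp del: of_nat_prod)
  qed
  have sq: "(\<Sum>G\<in>?I. 1 / real (\<Prod>G) ^ 2) \<le> 2"
  proof -
    have inj: "inj_on (\<lambda>G. \<Prod>G) ?I"
      by (rule inj_onI) (metis (no_types, lifting) mem_Collect_eq pr prime_factors_prod_primes finsub subsetD)
    have "(\<Sum>G\<in>?I. 1 / real (\<Prod>G) ^ 2) = (\<Sum>j\<in>(\<lambda>G. \<Prod>G) ` ?I. 1 / real j ^ 2)"
      by (subst sum.reindex[OF inj]) simp
    also have "\<dots> \<le> (\<Sum>j=1..n. 1 / real j ^ 2)"
      using pos by (intro sum_mono2) (auto simp: Suc_le_eq)
    finally show ?thesis using sum_inverse_squares_le[of n] by simp
  qed
  have "sqf_sum P n * sqf_sum P' n = (\<Sum>(A, B)\<in>?I \<times> ?I'. 1 / real (\<Prod>A) * (1 / real (\<Prod>B)))"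
    unfolding sqf_sum_def sum_product sum.cartesian_product by simp
  also have "\<dots> \<le> (\<Sum>(G, (V, X))\<in>?I \<times> ?K. 1 / real (\<Prod>G) ^ 2 * (1 / real (\<Prod>V)))"
  proof (rule sum_le_inj[OF _ inj])
    show "finite (?I \<times> ?K)" using fin by (auto intro!: finite_SigmaI finite_subsets_bounded intro: finsub)
    show "?f x \<in> ?I \<times> ?K" if "x \<in> ?I \<times> ?I'" for x using mem that by blast
    show "(case x of (A, B) \<Rightarrow> 1 / real (\<Prod>A) * (1 / real (\<Prod>B))) \<le>
      (case ?f x of (G, V, X) \<Rightarrow> 1 / real (\<Prod>G) ^ 2 * (1 / real (\<Prod>V)))" if x: "x \<in> ?I \<times> ?I'" for x
    proof -
      obtain A B where AB: "x = (A, B)" by (cases x)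
      then have "A \<subseteq> P" "B \<subseteq> P'" using x by auto
      from val[OF this] show ?thesis unfolding AB split_conv by (rule eq_refl)
    qed
  qed (auto simp: prod_nonneg)
  also have "\<dots> = (\<Sum>G\<in>?I. 1 / real (\<Prod>G) ^ 2) * (\<Sum>(V, X)\<in>?K. 1 / real (\<Prod>V))"
    by (simp add: sum_product sum.cartesian_product case_prod_unfold)
  also have "\<dots> \<le> 2 * (\<Sum>(V, X)\<in>?K. 1 / real (\<Prod>V))"
    using sq by (intro mult_right_mono) (auto intro!: sum_nonneg simp: prod_nonneg)
  also have "(\<Sum>(V, X)\<in>?K. 1 / real (\<Prod>V)) = (\<Sum>V\<in>?J. \<Sum>X | X \<subseteq> V \<and> V - X \<subseteq> P'. 1 / real (\<Prod>V))"
  proof -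
    have "finite {X. X \<subseteq> V \<and> V - X \<subseteq> P'}" if "V \<in> ?J" for V
      by (rule finite_subsets_bounded[OF finsub]) (use that in blast)
    then show ?thesis using finJ by (subst sum.Sigma) blast+
  qed
  also have "\<dots> = (\<Sum>V\<in>?J. \<Prod>p\<in>V. (if p \<in> P' then 2 else 1) / real p)"
  proof (intro sum.cong refl)
    fix V assume V: "V \<in> ?J"
    then have fV: "finite V" using finsub by auto
    have "bij_betw (\<lambda>Y. V - Y) (Pow (V \<inter> P')) {X. X \<subseteq> V \<and> V - X \<subseteq> P'}"
      by (rule bij_betw_byWitness[of _ "\<lambda>X. V - X"]) auto
    then have "card {X. X \<subseteq> V \<and> V - X \<subseteq> P'} = 2 ^ card (V \<inter> P')"
      using bij_betw_same_card card_Pow[of "V \<inter> P'"] fV by fastforce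
    moreover have "(\<Prod>p\<in>V. (if p \<in> P' then 2 else 1 :: real)) = 2 ^ card (V \<inter> P')"
      using fV by (simp add: prod.If_cases)
    ultimately show "(\<Sum>X | X \<subseteq> V \<and> V - X \<subseteq> P'. 1 / real (\<Prod>V)) = (\<Prod>p\<in>V. (if p \<in> P' then 2 else 1) / real p)"
      by (simp add: prod_dividef)
  qed
  finally show ?thesis .
qed

lemma prime_sum_le_prod: "(\<And>p. p \<in> P \<Longrightarrow> prime p) \<Longrightarrow> (\<Prod>p\<in>P. 1 + 1 / real p) > 0"
  by (intro prod_pos) (auto intro: add_pos_nonneg)

text \<open>The same \<open>y\<close> bounds the sifting primes and the level, so that the error
  stays a fixed power of \<open>y\<close>. Primes dividing \<open>D\<close> are exempt at the price
  of an Euler product over them.\<close>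

theorem sieve_dim1:
  assumes y: "y \<ge> 2" and T: "T \<subseteq> {..<N}"
    and avoid: "\<And>l. prime l \<Longrightarrow> l \<le> y \<Longrightarrow> \<not> l dvd D \<Longrightarrow> \<exists>a<l. \<forall>t\<in>T. t mod l \<noteq> a"
  shows "real (card T) \<le> 2 * real N * (\<Prod>l | l \<in> primes_upto y \<and> l dvd D. 1 + 1 / real l) / ln (real y) + real y ^ 6"
proof -
  define P where "P = {l \<in> primes_upto y. \<not> l dvd D}"
  have finP: "finite P" by (simp add: P_def)
  have pr: "prime l" if "l \<in> P" for l using that by (auto simp: P_def primes_upto_def)
  have "\<exists>a<l. \<forall>t\<in>T. t mod l \<noteq> a" if "l \<in> P" for l
    using that avoid by (auto simp: P_def primes_upto_def)
  then obtain a where a: "\<And>l. l \<in> P \<Longrightarrow> a l < l \<and> (\<forall>t\<in>T. t mod l \<noteq> a l)" by metis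
  define L where "L = (\<Sum>U | U \<subseteq> P \<and> \<Prod>U \<le> y. \<Prod>l\<in>U. real (card {a l}) / (real l - real (card {a l})))"
  define W where "W = (\<Prod>l | l \<in> primes_upto y \<and> l dvd D. 1 + 1 / real l)"
  have Wpos: "W > 0" unfolding W_def by (intro prime_sum_le_prod) (auto simp: primes_upto_def)
  have lnpos: "ln (real y) > 0" using y by simp
  have "sqf_sum P y \<le> L"
    unfolding sqf_sum_def L_def
  proof (intro sum_mono)
    fix U assume "U \<in> {U. U \<subseteq> P \<and> \<Prod>U \<le> y}"
    then have U: "U \<subseteq> P" by auto
    have "1 / real (\<Prod>U) = (\<Prod>l\<in>U. 1 / real l)" by (simp add: prod_dividef)
    also have "\<dots> \<le> (\<Prod>l\<in>U. real (card {a l}) / (real l - real (card {a l})))"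
    proof (intro prod_mono conjI)
      fix l assume "l \<in> U"
      then have "l \<ge> 2" using U pr prime_ge_2_nat by blast
      then show "1 / real l \<le> real (card {a l}) / (real l - real (card {a l}))" by (simp add: frac_le)
    qed simp
    finally show "1 / real (\<Prod>U) \<le> (\<Prod>l\<in>U. real (card {a l}) / (real l - real (card {a l})))" .
  qed
  moreover have "ln (real y) \<le> 2 * (sqf_sum P y * W)"
  proof -
    have "ln (real y) \<le> ln (real y + 1)" using y by simp
    also have "\<dots> \<le> 2 * sqf_sum (primes_upto y) y" by (intro harm_le_sqf_sum) (auto simp: primes_upto_def)
    also have "sqf_sum (primes_upto y) y \<le> sqf_sum P y * W"
      unfolding P_def W_def by (rule sqf_sum_le_coprime) (auto simp: primes_upto_def)
    finally show ?thesis by simp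
  qed
  ultimately have "ln (real y) \<le> 2 * (L * W)"
    using Wpos by (smt (verit) mult_right_mono)
  then have Lge: "ln (real y) / (2 * W) \<le> L" using Wpos by (simp add: field_simps)
  have "real (card T) \<le> real N / L + real y ^ 6"
    unfolding L_def
  proof (rule selberg_sieve[OF finP pr _ _ T])
    fix l assume "l \<in> P"
    then show "{a l} \<subseteq> {..<l} \<and> 1 \<le> card {a l} \<and> card {a l} < l"
      using a pr prime_gt_1_nat by auto
  qed (use y a in auto)
  also have "real N / L \<le> real N / (ln (real y) / (2 * W))"
  proof (rule divide_left_mono)
    have "ln (real y) / (2 * W) > 0" using lnpos Wpos by simp
    then show "L * (ln (real y) / (2 * W)) > 0" using Lge by (intro mult_pos_pos) linarith+
  qed (use Lge in simp_all)
  finally show ?thesis by (simp add: W_def mult_ac)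
qed

text \<open>\<open>even D\<close> exempts 2 from the second forbidden class; two classes modulo 2
  would leave nothing. The level is split as \<open>n * n \<le> y\<close>, with one sum over all
  primes and one over those prime to \<open>D\<close>. The constant is \<open>32 = 16 * 2\<close>:
  the square of \<open>ln y \<le> 4 * sqf_sum P n\<close> and the 2 of the product
  inequality.\<close>

theorem sieve_dim2:
  assumes y: "y \<ge> 2" and T: "T \<subseteq> {..<N}" and D: "even D"
    and avoid1: "\<And>l. prime l \<Longrightarrow> l \<le> y \<Longrightarrow> \<exists>a<l. \<forall>t\<in>T. t mod l \<noteq> a"
    and avoid2: "\<And>l. prime l \<Longrightarrow> l \<le> y \<Longrightarrow> \<not> l dvd D \<Longrightarrow>
       \<exists>a<l. \<exists>b<l. a \<noteq> b \<and> (\<forall>t\<in>T. t mod l \<noteq> a \<and> t mod l \<noteq> b)"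
  shows "real (card T) \<le> 32 * real N * (\<Prod>l | l \<in> primes_upto y \<and> l dvd D. 1 + 1 / real l) / (ln (real y))\<^sup>2 + real y ^ 6"
proof -
  define P where "P = primes_upto y"
  define P' where "P' = {l \<in> P. \<not> l dvd D}"
  have finP: "finite P" by (simp add: P_def)
  have pr: "prime l" if "l \<in> P" for l using that by (auto simp: P_def primes_upto_def)
  have "\<exists>A. A \<subseteq> {..<l} \<and> card A = (if l \<in> P' then 2 else 1) \<and> (\<forall>t\<in>T. t mod l \<notin> A)" if l: "l \<in> P" for l
  proof (cases "l \<in> P'")
    case True
    then obtain a b where "a < l" "b < l" "a \<noteq> b" "\<forall>t\<in>T. t mod l \<noteq> a \<and> t mod l \<noteq> b"
      using avoid2[of l] by (auto simp: P'_def P_def primes_upto_def)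
    then show ?thesis using True by (intro exI[of _ "{a, b}"]) auto
  next
    case False
    obtain a where "a < l" "\<forall>t\<in>T. t mod l \<noteq> a" using avoid1[of l] l by (auto simp: P_def primes_upto_def)
    then show ?thesis using False by (intro exI[of _ "{a}"]) auto
  qed
  then obtain A where A: "\<And>l. l \<in> P \<Longrightarrow> A l \<subseteq> {..<l} \<and> card (A l) = (if l \<in> P' then 2 else 1) \<and> (\<forall>t\<in>T. t mod l \<notin> A l)"
    by metis
  define L where "L = (\<Sum>U | U \<subseteq> P \<and> \<Prod>U \<le> y. \<Prod>l\<in>U. real (card (A l)) / (real l - real (card (A l))))"
  define W where "W = (\<Prod>l | l \<in> primes_upto y \<and> l dvd D. 1 + 1 / real l)"
  have Wpos: "W > 0" unfolding W_def by (intro prime_sum_le_prod) (auto simp: primes_upto_def)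
  have lnpos: "ln (real y) > 0" using y by simp
  define n where "n = nat \<lfloor>sqrt (real y)\<rfloor>"
  have n: "real n \<le> sqrt (real y)" "sqrt (real y) < real n + 1" unfolding n_def by (auto simp: of_nat_floor) 
  have nn: "n * n \<le> y"
  proof -
    have "real n * real n \<le> sqrt (real y) * sqrt (real y)" using n by (intro mult_mono) auto
    then show ?thesis by (simp flip: of_nat_mult)
  qed
  have odd: "l \<ge> 3" if "l \<in> P'" for l
  proof -
    have "l \<ge> 2" "l \<noteq> 2" using that pr prime_ge_2_nat D by (auto simp: P'_def)
    then show ?thesis by linarith
  qed
  have small: "card (A l) < l" if "l \<in> P" for l
    using A[OF that] odd[of l] prime_ge_2_nat[OF pr[OF that]] by auto
  have lnn: "ln (real y) \<le> 2 * ln (real n + 1)"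
  proof -
    have "ln (real y) = 2 * ln (sqrt (real y))" using y by (simp add: ln_sqrt)
    also have "\<dots> \<le> 2 * ln (real n + 1)" using n y by simp
    finally show ?thesis .
  qed
  have n_le: "n \<le> y" using nn by (metis le_square le_trans)
  have A1: "ln (real n + 1) \<le> 2 * sqf_sum P n"
    by (rule harm_le_sqf_sum) (use n_le in \<open>auto simp: primes_upto_def P_def\<close>)
  have A2: "sqf_sum P n \<le> sqf_sum P' n * W"
    using sqf_sum_le_coprime[of P n D] finP pr by (simp add: P'_def W_def P_def)
  have A3: "sqf_sum P n * sqf_sum P' n \<le> 2 * L"
  proof -
    have "sqf_sum P n * sqf_sum P' n \<le>
      2 * (\<Sum>V | V \<subseteq> P \<and> \<Prod>V \<le> n * n. \<Prod>p\<in>V. (if p \<in> P' then 2 else 1) / real p)"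
      by (rule sqf_sum_product_le) (use finP pr in \<open>auto simp: P'_def\<close>)
    also have "(\<Sum>V | V \<subseteq> P \<and> \<Prod>V \<le> n * n. \<Prod>p\<in>V. (if p \<in> P' then 2 else 1) / real p) \<le>
       (\<Sum>V | V \<subseteq> P \<and> \<Prod>V \<le> y. \<Prod>p\<in>V. (if p \<in> P' then 2 else 1) / real p)"
      using finP nn by (intro sum_mono2) (auto intro!: prod_nonneg)
    also have "\<dots> \<le> L" unfolding L_def
    proof (intro sum_mono prod_mono conjI)
      fix V p assume "V \<in> {V. V \<subseteq> P \<and> \<Prod>V \<le> y}" "p \<in> V"
      then have p: "p \<in> P" by auto
      have "(if p \<in> P' then 2 else 1) / real p = real (card (A p)) / real p" using A[OF p] by auto
      also have "\<dots> \<le> real (card (A p)) / (real p - real (card (A p)))"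
        using small[OF p] by (intro divide_left_mono) (auto intro!: mult_pos_pos)
      finally show "(if p \<in> P' then 2 else 1) / real p \<le> real (card (A p)) / (real p - real (card (A p)))" .
    qed simp
    finally show ?thesis by simp
  qed
  have "(ln (real y))\<^sup>2 \<le> (2 * (2 * sqf_sum P n))\<^sup>2"
    using lnn A1 lnpos by (intro power_mono) auto
  also have "\<dots> = 16 * (sqf_sum P n * sqf_sum P n)" by (simp add: power2_eq_square)
  also have "\<dots> \<le> 16 * (sqf_sum P n * (sqf_sum P' n * W))"
    using A2 sqf_sum_nonneg by (intro mult_left_mono) auto
  also have "\<dots> = 16 * (sqf_sum P n * sqf_sum P' n) * W" by simp
  also have "\<dots> \<le> 16 * (2 * L) * W" using A3 Wpos by (intro mult_right_mono mult_left_mono) auto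
  finally have Lge: "(ln (real y))\<^sup>2 / (32 * W) \<le> L" using Wpos by (simp add: field_simps)
  have "real (card T) \<le> real N / L + real y ^ 6"
    unfolding L_def
  proof (rule selberg_sieve[OF finP pr _ _ T])
    fix l assume l: "l \<in> P"
    then show "A l \<subseteq> {..<l} \<and> 1 \<le> card (A l) \<and> card (A l) < l"
      using A[OF l] small[OF l] by (auto split: if_splits)
  qed (use y A in auto)
  also have "real N / L \<le> real N / ((ln (real y))\<^sup>2 / (32 * W))"
  proof (rule divide_left_mono)
    have "(ln (real y))\<^sup>2 / (32 * W) > 0" using lnpos Wpos by simp
    then show "L * ((ln (real y))\<^sup>2 / (32 * W)) > 0" using Lge by (intro mult_pos_pos) linarith+
  qed (use Lge in simp_all)
  finally show ?thesis by (simp add: W_def mult_ac)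
qed

section \<open>Estimates of Chebyshev and Mertens\<close>

lemma prod_primes_dvd_nat:
  fixes U :: "nat set"
  assumes "finite U" "\<And>p. p \<in> U \<Longrightarrow> prime p" "\<And>p. p \<in> U \<Longrightarrow> p dvd n"
  shows "\<Prod>U dvd n"
  using assms
proof (induction U rule: finite_induct)
  case (insert q U)
  have "coprime q (\<Prod>U)" using insert by (intro coprime_prod_prime_distinct) auto
  then have "q * \<Prod>U dvd n" using insert by (intro divides_mult) auto
  then show ?case using insert.hyps by simp
qed simp

lemma central_binomial_le: "(2 * m + 1) choose m \<le> 4 ^ m"
proof -
  have "2 * ((2 * m + 1) choose m) = ((2 * m + 1) choose m) + ((2 * m + 1) choose (m + 1))"
    using binomial_symmetric[of m "2 * m + 1"] by simp
  also have "\<dots> = (\<Sum>k\<in>{m, m + 1}. (2 * m + 1) choose k)" by simp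
  also have "\<dots> \<le> (\<Sum>k\<le>2 * m + 1. (2 * m + 1) choose k)" by (intro sum_mono2) auto
  also have "\<dots> = 2 ^ (2 * m + 1)" by (rule choose_row_sum)
  also have "\<dots> = 2 * 4 ^ m" by (simp add: power_mult)
  finally show ?thesis by simp
qed

text \<open>Erdos's induction: for odd \<open>n = 2 * m + 1\<close> the primes above
  \<open>m + 1\<close> divide \<open>n choose m\<close>, which is at most \<open>4 ^ m\<close>; an
  even \<open>n > 2\<close> adds no prime.\<close>

lemma primorial_le: "\<Prod>(primes_upto n) \<le> 4 ^ n"
proof (induction n rule: less_induct)
  case (less n)
  consider "n \<le> 2" | "n > 2" "even n" | "n > 2" "odd n" by linarith
  then show ?case
  proof cases
    case 1
    have "primes_upto n \<subseteq> {2}" using 1 by (auto simp: primes_upto_def dest: prime_ge_2_nat)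
    then consider "primes_upto n = {}" | "primes_upto n = {2}" by blast
    then show ?thesis
    proof cases
      case 2
      then have "n \<ge> 2" unfolding primes_upto_def by blast
      then have "(4::nat) ^ 2 \<le> 4 ^ n" by (intro power_increasing) auto
      then show ?thesis using 2 by simp
    qed simp
  next
    case 2
    have "primes_upto n = primes_upto (n - 1)"
    proof -
      have "\<not> prime n" using 2 prime_odd_nat[of n] by auto
      then have "p \<le> n - 1" if "prime p" "p \<le> n" for p using that by (cases "p = n") auto
      then show ?thesis by (auto simp: primes_upto_def)
    qed
    then have "\<Prod>(primes_upto n) \<le> 4 ^ (n - 1)" using less[of "n - 1"] 2 by simp
    also have "\<dots> \<le> (4::nat) ^ n" by (intro power_increasing) auto
    finally show ?thesis .
  next
    case 3
    then obtain m where m: "n = 2 * m + 1" by (auto elim: oddE)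
    let ?Q = "{p. prime p \<and> m + 1 < p \<and> p \<le> n}"
    have finQ: "finite ?Q" by (rule finite_subset[of _ "{..n}"]) auto
    have "\<Prod>?Q dvd n choose m"
    proof (rule prod_primes_dvd_nat)
      show "finite ?Q" by (rule finQ)
      fix p assume p: "p \<in> ?Q"
      show "prime p" using p by auto
      have "fact m * fact (m + 1) * (n choose m) = (fact n :: nat)"
        using binomial_fact_lemma[of m n] by (simp add: m)
      then have "p dvd fact m * fact (m + 1) * (n choose m)" using p by (simp add: prime_dvd_fact_iff)
      moreover have "\<not> p dvd fact m" "\<not> p dvd fact (m + 1)"
        using p by (auto simp: prime_dvd_fact_iff simp del: fact_Suc)
      ultimately show "p dvd n choose m" using p by (simp add: prime_dvd_mult_iff)
    qed
    then have "\<Prod>?Q \<le> n choose m" by (rule dvd_imp_le) (simp add: m)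
    also have "\<dots> \<le> 4 ^ m" unfolding m by (rule central_binomial_le)
    finally have Q: "\<Prod>?Q \<le> 4 ^ m" .
    have "primes_upto n = primes_upto (m + 1) \<union> ?Q" using m by (auto simp: primes_upto_def)
    then have "\<Prod>(primes_upto n) = \<Prod>(primes_upto (m + 1)) * \<Prod>?Q"
      using finQ by (simp only:) (rule prod.union_disjoint, auto simp: primes_upto_def)
    also have "\<dots> \<le> 4 ^ (m + 1) * 4 ^ m"
      using less[of "m + 1"] 3 m Q by (intro mult_le_mono) auto
    also have "\<dots> = 4 ^ n" by (simp add: m power_add mult_2)
    finally show ?thesis .
  qed
qed

lemma sum_ln_primes_le: "(\<Sum>p\<in>primes_upto n. ln (real p)) \<le> 2 * real n"
proof -
  have "(\<Sum>p\<in>primes_upto n. ln (real p)) = ln (\<Prod>p\<in>primes_upto n. real p)"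
    by (rule ln_prod[symmetric]) (auto simp: prime_gt_0_nat dest: prime_of_primes_upto)
  also have "(\<Prod>p\<in>primes_upto n. real p) = real (\<Prod>(primes_upto n))" by simp
  also have "ln \<dots> \<le> ln (real (4 ^ n))"
  proof (rule ln_mono)
    show "real (\<Prod>(primes_upto n)) \<le> real (4 ^ n)" by (rule of_nat_mono[OF primorial_le])
    have "\<Prod>(primes_upto n) > 0" by (rule prod_primes_pos) (rule prime_of_primes_upto)
    then show "real (\<Prod>(primes_upto n)) > 0" by (simp only: of_nat_0_less_iff)
  qed
  also have "\<dots> = real n * ln 4" by (simp add: ln_realpow)
  also have "real n * ln 4 \<le> real n * 2"
  proof (rule mult_left_mono)
    show "ln (4::real) \<le> 2"
  proof -
    have "ln (4::real) = 2 * ln 2" using ln_realpow[of "2::real" 2] by simp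
    moreover have "ln (2::real) < 1" by (rule ln_2_less_1)
    ultimately show ?thesis by linarith
    qed
  qed simp
  finally show ?thesis by (simp add: mult.commute)
qed

section \<open>Legendre's formula for \<open>ln (fact n)\<close> and Mertens's estimates\<close>

lemma card_multiples_upto:
  assumes d: "d > 0"
  shows "card {k \<in> {1..n}. d dvd k} = n div (d::nat)"
proof -
  have "bij_betw (\<lambda>j. d * j) {1..n div d} {k \<in> {1..n}. d dvd k}"
  proof (rule bij_betwI')
    fix x assume "x \<in> {1..n div d}"
    then have x: "1 \<le> x" "x \<le> n div d" by auto
    have "d * x \<le> d * (n div d)" using x by simp
    also have "\<dots> \<le> n" by simp
    finally have "d * x \<le> n" .
    moreover have "d * x \<ge> 1" using d x by (simp add: Suc_le_eq)
    ultimately show "d * x \<in> {k \<in> {1..n}. d dvd k}" by simp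
  next
    fix k assume "k \<in> {k \<in> {1..n}. d dvd k}"
    then obtain j where j: "k = d * j" "1 \<le> d * j" "d * j \<le> n" by (auto elim: dvdE)
    then have "j \<ge> 1" by (cases j) auto
    moreover have "j \<le> n div d"
      using div_le_mono[OF j(3), of d] d by simp
    ultimately show "\<exists>x\<in>{1..n div d}. k = d * x" using j(1) by (intro bexI[of _ j]) simp_all
  next
    fix x y show "(d * x = d * y) = (x = y)" using d by simp
  qed
  from bij_betw_same_card[OF this] show ?thesis by simp
qed

lemma multiplicity_eq_card:
  assumes "prime p" "0 < k" "k \<le> n"
  shows "multiplicity p k = card {j \<in> {1..n}. p ^ j dvd (k::nat)}"
proof -
  have "{j \<in> {1..n}. p ^ j dvd k} = {1..multiplicity p k}"
  proof -
    have le: "multiplicity p k \<le> n"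
    proof -
      have "multiplicity p k < p ^ multiplicity p k"
        using prime_gt_1_nat[OF assms(1)] by (intro power_gt_expt) simp
      also have "\<dots> \<le> k" using assms(2) multiplicity_dvd by (intro dvd_imp_le)
      finally show ?thesis using assms by linarith
    qed
    have iff: "p ^ j dvd k \<longleftrightarrow> j \<le> multiplicity p k" for j
      using assms prime_gt_1_nat[OF assms(1)] by (intro power_dvd_iff_le_multiplicity) auto
    show ?thesis unfolding iff using le by (intro set_eqI) (simp, linarith)
  qed
  then show ?thesis by simp
qed

lemma ln_fact_eq:
  "ln (fact n :: real) = (\<Sum>p\<in>primes_upto n. \<Sum>j=1..n. ln (real p) * real (n div p ^ j))"
proof -
  have lnk: "ln (real k) = (\<Sum>p\<in>primes_upto n. \<Sum>j=1..n. if p ^ j dvd k then ln (real p) else 0)" if k: "k \<in> {1..n}" for k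
  proof -
    have k0: "k > 0" using k by auto
    have "real k = real (\<Prod>p\<in>prime_factors k. p ^ multiplicity p k)" using prime_factorization_nat[OF k0] by simp
    also have "\<dots> = (\<Prod>p\<in>prime_factors k. real p ^ multiplicity p k)" by simp
    finally have "ln (real k) = (\<Sum>p\<in>prime_factors k. ln (real p ^ multiplicity p k))"
      by (simp only:) (rule ln_prod, auto intro: prime_gt_0_nat in_prime_factors_imp_prime)
    also have "\<dots> = (\<Sum>p\<in>prime_factors k. real (multiplicity p k) * ln (real p))"
      by (intro sum.cong refl ln_realpow)
    also have "\<dots> = (\<Sum>p\<in>primes_upto n. real (multiplicity p k) * ln (real p))"
    proof (rule sum.mono_neutral_left)
      show "prime_factors k \<subseteq> primes_upto n"
      proof
        fix p assume p: "p \<in> prime_factors k"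
        then have "p \<le> k" using k0 by (auto intro: dvd_imp_le)
        then show "p \<in> primes_upto n" using p k by (auto simp: primes_upto_def)
      qed
      show "\<forall>p\<in>primes_upto n - prime_factors k. real (multiplicity p k) * ln (real p) = 0"
        using k0 by (auto simp: prime_factors_multiplicity primes_upto_def)
    qed simp
    also have "\<dots> = (\<Sum>p\<in>primes_upto n. \<Sum>j=1..n. if p ^ j dvd k then ln (real p) else 0)"
    proof (rule sum.cong[OF refl])
      fix p assume "p \<in> primes_upto n"
      then have p: "prime p" by (rule prime_of_primes_upto)
      have "multiplicity p k = card {j \<in> {1..n}. p ^ j dvd k}" using multiplicity_eq_card[OF p k0] k by simp
      then have "real (multiplicity p k) * ln (real p) = (\<Sum>j | j \<in> {1..n} \<and> p ^ j dvd k. ln (real p))" by simp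
      also have "\<dots> = (\<Sum>j=1..n. if p ^ j dvd k then ln (real p) else 0)"
        by (rule sum.inter_filter) simp
      finally show "real (multiplicity p k) * ln (real p) = (\<Sum>j=1..n. if p ^ j dvd k then ln (real p) else 0)" .
    qed
    finally show ?thesis .
  qed
  have "ln (fact n :: real) = ln (\<Prod>k=1..n. real k)" by (simp add: fact_prod)
  also have "\<dots> = (\<Sum>k=1..n. ln (real k))" by (rule ln_prod) auto
  also have "\<dots> = (\<Sum>k=1..n. \<Sum>p\<in>primes_upto n. \<Sum>j=1..n. if p ^ j dvd k then ln (real p) else 0)"
    by (rule sum.cong[OF refl lnk])
  also have "\<dots> = (\<Sum>p\<in>primes_upto n. \<Sum>k=1..n. \<Sum>j=1..n. if p ^ j dvd k then ln (real p) else 0)"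
    by (rule sum.swap)
  also have "\<dots> = (\<Sum>p\<in>primes_upto n. \<Sum>j=1..n. \<Sum>k=1..n. if p ^ j dvd k then ln (real p) else 0)"
    by (rule sum.cong[OF refl], rule sum.swap)
  also have "\<dots> = (\<Sum>p\<in>primes_upto n. \<Sum>j=1..n. ln (real p) * real (n div p ^ j))"
  proof (rule sum.cong[OF refl], rule sum.cong[OF refl])
    fix p j assume "p \<in> primes_upto n"
    then have "p ^ j > 0" by (simp add: primes_upto_def prime_gt_0_nat)
    have "(\<Sum>k=1..n. if p ^ j dvd k then ln (real p) else 0) = (\<Sum>k | k \<in> {1..n} \<and> p ^ j dvd k. ln (real p))"
      by (rule sum.inter_filter[symmetric]) simp
    also have "\<dots> = real (card {k \<in> {1..n}. p ^ j dvd k}) * ln (real p)" by simp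
    also have "card {k \<in> {1..n}. p ^ j dvd k} = n div p ^ j" by (rule card_multiples_upto) fact
    finally show "(\<Sum>k=1..n. if p ^ j dvd k then ln (real p) else 0) = ln (real p) * real (n div p ^ j)" by simp
  qed
  finally show ?thesis .
qed

lemma real_div_minus_one_le:
  assumes "d > 0"
  shows "real n / real d - 1 \<le> real (n div d)"
proof -
  have "n mod d < d" using assms by simp
  then have "n \<le> d * (n div d) + d" using mult_div_mod_eq[of d n] by linarith
  then have "real n \<le> real (d * (n div d) + d)" by (rule of_nat_mono)
  then have "real n \<le> (real (n div d) + 1) * real d" by (simp add: algebra_simps)
  then have "real n / real d \<le> real (n div d) + 1" using assms by (simp add: divide_le_eq)
  then show ?thesis by linarith
qed

lemma real_div_le: "real (n div d) \<le> real n / real d"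
proof (cases "d = 0")
  case False
  have "n div d * d \<le> n" by simp
  then have "real (n div d * d) \<le> real n" by (rule of_nat_mono)
  then show ?thesis using False by (simp add: le_divide_eq)
qed simp

lemma harm_le: "n \<ge> 1 \<Longrightarrow> harm n \<le> 1 + ln (real n)"
proof (induction n rule: nat_induct_at_least)
  case (Suc n)
  have n: "real n > 0" using Suc.hyps by simp
  have "ln (real n / (real n + 1)) \<le> real n / (real n + 1) - 1" using n by (intro ln_le_minus_one) auto
  also have "\<dots> = - (1 / (real n + 1))" using n by (simp add: field_simps)
  finally have "1 / (real n + 1) \<le> ln (real n + 1) - ln (real n)" using n by (simp add: ln_div)
  then show ?case using Suc.IH by (simp add: harm_Suc inverse_eq_divide add.commute)
qed (simp add: harm_def)

lemma ln_prime_nonneg: "p \<in> primes_upto n \<Longrightarrow> ln (real p) \<ge> 0"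
  using prime_ge_1_nat by (auto simp: primes_upto_def)

text \<open>Legendre's formula with only the first powers kept, compared with
  \<open>ln (n ^ n)\<close>; replacing integer parts costs the sum of \<open>ln p\<close>, at most
  \<open>2 * n\<close>.\<close>

theorem mertens_upper:
  assumes "n \<ge> 1"
  shows "(\<Sum>p\<in>primes_upto n. ln (real p) / real p) \<le> ln (real n) + 2"
proof -
  have n: "real n > 0" using assms by simp
  have "(\<Sum>p\<in>primes_upto n. ln (real p) * (real n / real p - 1)) \<le> (\<Sum>p\<in>primes_upto n. \<Sum>j=1..n. ln (real p) * real (n div p ^ j))"
  proof (rule sum_mono)
    fix p assume p: "p \<in> primes_upto n"
    have "real n / real p - 1 \<le> real (n div p)"
      using prime_gt_0_nat[OF prime_of_primes_upto[OF p]] by (rule real_div_minus_one_le)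
    then have "ln (real p) * (real n / real p - 1) \<le> ln (real p) * real (n div p ^ 1)"
      using ln_prime_nonneg[OF p] by (intro mult_left_mono) auto
    also have "\<dots> \<le> (\<Sum>j=1..n. ln (real p) * real (n div p ^ j))"
      using assms ln_prime_nonneg[OF p] by (intro member_le_sum) auto
    finally show "ln (real p) * (real n / real p - 1) \<le> (\<Sum>j=1..n. ln (real p) * real (n div p ^ j))" .
  qed
  also have "\<dots> = ln (fact n)" by (rule ln_fact_eq[symmetric])
  also have "\<dots> \<le> ln (real n ^ n)"
  proof (rule ln_mono)
    show "fact n \<le> real n ^ n" using fact_le_power[of n, where ?'a = real] by simp
  qed simp
  also have "\<dots> = real n * ln (real n)" using n by (simp add: ln_realpow)
  finally have "(\<Sum>p\<in>primes_upto n. ln (real p) * (real n / real p - 1)) \<le> real n * ln (real n)" .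
  moreover have "(\<Sum>p\<in>primes_upto n. ln (real p) * (real n / real p - 1)) =
      real n * (\<Sum>p\<in>primes_upto n. ln (real p) / real p) - (\<Sum>p\<in>primes_upto n. ln (real p))"
    by (simp add: right_diff_distrib sum_subtractf sum_distrib_left mult_ac)
  ultimately have "real n * (\<Sum>p\<in>primes_upto n. ln (real p) / real p) \<le> real n * (ln (real n) + 2)"
    using sum_ln_primes_le[of n] by (simp add: distrib_left)
  then show ?thesis using n by simp
qed

text \<open>The right-hand side telescopes: its increment at \<open>k\<close> dominates the term
  because \<open>k * ln (k / (k - 1)) \<le> 2\<close>. The sum arises from the higher prime powers
  in Legendre's formula.\<close>

lemma sum_ln_over_quadratic_le:
  assumes "n \<ge> 1"
  shows "(\<Sum>k=2..n. ln (real k) / (real k * (real k - 1))) \<le> 2 - (ln (real n) + 2) / real n"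
  using assms
proof (induction n rule: nat_induct_at_least)
  case (Suc n)
  define k where "k = real (Suc n)"
  have k: "k > 1" "real n = k - 1" using Suc.hyps by (auto simp: k_def)
  have "ln (k / (k - 1)) \<le> k / (k - 1) - 1" using k by (intro ln_le_minus_one) auto
  also have "\<dots> = 1 / (k - 1)" using k by (simp add: field_simps)
  finally have l: "k * (ln k - ln (k - 1)) \<le> k * (1 / (k - 1))" using k by (intro mult_left_mono) (auto simp: ln_div)
  also have "k * (1 / (k - 1)) \<le> 2"
  proof -
    have "k \<ge> 2" using Suc.hyps by (simp add: k_def)
    then show ?thesis by (simp add: divide_le_eq)
  qed
  finally have l2: "k * ln k - k * ln (k - 1) \<le> 2" by (simp add: right_diff_distrib)
  have "(ln (k - 1) + 2) / (k - 1) - (ln k + 2) / k - ln k / (k * (k - 1)) =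
     (2 - (k * ln k - k * ln (k - 1))) / (k * (k - 1))"
    using k by (simp add: divide_simps) (simp add: algebra_simps)
  moreover have "\<dots> \<ge> 0" using l2 k by (intro divide_nonneg_pos) auto
  ultimately have "ln k / (k * (k - 1)) \<le> (ln (k - 1) + 2) / (k - 1) - (ln k + 2) / k" by linarith
  moreover have "(\<Sum>k=2..Suc n. ln (real k) / (real k * (real k - 1))) =
     (\<Sum>k=2..n. ln (real k) / (real k * (real k - 1))) + ln k / (k * (k - 1))"
    using Suc.hyps by (simp add: k_def)
  ultimately show ?case using Suc.IH k unfolding k_def[symmetric] by simp
qed simp

text \<open>The 3 is 1 from the lower bound \<open>n * ln n - n\<close> for
  \<open>ln (fact n)\<close> plus 2 from the higher prime powers, whose geometric series are at most
  \<open>1 / (p * (p - 1))\<close>.\<close>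

theorem mertens_lower:
  assumes "n \<ge> 1"
  shows "(\<Sum>p\<in>primes_upto n. ln (real p) / real p) \<ge> ln (real n) - 3"
proof -
  have n: "real n > 0" using assms by simp
  have "real n * ln (real n) - real n \<le> ln (fact n)"
  proof -
    have "real n * ln (real n) - real n \<le> ln (fact n)" using assms
    proof (induction n rule: nat_induct_at_least)
      case (Suc n)
      have n: "real n > 0" using Suc.hyps by simp
      have "real n * (ln (real n + 1) - ln (real n)) \<le> 1"
      proof -
        have "ln (real n + 1) - ln (real n) = ln (1 + 1 / real n)"
        proof -
          have "1 + 1 / real n = (real n + 1) / real n" using n by (simp add: field_simps)
          then show ?thesis using n by (simp add: ln_div)
        qed
        also have "\<dots> \<le> 1 / real n" by (rule ln_add_one_self_le_self) simp
        finally show ?thesis using n by (simp add: field_simps)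
      qed
      moreover have "ln (fact (Suc n) :: real) = ln (real n + 1) + ln (fact n)"
        by (simp add: ln_mult add.commute)
      moreover have "real (Suc n) * ln (real (Suc n)) = real n * ln (real n + 1) + ln (real n + 1)"
        by (simp add: algebra_simps)
      ultimately show ?case using Suc.IH by (simp add: right_diff_distrib)
    qed simp
    then show ?thesis .
  qed
  also have "ln (fact n :: real) = (\<Sum>p\<in>primes_upto n. \<Sum>j=1..n. ln (real p) * real (n div p ^ j))" by (rule ln_fact_eq)
  also have "\<dots> \<le> (\<Sum>p\<in>primes_upto n. real n * (ln (real p) / real p + ln (real p) / (real p * (real p - 1))))"
  proof (rule sum_mono)
    fix p assume p: "p \<in> primes_upto n"
    have p2: "real p \<ge> 2" using prime_ge_2_nat[OF prime_of_primes_upto[OF p]] by simp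
    have geo: "(\<Sum>j=1..m. 1 / real p ^ j) \<le> 1 / (real p - 1)" for m
    proof -
      have "(\<Sum>j=1..m. 1 / real p ^ j) = (1 - 1 / real p ^ m) / (real p - 1)"
      proof (induction m)
        case (Suc m)
        then show ?case using p2 by (simp add: divide_simps) (simp add: algebra_simps)
      qed simp
      also have "\<dots> \<le> 1 / (real p - 1)" using p2 by (intro divide_right_mono) auto
      finally show ?thesis .
    qed
    have "(\<Sum>j=1..n. ln (real p) * real (n div p ^ j)) \<le> (\<Sum>j=1..n. ln (real p) * (real n * (1 / real p ^ j)))"
    proof (intro sum_mono mult_left_mono)
      show "real (n div p ^ j) \<le> real n * (1 / real p ^ j)" for j
        using real_div_le[of n "p ^ j"] by simp
    qed (use ln_prime_nonneg[OF p] in auto)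
    also have "\<dots> = ln (real p) * real n * (\<Sum>j=1..n. 1 / real p ^ j)" by (simp add: sum_distrib_left mult_ac)
    also have "\<dots> \<le> ln (real p) * real n * (1 / (real p - 1))"
      using ln_prime_nonneg[OF p] geo by (intro mult_left_mono) auto
    also have "\<dots> = real n * (ln (real p) / real p + ln (real p) / (real p * (real p - 1)))"
      using p2 by (simp add: divide_simps) (simp add: algebra_simps)
    finally show "(\<Sum>j=1..n. ln (real p) * real (n div p ^ j)) \<le> real n * (ln (real p) / real p + ln (real p) / (real p * (real p - 1)))" .
  qed
  also have "\<dots> = real n * ((\<Sum>p\<in>primes_upto n. ln (real p) / real p) + (\<Sum>p\<in>primes_upto n. ln (real p) / (real p * (real p - 1))))"
    by (simp add: sum_distrib_left sum.distrib distrib_left)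
  also have "\<dots> \<le> real n * ((\<Sum>p\<in>primes_upto n. ln (real p) / real p) + 2)"
  proof -
    have "(\<Sum>p\<in>primes_upto n. ln (real p) / (real p * (real p - 1))) \<le> (\<Sum>k=2..n. ln (real k) / (real k * (real k - 1)))"
      by (intro sum_mono2) (auto simp: primes_upto_def prime_ge_2_nat)
    also have "\<dots> \<le> 2 - (ln (real n) + 2) / real n" by (rule sum_ln_over_quadratic_le[OF assms])
    also have "\<dots> \<le> 2" using assms by simp
    finally show ?thesis using n by simp
  qed
  finally have "real n * (ln (real n) - 1) \<le> real n * ((\<Sum>p\<in>primes_upto n. ln (real p) / real p) + 2)"
    by (simp add: right_diff_distrib)
  then show ?thesis using n by simp
qed

lemma primes_upto_split:
  assumes "a \<le> b"
  shows "(\<Sum>p\<in>primes_upto b. f p) = (\<Sum>p\<in>primes_upto a. f p) + (\<Sum>p | prime p \<and> a < p \<and> p \<le> b. f p)"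
proof -
  have "primes_upto b = primes_upto a \<union> {p. prime p \<and> a < p \<and> p \<le> b}" using assms by (auto simp: primes_upto_def)
  then show ?thesis by (simp only:) (rule sum.union_disjoint, auto simp: primes_upto_def intro: finite_subset[of _ "{..b}"])
qed

text \<open>5 is the sum of the errors in the two Mertens estimates. Bounding \<open>ln p\<close> by
  \<open>ln b\<close> takes the place of partial summation and loses only a constant factor when
  both ends are fixed powers of one number.\<close>

lemma sum_inverse_primes_interval_ge:
  assumes "1 \<le> a" "a \<le> b" "2 \<le> b"
  shows "(\<Sum>p | prime p \<and> a < p \<and> p \<le> b. 1 / real p) \<ge> (ln (real b) - ln (real a) - 5) / ln (real b)"
proof -
  have lnb: "ln (real b) > 0" using assms by simp
  have "ln (real b) - ln (real a) - 5 \<le> (\<Sum>p | prime p \<and> a < p \<and> p \<le> b. ln (real p) / real p)"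
    using mertens_lower[of b] mertens_upper[of a] primes_upto_split[OF assms(2), of "\<lambda>p. ln (real p) / real p"] assms by simp
  also have "\<dots> \<le> (\<Sum>p | prime p \<and> a < p \<and> p \<le> b. ln (real b) * (1 / real p))"
    using assms by (intro sum_mono) (auto intro!: divide_right_mono)
  also have "\<dots> = ln (real b) * (\<Sum>p | prime p \<and> a < p \<and> p \<le> b. 1 / real p)" by (simp add: sum_distrib_left)
  finally show ?thesis using lnb by (simp add: divide_le_eq mult.commute)
qed

lemma card_primes_ge:
  assumes "n \<ge> 1024"
  shows "real (card (primes_upto n)) \<ge> real n / (1024 * ln (real n))"
proof -
  \<comment> \<open>The ratio \<open>n / a\<close> is at least \<open>2 ^ 9\<close>, and
    \<open>9 * ln 2 \<ge> 6\<close> exceeds the total Mertens error 5 by 1, so the interval carries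
    mass at least 1.\<close>
  define a where "a = n div 512"
  have a: "a \<ge> 1" "a \<le> n" "real n \<ge> 512 * real a" "real a \<ge> real n / 1024"
  proof -
    show "a \<ge> 1" using assms by (simp add: a_def)
    show "a \<le> n" by (simp add: a_def)
    have "512 * a \<le> n" by (simp add: a_def)
    then show "real n \<ge> 512 * real a" by linarith
    have "n < 512 * (a + 1)" by (simp add: a_def)
    then have "n \<le> 1024 * a" using \<open>a \<ge> 1\<close> by (simp add: distrib_left)
    then show "real a \<ge> real n / 1024" by linarith
  qed
  have lnn: "ln (real n) > 0" using assms by simp
  have "6 \<le> ln (real n) - ln (real a)"
  proof -
    have "(6::real) \<le> 9 * ln 2" using ln2_ge_two_thirds by simp
    also have "\<dots> = ln (2 ^ 9)" using ln_realpow[of "2::real" 9] by simp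
    also have "\<dots> \<le> ln (real n / real a)" using a by (intro ln_mono) (auto simp: field_simps)
    also have "\<dots> = ln (real n) - ln (real a)" using a by (simp add: ln_div)
    finally show ?thesis .
  qed
  then have "1 \<le> (\<Sum>p | prime p \<and> a < p \<and> p \<le> n. ln (real p) / real p)"
    using mertens_lower[of n] mertens_upper[of a] primes_upto_split[OF a(2), of "\<lambda>p. ln (real p) / real p"] a assms by linarith
  also have "\<dots> \<le> (\<Sum>p | prime p \<and> a < p \<and> p \<le> n. ln (real n) / real a)"
    using a by (intro sum_mono frac_le) auto
  also have "\<dots> = real (card {p. prime p \<and> a < p \<and> p \<le> n}) * (ln (real n) / real a)" by simp
  also have "\<dots> \<le> real (card (primes_upto n)) * (ln (real n) / real a)"
    using lnn by (intro mult_right_mono of_nat_mono card_mono) (auto simp: primes_upto_def[symmetric], auto simp: primes_upto_def)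
  finally have "real a / ln (real n) \<le> real (card (primes_upto n))" using lnn a by (simp add: field_simps)
  moreover have "real n / (1024 * ln (real n)) \<le> real a / ln (real n)"
    using a(4) lnn by (simp add: divide_right_mono flip: divide_divide_eq_left)
  ultimately show ?thesis by linarith
qed

lemma sqf_sum_le_ln:
  assumes "finite P" "\<And>p. p \<in> P \<Longrightarrow> prime p" "n \<ge> 1"
  shows "sqf_sum P n \<le> 1 + ln (real n)"
proof -
  let ?I = "{U. U \<subseteq> P \<and> \<Prod>U \<le> n}"
  have "sqf_sum P n \<le> (\<Sum>k=1..n. 1 / real k)"
    unfolding sqf_sum_def
  proof (rule sum_le_inj)
    show "inj_on (\<lambda>U. \<Prod>U) ?I"
      by (rule inj_onI) (metis (no_types, lifting) mem_Collect_eq assms(1,2) prime_factors_prod_primes finite_subset subsetD)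
    show "\<Prod>U \<in> {1..n}" if "U \<in> ?I" for U
      using that prod_primes_pos[of U] assms(2) by (auto simp: Suc_le_eq)
  qed auto
  also have "\<dots> = harm n" by (simp add: harm_def inverse_eq_divide)
  also have "\<dots> \<le> 1 + ln (real n)" using harm_le assms(3) by simp
  finally show ?thesis .
qed

lemma exp_le_linear: "0 \<le> t \<Longrightarrow> t \<le> 1 \<Longrightarrow> exp t \<le> 1 + 2 * (t::real)"
  using exp_bound[of t] mult_left_le[of t t] by (simp add: power2_eq_square)

text \<open>Rankin's trick. The product \<open>E\<close> is the sum of \<open>1 / k\<close> over the
  squarefree \<open>k\<close> with no prime factor above \<open>y\<close>. For
  \<open>k > y ^ 4\<close> insert the factor \<open>exp (-4)\<close> times \<open>k\<close> to the
  power \<open>1 / ln y\<close>, which is at least 1. It raises the Euler product by at most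
  \<open>exp 3\<close>, so this tail is at most \<open>E / 2\<close>, and the harmonic sum up to
  \<open>y ^ 4\<close> bounds the other half.\<close>

lemma prod_one_plus_inverse_primes_le:
  assumes y: "ln (real y) \<ge> 4"
  shows "(\<Prod>p\<in>primes_upto y. 1 + 1 / real p) \<le> 10 * ln (real y)"
proof -
  let ?P = "primes_upto y"
  define e where "e = 1 / ln (real y)"
  define E where "E = (\<Prod>p\<in>?P. 1 + 1 / real p)"
  have y2: "y \<ge> 2" using y by (cases "y \<le> 1") (auto simp: le_Suc_eq)
  have E_sum: "E = (\<Sum>U\<in>Pow ?P. 1 / real (\<Prod>U))"
    unfolding E_def by (subst add.commute, subst prod_add) (auto simp: prod_dividef)
  have Epos: "E > 0" unfolding E_def by (rule prime_sum_le_prod) (rule prime_of_primes_upto)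
  have finU: "finite U" if "U \<subseteq> ?P" for U using that finite_subset finite_primes_upto by blast
  have prodpos: "\<Prod>U > 0" if "U \<subseteq> ?P" for U using that by (intro prod_primes_pos) (auto dest: prime_of_primes_upto)
  have "(\<Sum>U\<in>Pow ?P - {U. U \<subseteq> ?P \<and> \<Prod>U \<le> y ^ 4}. 1 / real (\<Prod>U)) \<le>
     (\<Sum>U\<in>Pow ?P - {U. U \<subseteq> ?P \<and> \<Prod>U \<le> y ^ 4}. exp (-4) * (\<Prod>p\<in>U. exp (e * ln (real p)) / real p))"
  proof (rule sum_mono)
    fix U assume "U \<in> Pow ?P - {U. U \<subseteq> ?P \<and> \<Prod>U \<le> y ^ 4}"
    then have U: "U \<subseteq> ?P" "\<Prod>U > y ^ 4" by auto
    have "4 * ln (real y) = ln (real (y ^ 4))" using y2 by (simp add: ln_realpow)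
    also have "\<dots> \<le> ln (real (\<Prod>U))" using U y2 by (intro ln_mono of_nat_mono) auto
    finally have "4 \<le> e * ln (real (\<Prod>U))" using y by (simp add: e_def field_simps)
    then have "1 \<le> exp (-4) * exp (e * ln (real (\<Prod>U)))" by (simp flip: exp_add)
    moreover have "exp (e * ln (real (\<Prod>U))) = (\<Prod>p\<in>U. exp (e * ln (real p)))"
    proof -
      have "ln (real (\<Prod>U)) = (\<Sum>p\<in>U. ln (real p))"
      proof -
        have "ln (\<Prod>p\<in>U. real p) = (\<Sum>p\<in>U. ln (real p))"
          using U finU[OF U(1)] by (intro ln_prod) (auto simp: prime_gt_0_nat primes_upto_def)
        then show ?thesis by simp
      qed
      then show ?thesis by (simp add: sum_distrib_left exp_sum finU[OF U(1)] del: of_nat_prod)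
    qed
    ultimately have "1 * (1 / real (\<Prod>U)) \<le> exp (-4) * (\<Prod>p\<in>U. exp (e * ln (real p))) * (1 / real (\<Prod>U))"
      by (intro mult_right_mono) (auto simp: prod_nonneg)
    then show "1 / real (\<Prod>U) \<le> exp (-4) * (\<Prod>p\<in>U. exp (e * ln (real p)) / real p)"
      by (simp add: prod_dividef)
  qed
  also have "\<dots> \<le> (\<Sum>U\<in>Pow ?P. exp (-4) * (\<Prod>p\<in>U. exp (e * ln (real p)) / real p))"
    by (intro sum_mono2) (auto intro!: mult_nonneg_nonneg prod_nonneg)
  also have "\<dots> = exp (-4) * (\<Prod>p\<in>?P. exp (e * ln (real p)) / real p + 1)"
    by (subst prod_add) (auto simp: sum_distrib_left)
  also have "\<dots> \<le> exp (-4) * (E * exp 3)"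
  proof (rule mult_left_mono)
    have "(\<Prod>p\<in>?P. exp (e * ln (real p)) / real p + 1) \<le> (\<Prod>p\<in>?P. (1 + 1 / real p) * exp (2 * e * (ln (real p) / real p)))"
    proof (intro prod_mono conjI)
      fix p assume p: "p \<in> ?P"
      have p0: "real p > 0" using prime_of_primes_upto[OF p] prime_gt_0_nat by simp
      have t: "0 \<le> e * ln (real p)" "e * ln (real p) \<le> 1"
      proof -
        show "0 \<le> e * ln (real p)" using ln_prime_nonneg[OF p] y by (simp add: e_def)
        have "ln (real p) \<le> ln (real y)" using p p0 by (intro ln_mono) (auto simp: primes_upto_def)
        then show "e * ln (real p) \<le> 1" using y by (simp add: e_def divide_le_eq)
      qed
      have "exp (e * ln (real p)) / real p + 1 \<le> (1 + 2 * (e * ln (real p))) / real p + 1"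
        using exp_le_linear[OF t] p0 by (intro add_right_mono divide_right_mono) auto
      also have "\<dots> = 1 + 1 / real p + 2 * e * (ln (real p) / real p)" by (simp add: add_divide_distrib)
      also have "\<dots> \<le> (1 + 1 / real p) * (1 + 2 * e * (ln (real p) / real p))"
      proof -
        define X where "X = 2 * e * (ln (real p) / real p)"
        have "X \<ge> 0" using t p0 by (simp add: X_def)
        then have "X / real p \<ge> 0" using p0 by simp
        then show ?thesis unfolding X_def[symmetric] by (simp add: distrib_left distrib_right)
      qed
      also have "\<dots> \<le> (1 + 1 / real p) * exp (2 * e * (ln (real p) / real p))"
        by (intro mult_left_mono exp_ge_add_one_self) simp
      finally show "exp (e * ln (real p)) / real p + 1 \<le> (1 + 1 / real p) * exp (2 * e * (ln (real p) / real p))" .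
    qed (auto intro!: add_nonneg_nonneg)
    also have "\<dots> = E * exp (2 * e * (\<Sum>p\<in>?P. ln (real p) / real p))"
      by (simp add: prod.distrib E_def sum_distrib_left exp_sum)
    also have "\<dots> \<le> E * exp 3"
    proof -
      have "(\<Sum>p\<in>?P. ln (real p) / real p) \<le> ln (real y) + 2" using y2 by (intro mertens_upper) auto
      then have "2 * e * (\<Sum>p\<in>?P. ln (real p) / real p) \<le> 2 * e * (ln (real y) + 2)"
        using y by (intro mult_left_mono) (auto simp: e_def)
      \<comment> \<open>The left side is \<open>2 + 4 / ln y\<close>; here
        \<open>ln y \<ge> 4\<close> enters.\<close>
      also have "\<dots> \<le> 3" using y by (simp add: e_def field_simps)
      finally show ?thesis using Epos by (intro mult_left_mono) auto
    qed
    finally show "(\<Prod>p\<in>?P. exp (e * ln (real p)) / real p + 1) \<le> E * exp 3" .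
  qed simp
  also have "\<dots> = E * exp (-1)" by (simp flip: exp_add)
  also have "\<dots> \<le> E * (1 / 2)"
  proof (rule mult_left_mono)
    have "exp 1 \<ge> (2::real)" using exp_ge_add_one_self[of "1::real"] by simp
    then show "exp (- 1) \<le> (1 / 2 :: real)" by (simp add: exp_minus inverse_eq_divide divide_le_eq)
  qed (use Epos in simp)
  finally have tail: "(\<Sum>U\<in>Pow ?P - {U. U \<subseteq> ?P \<and> \<Prod>U \<le> y ^ 4}. 1 / real (\<Prod>U)) \<le> E / 2" by simp
  have "E = (\<Sum>U\<in>Pow ?P - {U. U \<subseteq> ?P \<and> \<Prod>U \<le> y ^ 4}. 1 / real (\<Prod>U)) + sqf_sum ?P (y ^ 4)"
    unfolding E_sum sqf_sum_def by (rule sum.subset_diff) auto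
  then have "E \<le> 2 * sqf_sum ?P (y ^ 4)" using tail by linarith
  moreover have "sqf_sum ?P (y ^ 4) \<le> 1 + ln (real (y ^ 4))"
    using y2 by (intro sqf_sum_le_ln) (auto simp: prime_of_primes_upto)
  moreover have "ln (real (y ^ 4)) = 4 * ln (real y)" using y2 by (simp add: ln_realpow)
  ultimately have "E \<le> 10 * ln (real y)" using y by linarith
  then show ?thesis unfolding E_def .
qed

text \<open>The cutoff \<open>ln y\<close> keeps the product of these primes below
  \<open>y ^ 2\<close>, so that all of them together fit into a modulus. The remaining prime factors
  of a number bounded by a fixed power of \<open>y\<close> contribute only a bounded factor to an
  Euler product.\<close>

definition small_primes :: "nat \<Rightarrow> nat set" where
  "small_primes y = primes_upto (nat \<lfloor>ln (real y)\<rfloor>)"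

lemma prod_small_primes_le:
  assumes "y \<ge> 1"
  shows "\<Prod>(small_primes y) \<le> y ^ 2"
proof -
  define z where "z = nat \<lfloor>ln (real y)\<rfloor>"
  have z: "real z \<le> ln (real y)" unfolding z_def using assms by (intro of_nat_floor) auto
  have "real (\<Prod>(small_primes y)) \<le> real (4 ^ z)"
    unfolding small_primes_def z_def[symmetric] by (rule of_nat_mono[OF primorial_le])
  also have "\<dots> \<le> exp 2 ^ z"
  proof -
    have "(4::real) = 2 * 2" by simp
    also have "\<dots> \<le> exp 1 * exp 1" using exp_ge_add_one_self[of "1::real"] by (intro mult_mono) auto
    also have "\<dots> = exp 2" by (simp flip: exp_add)
    finally show ?thesis by (simp add: power_mono)
  qed
  also have "\<dots> = exp (2 * real z)" by (simp add: exp_of_nat_mult mult.commute flip: exp_of_nat_mult)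
  also have "\<dots> \<le> exp (2 * ln (real y))" using z by simp
  also have "\<dots> = real (y ^ 2)" using assms by (simp add: exp_double)
  finally show ?thesis by (simp only: of_nat_le_iff)
qed

section \<open>Primes in residue classes on average\<close>

lemma root_mod_exists:
  fixes D l q :: nat
  assumes "coprime D l" "l > 0"
  shows "\<exists>a<l. l dvd q + D * a"
proof -
  obtain x where x: "[D * x = 1] (mod l)" using cong_solve_coprime_nat[OF assms(1)] by auto
  \<comment> \<open>\<open>(l - 1) * q\<close> represents \<open>- q\<close> modulo \<open>l\<close>
    within the natural numbers.\<close>
  let ?a = "(x * ((l - 1) * q)) mod l"
  have "[D * ?a = D * (x * ((l - 1) * q))] (mod l)" by (intro cong_mult) (auto simp: Cong.cong_def)
  also have "D * (x * ((l - 1) * q)) = (D * x) * ((l - 1) * q)" by simp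
  also have "[(D * x) * ((l - 1) * q) = 1 * ((l - 1) * q)] (mod l)" by (rule cong_mult[OF x cong_refl])
  finally have c: "[q + D * ?a = q + 1 * ((l - 1) * q)] (mod l)" by (intro cong_add) auto
  have "q + 1 * ((l - 1) * q) = l * q" using assms(2) by (cases l) auto
  then have "(q + D * ?a) mod l = (l * q) mod l" using c unfolding Cong.cong_def by (simp only:)
  then have "l dvd q + D * ?a" by (simp only: dvd_eq_mod_eq_0 mod_mult_self1_is_0)
  moreover have "?a < l" using assms(2) by simp
  ultimately show ?thesis by blast
qed

lemma prime_dvd_shift:
  fixes l :: nat
  assumes "l dvd q + D * a" "t mod l = a"
  shows "l dvd q + D * t"
proof -
  have "t = a + l * (t div l)" using assms(2) by (metis mod_mult_div_eq)
  then have "q + D * t = (q + D * a) + l * (D * (t div l))" by (metis add.assoc distrib_left mult.left_commute)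
  moreover have "l dvd (q + D * a) + l * (D * (t div l))" by (rule dvd_add[OF assms(1) dvd_triv_left])
  ultimately show ?thesis by (simp only:)
qed

lemma prod_primes_le_totient:
  assumes "D > 0" "finite P" "\<And>l. l \<in> P \<Longrightarrow> prime l \<and> l dvd D"
  shows "(\<Prod>l\<in>P. 1 + 1 / real l) \<le> real D / real (totient D)"
proof -
  have "(\<Prod>l\<in>P. 1 + 1 / real l) \<le> (\<Prod>l\<in>prime_factors D. 1 + 1 / real l)"
    by (rule prod_mono2) (use assms in \<open>auto simp: prime_factors_dvd\<close>)
  also have "\<dots> \<le> (\<Prod>l\<in>prime_factors D. 1 / (1 - 1 / real l))"
  proof (intro prod_mono conjI)
    fix l assume "l \<in> prime_factors D"
    then have "l \<ge> 2" using in_prime_factors_imp_prime prime_ge_2_nat by blast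
    then have "real l \<ge> 2" by simp
    then show "1 + 1 / real l \<le> 1 / (1 - 1 / real l)" by (simp add: divide_simps) (simp add: algebra_simps)
  qed simp
  also have "\<dots> = real D / real (totient D)"
    using totient_formula2[of D] assms(1) by (simp add: prod_dividef)
  finally show ?thesis .
qed

text \<open>The bound of Brun and Titchmarsh. The members of \<open>S\<close> are
  \<open>q0 + D * t\<close> with \<open>q0\<close> the least of them, and \<open>y < q\<close> keeps
  every prime \<open>l \<le> y\<close> from dividing one. The Euler product over the exempt primes
  \<open>l dvd D\<close> turns \<open>H / D\<close> into \<open>H / \<phi>(D)\<close>.\<close>

lemma card_primes_cong:
  assumes y: "y \<ge> 2" and S: "\<And>q. q \<in> S \<Longrightarrow> prime q \<and> u < q \<and> q \<le> u + H \<and> y < q"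
    and D: "1 \<le> D" "D \<le> H" and cong: "\<And>q q'. q \<in> S \<Longrightarrow> q' \<in> S \<Longrightarrow> [q = q'] (mod D)"
  shows "real (card S) \<le> 4 * real H / (real (totient D) * ln (real y)) + real y ^ 6"
proof (cases "S = {}")
  case True
  have "ln (real y) > 0" using y by simp
  then show ?thesis using True by simp
next
  case False
  have finS: "finite S" using S by (intro finite_subset[of S "{..u + H}"]) auto
  define q0 where "q0 = Min S"
  have q0: "q0 \<in> S" "\<And>q. q \<in> S \<Longrightarrow> q0 \<le> q" using finS False by (auto simp: q0_def)
  define \<tau> where "\<tau> q = (q - q0) div D" for q
  have \<tau>: "q = q0 + D * \<tau> q" if "q \<in> S" for q
  proof -
    have "D dvd q - q0" using cong[OF that q0(1)] q0(2)[OF that] cong_altdef_nat by blast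
    then show ?thesis using q0(2)[OF that] by (simp add: \<tau>_def)
  qed
  have inj: "inj_on \<tau> S"
  proof (rule inj_onI)
    fix q q' assume q: "q \<in> S" "q' \<in> S" "\<tau> q = \<tau> q'"
    show "q = q'" using \<tau>[OF q(1)] \<tau>[OF q(2)] q(3) by simp
  qed
  define N where "N = H div D + 1"
  have TN: "\<tau> ` S \<subseteq> {..<N}"
  proof (rule image_subsetI)
    fix q assume q: "q \<in> S"
    have "q - q0 \<le> H" using S[OF q] S[OF q0(1)] by linarith
    then have "\<tau> q \<le> H div D" unfolding \<tau>_def by (rule div_le_mono)
    then show "\<tau> q \<in> {..<N}" by (simp add: N_def)
  qed
  define W where "W = (\<Prod>l | l \<in> primes_upto y \<and> l dvd D. 1 + 1 / real l)"
  have "real (card (\<tau> ` S)) \<le> 2 * real N * W / ln (real y) + real y ^ 6"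
    unfolding W_def
  proof (rule sieve_dim1[OF y TN])
    fix l assume l: "prime l" "l \<le> y" "\<not> l dvd D"
    then have "coprime D l" by (metis coprime_commute prime_imp_coprime)
    then obtain a where a: "a < l" "l dvd q0 + D * a" using root_mod_exists[of D l q0] prime_gt_0_nat[OF l(1)] by auto
    have "\<tau> q mod l \<noteq> a" if q: "q \<in> S" for q
    proof
      assume "\<tau> q mod l = a"
      then have "l dvd q0 + D * \<tau> q" by (rule prime_dvd_shift[OF a(2)])
      then have "l dvd q" unfolding \<tau>[OF q, symmetric] .
      then have "l = q" using S[OF q] l(1) by (intro primes_dvd_imp_eq) auto
      then show False using S[OF q] l(2) by simp
    qed
    then show "\<exists>a<l. \<forall>t\<in>\<tau> ` S. t mod l \<noteq> a" using a(1) by blast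
  qed
  also have "card (\<tau> ` S) = card S" by (rule card_image[OF inj])
  also have "2 * real N * W / ln (real y) \<le> 4 * real H / (real (totient D) * ln (real y))"
  proof -
    have "real N \<le> 2 * (real H / real D)"
    proof -
      have "real (H div D) \<le> real H / real D" by (rule real_div_le)
      moreover have "1 \<le> real H / real D" using D by simp
      ultimately show ?thesis by (simp add: N_def)
    qed
    moreover have "W \<le> real D / real (totient D)"
      unfolding W_def using D by (intro prod_primes_le_totient) (auto simp: primes_upto_def)
    moreover have "W \<ge> 0" unfolding W_def by (intro prod_nonneg) auto
    ultimately have "real N * W \<le> 2 * (real H / real D) * (real D / real (totient D))"
      by (intro mult_mono) auto
    also have "\<dots> = 2 * real H / real (totient D)" using D by simp
    finally have "2 * (real N * W) / ln (real y) \<le> 2 * (2 * real H / real (totient D)) / ln (real y)"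
      using y by (intro divide_right_mono) auto
    then show ?thesis by (simp add: mult_ac)
  qed
  finally show ?thesis by simp
qed

text \<open>The form in which the distribution of primes is passed on. \<open>S\<close> is any set
  of mutually congruent members rather than a named class, since the classes arise as solution sets
  of divisibility conditions. The weights \<open>1 / q\<close> match the number of choices left for
  \<open>p\<close>.\<close>

definition avg_primes :: "nat set \<Rightarrow> nat \<Rightarrow> real \<Rightarrow> bool" where
  "avg_primes Q M C \<longleftrightarrow> finite Q \<and> (\<forall>q\<in>Q. prime q) \<and>
    (\<forall>D S. 1 \<le> D \<longrightarrow> D \<le> M \<longrightarrow> S \<subseteq> Q \<longrightarrow> (\<forall>q\<in>S. \<forall>q'\<in>S. [q = q'] (mod D)) \<longrightarrow>
       (\<Sum>q\<in>S. 1 / real q) \<le> C / real (totient D))"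

lemma avg_primesD:
  assumes "avg_primes Q M C" "1 \<le> D" "D \<le> M" "S \<subseteq> Q" "\<And>q q'. q \<in> S \<Longrightarrow> q' \<in> S \<Longrightarrow> [q = q'] (mod D)"
  shows "(\<Sum>q\<in>S. 1 / real q) \<le> C / real (totient D)"
  using assms unfolding avg_primes_def by blast

text \<open>Dyadic blocks: in each the sieve gives \<open>4 / (\<phi>(D) ln y)\<close>, and the
  number \<open>J \<le> c * ln y\<close> of blocks cancels the logarithm. The errors
  \<open>y ^ 6\<close> form a geometric series, bounded because
  \<open>D * y ^ 6 \<le> Y0\<close>.\<close>

lemma avg_primes_interval:
  assumes y: "y \<ge> 2" and M: "1 \<le> M" "M * y ^ 6 \<le> Y0" and J: "Y1 \<le> Y0 * 2 ^ J" "real J \<le> c * ln (real y)"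
  shows "avg_primes {q. prime q \<and> Y0 < q \<and> q \<le> Y1} M (4 * c + 2)"
  unfolding avg_primes_def
proof (intro conjI allI impI)
  show "finite {q. prime q \<and> Y0 < q \<and> q \<le> Y1}" by (rule finite_subset[of _ "{..Y1}"]) auto
  fix D S assume D: "1 \<le> D" "D \<le> M" and S: "S \<subseteq> {q. prime q \<and> Y0 < q \<and> q \<le> Y1}"
    and cong: "\<forall>q\<in>S. \<forall>q'\<in>S. [q = q'] (mod D)"
  have finS: "finite S" using S by (intro finite_subset[of S "{..Y1}"]) auto
  have lny: "ln (real y) > 0" using y by simp
  have y6: "y ^ 6 \<ge> 1" using y by (simp add: Suc_le_eq)
  have MY: "M \<le> Y0" using M(2) y6 by (metis le_trans mult.right_neutral mult_le_mono2)
  have yY: "y \<le> Y0"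
  proof -
    have "y ^ 1 \<le> y ^ 6" using y by (intro power_increasing) auto
    also have "\<dots> \<le> M * y ^ 6" using M(1) by simp
    finally show ?thesis using M(2) by simp
  qed
  have Y0: "Y0 > 0" using MY M(1) by simp
  have tD: "real (totient D) > 0" "real (totient D) \<le> real D" using D by (auto simp: totient_le)
  define B where "B j = {q \<in> S. Y0 * 2 ^ j < q \<and> q \<le> Y0 * 2 ^ j + Y0 * 2 ^ j}" for j
  have cover: "\<exists>j<J. q \<in> B j" if q: "q \<in> S" for q
  proof -
    have qY: "Y0 < q" "q \<le> Y0 * 2 ^ J" using q S J(1) by auto
    define j where "j = (LEAST j. q \<le> Y0 * 2 ^ j)"
    have j: "q \<le> Y0 * 2 ^ j" unfolding j_def using qY(2) by (rule LeastI)
    have "j \<le> J" unfolding j_def using qY(2) by (rule Least_le)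
    have "j \<noteq> 0" using j qY by (cases j) auto
    then obtain i where i: "j = Suc i" by (cases j) auto
    have "\<not> q \<le> Y0 * 2 ^ i" using not_less_Least[of i "\<lambda>j. q \<le> Y0 * 2 ^ j"] i unfolding j_def by simp
    then have "q \<in> B i" using j q unfolding i B_def by (simp add: mult_2 distrib_left)
    then show ?thesis using i \<open>j \<le> J\<close> by (intro exI[of _ i]) auto
  qed
  have blk: "(\<Sum>q\<in>B j. 1 / real q) \<le> 4 / (real (totient D) * ln (real y)) + real y ^ 6 / real Y0 * (1 / 2) ^ j" for j
  proof -
    have H: "real (Y0 * 2 ^ j) > 0" using Y0 by simp
    have "(\<Sum>q\<in>B j. 1 / real q) \<le> (\<Sum>q\<in>B j. 1 / real (Y0 * 2 ^ j))"
      using H by (intro sum_mono divide_left_mono of_nat_mono) (auto simp: B_def)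
    also have "\<dots> = real (card (B j)) / real (Y0 * 2 ^ j)" by simp
    also have "\<dots> \<le> (4 * real (Y0 * 2 ^ j) / (real (totient D) * ln (real y)) + real y ^ 6) / real (Y0 * 2 ^ j)"
    proof (rule divide_right_mono)
      show "real (card (B j)) \<le> 4 * real (Y0 * 2 ^ j) / (real (totient D) * ln (real y)) + real y ^ 6"
      proof (rule card_primes_cong[OF y, of _ "Y0 * 2 ^ j"])
        fix q assume "q \<in> B j"
        then show "prime q \<and> Y0 * 2 ^ j < q \<and> q \<le> Y0 * 2 ^ j + Y0 * 2 ^ j \<and> y < q"
          using S yY unfolding B_def by auto
      next
        have "D \<le> Y0 * 1" using D MY by simp
        also have "\<dots> \<le> Y0 * 2 ^ j" by (intro mult_le_mono2) simp
        finally show "D \<le> Y0 * 2 ^ j" .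
      qed (use D cong in \<open>auto simp: B_def\<close>)
    qed simp
    also have "\<dots> = 4 / (real (totient D) * ln (real y)) + real y ^ 6 / real Y0 * (1 / 2) ^ j"
      using H Y0 by (simp add: add_divide_distrib power_one_over)
    finally show ?thesis .
  qed
  have "(\<Sum>q\<in>S. 1 / real q) \<le> (\<Sum>q\<in>S. \<Sum>j<J. if q \<in> B j then 1 / real q else 0)"
  proof (rule sum_mono)
    fix q assume "q \<in> S"
    then obtain j where j: "j < J" "q \<in> B j" using cover by blast
    then have "1 / real q = (if q \<in> B j then 1 / real q else 0)" by simp
    also have "\<dots> \<le> (\<Sum>j<J. if q \<in> B j then 1 / real q else 0)"
      using j by (intro member_le_sum) auto
    finally show "1 / real q \<le> (\<Sum>j<J. if q \<in> B j then 1 / real q else 0)" .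
  qed
  also have "\<dots> = (\<Sum>j<J. \<Sum>q\<in>S. if q \<in> B j then 1 / real q else 0)" by (rule sum.swap)
  also have "\<dots> = (\<Sum>j<J. \<Sum>q\<in>B j. 1 / real q)"
  proof (rule sum.cong[OF refl])
    fix j
    have "B j = {q \<in> S. q \<in> B j}" by (auto simp: B_def)
    then show "(\<Sum>q\<in>S. if q \<in> B j then 1 / real q else 0) = (\<Sum>q\<in>B j. 1 / real q)"
      using sum.inter_filter[OF finS, of "\<lambda>q. 1 / real q" "\<lambda>q. q \<in> B j"] by simp
  qed
  also have "\<dots> \<le> (\<Sum>j<J. 4 / (real (totient D) * ln (real y)) + real y ^ 6 / real Y0 * (1 / 2) ^ j)"
    by (intro sum_mono blk)
  also have "\<dots> = real J * (4 / (real (totient D) * ln (real y))) + real y ^ 6 / real Y0 * (\<Sum>j<J. (1 / 2) ^ j)"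
    by (simp add: sum.distrib sum_distrib_left)
  also have "\<dots> \<le> 4 * c / real (totient D) + 2 / real (totient D)"
  proof (rule add_mono)
    have "real J * (4 / (real (totient D) * ln (real y))) \<le> c * ln (real y) * (4 / (real (totient D) * ln (real y)))"
      using J(2) tD lny by (intro mult_right_mono) auto
    then show "real J * (4 / (real (totient D) * ln (real y))) \<le> 4 * c / real (totient D)" using lny by (simp add: mult.commute)
    have "(\<Sum>j<J. (1 / 2 :: real) ^ j) \<le> 2" by (simp add: sum_gp_strict)
    moreover have "real y ^ 6 / real Y0 \<le> 1 / real (totient D)"
    proof -
      have "real (D * y ^ 6) \<le> real Y0" using D(2) M(2) by (intro of_nat_mono) (meson le_trans mult_le_mono1)
      then have "real D * real y ^ 6 \<le> real Y0" by simp
      then have "real (totient D) * real y ^ 6 \<le> real Y0" using tD by (smt (verit) mult_right_mono zero_le_power of_nat_0_le_iff)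
      then show ?thesis using tD Y0 by (simp add: divide_simps mult.commute)
    qed
    ultimately have "real y ^ 6 / real Y0 * (\<Sum>j<J. (1 / 2) ^ j) \<le> 1 / real (totient D) * 2"
      by (intro mult_mono) (auto intro!: sum_nonneg)
    then show "real y ^ 6 / real Y0 * (\<Sum>j<J. (1 / 2) ^ j) \<le> 2 / real (totient D)" by simp
  qed
  finally show "(\<Sum>q\<in>S. 1 / real q) \<le> (4 * c + 2) / real (totient D)" by (simp add: add_divide_distrib)
qed auto

lemma avg_primes_powers:
  assumes y: "ln (real y) \<ge> 4" and "b \<ge> 6"
  shows "avg_primes {q. prime q \<and> y ^ b < q \<and> q \<le> y ^ (b + k)} (y ^ (b - 6)) (6 * real k + 6)"
proof -
  have y2: "y \<ge> 2" using y by (cases "y \<le> 1") (auto simp: le_Suc_eq)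
  \<comment> \<open>Because \<open>ln 2 \<ge> 2 / 3\<close>, this many doublings cover a factor
    \<open>y ^ k\<close>.\<close>
  define J where "J = nat \<lceil>real k * (3 / 2 * ln (real y))\<rceil>"
  have "real J < real k * (3 / 2 * ln (real y)) + 1" unfolding J_def using y by (simp add: of_nat_nat) linarith
  then have J: "real J \<le> (3 / 2 * real k + 1) * ln (real y)" using y by (simp add: distrib_right)
  have "real k * (3 / 2 * ln (real y)) \<le> real J" unfolding J_def by (rule real_nat_ceiling_ge)
  then have "real k * (3 / 2 * ln (real y)) * (2 / 3) \<le> real J * ln 2"
    using ln2_ge_two_thirds y by (intro mult_mono) auto
  then have "ln (real y ^ k) \<le> ln (2 ^ J)" using y2 by (simp add: ln_realpow)
  then have "real y ^ k \<le> 2 ^ J" using y2 by simp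
  then have yk: "y ^ k \<le> 2 ^ J" by (metis of_nat_le_iff of_nat_numeral of_nat_power)
  have "avg_primes {q. prime q \<and> y ^ b < q \<and> q \<le> y ^ (b + k)} (y ^ (b - 6)) (4 * (3 / 2 * real k + 1) + 2)"
  proof (rule avg_primes_interval[OF y2 _ _ _ J])
    show "1 \<le> y ^ (b - 6)" using y2 by simp
    show "y ^ (b - 6) * y ^ 6 \<le> y ^ b" using assms(2) by (simp flip: power_add)
    show "y ^ (b + k) \<le> y ^ b * 2 ^ J" using yk by (simp add: power_add)
  qed
  then show ?thesis by (simp add: algebra_simps)
qed

text \<open>Each prime \<open>l \<in> U\<close> splits \<open>S\<close> into at most
  \<open>k\<close> classes while it multiplies the modulus by \<open>l\<close>, so it contributes
  the factor \<open>k / (l - 1)\<close>.\<close>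

lemma avg_primes_classes:
  assumes avg: "avg_primes Q M C" and finU: "finite U"
    and "\<And>l. l \<in> U \<Longrightarrow> prime l" "d \<ge> 1" "\<And>l. l \<in> U \<Longrightarrow> \<not> l dvd d" "d * \<Prod>U \<le> M" "S \<subseteq> Q"
    "\<And>q q'. q \<in> S \<Longrightarrow> q' \<in> S \<Longrightarrow> [q = q'] (mod d)" "\<And>l. l \<in> U \<Longrightarrow> card ((\<lambda>q. q mod l) ` S) \<le> k"
  shows "(\<Sum>q\<in>S. 1 / real q) \<le> real k ^ card U * C / (real (totient d) * (\<Prod>l\<in>U. real l - 1))"
  using finU assms(3-)
proof (induction U arbitrary: d S rule: finite_induct)
  case empty
  then show ?case using avg_primesD[OF avg, of d S] by simp
next
  case (insert l U)
  have l: "prime l" "\<not> l dvd d" using insert.prems(1,3) by blast+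
  have finS: "finite S" using insert.prems(5) avg finite_subset unfolding avg_primes_def by blast
  have C: "C \<ge> 0"
  proof -
    have "d * \<Prod>(insert l U) \<ge> 1" using insert.prems(1,2) prod_primes_pos[of "insert l U"] by (simp add: Suc_le_eq)
    then have "1 \<le> M" using insert.prems(4) by (rule le_trans)
    then have "0 \<le> C / real (totient 1)" using avg_primesD[OF avg, of 1 "{}"] by simp
    then show ?thesis by simp
  qed
  have tot: "totient (d * l) = totient d * (l - 1)"
  proof -
    have "coprime d l" using l by (metis coprime_commute prime_imp_coprime)
    then show ?thesis using l(1) by (simp add: totient_mult_coprime totient_prime)
  qed
  have lr: "real (l - 1) = real l - 1" using prime_ge_1_nat[OF l(1)] by (simp add: of_nat_diff)
  let ?R = "(\<lambda>q. q mod l) ` S"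
  have part: "(\<Sum>q\<in>{q \<in> S. q mod l = c}. 1 / real q) \<le> real k ^ card U * C / (real (totient (d * l)) * (\<Prod>l\<in>U. real l - 1))" for c
  proof (rule insert.IH)
    show "1 \<le> d * l" using insert.prems(2) l(1) by (simp add: Suc_le_eq prime_gt_0_nat)
    show "\<not> l' dvd d * l" if "l' \<in> U" for l'
    proof
      assume "l' dvd d * l"
      moreover have "prime l'" "\<not> l' dvd d" using insert.prems(1,3) that by blast+
      ultimately have "l' dvd l" by (simp add: prime_dvd_mult_iff)
      then have "l' = l" using \<open>prime l'\<close> l(1) primes_dvd_imp_eq by blast
      then show False using that insert.hyps by simp
    qed
    show "d * l * \<Prod>U \<le> M" using insert.prems(4) insert.hyps by (simp add: mult.assoc)
    show "{q \<in> S. q mod l = c} \<subseteq> Q" using insert.prems(5) by blast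
    show "[q = q'] (mod d * l)" if "q \<in> {q \<in> S. q mod l = c}" "q' \<in> {q \<in> S. q mod l = c}" for q q'
    proof (rule coprime_cong_mult_nat)
      show "[q = q'] (mod d)" by (rule insert.prems(6)) (use that in blast)+
      show "[q = q'] (mod l)" using that by (simp add: Cong.cong_def)
      show "coprime d l" using l by (metis coprime_commute prime_imp_coprime)
    qed
    show "card ((\<lambda>q. q mod l') ` {q \<in> S. q mod l = c}) \<le> k" if "l' \<in> U" for l'
    proof -
      have "card ((\<lambda>q. q mod l') ` {q \<in> S. q mod l = c}) \<le> card ((\<lambda>q. q mod l') ` S)"
        using finS by (intro card_mono) auto
      also have "\<dots> \<le> k" by (rule insert.prems(7)) (use that in blast)
      finally show ?thesis .
    qed
    show "prime l'" if "l' \<in> U" for l' by (rule insert.prems(1)) (use that in blast)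
  qed
  have pos: "(\<Prod>l\<in>U. real l - 1) \<ge> 0"
  proof (intro prod_nonneg)
    fix l' assume "l' \<in> U"
    then have "l' \<ge> 1" using insert.prems(1) prime_ge_1_nat by blast
    then show "0 \<le> real l' - 1" by simp
  qed
  have "(\<Sum>q\<in>S. 1 / real q) = (\<Sum>c\<in>?R. \<Sum>q\<in>{q \<in> S. q mod l = c}. 1 / real q)"
    using finS by (intro sum.group[symmetric]) auto
  also have "\<dots> \<le> (\<Sum>c\<in>?R. real k ^ card U * C / (real (totient (d * l)) * (\<Prod>l\<in>U. real l - 1)))"
    by (intro sum_mono part)
  also have "\<dots> = real (card ?R) * (real k ^ card U * C / (real (totient (d * l)) * (\<Prod>l\<in>U. real l - 1)))" by simp
  also have "\<dots> \<le> real k * (real k ^ card U * C / (real (totient (d * l)) * (\<Prod>l\<in>U. real l - 1)))"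
    using insert.prems(7)[of l] C pos by (intro mult_right_mono divide_nonneg_nonneg mult_nonneg_nonneg of_nat_mono) auto
  also have "\<dots> = real k ^ card (insert l U) * C / (real (totient d) * (\<Prod>l\<in>insert l U. real l - 1))"
    using insert.hyps by (simp add: tot lr[unfolded One_nat_def] mult_ac)
  finally show ?case .
qed

lemma sum_inverse_pronic_le:
  assumes "finite Z" "\<And>l. l \<in> Z \<Longrightarrow> prime l"
  shows "(\<Sum>l\<in>Z. 1 / (real l * (real l - 1))) \<le> 1"
proof -
  have tele: "(\<Sum>k=2..n. 1 / (real k * (real k - 1))) \<le> 1 - 1 / real n" if "n \<ge> 1" for n
    using that
  proof (induction n rule: nat_induct_at_least)
    case (Suc n)
    have n: "real n > 0" using Suc.hyps by simp
    have "1 / (real (Suc n) * (real (Suc n) - 1)) = 1 / real n - 1 / real (Suc n)"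
      using n by (simp add: divide_simps)
    moreover have "(\<Sum>k=2..Suc n. 1 / (real k * (real k - 1))) = (\<Sum>k=2..n. 1 / (real k * (real k - 1))) + 1 / (real (Suc n) * (real (Suc n) - 1))"
      using Suc.hyps by simp
    ultimately show ?case using Suc.IH by linarith
  qed simp
  obtain n where n: "Z \<subseteq> {..n}" using assms(1) finite_nat_iff_bounded_le by blast
  have "(\<Sum>l\<in>Z. 1 / (real l * (real l - 1))) \<le> (\<Sum>k=2..n + 1. 1 / (real k * (real k - 1)))"
    using n assms(2) prime_ge_2_nat by (intro sum_mono2) auto
  also have "\<dots> \<le> 1 - 1 / real (n + 1)" by (intro tele) simp
  also have "\<dots> \<le> 1" by simp
  finally show ?thesis .
qed

text \<open>Averaged over \<open>q\<close>, a product over primes that force \<open>q\<close> into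
  few classes is bounded. When it is expanded, \<open>l\<close> contributes \<open>K / l\<close>
  times the density \<open>k / (l - 1)\<close>, and these terms have a convergent sum. Primes of
  \<open>d\<close> stay out of \<open>E\<close> because \<open>d\<close> already fixes the class
  modulo them.\<close>

lemma avg_primes_exp_prod:
  assumes avg: "avg_primes Q M C" and Z: "finite Z" "\<And>l. l \<in> Z \<Longrightarrow> prime l"
    and d: "d \<ge> 1" "d * \<Prod>Z \<le> M" and S: "S \<subseteq> Q" and cong: "\<And>q q'. q \<in> S \<Longrightarrow> q' \<in> S \<Longrightarrow> [q = q'] (mod d)"
    and E: "\<And>q. q \<in> S \<Longrightarrow> E q \<subseteq> Z" "\<And>q l. q \<in> S \<Longrightarrow> l \<in> E q \<Longrightarrow> \<not> l dvd d"
    and k: "\<And>l. l \<in> Z \<Longrightarrow> \<not> l dvd d \<Longrightarrow> card ((\<lambda>q. q mod l) ` {q \<in> S. l \<in> E q}) \<le> k" and K: "K \<ge> 0"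
  shows "(\<Sum>q\<in>S. 1 / real q * (\<Prod>l\<in>E q. 1 + K / real l)) \<le> C * exp (real k * K) / real (totient d)"
proof -
  define Z' where "Z' = {l \<in> Z. \<not> l dvd d}"
  have finZ': "finite Z'" and prZ': "\<And>l. l \<in> Z' \<Longrightarrow> prime l" using Z by (auto simp: Z'_def)
  have finS: "finite S" using S avg finite_subset unfolding avg_primes_def by blast
  have ge2: "real l \<ge> 2" if "l \<in> Z'" for l using prime_ge_2_nat[OF prZ'[OF that]] by simp
  have EZ: "E q \<subseteq> Z'" if "q \<in> S" for q using E that by (auto simp: Z'_def)
  have C: "C \<ge> 0"
  proof -
    have "\<Prod>Z \<ge> 1" using prod_primes_pos[of Z] Z(2) by (simp add: Suc_le_eq)
    then have "1 * 1 \<le> d * \<Prod>Z" using d(1) by (intro mult_le_mono) auto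
    then have "1 \<le> M" using d(2) by linarith
    then have "0 \<le> C / real (totient 1)" using avg_primesD[OF avg, of 1 "{}"] by simp
    then show ?thesis by simp
  qed
  have expand: "(\<Prod>l\<in>E q. 1 + K / real l) = (\<Sum>U\<in>Pow Z'. if U \<subseteq> E q then (\<Prod>l\<in>U. K / real l) else 0)" if q: "q \<in> S" for q
  proof -
    have fE: "finite (E q)" using EZ[OF q] finZ' finite_subset by blast
    have "(\<Prod>l\<in>E q. 1 + K / real l) = (\<Prod>l\<in>E q. K / real l + 1)" by (simp add: add.commute)
    also have "\<dots> = (\<Sum>U\<in>Pow (E q). (\<Prod>l\<in>U. K / real l))" by (subst prod_add[OF fE]) simp
    also have "\<dots> = (\<Sum>U\<in>{U \<in> Pow Z'. U \<subseteq> E q}. (\<Prod>l\<in>U. K / real l))"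
      using EZ[OF q] by (intro sum.cong) auto
    also have "\<dots> = (\<Sum>U\<in>Pow Z'. if U \<subseteq> E q then (\<Prod>l\<in>U. K / real l) else 0)"
      using finZ' by (intro sum.inter_filter) simp
    finally show ?thesis .
  qed
  have inner: "(\<Sum>q\<in>{q \<in> S. U \<subseteq> E q}. 1 / real q) \<le> real k ^ card U * C / (real (totient d) * (\<Prod>l\<in>U. real l - 1))" if U: "U \<subseteq> Z'" for U
  proof (rule avg_primes_classes[OF avg])
    show fU: "finite U" using U finZ' finite_subset by blast
    have "\<Prod>U dvd \<Prod>Z" using U Z(1) by (intro prod_dvd_prod_subset) (auto simp: Z'_def)
    then have "\<Prod>U \<le> \<Prod>Z" by (rule dvd_imp_le) (rule prod_primes_pos, rule Z(2))
    then have "d * \<Prod>U \<le> d * \<Prod>Z" by (rule mult_le_mono2)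
    then show "d * \<Prod>U \<le> M" using d(2) by (rule le_trans)
    show "card ((\<lambda>q. q mod l) ` {q \<in> S. U \<subseteq> E q}) \<le> k" if "l \<in> U" for l
    proof -
      have "card ((\<lambda>q. q mod l) ` {q \<in> S. U \<subseteq> E q}) \<le> card ((\<lambda>q. q mod l) ` {q \<in> S. l \<in> E q})"
        using finS that by (intro card_mono) auto
      also have "\<dots> \<le> k"
      proof (rule k)
        show "l \<in> Z" "\<not> l dvd d" using U that unfolding Z'_def by blast+
      qed
      finally show ?thesis .
    qed
    show "\<not> l dvd d" if "l \<in> U" for l using U that unfolding Z'_def by blast
    show "prime l" if "l \<in> U" for l using U that prZ' by blast
    show "{q \<in> S. U \<subseteq> E q} \<subseteq> Q" using S by blast
  qed (use d cong in simp_all)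
  have "(\<Sum>q\<in>S. 1 / real q * (\<Prod>l\<in>E q. 1 + K / real l)) =
      (\<Sum>q\<in>S. \<Sum>U\<in>Pow Z'. if U \<subseteq> E q then (\<Prod>l\<in>U. K / real l) * (1 / real q) else 0)"
  proof (rule sum.cong[OF refl])
    fix q assume "q \<in> S"
    then show "1 / real q * (\<Prod>l\<in>E q. 1 + K / real l) = (\<Sum>U\<in>Pow Z'. if U \<subseteq> E q then (\<Prod>l\<in>U. K / real l) * (1 / real q) else 0)"
      unfolding expand[OF \<open>q \<in> S\<close>] sum_distrib_left by (intro sum.cong refl) auto
  qed
  also have "\<dots> = (\<Sum>U\<in>Pow Z'. \<Sum>q\<in>S. if U \<subseteq> E q then (\<Prod>l\<in>U. K / real l) * (1 / real q) else 0)"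
    by (rule sum.swap)
  also have "\<dots> = (\<Sum>U\<in>Pow Z'. (\<Prod>l\<in>U. K / real l) * (\<Sum>q\<in>{q \<in> S. U \<subseteq> E q}. 1 / real q))"
    unfolding sum_distrib_left by (rule sum.cong[OF refl], rule sum.inter_filter[OF finS, symmetric])
  also have "\<dots> \<le> (\<Sum>U\<in>Pow Z'. (\<Prod>l\<in>U. K / real l) * (real k ^ card U * C / (real (totient d) * (\<Prod>l\<in>U. real l - 1))))"
    using inner K by (intro sum_mono mult_left_mono) (auto intro!: prod_nonneg)
  also have "\<dots> = C / real (totient d) * (\<Sum>U\<in>Pow Z'. \<Prod>l\<in>U. real k * K * (1 / (real l * (real l - 1))))"
    unfolding sum_distrib_left by (rule sum.cong[OF refl]) (simp add: prod_dividef prod.distrib power_mult_distrib mult_ac)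
  also have "(\<Sum>U\<in>Pow Z'. \<Prod>l\<in>U. real k * K * (1 / (real l * (real l - 1)))) = (\<Prod>l\<in>Z'. real k * K * (1 / (real l * (real l - 1))) + 1)"
    by (subst prod_add[OF finZ']) simp
  also have "\<dots> \<le> (\<Prod>l\<in>Z'. exp (real k * K * (1 / (real l * (real l - 1)))))"
  proof (intro prod_mono conjI)
    fix l assume "l \<in> Z'"
    then have "1 / (real l * (real l - 1)) \<ge> 0" using ge2[of l] by simp
    then show "0 \<le> real k * K * (1 / (real l * (real l - 1))) + 1" using K by (intro add_nonneg_nonneg mult_nonneg_nonneg) auto
    show "real k * K * (1 / (real l * (real l - 1))) + 1 \<le> exp (real k * K * (1 / (real l * (real l - 1))))"
      using exp_ge_add_one_self by (simp add: add.commute)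
  qed
  also have "\<dots> = exp (real k * K * (\<Sum>l\<in>Z'. 1 / (real l * (real l - 1))))"
    unfolding sum_distrib_left using finZ' by (simp add: exp_sum)
  also have "\<dots> \<le> exp (real k * K)"
    using sum_inverse_pronic_le[OF finZ' prZ'] K by (simp add: mult_left_le)
  finally show ?thesis using C by (simp add: divide_right_mono mult_left_mono)
qed

text \<open>An Euler product for a weight that depends only on the set of prime factors: all powers
  of \<open>l\<close> together weigh \<open>c l\<close> times \<open>1 / l + 1 / l^2 + ...\<close>,
  at most \<open>2 * c l / l\<close>.\<close>

lemma multiplicative_sum_le:
  fixes c :: "nat \<Rightarrow> real"
  assumes "finite W" "\<And>l. l \<in> W \<Longrightarrow> prime l" "\<And>l. c l \<ge> 0" "finite X" "\<And>w. w \<in> X \<Longrightarrow> w > 0 \<and> prime_factors w \<subseteq> W"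
  shows "(\<Sum>w\<in>X. (\<Prod>l\<in>prime_factors w. c l) / real w) \<le> (\<Prod>l\<in>W. 1 + 2 * c l / real l)"
  using assms
proof (induction W arbitrary: X rule: finite_induct)
  case empty
  have "X \<subseteq> {1}"
  proof
    fix w assume "w \<in> X"
    then have "w > 0" "prime_factors w = {}" using empty.prems(4) by auto
    then show "w \<in> {1}" using prime_factorization_nat[of w] by simp
  qed
  then have "(\<Sum>w\<in>X. (\<Prod>l\<in>prime_factors w. c l) / real w) \<le> (\<Sum>w\<in>{1}. (\<Prod>l\<in>prime_factors w. c l) / real w)"
    by (intro sum_mono2) auto
  then show ?case by simp
next
  case (insert l W)
  have l: "prime l" using insert.prems(1) by blast
  then have l2: "real l \<ge> 2" using prime_ge_2_nat[of l] by simp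
  define v where "v w = multiplicity l w" for w
  define u where "u w = w div l ^ v w" for w :: nat
  have w_eq: "w = l ^ v w * u w" and u_pos: "u w > 0" and u_ndvd: "\<not> l dvd u w"
    and u_pf: "prime_factors (u w) \<subseteq> W" if "w \<in> X" for w
  proof -
    have w: "w > 0" "prime_factors w \<subseteq> insert l W" using insert.prems(4)[OF that] by blast+
    have eq: "l ^ v w * u w = w" using multiplicity_dvd[of l w] by (simp add: u_def v_def)
    then show "w = l ^ v w * u w" by simp
    have "u w \<noteq> 0" using w(1) eq by (metis mult_0_right less_not_refl)
    then show "u w > 0" by simp
    show nd: "\<not> l dvd u w" unfolding u_def v_def using w(1) l
      by (intro multiplicity_decompose) (auto simp: prime_gt_1_nat)
    show "prime_factors (u w) \<subseteq> W"
    proof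
      fix p assume p: "p \<in> prime_factors (u w)"
      then have "p dvd w" using eq by (metis dvd_mult in_prime_factors_imp_dvd)
      then have "p \<in> prime_factors w" using p w(1) by (auto simp: prime_factors_dvd)
      moreover have "p \<noteq> l" using p nd in_prime_factors_imp_dvd by blast
      ultimately show "p \<in> W" using w(2) by auto
    qed
  qed
  define V where "V = Max (insert 0 (v ` X))"
  have vV: "v w \<le> V" if "w \<in> X" for w unfolding V_def using insert.prems(3) that by (intro Max_ge) auto
  define b where "b j = (if j = 0 then 1 else c l / real l ^ j)" for j
  have bsum: "(\<Sum>j\<le>V. b j) \<le> 1 + 2 * c l / real l"
  proof -
    have "(\<Sum>j\<le>m. b j) \<le> 1 + c l * (2 / real l - 2 / real l ^ Suc m)" for m
    proof (induction m)
      case 0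
      then show ?case by (simp add: b_def)
    next
      case (Suc m)
      have "1 / real l ^ Suc m \<le> 2 / real l ^ Suc m - 2 / real l ^ Suc (Suc m)"
        using l2 by (simp add: divide_simps)
      then have "c l * (1 / real l ^ Suc m) \<le> c l * (2 / real l ^ Suc m - 2 / real l ^ Suc (Suc m))"
        using insert.prems(2) by (intro mult_left_mono) auto
      moreover have "b (Suc m) = c l * (1 / real l ^ Suc m)" by (simp add: b_def)
      moreover have "c l * (2 / real l - 2 / real l ^ Suc (Suc m)) =
          c l * (2 / real l - 2 / real l ^ Suc m) + c l * (2 / real l ^ Suc m - 2 / real l ^ Suc (Suc m))"
        unfolding distrib_left[symmetric] by simp
      ultimately show ?case using Suc unfolding sum.atMost_Suc by linarith
    qed
    note bound = this[of V]
    have "c l * (2 / real l - 2 / real l ^ Suc V) \<le> c l * (2 / real l)"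
      using insert.prems(2)[of l] l2 by (intro mult_left_mono) auto
    with bound show ?thesis by (simp add: mult.commute)
  qed
  have val: "(\<Prod>p\<in>prime_factors w. c p) / real w = b (v w) * ((\<Prod>p\<in>prime_factors (u w). c p) / real (u w))" if w: "w \<in> X" for w
  proof (cases "v w = 0")
    case True
    then have "w = u w" using w_eq[OF w] by simp
    then show ?thesis using True by (simp add: b_def)
  next
    case False
    have "prime_factors w = insert l (prime_factors (u w))"
    proof -
      have "prime_factors w = prime_factors (l ^ v w) \<union> prime_factors (u w)"
        by (subst w_eq[OF w], rule prime_factors_product) (use l u_pos[OF w] in \<open>auto simp: prime_gt_0_nat\<close>)
      also have "prime_factors (l ^ v w) = {l}" using False l by (simp add: prime_factorization_prime_power)
      finally show ?thesis by simp
    qed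
    moreover have "l \<notin> prime_factors (u w)" using u_ndvd[OF w] in_prime_factors_imp_dvd by blast
    moreover have "real w = real l ^ v w * real (u w)" using w_eq[OF w] by (metis of_nat_mult of_nat_power)
    ultimately show ?thesis using False by (simp add: b_def)
  qed
  have inj: "inj_on (\<lambda>w. (v w, u w)) X"
  proof (rule inj_onI)
    fix w w' assume ww: "w \<in> X" "w' \<in> X" "(v w, u w) = (v w', u w')"
    then have "l ^ v w * u w = l ^ v w' * u w'" by simp
    then show "w = w'" using w_eq[OF ww(1)] w_eq[OF ww(2)] by simp
  qed
  have nonneg: "(\<Prod>p\<in>prime_factors w. c p) / real w \<ge> 0" for w
    using insert.prems(2) by (intro divide_nonneg_nonneg prod_nonneg) auto
  have "(\<Sum>w\<in>X. (\<Prod>p\<in>prime_factors w. c p) / real w) \<le> (\<Sum>(j, w)\<in>{..V} \<times> u ` X. b j * ((\<Prod>p\<in>prime_factors w. c p) / real w))"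
  proof (rule sum_le_inj[OF _ inj])
    show "finite ({..V} \<times> u ` X)" using insert.prems(3) by simp
    show "(v w, u w) \<in> {..V} \<times> u ` X" if "w \<in> X" for w using vV[OF that] that by auto
    show "(\<Prod>p\<in>prime_factors w. c p) / real w \<le> (case (v w, u w) of (j, w) \<Rightarrow> b j * ((\<Prod>p\<in>prime_factors w. c p) / real w))" if "w \<in> X" for w
      unfolding split_conv val[OF that] by (rule order_refl)
    show "0 \<le> (case t of (j, w) \<Rightarrow> b j * ((\<Prod>p\<in>prime_factors w. c p) / real w))" for t
    proof -
      obtain j w where t: "t = (j, w)" by (cases t)
      have "b j \<ge> 0" using insert.prems(2)[of l] by (simp add: b_def)
      then show ?thesis unfolding t split_conv using nonneg by (rule mult_nonneg_nonneg)
    qed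
  qed
  also have "\<dots> = (\<Sum>j\<le>V. b j) * (\<Sum>w\<in>u ` X. (\<Prod>p\<in>prime_factors w. c p) / real w)"
    by (simp only: sum_product sum.cartesian_product)
  also have "\<dots> \<le> (1 + 2 * c l / real l) * (\<Prod>l\<in>W. 1 + 2 * c l / real l)"
  proof (rule mult_mono[OF bsum])
    show "(\<Sum>w\<in>u ` X. (\<Prod>p\<in>prime_factors w. c p) / real w) \<le> (\<Prod>l\<in>W. 1 + 2 * c l / real l)"
    proof (rule insert.IH)
      show "finite (u ` X)" using insert.prems(3) by simp
      show "w > 0 \<and> prime_factors w \<subseteq> W" if "w \<in> u ` X" for w using that u_pos u_pf by blast
    qed (use insert.prems(1,2) in blast)+
    show "0 \<le> 1 + 2 * c l / real l" using insert.prems(2)[of l] by (intro add_nonneg_nonneg) auto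
    show "0 \<le> (\<Sum>w\<in>u ` X. (\<Prod>p\<in>prime_factors w. c p) / real w)" by (intro sum_nonneg nonneg)
  qed
  finally show ?case using insert.hyps by simp
qed

text \<open>A number up to \<open>y ^ K\<close> has at most \<open>2 * K * ln y\<close> prime
  factors, and for those from \<open>ln y\<close> on each factor is at most
  \<open>1 + c / ln y\<close>. This lets the later averages deal with the primes up to
  \<open>ln y\<close> alone.\<close>

lemma large_prime_prod_le:
  assumes y: "ln (real y) \<ge> 4" and E: "0 < E" "E \<le> y ^ K" and c: "c \<ge> 0"
    and P: "finite P" "\<And>l. l \<in> P \<Longrightarrow> prime l \<and> l dvd E \<and> ln (real y) \<le> real l"
  shows "(\<Prod>l\<in>P. 1 + c / real l) \<le> exp (2 * c * real K)"
proof -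
  have y0: "y > 0" using y by (cases y) auto
  have "\<Prod>P dvd E" using P by (intro prod_primes_dvd_nat) auto
  then have "\<Prod>P \<le> y ^ K" using E by (meson dvd_imp_le le_trans)
  moreover have "2 ^ card P \<le> \<Prod>P"
  proof -
    have "(\<Prod>l\<in>P. 2) \<le> (\<Prod>l\<in>P. l)" using P prime_ge_2_nat by (intro prod_mono) auto
    then show ?thesis by simp
  qed
  ultimately have "real (2 ^ card P) \<le> real (y ^ K)" by (intro of_nat_mono) linarith
  then have "ln (real (2 ^ card P)) \<le> ln (real (y ^ K))" by (intro ln_mono) auto
  then have "real (card P) * ln 2 \<le> real K * ln (real y)" using y0 by (simp add: ln_realpow)
  moreover have "real (card P) * (1 / 2) \<le> real (card P) * ln 2" using ln2_ge_two_thirds by (intro mult_left_mono) auto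
  ultimately have cP: "real (card P) \<le> 2 * real K * ln (real y)" by simp
  have "(\<Prod>l\<in>P. 1 + c / real l) \<le> (\<Prod>l\<in>P. exp (c / ln (real y)))"
  proof (intro prod_mono conjI)
    fix l assume "l \<in> P"
    then have "ln (real y) \<le> real l" using P by auto
    then have "c / real l \<le> c / ln (real y)" using c y by (intro divide_left_mono) auto
    then show "1 + c / real l \<le> exp (c / ln (real y))" using exp_ge_add_one_self[of "c / ln (real y)"] by linarith
  qed (use c in \<open>auto intro!: add_nonneg_nonneg\<close>)
  also have "\<dots> = exp (real (card P) * (c / ln (real y)))" by (simp only: prod_constant exp_of_nat_mult)
  also have "\<dots> \<le> exp (2 * real K * ln (real y) * (c / ln (real y)))"
    using cP c y by (simp del: times_divide_eq_right add: mult_right_mono)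
  also have "\<dots> = exp (2 * c * real K)" using y by (simp add: mult_ac)
  finally show ?thesis .
qed

section \<open>Pairs of primes with equal values\<close>

lemma prod_union_le:
  fixes f :: "'a \<Rightarrow> real"
  assumes "finite A" "finite B" "\<And>x. f x \<ge> 1"
  shows "prod f (A \<union> B) \<le> prod f A * prod f B"
proof -
  have "prod f (A \<union> B) = prod f A * prod f (B - A)"
    using assms(1,2) by (subst prod.union_disjoint[symmetric]) (auto simp: Un_Diff_cancel)
  also have "\<dots> \<le> prod f A * prod f B"
  proof (rule mult_left_mono)
    show "prod f (B - A) \<le> prod f B" using assms by (intro prod_mono2) (auto intro: order_trans[OF zero_le_one])
    show "0 \<le> prod f A" using assms(3) by (intro prod_nonneg) (auto intro: order_trans[OF zero_le_one])
  qed
  finally show ?thesis .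
qed

lemma prod_subset_le:
  fixes f :: "'a \<Rightarrow> real"
  assumes "finite B" "A \<subseteq> B" "\<And>x. f x \<ge> 1"
  shows "prod f A \<le> prod f B"
  by (rule prod_mono2) (use assms in \<open>auto intro: order_trans[OF zero_le_one]\<close>)

text \<open>The solutions of the linear equation lie on the line
  \<open>(p0 + a' * t, p0' + a * t)\<close>, and both coordinates have to be prime. Modulo
  \<open>l\<close> this forbids two classes of \<open>t\<close>, which differ unless
  \<open>l\<close> divides the determinant \<open>a * p0 - a' * p0'\<close>, that is
  \<open>(c - c') / g\<close>. The gcd enters through the step \<open>a' = A' / g\<close>.\<close>

lemma pair_sieve:
  fixes F :: "(nat \<times> nat) set"
  assumes y: "y \<ge> 2" and A: "A \<ge> 1" "A' \<ge> 1" and cc: "c \<noteq> c'"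
    and F: "\<And>p p'. (p, p') \<in> F \<Longrightarrow> prime p \<and> prime p' \<and> y < p \<and> y < p' \<and> p \<le> X \<and> p * A + c' = p' * A' + c"
    and finF: "finite F"
  defines "g \<equiv> gcd A A'" and "nd \<equiv> nat \<bar>int c - int c'\<bar>"
  shows "real (card F) \<le> 32 * real (X div (A' div g) + 1) *
     (\<Prod>l | l \<in> primes_upto y \<and> l dvd 2 * (A * A' * nd). 1 + 1 / real l) / (ln (real y))\<^sup>2 + real y ^ 6"
proof (cases "F = {}")
  case True
  have "(\<Prod>l | l \<in> primes_upto y \<and> l dvd 2 * (A * A' * nd). 1 + 1 / real l) \<ge> 0" by (intro prod_nonneg) auto
  then show ?thesis using True by (simp add: add_nonneg_nonneg)
next
  case False
  define a a' where "a = A div g" and "a' = A' div g"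
  have g: "g > 0" "A = g * a" "A' = g * a'" "coprime a a'"
    using A by (auto simp: g_def a_def a'_def intro!: div_gcd_coprime)
  have a0: "a > 0" "a' > 0" using g A by (auto intro!: gr0I)
  \<comment> \<open>Starting from the least first coordinate keeps the parameter in the natural
    numbers; the second coordinate then increases as well.\<close>
  define p0 where "p0 = Min (fst ` F)"
  have "p0 \<in> fst ` F" unfolding p0_def using finF False by (intro Min_in) auto
  then obtain p0' where p0: "(p0, p0') \<in> F" by auto
  have p0_le: "p0 \<le> p" if "(p, p') \<in> F" for p p'
    unfolding p0_def using finF that by (intro Min_le) force+
  define \<tau> where "\<tau> x = (fst x - p0) div a'" for x :: "nat \<times> nat"
  have rep: "p = p0 + a' * \<tau> (p, p') \<and> p' = p0' + a * \<tau> (p, p')" if pp: "(p, p') \<in> F" for p p'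
  proof -
    have "p * A + c' = p' * A' + c" "p0 * A + c' = p0' * A' + c" using F[OF pp] F[OF p0] by auto
    then have "p * A + p0' * A' = p' * A' + p0 * A" by linarith
    then have "g * (p * a + p0' * a') = g * (p' * a' + p0 * a)" unfolding g(2,3) by (simp add: algebra_simps)
    then have e1: "p * a + p0' * a' = p' * a' + p0 * a" using g(1) by simp
    obtain d where d: "p = p0 + d" using p0_le[OF pp] le_Suc_ex by blast
    have e2: "d * a + p0' * a' = p' * a'" using e1 unfolding d by (simp add: algebra_simps)
    then have "p0' * a' \<le> p' * a'" by linarith
    then have "p0' \<le> p'" using a0 by simp
    then obtain d' where d': "p' = p0' + d'" using le_Suc_ex by blast
    have e3: "d * a = d' * a'" using e2 unfolding d' by (simp add: algebra_simps)
    then have "a' dvd d * a" by simp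
    then have "a' dvd d" using g(4) by (simp add: coprime_dvd_mult_left_iff coprime_commute)
    then obtain t where t: "d = a' * t" by (rule dvdE)
    have "d' = a * t" using e3 a0 unfolding t by (simp add: mult.commute)
    moreover have "\<tau> (p, p') = t" unfolding \<tau>_def d t using a0 by simp
    ultimately show ?thesis using d d' t by simp
  qed
  have inj: "inj_on \<tau> F"
  proof (rule inj_onI)
    fix x x' assume x: "x \<in> F" "x' \<in> F" "\<tau> x = \<tau> x'"
    obtain p p' r r' where pr: "x = (p, p')" "x' = (r, r')" by (cases x, cases x')
    have "\<tau> (p, p') = \<tau> (r, r')" using x(3) unfolding pr .
    then show "x = x'" using rep[OF x(1)[unfolded pr(1)]] rep[OF x(2)[unfolded pr(2)]] unfolding pr by (metis (no_types))
  qed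
  define N where "N = X div a' + 1"
  have TN: "\<tau> ` F \<subseteq> {..<N}"
  proof (rule image_subsetI)
    fix x assume x: "x \<in> F"
    obtain p p' where pr: "x = (p, p')" by (cases x)
    have "p \<le> X" using F x unfolding pr by blast
    then have "fst x - p0 \<le> X" unfolding pr by simp
    then have "\<tau> x \<le> X div a'" unfolding \<tau>_def by (rule div_le_mono)
    then show "\<tau> x \<in> {..<N}" by (simp add: N_def)
  qed
  have avoid: "\<tau> x mod l \<noteq> b" if x: "x \<in> F" and l: "prime l" "l \<le> y" and b: "l dvd p0 + a' * b \<or> l dvd p0' + a * b" for x l b
  proof
    assume m: "\<tau> x mod l = b"
    obtain p p' where pr: "x = (p, p')" by (cases x)
    have Fx: "prime p" "prime p'" "y < p" "y < p'" using F x unfolding pr by blast+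
    have "l dvd p \<or> l dvd p'" using b
    proof
      assume "l dvd p0 + a' * b"
      then have "l dvd p0 + a' * \<tau> x" using m by (rule prime_dvd_shift)
      then show ?thesis using rep[OF x[unfolded pr]] unfolding pr by (metis (no_types))
    next
      assume "l dvd p0' + a * b"
      then have "l dvd p0' + a * \<tau> x" using m by (rule prime_dvd_shift)
      then show ?thesis using rep[OF x[unfolded pr]] unfolding pr by (metis (no_types))
    qed
    then have "l = p \<or> l = p'" using l(1) Fx primes_dvd_imp_eq by blast
    then show False using l(2) Fx by auto
  qed
  have cop: "coprime e l" if "prime l" "\<not> l dvd e" for e l :: nat
    using that by (metis coprime_commute prime_imp_coprime)
  have root: "\<exists>b<l. l dvd r + e * b" if "prime l" "\<not> l dvd e" for r e l :: nat
    using root_mod_exists[OF cop[OF that]] prime_gt_0_nat[OF that(1)] by blast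
  have "real (card (\<tau> ` F)) \<le> 32 * real N * (\<Prod>l | l \<in> primes_upto y \<and> l dvd 2 * (A * A' * nd). 1 + 1 / real l) / (ln (real y))\<^sup>2 + real y ^ 6"
  proof (rule sieve_dim2[OF y TN])
    show "even (2 * (A * A' * nd))" by simp
    fix l assume l: "prime l" "l \<le> y"
    show "\<exists>b<l. \<forall>t\<in>\<tau> ` F. t mod l \<noteq> b"
    proof (cases "l dvd a'")
      case False
      then obtain b where "b < l" "l dvd p0 + a' * b" using root l(1) by blast
      then show ?thesis using avoid l by blast
    next
      \<comment> \<open>\<open>a\<close> and \<open>a'\<close> are coprime: if the first coordinate
        is constant modulo \<open>l\<close>, the second still runs through all classes.\<close>
      case True
      then have "\<not> l dvd a" using g(4) l(1) not_prime_unit coprime_common_divisor by blast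
      then obtain b where "b < l" "l dvd p0' + a * b" using root l(1) by blast
      then show ?thesis using avoid l by blast
    qed
  next
    fix l assume l: "prime l" "l \<le> y" "\<not> l dvd 2 * (A * A' * nd)"
    have na: "\<not> l dvd a" "\<not> l dvd a'" "\<not> l dvd nd" using l(3) unfolding g(2,3) by auto
    obtain b where b: "b < l" "l dvd p0 + a' * b" using root l(1) na by blast
    obtain b' where b': "b' < l" "l dvd p0' + a * b'" using root l(1) na by blast
    have "b \<noteq> b'"
    proof
      assume eq: "b = b'"
      have "int l dvd int (a * (p0 + a' * b)) - int (a' * (p0' + a * b))"
        using b b' eq by (intro dvd_diff) (simp_all only: int_dvd_int_iff dvd_mult)
      also have "int (a * (p0 + a' * b)) - int (a' * (p0' + a * b)) = int (p0 * a) - int (p0' * a')"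
        by (simp add: algebra_simps)
      finally have "int l dvd int g * (int (p0 * a) - int (p0' * a'))" by simp
      also have "int g * (int (p0 * a) - int (p0' * a')) = int (p0 * A) - int (p0' * A')"
        unfolding g(2,3) by (simp add: algebra_simps)
      also have "\<dots> = int c - int c'"
        using F[OF p0] by (simp flip: of_nat_add of_nat_mult add: algebra_simps)
      finally have "l dvd nd" unfolding nd_def by (simp add: dvd_nat_abs_iff)
      then show False using na by simp
    qed
    then show "\<exists>a<l. \<exists>b<l. a \<noteq> b \<and> (\<forall>t\<in>\<tau> ` F. t mod l \<noteq> a \<and> t mod l \<noteq> b)"
      using b b' avoid l by blast
  qed
  also have "card (\<tau> ` F) = card F" by (rule card_image[OF inj])
  finally show ?thesis unfolding N_def a'_def .
qed

lemma ln_le_self: "x > 0 \<Longrightarrow> ln (real x) \<le> real x"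
  using ln_le_minus_one[of "real x"] by simp

lemma small_primesD:
  assumes "l \<in> small_primes y" shows "prime l"
  using assms prime_of_primes_upto unfolding small_primes_def by blast

lemma finite_small_primes [simp]: "finite (small_primes y)" by (simp add: small_primes_def)

lemma small_primes_iff:
  assumes "y \<ge> 1"
  shows "l \<in> small_primes y \<longleftrightarrow> prime l \<and> real l \<le> ln (real y)"
proof -
  have "l \<le> nat \<lfloor>ln (real y)\<rfloor> \<longleftrightarrow> real l \<le> ln (real y)"
    using assms by (simp add: le_nat_floor nat_le_iff le_floor_iff le_nat_iff)
  then show ?thesis by (auto simp: small_primes_def primes_upto_def)
qed

text \<open>The primes from \<open>ln y\<close> on in the product cost \<open>exp (2 * K)\<close>,
  and the error \<open>y ^ 6\<close> is absorbed because \<open>A' * y ^ 8 \<le> X\<close> and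
  \<open>ln y \<le> y\<close>. The constant is \<open>97 = 32 * 2 * (3 / 2) + 1\<close>, where
  \<open>3 / 2\<close> is the factor of the prime 2.\<close>

lemma pair_count:
  fixes F :: "(nat \<times> nat) set"
  assumes y: "ln (real y) \<ge> 4" and A: "A \<ge> 1" "A' \<ge> 1" and cc: "c \<noteq> c'"
    and F: "\<And>p p'. (p, p') \<in> F \<Longrightarrow> prime p \<and> prime p' \<and> y < p \<and> y < p' \<and> p \<le> X \<and> p * A + c' = p' * A' + c"
    and finF: "finite F" and X: "A' * y ^ 8 \<le> X"
    and E: "A * A' * nat \<bar>int c - int c'\<bar> \<le> y ^ K"
  shows "real (card F) \<le> 97 * exp (2 * real K) * (real X * real (gcd A A') / (real A' * (ln (real y))\<^sup>2)) *
     (\<Prod>l | l \<in> small_primes y \<and> l dvd A * A' * nat \<bar>int c - int c'\<bar>. 1 + 1 / real l)"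
proof -
  have y2: "y \<ge> 2" using y by (cases "y \<le> 1") (auto simp: le_Suc_eq)
  define g where "g = gcd A A'"
  define e where "e = A * A' * nat \<bar>int c - int c'\<bar>"
  define L where "L = ln (real y)"
  have L: "L \<ge> 4" using y by (simp add: L_def)
  have e0: "e > 0" using A cc by (simp add: e_def)
  have g0: "g > 0" "g dvd A'" using A by (auto simp: g_def)
  define W where "W = (\<Prod>l | l \<in> small_primes y \<and> l dvd e. 1 + 1 / real l)"
  have W1: "W \<ge> 1" unfolding W_def by (intro prod_ge_1) auto
  define V where "V = real X * real g / (real A' * L\<^sup>2)"
  let ?P = "{l. l \<in> primes_upto y \<and> l dvd 2 * e}"
  let ?S = "{l. l \<in> small_primes y \<and> l dvd e}" and ?B = "{l \<in> primes_upto y. l dvd e \<and> L \<le> real l}"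
  have "(\<Prod>l\<in>?P. 1 + 1 / real l) \<le> (\<Prod>l\<in>{2} \<union> (?S \<union> ?B). 1 + 1 / real l)"
  proof (rule prod_subset_le)
    show "?P \<subseteq> {2} \<union> (?S \<union> ?B)"
    proof
      fix l assume l: "l \<in> ?P"
      then have pl: "prime l" "l dvd 2 * e" by (auto simp: primes_upto_def)
      show "l \<in> {2} \<union> (?S \<union> ?B)"
      proof (cases "l = 2")
        case False
        then have "l dvd e" using pl primes_dvd_imp_eq[of l 2] by (auto simp: prime_dvd_mult_iff)
        moreover have "l \<in> small_primes y \<or> L \<le> real l" using small_primes_iff[of y l] y2 pl(1) unfolding L_def by auto
        ultimately show ?thesis using l by auto
      qed simp
    qed
  qed auto
  also have "\<dots> \<le> (\<Prod>l\<in>{2}. 1 + 1 / real l) * (\<Prod>l\<in>?S \<union> ?B. 1 + 1 / real l)" by (rule prod_union_le) auto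
  also have "\<dots> \<le> (3 / 2) * (W * exp (2 * real K))"
  proof (intro mult_mono)
    have "(\<Prod>l\<in>?S \<union> ?B. 1 + 1 / real l) \<le> W * (\<Prod>l\<in>?B. 1 + 1 / real l)"
      unfolding W_def by (rule prod_union_le) auto
    also have "\<dots> \<le> W * exp (2 * 1 * real K)"
    proof (rule mult_left_mono)
      show "(\<Prod>l\<in>?B. 1 + 1 / real l) \<le> exp (2 * 1 * real K)"
        by (rule large_prime_prod_le[OF y e0 E[folded e_def]]) (auto simp: L_def primes_upto_def intro: finite_subset[of _ "{..y}"])
    qed (use W1 in simp)
    finally show "(\<Prod>l\<in>?S \<union> ?B. 1 + 1 / real l) \<le> W * exp (2 * real K)" by simp
  qed (auto intro!: prod_nonneg)
  finally have P: "(\<Prod>l\<in>?P. 1 + 1 / real l) \<le> (3 / 2) * (W * exp (2 * real K))" .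
  have N: "real (X div (A' div g) + 1) \<le> 2 * (real X * real g / real A')"
  proof -
    have "real (X div (A' div g)) \<le> real X / real (A' div g)" by (rule real_div_le)
    also have "real (A' div g) = real A' / real g" using g0 by (simp add: real_of_nat_div)
    finally have "real (X div (A' div g)) \<le> real X * real g / real A'" by simp
    moreover have "1 \<le> real X * real g / real A'"
    proof -
      have "A' * 1 \<le> A' * y ^ 8" using y2 by (intro mult_le_mono2) simp
      then have "A' \<le> X" using X by linarith
      then have "A' * 1 \<le> X * g" using g0 by (intro mult_le_mono) auto
      then have "real A' \<le> real X * real g" by (metis mult.right_neutral of_nat_le_iff of_nat_mult)
      then show ?thesis using A by simp
    qed
    ultimately show ?thesis by simp
  qed
  have "real (card F) \<le> 32 * real (X div (A' div g) + 1) * (\<Prod>l\<in>?P. 1 + 1 / real l) / L\<^sup>2 + real y ^ 6"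
    unfolding e_def g_def L_def by (rule pair_sieve[OF y2 A cc F finF])
  also have "\<dots> \<le> 32 * (2 * (real X * real g / real A')) * ((3 / 2) * (W * exp (2 * real K))) / L\<^sup>2 + V * (W * exp (2 * real K))"
  proof (intro add_mono divide_right_mono mult_mono P N order_refl)
    show "real y ^ 6 \<le> V * (W * exp (2 * real K))"
    proof -
      have "L \<le> real y" unfolding L_def using y2 by (intro ln_le_self) simp
      then have "real y ^ 6 * L\<^sup>2 \<le> real y ^ 6 * (real y)\<^sup>2" using L by (intro mult_left_mono power_mono) auto
      also have "\<dots> = real y ^ 8" by (simp flip: power_add)
      finally have "real A' * (real y ^ 6 * L\<^sup>2) \<le> real A' * real y ^ 8" by (rule mult_left_mono) simp
      also have "\<dots> = real (A' * y ^ 8)" by simp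
      also have "\<dots> \<le> real X" using X by (rule of_nat_mono)
      also have "\<dots> \<le> real X * real g" using g0 by (simp add: mult_le_cancel_left1)
      finally have "real y ^ 6 * (real A' * L\<^sup>2) \<le> real X * real g" by (simp add: mult_ac)
      then have "real y ^ 6 \<le> V" unfolding V_def using A L by (simp add: pos_le_divide_eq)
      also have "V * 1 \<le> V * (W * exp (2 * real K))"
      proof (rule mult_left_mono)
        have "1 * 1 \<le> W * exp (2 * real K)" using W1 by (intro mult_mono) auto
        then show "1 \<le> W * exp (2 * real K)" by simp
      qed (simp add: V_def)
      finally show ?thesis by simp
    qed
  qed (auto intro!: prod_nonneg)
  also have "\<dots> = 97 * exp (2 * real K) * V * W" by (simp add: V_def)
  finally show ?thesis unfolding V_def W_def L_def g_def e_def .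
qed

section \<open>The values \<open>k + totient k\<close> as linear forms and their common
  divisors\<close>

definition plus_phi :: "nat \<Rightarrow> nat" where "plus_phi m = m + totient m"

definition tgcd :: "nat \<Rightarrow> nat" where "tgcd s = gcd s (totient s)"

text \<open>For a prime \<open>q > s\<close> the value at \<open>q * s\<close> is
  \<open>q * plus_phi s - totient s\<close>. The gcd of the two coefficients is
  \<open>tgcd s\<close>; dividing it out leaves a linear form in \<open>q\<close> with coprime
  coefficients.\<close>

definition rform :: "nat \<Rightarrow> nat \<Rightarrow> nat" where
  "rform s q = q * (plus_phi s div tgcd s) - totient s div tgcd s"

lemma totient_prime_times:
  assumes "prime q" "\<not> q dvd s"
  shows "totient (q * s) = (q - 1) * totient s"
  using assms by (simp add: totient_mult_coprime totient_prime prime_imp_coprime)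

lemma rform_facts:
  assumes s: "s > 0" and q: "prime q" "s < q"
  shows "plus_phi (q * s) = tgcd s * rform s q"
    and "q * (plus_phi s div tgcd s) = rform s q + totient s div tgcd s"
    and "rform s q > 0"
    and "coprime (plus_phi s div tgcd s) (totient s div tgcd s)"
    and "plus_phi (q * s) + totient s = q * plus_phi s"
    and "tgcd s > 0"
proof -
  define g where "g = tgcd s"
  have t: "totient s > 0" using s by simp
  have g: "g > 0" "g dvd s" "g dvd totient s" using s by (auto simp: g_def tgcd_def)
  show "tgcd s > 0" using g(1) by (simp add: g_def)
  define a b where "a = s div g" and "b = totient s div g"
  have ab: "s = g * a" "totient s = g * b" using g by (auto simp: a_def b_def)
  have cop: "coprime a b" unfolding a_def b_def g_def tgcd_def using s by (intro div_gcd_coprime) auto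
  have pdiv: "plus_phi s div g = a + b" using g(1) unfolding plus_phi_def ab(2) by (subst ab(1)) (simp flip: distrib_left)
  have "coprime (a + b) b" using cop by (simp add: coprime_iff_gcd_eq_1 gcd_add1)
  then show "coprime (plus_phi s div tgcd s) (totient s div tgcd s)" using pdiv unfolding g_def[symmetric] b_def[symmetric] by simp
  have b0: "b > 0" "a > 0" using t s ab by (auto intro!: gr0I)
  have q1: "q \<ge> 1" using q by (simp add: prime_ge_1_nat)
  have qab: "b < q * (a + b)" 
  proof -
    have "b < a + b" using b0 by simp
    also have "\<dots> \<le> q * (a + b)" using q1 by simp
    finally show ?thesis .
  qed
  have r: "rform s q = q * (a + b) - b" unfolding rform_def g_def[symmetric] pdiv b_def[symmetric] by simp
  then show "q * (plus_phi s div tgcd s) = rform s q + totient s div tgcd s"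
    unfolding g_def[symmetric] pdiv b_def[symmetric] using qab by simp
  show "rform s q > 0" using r qab by simp
  have nd: "\<not> q dvd s" using q(2) s by (auto dest: dvd_imp_le)
  have tot: "totient (q * s) = (q - 1) * totient s" by (rule totient_prime_times[OF q(1) nd])
  have "plus_phi (q * s) + totient s = q * s + ((q - 1) * totient s + 1 * totient s)" unfolding plus_phi_def tot by simp
  also have "\<dots> = q * s + q * totient s" unfolding distrib_right[symmetric] using q1 by simp
  finally show e: "plus_phi (q * s) + totient s = q * plus_phi s" by (simp add: plus_phi_def distrib_left)
  have "tgcd s * rform s q + totient s = g * (q * (a + b) - b) + g * b" unfolding r g_def[symmetric] ab(2) by simp
  also have "\<dots> = g * (q * (a + b))" unfolding distrib_left[symmetric] using qab by simp
  also have "\<dots> = q * (g * a + g * b)" by (simp add: algebra_simps)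
  also have "\<dots> = q * plus_phi s" unfolding plus_phi_def ab[symmetric] ..
  finally show "plus_phi (q * s) = tgcd s * rform s q" using e by linarith
qed

text \<open>A common divisor of \<open>d\<close> and the leading coefficient would divide the
  constant term too. So the leading coefficient is invertible modulo \<open>d\<close>, and
  divisibility of the form by \<open>d\<close> fixes the class of the prime.\<close>

lemma rform_cong:
  assumes s: "s > 0" and q: "prime q" "s < q" "prime r" "s < r" and d: "d dvd rform s q" "d dvd rform s r"
  shows "[q = r] (mod d)"
proof -
  define al be where "al = plus_phi s div tgcd s" and "be = totient s div tgcd s"
  have e: "q * al = rform s q + be" "r * al = rform s r + be"
    using rform_facts(2)[OF s] q by (auto simp: al_def be_def)
  have cop: "coprime al be" unfolding al_def be_def by (rule rform_facts(4)[OF s q(1,2)])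
  have "coprime d al"
  proof (rule coprimeI)
    fix c assume c: "c dvd d" "c dvd al"
    then have "c dvd rform s q + be" using e(1) by (metis dvd_mult)
    moreover have "c dvd rform s q" using c(1) d(1) by (rule dvd_trans)
    ultimately have "c dvd be" by (metis dvd_add_right_iff)
    then show "is_unit c" using c(2) cop coprime_common_divisor by blast
  qed
  moreover have "[q * al = r * al] (mod d)"
    unfolding e using d by (simp add: Cong.cong_def mod_add_left_eq flip: mod_add_eq)
  ultimately show ?thesis by (simp add: cong_mult_rcancel_nat coprime_commute)
qed

lemma gcd_mult_dvd_nat: "gcd (a * b) c dvd gcd a c * gcd b (c::nat)"
proof -
  let ?e = "gcd (a * b) c"
  have e: "?e dvd a * b" "?e dvd c" by simp_all
  have "a * gcd b c = gcd (a * b) (a * c)" "c * gcd b c = gcd (c * b) (c * c)"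
    by (rule gcd_mult_distrib_nat)+
  then have "?e dvd a * gcd b c" "?e dvd c * gcd b c" using e by simp_all
  then have "?e dvd gcd (a * gcd b c) (c * gcd b c)" by simp
  also have "gcd (a * gcd b c) (c * gcd b c) = gcd a c * gcd b c"
    using gcd_mult_distrib_nat[of "gcd b c" a c] by (simp only: mult.commute)
  finally show ?thesis .
qed

lemma gcd_four_le:
  fixes a b a' b' :: nat
  assumes "coprime a a'" "b > 0" "b' > 0" "a > 0" "a' > 0"
  shows "gcd (a * b) (a' * b') \<le> gcd a b' * gcd a' b * gcd b b'"
proof -
  have "gcd (a * b) (a' * b') dvd gcd a (a' * b') * gcd b (a' * b')" by (rule gcd_mult_dvd_nat)
  also have "\<dots> dvd (gcd a a' * gcd a b') * (gcd b a' * gcd b b')"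
    using gcd_mult_dvd_nat[of a' b' a] gcd_mult_dvd_nat[of a' b' b] by (intro mult_dvd_mono) (simp_all add: gcd.commute)
  also have "gcd a a' = 1" using assms(1) by simp
  finally have "gcd (a * b) (a' * b') dvd gcd a b' * gcd a' b * gcd b b'" by (simp add: gcd.commute mult.assoc)
  then show ?thesis using assms by (intro dvd_imp_le) auto
qed

text \<open>Used to sort a sum by the value of a gcd: the exact condition
  \<open>\<tau> x = t\<close> is relaxed to membership in \<open>Y t\<close>, a divisibility
  condition on which averages are available.\<close>

lemma sum_le_fibers:
  fixes F :: "'a \<Rightarrow> real"
  assumes "finite X" "finite T" "\<And>x. x \<in> X \<Longrightarrow> \<tau> x \<in> T \<and> x \<in> Y (\<tau> x) \<and> F x \<le> G (\<tau> x) x"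
    "\<And>t. t \<in> T \<Longrightarrow> finite (Y t)" "\<And>t x. t \<in> T \<Longrightarrow> x \<in> Y t \<Longrightarrow> 0 \<le> G t x"
  shows "sum F X \<le> (\<Sum>t\<in>T. \<Sum>x\<in>Y t. G t x)"
proof -
  have "sum F X = (\<Sum>t\<in>T. \<Sum>x | x \<in> X \<and> \<tau> x = t. F x)"
    using assms(1-3) by (intro sum.group[symmetric]) auto
  also have "\<dots> \<le> (\<Sum>t\<in>T. \<Sum>x\<in>Y t. G t x)"
  proof (rule sum_mono)
    fix t assume t: "t \<in> T"
    have "(\<Sum>x | x \<in> X \<and> \<tau> x = t. F x) \<le> (\<Sum>x | x \<in> X \<and> \<tau> x = t. G t x)"
      using assms(3) by (intro sum_mono) auto
    also have "\<dots> \<le> (\<Sum>x\<in>Y t. G t x)"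
      using assms(3,4,5) t by (intro sum_mono2) auto
    finally show "(\<Sum>x | x \<in> X \<and> \<tau> x = t. F x) \<le> (\<Sum>x\<in>Y t. G t x)" .
  qed
  finally show ?thesis .
qed

lemma card_image_Un_le:
  assumes "finite S" "S = S1 \<union> S2" "card (f ` S1) \<le> k1" "card (f ` S2) \<le> k2"
  shows "card (f ` S) \<le> k1 + k2"
  unfolding assms(2) image_Un using card_Un_le[of "f ` S1" "f ` S2"] assms(3,4) by linarith

lemma card_image_le_1:
  assumes "\<And>x x'. x \<in> S \<Longrightarrow> x' \<in> S \<Longrightarrow> f x = f x'"
  shows "card (f ` S) \<le> 1"
proof (cases "S = {}")
  case False
  then obtain x where "x \<in> S" by blast
  then have "f ` S = {f x}" using assms by blast
  then show ?thesis by simp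
qed simp

lemma ratio_totient_le:
  assumes "n > 0"
  shows "real n / real (totient n) \<le> 2 ^ card (prime_factors n)"
proof -
  have "real n / real (totient n) = (\<Prod>l\<in>prime_factors n. 1 / (1 - 1 / real l))"
    using totient_formula2[of n] assms by (simp add: prod_dividef)
  also have "\<dots> \<le> (\<Prod>l\<in>prime_factors n. 2)"
  proof (intro prod_mono conjI)
    fix l assume "l \<in> prime_factors n"
    then have "l \<ge> 2" using in_prime_factors_imp_prime prime_ge_2_nat by blast
    then have "real l \<ge> 2" by simp
    then show "1 / (1 - 1 / real l) \<le> 2" "0 \<le> 1 / (1 - 1 / real l)" by (simp_all add: divide_simps)
  qed
  finally show ?thesis by simp
qed

lemma card_divisors_squarefree_le:
  assumes "squarefree (n::nat)"
  shows "card {d. d dvd n} \<le> 2 ^ card (prime_factors n)"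
proof -
  have n: "n > 0" using assms by (auto intro!: Nat.gr0I)
  have "inj_on prime_factors {d. d dvd n}"
  proof (rule inj_onI)
    fix d e assume d: "d \<in> {d. d dvd n}" "e \<in> {d. d dvd n}" "prime_factors d = prime_factors e"
    have sq: "squarefree d" "squarefree e"
      by (rule squarefree_mono[OF _ assms], use d in blast)+
    have "d = \<Prod>(prime_factors d)" by (rule prod_prime_factors_squarefree[OF sq(1), symmetric])
    also have "\<dots> = \<Prod>(prime_factors e)" using d(3) by (rule arg_cong)
    also have "\<dots> = e" by (rule prod_prime_factors_squarefree[OF sq(2)])
    finally show "d = e" .
  qed
  moreover have "prime_factors ` {d. d dvd n} \<subseteq> Pow (prime_factors n)"
  proof (rule image_subsetI)
    fix d assume "d \<in> {d. d dvd n}"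
    then have "d dvd n" by simp
    moreover have "n \<noteq> 0" using n by simp
    ultimately show "prime_factors d \<in> Pow (prime_factors n)" using dvd_prime_factors by (intro PowI)
  qed
  ultimately have "card {d. d dvd n} \<le> card (Pow (prime_factors n))"
    by (rule card_inj_on_le) (rule finite_Pow_iff[THEN iffD2], rule finite_set_mset)
  also have "card (Pow (prime_factors n)) = 2 ^ card (prime_factors n)"
    by (rule card_Pow) (rule finite_set_mset)
  finally show ?thesis .
qed

section \<open>Averaging over the largest fixed primes\<close>

text \<open>Solvability of \<open>p * plus_phi m - totient m = p' * plus_phi m' - totient m'\<close> in integers.\<close>
definition collide :: "nat \<Rightarrow> nat \<Rightarrow> bool" where
  "collide m m' \<longleftrightarrow> int (gcd (plus_phi m) (plus_phi m')) dvd int (totient m) - int (totient m')"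

text \<open>Apart from 2, its primes are the ones at which the sieve for pairs
  \<open>(p, p')\<close> may have fewer than two classes to remove.\<close>

definition pair_defect :: "nat \<Rightarrow> nat \<Rightarrow> nat" where
  "pair_defect m m' = plus_phi m * plus_phi m' * nat \<bar>int (totient m) - int (totient m')\<bar>"

text \<open>Modulo a common divisor of the values, \<open>q\<close> behaves like
  \<open>totient s / plus_phi s\<close> and \<open>q'\<close> likewise. Substituting this into
  \<open>q * s - q' * s'\<close> and clearing denominators leaves this difference, which is free of
  \<open>q\<close> and \<open>q'\<close>.\<close>

definition Delta :: "nat \<Rightarrow> nat \<Rightarrow> nat" where
  "Delta s s' = nat \<bar>int (s * totient s * plus_phi s') - int (s' * totient s' * plus_phi s)\<bar>"

lemma collide_commute: "collide m m' \<longleftrightarrow> collide m' m"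
  unfolding collide_def by (simp add: gcd.commute dvd_diff_commute)

text \<open>The totients agree modulo \<open>d\<close> by the collision, and the sums
  \<open>m + totient m\<close> and \<open>m' + totient m'\<close> both vanish modulo
  \<open>d\<close>; so the arguments agree as well.\<close>

lemma collide_dvd_diff:
  assumes "collide m m'" "d dvd plus_phi m" "d dvd plus_phi m'"
  shows "int d dvd int m - int m'" "int d dvd int (totient m) - int (totient m')"
proof -
  have "d dvd gcd (plus_phi m) (plus_phi m')" using assms by simp
  then have "int d dvd int (gcd (plus_phi m) (plus_phi m'))" by simp
  then show t: "int d dvd int (totient m) - int (totient m')" using assms(1) unfolding collide_def by (rule dvd_trans)
  have "int d dvd int (plus_phi m) - int (plus_phi m')" using assms(2,3) by (intro dvd_diff) simp_all
  then have "int d dvd (int (plus_phi m) - int (plus_phi m')) - (int (totient m) - int (totient m'))"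
    using t by (rule dvd_diff)
  then show "int d dvd int m - int m'" by (simp add: plus_phi_def)
qed

lemma squarefree_mult_imp_coprime:
  assumes "squarefree (a * b :: nat)"
  shows "coprime a b"
proof -
  have "gcd a b ^ 2 dvd a * b" unfolding power2_eq_square by (intro mult_dvd_mono) auto
  then have "gcd a b dvd 1" using assms squarefreeD by blast
  then show ?thesis by (simp add: coprime_iff_gcd_eq_1)
qed

lemma coprime_below_prime:
  assumes "prime (q::nat)" "0 < u" "u < q"
  shows "coprime u q"
proof -
  have "\<not> q dvd u" using assms by (auto dest: dvd_imp_le)
  then show ?thesis using assms(1) by (metis coprime_commute prime_imp_coprime)
qed

lemma dvd_transfer:
  fixes s s' q q' d :: nat
  assumes "int d dvd int (q * s) - int (q' * s')" "d dvd s" "d > 0" "d < q'" "prime q'"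
  shows "d dvd s'"
proof -
  have "int d dvd int (q * s)" using assms(2) by simp
  then have "int d dvd int (q * s) - (int (q * s) - int (q' * s'))" using assms(1) by (rule dvd_diff)
  then have "int d dvd int (q' * s')" by simp
  then have "d dvd q' * s'" by (simp only: int_dvd_int_iff)
  then show ?thesis using coprime_below_prime[OF assms(5,3,4)] by (simp add: coprime_dvd_mult_right_iff)
qed

text \<open>A divisor of \<open>s\<close> and of its totient divides the value at
  \<open>q * s\<close> for every \<open>q\<close>. If it divides the other value too, the collision
  carries it over to \<open>s'\<close>.\<close>

lemma common_divisor_of_parts:
  assumes s: "s > 0" "s' > 0" and q: "prime q" "s < q" and q': "prime q'" "s < q'" "s' < q'"
    and col: "collide (q * s) (q' * s')" and u: "u dvd tgcd s" "u dvd rform s' q'"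
  shows "u dvd gcd s s'"
proof -
  have us: "u dvd s" using u(1) unfolding tgcd_def by simp
  have u0: "u > 0" "u < q'" using dvd_pos_nat[OF s(1) us] dvd_imp_le[OF us s(1)] q'(2) by simp_all
  have "u dvd plus_phi (q * s)" unfolding rform_facts(1)[OF s(1) q] using u(1) by simp
  moreover have "u dvd plus_phi (q' * s')" unfolding rform_facts(1)[OF s(2) q'(1,3)] using u(2) by simp
  ultimately have "int u dvd int (q * s) - int (q' * s')" using collide_dvd_diff(1)[OF col] by blast
  then have "u dvd s'" using us u0 q'(1) by (rule dvd_transfer)
  then show ?thesis using us by simp
qed

lemma common_divisor_dvd_Delta:
  assumes s: "s > 0" "s' > 0" and q: "prime q" "s < q" and q': "prime q'" "s' < q'"
    and w: "w dvd plus_phi (q * s)" "w dvd plus_phi (q' * s')" and d: "int w dvd int (q * s) - int (q' * s')"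
  shows "w dvd Delta s s'"
proof -
  define a b A B where "a = int (plus_phi s)" and "b = int (plus_phi s')" and "A = int (plus_phi (q * s))" and "B = int (plus_phi (q' * s'))"
  have e: "int q * a = A + int (totient s)" "int q' * b = B + int (totient s')"
    using rform_facts(5)[OF s(1) q] rform_facts(5)[OF s(2) q'] unfolding a_def b_def A_def B_def
    by (metis of_nat_add of_nat_mult)+
  have "a * b * (int (q * s) - int (q' * s')) = (int q * a) * int s * b - (int q' * b) * int s' * a"
    by (simp add: algebra_simps)
  also have "\<dots> = (int s * int (totient s) * b - int s' * int (totient s') * a) + (A * (int s * b) - B * (int s' * a))"
    unfolding e by (simp add: algebra_simps)
  finally have "int s * int (totient s) * b - int s' * int (totient s') * a =
      a * b * (int (q * s) - int (q' * s')) - (A * (int s * b) - B * (int s' * a))" by simp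
  moreover have "int w dvd a * b * (int (q * s) - int (q' * s'))" using d by (rule dvd_mult)
  moreover have "int w dvd A" "int w dvd B" using w unfolding A_def B_def by simp_all
  then have "int w dvd A * (int s * b) - B * (int s' * a)" by (intro dvd_diff dvd_mult2)
  ultimately have "int w dvd int s * int (totient s) * b - int s' * int (totient s') * a" by simp
  then show ?thesis unfolding Delta_def a_def b_def by (simp add: dvd_nat_abs_iff)
qed

lemma prime_dvd_totient_imp_dvd:
  assumes s: "s > 0" and q: "prime q" "s < q" and l: "prime l" "l < q" "l dvd plus_phi (q * s)" "l dvd totient s"
  shows "l dvd s"
proof -
  have "l dvd q * plus_phi s" using l(3,4) rform_facts(5)[OF s q] by (metis dvd_add)
  moreover have "\<not> l dvd q" using l(1,2) q(1) primes_dvd_imp_eq by blast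
  ultimately have "l dvd plus_phi s" using l(1) by (simp add: prime_dvd_mult_iff)
  then show ?thesis using l(4) unfolding plus_phi_def by (simp add: dvd_add_left_iff)
qed

text \<open>The factors \<open>u\<close>, \<open>v\<close>, \<open>w\<close> of the gcd are weighed
  against the densities gained from fixing \<open>q'\<close> modulo \<open>lcm u w\<close> and
  \<open>q\<close> modulo \<open>lcm v w\<close>. Essentially \<open>1 / w\<close> survives, up to
  factors exponential in the number of primes and the overlap of \<open>w\<close> with
  \<open>D\<close>.\<close>

lemma totient_lcm_term_le:
  assumes D: "squarefree (D::nat)" and u: "u dvd D" and v: "v dvd D" and cop: "coprime u v" and w: "w > 0"
  shows "real u * real v * real w / (real (totient (lcm u w)) * real (totient (lcm v w))) \<le>
    4 ^ card (prime_factors D) * (4 ^ card (prime_factors w) * real (gcd w D) / real w)"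
proof -
  have D0: "D > 0" using D by (auto intro!: Nat.gr0I)
  have u0: "u > 0" "v > 0" using u v D0 by (auto intro: dvd_pos_nat)
  have inv: "1 / real (totient (lcm t w)) \<le> real (gcd t w) / (real (totient t) * real (totient w))" if "t > 0" for t
  proof -
    have "real (totient (lcm t w)) * real (totient (gcd t w)) = real (totient t) * real (totient w)"
      by (metis mult.commute of_nat_mult totient_gcd_lcm)
    moreover have pos: "real (totient (lcm t w)) > 0" "real (totient (gcd t w)) > 0" "real (totient t) * real (totient w) > 0"
      using that w by (simp_all add: lcm_pos_nat)
    ultimately have "1 / real (totient (lcm t w)) = real (totient (gcd t w)) / (real (totient t) * real (totient w))"
      by (simp add: divide_simps mult.commute)
    also have "\<dots> \<le> real (gcd t w) / (real (totient t) * real (totient w))"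
      using pos by (intro divide_right_mono of_nat_mono totient_le) auto
    finally show ?thesis .
  qed
  have om: "(2::real) ^ card (prime_factors t) \<le> 2 ^ card (prime_factors D)" if "t dvd D" for t
    using that D0 dvd_prime_factors[of D t] by (intro power_increasing card_mono) auto
  have gg: "gcd u w * gcd v w \<le> gcd w D"
  proof (rule dvd_imp_le)
    have c: "coprime (gcd u w) (gcd v w)" using cop by (meson coprime_divisors gcd_dvd1)
    have "gcd u w * gcd v w dvd w" using c by (intro divides_mult) auto
    moreover have "gcd u w * gcd v w dvd D" using c u v by (intro divides_mult) (auto intro: dvd_trans[OF gcd_dvd1])
    ultimately show "gcd u w * gcd v w dvd gcd w D" by simp
  qed (use w in simp)
  let ?U = "real u / real (totient u)" and ?V = "real v / real (totient v)" and ?W = "real w / real (totient w)"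
  have "real u * real v * real w / (real (totient (lcm u w)) * real (totient (lcm v w))) =
     real u * real v * real w * ((1 / real (totient (lcm u w))) * (1 / real (totient (lcm v w))))" by simp
  also have "\<dots> \<le> real u * real v * real w * ((real (gcd u w) / (real (totient u) * real (totient w))) * (real (gcd v w) / (real (totient v) * real (totient w))))"
    using inv[OF u0(1)] inv[OF u0(2)] by (intro mult_left_mono mult_mono) auto
  also have "\<dots> = (?U * ?V) * (?W * ?W) * (real (gcd u w * gcd v w) / real w)" using w by (simp add: mult_ac)
  also have "\<dots> \<le> (2 ^ card (prime_factors D) * 2 ^ card (prime_factors D)) * (2 ^ card (prime_factors w) * 2 ^ card (prime_factors w)) * (real (gcd w D) / real w)"
    using ratio_totient_le[OF u0(1)] ratio_totient_le[OF u0(2)] ratio_totient_le[OF w] om[OF u] om[OF v] gg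
    by (intro mult_mono divide_right_mono of_nat_mono) (auto intro: order_trans)
  also have "\<dots> = 4 ^ card (prime_factors D) * (4 ^ card (prime_factors w) * real (gcd w D) / real w)"
    by (simp flip: power_mult_distrib)
  finally show ?thesis .
qed

text \<open>\<open>s\<close> and \<open>s'\<close> are what remains of \<open>m\<close> and
  \<open>m'\<close> without \<open>q\<close> and \<open>q'\<close>, later \<open>r * s\<close> and
  \<open>r' * s'\<close>. The level \<open>M\<close> has room for moduli made of a divisor of
  \<open>s\<close>, a divisor of \<open>Delta\<close> and all primes of \<open>Z\<close>.\<close>

locale two_forms =
  fixes Q :: "nat set" and M :: nat and C :: real and Z :: "nat set" and s s' :: nat
  assumes avg: "avg_primes Q M C"
    and finZ: "finite Z" and prZ: "\<And>l. l \<in> Z \<Longrightarrow> prime l"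
    and sqf: "squarefree s" "squarefree s'"
    and big: "\<And>q. q \<in> Q \<Longrightarrow> s < q \<and> s' < q \<and> Delta s s' < q"
    and Delta_pos: "Delta s s' > 0"
    and M: "s * s' * Delta s s' * \<Prod>Z \<le> M"
begin

definition "gc = gcd (tgcd s) (tgcd s')"
definition "D = gcd s s'"
definition "D' = D div gc"
definition "N = {l. prime l \<and> l dvd Delta s s' \<and> \<not> l dvd totient s \<and> \<not> l dvd totient s' \<and> \<not> l dvd D}"
text \<open>These primes divide the difference of the totients for every choice of \<open>q\<close>
  and \<open>q'\<close>, so no average over \<open>q\<close>, \<open>q'\<close> can remove
  them.\<close>

definition "ss = {l \<in> Z. l dvd totient s \<and> l dvd totient s'}"
definition "uu q' = gcd (tgcd s div gc) (rform s' q')"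
definition "vv q = gcd (tgcd s' div gc) (rform s q)"
definition "ww q q' = gcd (rform s q) (rform s' q')"
text \<open>\<open>E1\<close> collects the conditions on \<open>q'\<close> alone, \<open>E2\<close>
  those that restrict \<open>q\<close> once \<open>q'\<close> is fixed. If \<open>l\<close> divides
  \<open>totient s\<close> but not \<open>totient s'\<close>, the difference of the totients
  vanishes modulo \<open>l\<close> only when \<open>l dvd q' - 1\<close>; if \<open>l\<close> does
  not divide \<open>totient s\<close>, its vanishing determines \<open>q\<close> modulo
  \<open>l\<close>.\<close>

definition "E1 d q' = {l \<in> Z. \<not> l dvd s * s' \<and> \<not> l dvd d \<and> l \<notin> ss \<and>
   (l dvd plus_phi (q' * s') \<or> l dvd totient s \<and> l dvd q' - 1)}"
definition "E2 d q' q = {l \<in> Z. \<not> l dvd s * s' \<and> \<not> l dvd d \<and> l \<notin> ss \<and>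
   (l dvd plus_phi (q * s) \<or> \<not> l dvd totient s \<and> int l dvd int (totient (q * s)) - int (totient (q' * s')))}"

lemma pos: "s > 0" "s' > 0"
  using sqf by (auto intro!: Nat.gr0I)

lemma primeQ: "q \<in> Q \<Longrightarrow> prime q" and finQ: "finite Q"
  using avg unfolding avg_primes_def by blast+

lemma gc_props: "gc > 0" "gc dvd tgcd s" "gc dvd tgcd s'" "gc dvd D" "D = gc * D'" "coprime gc D'" "squarefree D" "squarefree D'" "D > 0" "D' > 0"
proof -
  have t: "tgcd s > 0" using pos by (simp add: tgcd_def)
  show "gc > 0" unfolding gc_def using t by simp
  show d: "gc dvd tgcd s" "gc dvd tgcd s'" unfolding gc_def by simp_all
  have g: "tgcd s dvd s" "tgcd s' dvd s'" unfolding tgcd_def by simp_all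
  from dvd_trans[OF d(1) g(1)] dvd_trans[OF d(2) g(2)]
  show dD: "gc dvd D" unfolding D_def by (rule gcd_greatest)
  then show e: "D = gc * D'" unfolding D'_def by simp
  show sD: "squarefree D" by (rule squarefree_mono[OF _ sqf(1)]) (simp add: D_def)
  then show "coprime gc D'" unfolding e by (rule squarefree_mult_imp_coprime)
  show "squarefree D'" by (rule squarefree_mono[OF _ sD]) (simp add: e)
  show "D > 0" unfolding D_def using pos by simp
  then show "D' > 0" unfolding e by simp
qed

text \<open>The cross gcds are parts of \<open>tgcd s\<close> and \<open>tgcd s'\<close>, so the
  collision makes them divide \<open>gcd s s'\<close>; squarefreeness makes them coprime to
  \<open>gc\<close>, which leaves \<open>D'\<close>.\<close>

lemma uu_vv_dvd:
  assumes q: "q \<in> Q" "q' \<in> Q" and col: "collide (q * s) (q' * s')"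
  shows "uu q' dvd D'" "vv q dvd D'" "coprime (uu q') (vv q)"
proof -
  have b: "prime q" "prime q'" "s < q" "s' < q" "s < q'" "s' < q'" using q primeQ big by blast+
  have t: "tgcd s = gc * (tgcd s div gc)" "tgcd s' = gc * (tgcd s' div gc)" using gc_props(2,3) by simp_all
  have sq: "squarefree (tgcd s)" "squarefree (tgcd s')"
    by (rule squarefree_mono[OF gcd_dvd1[of s "totient s"] sqf(1), folded tgcd_def],
        rule squarefree_mono[OF gcd_dvd1[of s' "totient s'"] sqf(2), folded tgcd_def])
  have c: "coprime gc (tgcd s div gc)" "coprime gc (tgcd s' div gc)"
    by (rule squarefree_mult_imp_coprime, subst t(1)[symmetric], rule sq(1))
      (rule squarefree_mult_imp_coprime, subst t(2)[symmetric], rule sq(2))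
  have td: "tgcd s div gc dvd tgcd s" "tgcd s' div gc dvd tgcd s'"
    by (rule dvdI[of _ _ gc], subst mult.commute, rule t(1), rule dvdI[of _ _ gc], subst mult.commute, rule t(2))
  have u: "uu q' dvd tgcd s div gc" "vv q dvd tgcd s' div gc" unfolding uu_def vv_def by simp_all
  have "coprime (tgcd s div gc) (tgcd s' div gc)" unfolding gc_def using pos by (intro div_gcd_coprime) (simp add: tgcd_def)
  then show "coprime (uu q') (vv q)" using u coprime_divisors by blast
  have "uu q' dvd D" unfolding D_def
  proof (rule common_divisor_of_parts[OF pos b(1,3,2,5,6) col])
    show "uu q' dvd tgcd s" using u(1) td(1) by (rule dvd_trans)
  qed (simp add: uu_def)
  moreover have "coprime (uu q') gc" using c(1) u(1) by (meson coprime_commute coprime_divisors dvd_refl)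
  ultimately show "uu q' dvd D'" unfolding gc_props(5) by (simp add: coprime_dvd_mult_right_iff)
  have "vv q dvd gcd s' s"
  proof (rule common_divisor_of_parts[OF pos(2,1) b(2,6,1,4,3)])
    show "collide (q' * s') (q * s)" using col collide_commute by blast
    show "vv q dvd tgcd s'" using u(2) td(2) by (rule dvd_trans)
  qed (simp add: vv_def)
  then have "vv q dvd D" unfolding D_def by (simp add: gcd.commute)
  moreover have "coprime (vv q) gc" using c(2) u(2) by (meson coprime_commute coprime_divisors dvd_refl)
  ultimately show "vv q dvd D'" unfolding gc_props(5) by (simp add: coprime_dvd_mult_right_iff)
qed

text \<open>A prime of \<open>w\<close> that divides one of the totients divides the corresponding
  part, and by the collision the other part, hence \<open>D\<close>. The remaining primes divide
  \<open>Delta\<close> and neither totient nor \<open>D\<close>; these form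
  \<open>N\<close>.\<close>

lemma ww_props:
  assumes q: "q \<in> Q" "q' \<in> Q" and col: "collide (q * s) (q' * s')"
  shows "ww q q' > 0" "ww q q' dvd Delta s s'" "prime_factors (ww q q') \<subseteq> prime_factors D \<union> N"
proof -
  have b: "prime q" "prime q'" "s < q" "s' < q" "s < q'" "s' < q'" "Delta s s' < q" "Delta s s' < q'"
    using q primeQ big by blast+
  define w where "w = ww q q'"
  show w0: "ww q q' > 0" unfolding ww_def using rform_facts(3)[OF pos(1) b(1,3)] by simp
  have w: "w dvd plus_phi (q * s)" "w dvd plus_phi (q' * s')"
    unfolding w_def ww_def rform_facts(1)[OF pos(1) b(1,3)] rform_facts(1)[OF pos(2) b(2,6)] by simp_all
  have wd: "int w dvd int (q * s) - int (q' * s')" by (rule collide_dvd_diff(1)[OF col w])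
  show wD: "ww q q' dvd Delta s s'" using common_divisor_dvd_Delta[OF pos b(1,3,2,6) w wd] unfolding w_def .
  show "prime_factors (ww q q') \<subseteq> prime_factors D \<union> N"
  proof
    fix l assume "l \<in> prime_factors (ww q q')"
    then have l: "prime l" "l dvd w" unfolding w_def by auto
    have lD: "l dvd Delta s s'" using l(2) wD unfolding w_def by (rule dvd_trans)
    then have "l \<le> Delta s s'" using Delta_pos by (rule dvd_imp_le)
    then have lq: "l < q" "l < q'" using b(7,8) by linarith+
    have l0: "l > 0" using l(1) by (rule prime_gt_0_nat)
    have li: "int l dvd int w" using l(2) by simp
    have ld: "int l dvd int (q * s) - int (q' * s')" using li wd by (rule dvd_trans)
    then have ld': "int l dvd int (q' * s') - int (q * s)" by (simp only: dvd_diff_commute)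
    have la: "l dvd plus_phi (q * s)" "l dvd plus_phi (q' * s')" using l(2) w dvd_trans by blast+
    show "l \<in> prime_factors D \<union> N"
    proof (cases "l dvd D")
      case True
      then show ?thesis using l(1) gc_props(9) by (auto simp: prime_factors_dvd)
    next
      case False
      have "\<not> l dvd totient s"
      proof
        assume "l dvd totient s"
        then have ls: "l dvd s" using prime_dvd_totient_imp_dvd[OF pos(1) b(1,3) l(1) lq(1) la(1)] by blast
        have "l dvd s'" by (rule dvd_transfer[OF ld ls l0 lq(2) b(2)])
        then show False using ls False unfolding D_def by simp
      qed
      moreover have "\<not> l dvd totient s'"
      proof
        assume "l dvd totient s'"
        then have ls: "l dvd s'" using prime_dvd_totient_imp_dvd[OF pos(2) b(2,6) l(1) lq(2) la(2)] by blast
        have "l dvd s" by (rule dvd_transfer[OF ld' ls l0 lq(1) b(1)])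
        then show False using ls False unfolding D_def by simp
      qed
      ultimately show ?thesis unfolding N_def using l(1) lD False by blast
    qed
  qed
qed

lemma gcd_le_parts:
  assumes q: "q \<in> Q" "q' \<in> Q"
  shows "gcd (plus_phi (q * s)) (plus_phi (q' * s')) \<le> gc * (uu q' * vv q * ww q q')"
proof -
  have b: "prime q" "prime q'" "s < q" "s' < q'" using q primeQ big by blast+
  define a a' where "a = tgcd s div gc" and "a' = tgcd s' div gc"
  have t: "tgcd s = gc * a" "tgcd s' = gc * a'" unfolding a_def a'_def using gc_props(2,3) by simp_all
  have tp: "tgcd s > 0" "tgcd s' > 0" using pos by (simp_all add: tgcd_def)
  have cop: "coprime a a'" unfolding a_def a'_def gc_def using tp by (intro div_gcd_coprime) simp
  have "gcd (plus_phi (q * s)) (plus_phi (q' * s')) = gcd (gc * (a * rform s q)) (gc * (a' * rform s' q'))"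
    unfolding rform_facts(1)[OF pos(1) b(1,3)] rform_facts(1)[OF pos(2) b(2,4)] t by (simp only: mult.assoc)
  also have "\<dots> = gc * gcd (a * rform s q) (a' * rform s' q')" by (rule gcd_mult_distrib_nat[symmetric])
  also have "\<dots> \<le> gc * (gcd a (rform s' q') * gcd a' (rform s q) * gcd (rform s q) (rform s' q'))"
    using rform_facts(3)[OF pos(1) b(1,3)] rform_facts(3)[OF pos(2) b(2,4)] tp t
    by (intro mult_le_mono2 gcd_four_le cop) (auto intro!: gr0I)
  finally show ?thesis unfolding uu_def vv_def ww_def a_def a'_def .
qed

text \<open>The primes common to both totients, those of \<open>s * s'\<close> and those of
  \<open>w\<close> are split off at a separate cost; by assumption the primes of \<open>d1\<close>
  and \<open>d2\<close> are among the last two kinds. Every other prime of the defect restricts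
  \<open>q'\<close> alone, or \<open>q\<close> for given \<open>q'\<close>.\<close>

lemma defect_prod_le:
  assumes q: "q \<in> Q" "q' \<in> Q" and w: "w > 0" and dd: "\<And>l. l dvd d1 \<Longrightarrow> prime l \<Longrightarrow> l dvd s * s' \<or> l dvd w" "\<And>l. l dvd d2 \<Longrightarrow> prime l \<Longrightarrow> l dvd s * s' \<or> l dvd w"
  shows "(\<Prod>l | l \<in> Z \<and> l dvd pair_defect (q * s) (q' * s'). 1 + 1 / real l) \<le>
    (\<Prod>l\<in>ss. 1 + 1 / real l) * (\<Prod>l | l \<in> Z \<and> l dvd s * s'. 1 + 1 / real l) * 2 ^ card (prime_factors w) *
    ((\<Prod>l\<in>E1 d1 q'. 1 + 1 / real l) * (\<Prod>l\<in>E2 d2 q' q. 1 + 1 / real l))"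
proof -
  have b: "prime q" "prime q'" "s < q" "s' < q'" using q primeQ big by blast+
  let ?f = "\<lambda>l. 1 + 1 / real l"
  let ?S = "{l. l \<in> Z \<and> l dvd s * s'}"
  let ?L = "{l. l \<in> Z \<and> l dvd pair_defect (q * s) (q' * s')}"
  let ?W = "prime_factors w"
  have fin: "finite ss" "finite ?S" "finite (E1 d1 q')" "finite (E2 d2 q' q)" unfolding ss_def E1_def E2_def using finZ by auto
  have nd: "\<not> q' dvd s'" using b pos by (auto dest: dvd_imp_le)
  have tot: "totient (q' * s') = (q' - 1) * totient s'" by (rule totient_prime_times[OF b(2) nd])
  have nd2: "\<not> q dvd s" using b pos by (auto dest: dvd_imp_le)
  have tot2: "totient (q * s) = (q - 1) * totient s" by (rule totient_prime_times[OF b(1) nd2])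
  have "prod ?f ?L \<le> prod ?f (ss \<union> (?S \<union> (?W \<union> (E1 d1 q' \<union> E2 d2 q' q))))"
  proof (rule prod_subset_le)
    show "?L \<subseteq> ss \<union> (?S \<union> (?W \<union> (E1 d1 q' \<union> E2 d2 q' q)))"
    proof
      fix l assume l: "l \<in> ?L"
      then have pl: "prime l" "l \<in> Z" using prZ by auto
      show "l \<in> ss \<union> (?S \<union> (?W \<union> (E1 d1 q' \<union> E2 d2 q' q)))"
      proof (rule ccontr)
        assume n: "\<not> ?thesis"
        have n1: "l \<notin> ss" "\<not> l dvd s * s'" "\<not> l dvd w" using n pl w by (auto simp: prime_factors_dvd)
        have n2: "\<not> l dvd d1" "\<not> l dvd d2" using dd n1 pl(1) by blast+
        have "l dvd plus_phi (q * s) \<or> l dvd plus_phi (q' * s') \<or> l dvd nat \<bar>int (totient (q * s)) - int (totient (q' * s'))\<bar>"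
          using l pl(1) unfolding pair_defect_def by (auto simp: prime_dvd_mult_iff)
        then consider "l dvd plus_phi (q * s)" | "l dvd plus_phi (q' * s')" |
           "int l dvd int (totient (q * s)) - int (totient (q' * s'))" by (auto simp: dvd_nat_abs_iff)
        then have "l \<in> E1 d1 q' \<or> l \<in> E2 d2 q' q"
        proof cases
          case 3
          show ?thesis
          proof (cases "l dvd totient s")
            case True
            then have "\<not> l dvd totient s'" using n1(1) pl(2) unfolding ss_def by blast
            have "int l dvd int (totient (q * s))" using True unfolding tot2 by simp
            then have "int l dvd int (totient (q * s)) - (int (totient (q * s)) - int (totient (q' * s')))" using 3 by (rule dvd_diff)
            then have "int l dvd int (totient (q' * s'))" by simp
            then have "l dvd (q' - 1) * totient s'" unfolding tot by (simp only: int_dvd_int_iff)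
            then have "l dvd q' - 1" using pl(1) \<open>\<not> l dvd totient s'\<close> by (simp add: prime_dvd_mult_iff)
            then show ?thesis unfolding E1_def using n1 n2 pl True by blast
          next
            case False
            then show ?thesis unfolding E2_def using 3 n1 n2 pl by blast
          qed
        qed (use n1 n2 pl in \<open>auto simp: E1_def E2_def\<close>)
        then show False using n by blast
      qed
    qed
  qed (use fin in auto)
  also have "\<dots> \<le> prod ?f ss * prod ?f (?S \<union> (?W \<union> (E1 d1 q' \<union> E2 d2 q' q)))"
    using fin by (intro prod_union_le) auto
  also have "\<dots> \<le> prod ?f ss * (prod ?f ?S * (prod ?f ?W * (prod ?f (E1 d1 q') * prod ?f (E2 d2 q' q))))"
  proof (rule mult_left_mono)
    have "prod ?f (?S \<union> (?W \<union> (E1 d1 q' \<union> E2 d2 q' q))) \<le> prod ?f ?S * prod ?f (?W \<union> (E1 d1 q' \<union> E2 d2 q' q))"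
      using fin by (intro prod_union_le) auto
    also have "\<dots> \<le> prod ?f ?S * (prod ?f ?W * prod ?f (E1 d1 q' \<union> E2 d2 q' q))"
      using fin by (intro mult_left_mono prod_union_le prod_nonneg) auto
    also have "\<dots> \<le> prod ?f ?S * (prod ?f ?W * (prod ?f (E1 d1 q') * prod ?f (E2 d2 q' q)))"
      using fin by (intro mult_left_mono prod_union_le prod_nonneg) auto
    finally show "prod ?f (?S \<union> (?W \<union> (E1 d1 q' \<union> E2 d2 q' q))) \<le> prod ?f ?S * (prod ?f ?W * (prod ?f (E1 d1 q') * prod ?f (E2 d2 q' q)))" .
  qed (auto intro!: prod_nonneg)
  also have "\<dots> \<le> prod ?f ss * (prod ?f ?S * (2 ^ card ?W * (prod ?f (E1 d1 q') * prod ?f (E2 d2 q' q))))"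
  proof (intro mult_left_mono mult_right_mono)
    have "prod ?f ?W \<le> (\<Prod>l\<in>?W. 2)"
    proof (intro prod_mono conjI)
      fix l assume "l \<in> ?W"
      then have "l \<ge> 1" using in_prime_factors_imp_prime prime_ge_1_nat by blast
      then show "1 + 1 / real l \<le> 2" by simp
    qed simp
    then show "prod ?f ?W \<le> 2 ^ card ?W" by simp
  qed (auto intro!: prod_nonneg mult_nonneg_nonneg)
  finally show ?thesis by (simp add: mult.assoc)
qed

text \<open>The inner average over \<open>q\<close> is uniform in \<open>q'\<close>, so it is taken
  first. Each of \<open>E1\<close> and \<open>E2\<close> offers two alternatives at a prime
  \<open>l\<close>, each confined to one residue class; two classes with \<open>K = 1\<close> give
  the factor \<open>exp 2\<close>, once for \<open>q\<close> and once for \<open>q'\<close>.\<close>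

lemma fiber_sum_le:
  assumes u: "u dvd D'" and v: "v dvd D'" and w: "w dvd Delta s s'"
  shows "(\<Sum>q' | q' \<in> Q \<and> u dvd rform s' q' \<and> w dvd rform s' q'.
     1 / real q' * (\<Prod>l\<in>E1 (lcm u w) q'. 1 + 1 / real l) *
     (\<Sum>q | q \<in> Q \<and> v dvd rform s q \<and> w dvd rform s q. 1 / real q * (\<Prod>l\<in>E2 (lcm v w) q' q. 1 + 1 / real l))) \<le>
     (C * exp 2)\<^sup>2 / (real (totient (lcm u w)) * real (totient (lcm v w)))"
proof -
  have u0: "u > 0" "v > 0" "w > 0" using u v w gc_props(10) Delta_pos by (auto intro: dvd_pos_nat)
  have "D' dvd D" by (subst gc_props(5)) simp
  moreover have "D dvd s" unfolding D_def by simp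
  ultimately have D's: "D' dvd s" by (rule dvd_trans)
  have lcmM: "lcm t w * \<Prod>Z \<le> M" "lcm t w \<ge> 1" if "t dvd D'" for t
  proof -
    have t0: "t > 0" using that gc_props(10) by (rule dvd_pos_nat[rotated])
    have "t * 1 \<le> s * s'"
      using dvd_imp_le[OF dvd_trans[OF that D's] pos(1)] pos(2) by (intro mult_le_mono) auto
    then have ts: "t \<le> s * s'" by simp
    have "lcm t w \<le> t * w" using t0 u0 by (intro dvd_imp_le) (auto simp: lcm_least)
    also have "\<dots> \<le> (s * s') * Delta s s'" using ts dvd_imp_le[OF w Delta_pos] by (rule mult_le_mono)
    finally have "lcm t w * \<Prod>Z \<le> s * s' * Delta s s' * \<Prod>Z" by (rule mult_le_mono1)
    then show "lcm t w * \<Prod>Z \<le> M" using M by linarith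
    show "lcm t w \<ge> 1" using t0 u0 lcm_pos_nat[of t w] by simp
  qed
  have qs: "prime q" "s < q" "s' < q" if "q \<in> Q" for q using that primeQ big by blast+
  have C0: "C \<ge> 0"
  proof -
    have "\<Prod>Z \<ge> 1" using prod_primes_pos[of Z] prZ by (simp add: Suc_le_eq)
    then have "1 * 1 \<le> lcm u w * \<Prod>Z" using lcmM(2)[OF u] by (intro mult_le_mono) auto
    then have "1 \<le> M" using lcmM(1)[OF u] by linarith
    then have "0 \<le> C / real (totient 1)" using avg_primesD[OF avg, of 1 "{}"] by simp
    then show ?thesis by simp
  qed
  have classes: "card ((\<lambda>q. q mod l) ` {q \<in> S. l \<in> E q}) \<le> 2"
    if sub: "S \<subseteq> Q" and s0: "t > 0" "\<And>q. q \<in> Q \<Longrightarrow> t < q"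
      and l: "prime l" and P: "\<And>q. q \<in> S \<Longrightarrow> l \<in> E q \<Longrightarrow> \<not> l dvd t \<and> (l dvd plus_phi (q * t) \<or> R q)"
      and R: "\<And>q r. q \<in> S \<Longrightarrow> r \<in> S \<Longrightarrow> l \<in> E q \<Longrightarrow> l \<in> E r \<Longrightarrow> R q \<Longrightarrow> R r \<Longrightarrow> q mod l = r mod l"
    for S t E l R
  proof -
    let ?S = "{q \<in> S. l \<in> E q}"
    have finS: "finite ?S" by (rule finite_subset[OF _ finQ]) (use sub in blast)
    have "card ((\<lambda>q. q mod l) ` ?S) \<le> 1 + 1"
    proof (rule card_image_Un_le[OF finS])
      show "?S = {q \<in> ?S. l dvd plus_phi (q * t)} \<union> {q \<in> ?S. R q}" using P by blast
      show "card ((\<lambda>q. q mod l) ` {q \<in> ?S. l dvd plus_phi (q * t)}) \<le> 1"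
      proof (rule card_image_le_1)
        fix q r assume qr: "q \<in> {q \<in> ?S. l dvd plus_phi (q * t)}" "r \<in> {q \<in> ?S. l dvd plus_phi (q * t)}"
        then have Q: "q \<in> Q" "r \<in> Q" using sub by auto
        have nl: "\<not> l dvd t" using qr P by blast
        then have nt: "\<not> l dvd tgcd t" unfolding tgcd_def by simp
        have "l dvd tgcd t * rform t q" "l dvd tgcd t * rform t r"
          using qr rform_facts(1)[OF s0(1) qs(1)[OF Q(1)] s0(2)[OF Q(1)]] rform_facts(1)[OF s0(1) qs(1)[OF Q(2)] s0(2)[OF Q(2)]] by auto
        then have "l dvd rform t q" "l dvd rform t r" using nt l by (simp_all add: prime_dvd_mult_iff)
        then have "[q = r] (mod l)" by (rule rform_cong[OF s0(1) qs(1)[OF Q(1)] s0(2)[OF Q(1)] qs(1)[OF Q(2)] s0(2)[OF Q(2)]])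
        then show "q mod l = r mod l" by (simp add: Cong.cong_def)
      qed
      show "card ((\<lambda>q. q mod l) ` {q \<in> ?S. R q}) \<le> 1"
        by (rule card_image_le_1) (use R in blast)
    qed
    then show ?thesis by simp
  qed
  define S' where "S' = {q' \<in> Q. u dvd rform s' q' \<and> w dvd rform s' q'}"
  define S where "S = {q \<in> Q. v dvd rform s q \<and> w dvd rform s q}"
  have inner: "(\<Sum>q\<in>S. 1 / real q * (\<Prod>l\<in>E2 (lcm v w) q' q. 1 + 1 / real l)) \<le> C * exp (real 2 * 1) / real (totient (lcm v w))" if q': "q' \<in> Q" for q'
  proof (rule avg_primes_exp_prod[OF avg finZ prZ lcmM(2)[OF v] lcmM(1)[OF v]])
    show "S \<subseteq> Q" by (auto simp: S_def)
    fix q r assume "q \<in> S" "r \<in> S"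
    then have "lcm v w dvd rform s q" "lcm v w dvd rform s r" "q \<in> Q" "r \<in> Q" by (auto simp: S_def)
    then show "[q = r] (mod lcm v w)" using rform_cong[OF pos(1)] qs by blast
  next
    fix l assume l: "l \<in> Z" "\<not> l dvd lcm v w"
    show "card ((\<lambda>q. q mod l) ` {q \<in> S. l \<in> E2 (lcm v w) q' q}) \<le> 2"
    proof (rule classes[where t = s and R = "\<lambda>q. \<not> l dvd totient s \<and> int l dvd int (totient (q * s)) - int (totient (q' * s'))"])
      show "S \<subseteq> Q" by (auto simp: S_def)
      show "prime l" using prZ l by blast
      show "\<not> l dvd s \<and> (l dvd plus_phi (q * s) \<or> \<not> l dvd totient s \<and> int l dvd int (totient (q * s)) - int (totient (q' * s')))"
        if "q \<in> S" "l \<in> E2 (lcm v w) q' q" for q using that(2) unfolding E2_def by auto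
      fix q r assume qr: "q \<in> S" "r \<in> S" and
        Rq: "\<not> l dvd totient s \<and> int l dvd int (totient (q * s)) - int (totient (q' * s'))" and
        Rr: "\<not> l dvd totient s \<and> int l dvd int (totient (r * s)) - int (totient (q' * s'))"
      have Q: "q \<in> Q" "r \<in> Q" using qr by (auto simp: S_def)
      have tot: "totient (p * s) = (p - 1) * totient s" if "p \<in> Q" for p
        by (rule totient_prime_times[OF qs(1)[OF that]]) (use qs(2)[OF that] pos in \<open>auto dest: dvd_imp_le\<close>)
      have p1: "int (p - 1) = int p - 1" if "p \<in> Q" for p using prime_ge_1_nat[OF qs(1)[OF that]] by (simp add: of_nat_diff)
      have "int l dvd (int (totient (q * s)) - int (totient (q' * s'))) - (int (totient (r * s)) - int (totient (q' * s')))"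
        by (rule dvd_diff[OF conjunct2[OF Rq] conjunct2[OF Rr]])
      also have "\<dots> = (int q - int r) * int (totient s)"
        unfolding tot[OF Q(1)] tot[OF Q(2)] of_nat_mult p1[OF Q(1)] p1[OF Q(2)] by (simp add: algebra_simps)
      finally have "int l dvd int q - int r"
        using Rq \<open>prime l\<close> by (simp add: prime_dvd_mult_iff)
      then have "[int q = int r] (mod int l)" by (simp add: cong_iff_dvd_diff)
      then have "[q = r] (mod l)" by (simp only: cong_int_iff)
      then show "q mod l = r mod l" by (simp only: Cong.cong_def)
    qed (use pos qs in auto)
  qed (auto simp: E2_def)
  have outer: "(\<Sum>q'\<in>S'. 1 / real q' * (\<Prod>l\<in>E1 (lcm u w) q'. 1 + 1 / real l)) \<le> C * exp (real 2 * 1) / real (totient (lcm u w))"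
  proof (rule avg_primes_exp_prod[OF avg finZ prZ lcmM(2)[OF u] lcmM(1)[OF u]])
    show "S' \<subseteq> Q" by (auto simp: S'_def)
    fix q r assume "q \<in> S'" "r \<in> S'"
    then have "lcm u w dvd rform s' q" "lcm u w dvd rform s' r" "q \<in> Q" "r \<in> Q" by (auto simp: S'_def)
    then show "[q = r] (mod lcm u w)" using rform_cong[OF pos(2)] qs by blast
  next
    fix l assume l: "l \<in> Z" "\<not> l dvd lcm u w"
    show "card ((\<lambda>q. q mod l) ` {q \<in> S'. l \<in> E1 (lcm u w) q}) \<le> 2"
    proof (rule classes[where t = s' and R = "\<lambda>q. l dvd totient s \<and> l dvd q - 1"])
      show "S' \<subseteq> Q" by (auto simp: S'_def)
      show "prime l" using prZ l by blast
      show "\<not> l dvd s' \<and> (l dvd plus_phi (q * s') \<or> l dvd totient s \<and> l dvd q - 1)"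
        if "q \<in> S'" "l \<in> E1 (lcm u w) q" for q using that(2) unfolding E1_def by auto
      fix q r assume qr: "q \<in> S'" "r \<in> S'" "l dvd totient s \<and> l dvd q - 1" "l dvd totient s \<and> l dvd r - 1"
      have Q: "q \<in> Q" "r \<in> Q" using qr by (auto simp: S'_def)
      have p1: "p mod l = 1 mod l" if "p \<in> Q" "l dvd p - 1" for p
      proof -
        have "p \<ge> 1" using prime_ge_1_nat[OF qs(1)[OF that(1)]] .
        then show ?thesis using that(2) mod_eq_dvd_iff_nat[of 1 p l] by simp
      qed
      show "q mod l = r mod l" using p1[OF Q(1)] p1[OF Q(2)] qr by simp
    qed (use pos qs in auto)
  qed (auto simp: E1_def)
  have "(\<Sum>q'\<in>S'. 1 / real q' * (\<Prod>l\<in>E1 (lcm u w) q'. 1 + 1 / real l) * (\<Sum>q\<in>S. 1 / real q * (\<Prod>l\<in>E2 (lcm v w) q' q. 1 + 1 / real l))) \<le>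
     (\<Sum>q'\<in>S'. 1 / real q' * (\<Prod>l\<in>E1 (lcm u w) q'. 1 + 1 / real l) * (C * exp 2 / real (totient (lcm v w))))"
    using inner by (intro sum_mono mult_left_mono)
      (auto simp: S'_def intro!: prod_nonneg mult_nonneg_nonneg divide_nonneg_nonneg)
  also have "\<dots> = (\<Sum>q'\<in>S'. 1 / real q' * (\<Prod>l\<in>E1 (lcm u w) q'. 1 + 1 / real l)) * (C * exp 2 / real (totient (lcm v w)))"
    by (rule sum_distrib_right[symmetric])
  also have "\<dots> \<le> C * exp 2 / real (totient (lcm u w)) * (C * exp 2 / real (totient (lcm v w)))"
    using outer C0 by (intro mult_right_mono) auto
  also have "\<dots> = (C * exp 2)\<^sup>2 / (real (totient (lcm u w)) * real (totient (lcm v w)))" by (simp add: power2_eq_square)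
  finally show ?thesis unfolding S_def S'_def .
qed

end

lemma squarefree_dvdI:
  assumes "squarefree (n::nat)" "\<And>l. prime l \<Longrightarrow> l dvd n \<Longrightarrow> l dvd m"
  shows "n dvd m"
proof -
  have "\<Prod>(prime_factors n) dvd m"
    using assms(2) by (intro prod_primes_dvd_nat) auto
  then show ?thesis by (simp only: prod_prime_factors_squarefree[OF assms(1)])
qed

context two_forms
begin

lemma finN: "finite N"
  by (rule finite_subset[of _ "{..Delta s s'}"]) (use Delta_pos in \<open>auto simp: N_def dest: dvd_imp_le\<close>)

lemma gcd_weight_eq:
  assumes "w > 0"
  shows "8 ^ card (prime_factors w) * real (gcd w D') = (\<Prod>l\<in>prime_factors w. 8 * (if l dvd D' then real l else 1))"
proof -
  have sq: "squarefree (gcd w D')" by (rule squarefree_mono[OF _ gc_props(8)]) simp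
  have pf: "prime_factors (gcd w D') = {l \<in> prime_factors w. l dvd D'}"
    using assms gc_props(10) by (auto simp: prime_factors_dvd)
  have "real (gcd w D') = real (\<Prod>(prime_factors (gcd w D')))" by (simp only: prod_prime_factors_squarefree[OF sq])
  also have "\<dots> = (\<Prod>l\<in>{l \<in> prime_factors w. l dvd D'}. real l)" unfolding pf by simp
  also have "\<dots> = (\<Prod>l\<in>prime_factors w. if l dvd D' then real l else 1)" by (rule prod.inter_filter) simp
  finally show ?thesis by (simp add: prod.distrib)
qed

text \<open>The gcd is at most \<open>gc * u * v * w\<close>. For fixed \<open>u\<close>,
  \<open>v\<close>, \<open>w\<close> the averages apply, and the sum over \<open>w\<close> becomes
  an Euler product over the primes of \<open>D\<close> and \<open>N\<close>. In
  \<open>272 = 2 * 2 * 4 * 17\<close> the two factors 2 count the choices of \<open>u\<close> and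
  \<open>v\<close>, 4 comes from ratios of numbers to their totients, and
  \<open>17 = 1 + 2 * 8\<close> is the Euler factor at a prime of \<open>D'\<close>.\<close>

theorem two_forms_sum_le:
  "(\<Sum>(q, q') | q \<in> Q \<and> q' \<in> Q \<and> collide (q * s) (q' * s').
      real (gcd (plus_phi (q * s)) (plus_phi (q' * s'))) / (real q * real q') *
      (\<Prod>l | l \<in> Z \<and> l dvd pair_defect (q * s) (q' * s'). 1 + 1 / real l)) \<le>
   (C * exp 2)\<^sup>2 * (real gc * (\<Prod>l\<in>ss. 1 + 1 / real l) * (\<Prod>l | l \<in> Z \<and> l dvd s * s'. 1 + 1 / real l) *
     272 ^ card (prime_factors D') * (\<Prod>l\<in>prime_factors gc. 1 + 16 / real l) * (\<Prod>l\<in>N. 1 + 16 / real l))"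
proof -
  let ?f = "\<lambda>l. 1 + 1 / real l"
  define P where "P = prod ?f ss * (\<Prod>l | l \<in> Z \<and> l dvd s * s'. 1 + 1 / real l)"
  have P0: "P \<ge> 0" unfolding P_def by (intro mult_nonneg_nonneg prod_nonneg) auto
  define U where "U = {u. u dvd D'}"
  define Ws where "Ws = {w. w dvd Delta s s' \<and> prime_factors w \<subseteq> prime_factors D \<union> N}"
  define T where "T = {t \<in> U \<times> U \<times> Ws. coprime (fst t) (fst (snd t))}"
  define S where "S v w = {q. q \<in> Q \<and> v dvd rform s q \<and> w dvd rform s q}" for v w
  define S' where "S' u w = {q'. q' \<in> Q \<and> u dvd rform s' q' \<and> w dvd rform s' q'}" for u w
  define X where "X = {(q, q'). q \<in> Q \<and> q' \<in> Q \<and> collide (q * s) (q' * s')}"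
  define F where "F = (\<lambda>(q, q'). real (gcd (plus_phi (q * s)) (plus_phi (q' * s'))) / (real q * real q') *
      (\<Prod>l | l \<in> Z \<and> l dvd pair_defect (q * s) (q' * s'). 1 + 1 / real l))"
  define Y where "Y = (\<lambda>(u, v, w). S v w \<times> S' u w)"
  define G where "G = (\<lambda>(u, v, w) (q, q'). real gc * (real u * real v * real w) * (P * 2 ^ card (prime_factors w)) *
      (1 / real q' * prod ?f (E1 (lcm u w) q') * (1 / real q * prod ?f (E2 (lcm v w) q' q))))"
  \<comment> \<open>The 8 is 2 from the defect times 4 from the totients. At a prime of
    \<open>D'\<close> the overlap of \<open>w\<close> with \<open>D'\<close> cancels one
    \<open>1 / l\<close> of \<open>1 / w\<close>.\<close>
  define c where "c l = 8 * (if l dvd D' then real l else 1)" for l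
  define \<tau> where "\<tau> = (\<lambda>(q, q'). (uu q', vv q, ww q q'))"
  have finU: "finite U" unfolding U_def using gc_props(10) by simp
  have finW: "finite Ws" unfolding Ws_def by (rule finite_subset[of _ "{w. w dvd Delta s s'}"]) (use Delta_pos in auto)
  have finT: "finite T" unfolding T_def using finU finW by simp
  have finS: "finite (S v w)" "finite (S' u w)" for u v w unfolding S_def S'_def using finQ by auto
  have D's: "l dvd s * s'" if "l dvd D'" for l
  proof -
    have "D' dvd D" by (subst gc_props(5)) simp
    moreover have "D dvd s" by (simp add: D_def)
    ultimately have "l dvd s" using that dvd_trans by metis
    then show ?thesis by simp
  qed
  have wpos: "w > 0" if "w \<in> Ws" for w using that Delta_pos by (auto simp: Ws_def intro: dvd_pos_nat)
  have "sum F X \<le> (\<Sum>t\<in>T. \<Sum>x\<in>Y t. G t x)"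
  proof (rule sum_le_fibers[where \<tau> = \<tau>])
    show "finite X" unfolding X_def by (rule finite_subset[of _ "Q \<times> Q"]) (use finQ in auto)
    show "finite (Y t)" for t unfolding Y_def using finS by (cases t) auto
    show "0 \<le> G t x" for t x
      unfolding G_def using P0 by (cases t, cases x) (auto intro!: mult_nonneg_nonneg prod_nonneg divide_nonneg_nonneg)
    fix x assume x: "x \<in> X"
    obtain q q' where xq: "x = (q, q')" by (cases x)
    have q: "q \<in> Q" "q' \<in> Q" and col: "collide (q * s) (q' * s')" using x unfolding X_def xq by auto
    define u v w where "u = uu q'" and "v = vv q" and "w = ww q q'"
    have uv: "u dvd D'" "v dvd D'" "coprime u v" unfolding u_def v_def by (rule uu_vv_dvd[OF q col])+
    have w: "w > 0" "w dvd Delta s s'" "prime_factors w \<subseteq> prime_factors D \<union> N" unfolding w_def by (rule ww_props[OF q col])+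
    have tx: "\<tau> x = (u, v, w)" unfolding \<tau>_def xq u_def v_def w_def by simp
    have "(u, v, w) \<in> T" unfolding T_def U_def Ws_def using uv w by simp
    moreover have "x \<in> Y (u, v, w)"
      unfolding Y_def split_conv S_def S'_def xq u_def v_def w_def uu_def vv_def ww_def using q by simp
    moreover have "F x \<le> G (u, v, w) x"
    proof -
      have dd: "l dvd s * s' \<or> l dvd w" if "l dvd lcm t w" "prime l" "t dvd D'" for l t
      proof -
        have "l dvd t * w" using that(1) by (rule dvd_trans) (simp add: lcm_least)
        then have "l dvd t \<or> l dvd w" using that(2) by (simp add: prime_dvd_mult_iff)
        then show ?thesis using D's that(3) dvd_trans by blast
      qed
      have g: "real (gcd (plus_phi (q * s)) (plus_phi (q' * s'))) \<le> real gc * (real u * real v * real w)"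
        using gcd_le_parts[OF q] unfolding u_def v_def w_def by (metis of_nat_le_iff of_nat_mult)
      have p: "(\<Prod>l | l \<in> Z \<and> l dvd pair_defect (q * s) (q' * s'). 1 + 1 / real l) \<le>
         P * 2 ^ card (prime_factors w) * (prod ?f (E1 (lcm u w) q') * prod ?f (E2 (lcm v w) q' q))"
        unfolding P_def by (rule defect_prod_le[OF q w(1)]) (use dd uv in blast)+
      have "F x = real (gcd (plus_phi (q * s)) (plus_phi (q' * s'))) * (\<Prod>l | l \<in> Z \<and> l dvd pair_defect (q * s) (q' * s'). 1 + 1 / real l) * (1 / real q' * (1 / real q))"
        unfolding F_def xq by simp
      also have "\<dots> \<le> real gc * (real u * real v * real w) * (P * 2 ^ card (prime_factors w) * (prod ?f (E1 (lcm u w) q') * prod ?f (E2 (lcm v w) q' q))) * (1 / real q' * (1 / real q))"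
        using g p by (intro mult_right_mono mult_mono) (auto intro!: prod_nonneg)
      also have "\<dots> = G (u, v, w) x" unfolding G_def xq split_conv by (simp only: mult_ac)
      finally show ?thesis .
    qed
    ultimately show "\<tau> x \<in> T \<and> x \<in> Y (\<tau> x) \<and> F x \<le> G (\<tau> x) x" unfolding tx by blast
  qed (rule finT)
  also have "\<dots> \<le> (\<Sum>t\<in>T. (\<lambda>(u, v, w). real gc * P * (C * exp 2)\<^sup>2 * 4 ^ card (prime_factors D') * ((\<Prod>l\<in>prime_factors w. c l) / real w)) t)"
  proof (rule sum_mono)
    fix t assume t: "t \<in> T"
    obtain u v w where tu: "t = (u, v, w)" by (cases t)
    have uvw: "u dvd D'" "v dvd D'" "coprime u v" "w \<in> Ws" using t unfolding tu T_def U_def by auto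
    have w: "w dvd Delta s s'" "w > 0" using uvw(4) wpos unfolding Ws_def by auto
    let ?K = "real gc * (real u * real v * real w) * (P * 2 ^ card (prime_factors w))"
    have "(\<Sum>x\<in>Y t. G t x) = (\<Sum>(q, q')\<in>S v w \<times> S' u w. ?K * (1 / real q' * prod ?f (E1 (lcm u w) q') * (1 / real q * prod ?f (E2 (lcm v w) q' q))))"
      unfolding tu Y_def G_def split_conv ..
    also have "\<dots> = (\<Sum>q\<in>S v w. \<Sum>q'\<in>S' u w. ?K * (1 / real q' * prod ?f (E1 (lcm u w) q') * (1 / real q * prod ?f (E2 (lcm v w) q' q))))"
      by (rule sum.cartesian_product[symmetric])
    also have "\<dots> = (\<Sum>q'\<in>S' u w. \<Sum>q\<in>S v w. ?K * (1 / real q' * prod ?f (E1 (lcm u w) q') * (1 / real q * prod ?f (E2 (lcm v w) q' q))))"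
      by (rule sum.swap)
    also have "\<dots> = ?K * (\<Sum>q'\<in>S' u w. 1 / real q' * prod ?f (E1 (lcm u w) q') * (\<Sum>q\<in>S v w. 1 / real q * prod ?f (E2 (lcm v w) q' q)))"
      by (simp only: sum_distrib_left)
    also have "\<dots> \<le> ?K * ((C * exp 2)\<^sup>2 / (real (totient (lcm u w)) * real (totient (lcm v w))))"
      unfolding S_def S'_def using fiber_sum_le[OF uvw(1,2) w(1)] P0 by (intro mult_left_mono) (auto intro!: mult_nonneg_nonneg)
    also have "\<dots> = (real gc * P * (C * exp 2)\<^sup>2 * 2 ^ card (prime_factors w)) * (real u * real v * real w / (real (totient (lcm u w)) * real (totient (lcm v w))))"
      by simp
    also have "\<dots> \<le> (real gc * P * (C * exp 2)\<^sup>2 * 2 ^ card (prime_factors w)) * (4 ^ card (prime_factors D') * (4 ^ card (prime_factors w) * real (gcd w D') / real w))"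
      using totient_lcm_term_le[OF gc_props(8) uvw(1-3) w(2)] P0 by (intro mult_left_mono) (auto intro!: mult_nonneg_nonneg)
    also have "\<dots> = real gc * P * (C * exp 2)\<^sup>2 * 4 ^ card (prime_factors D') * (((2 * 4) ^ card (prime_factors w) * real (gcd w D')) / real w)"
      by (simp only: power_mult_distrib) (simp add: mult_ac)
    also have "(2 * 4 :: real) ^ card (prime_factors w) * real (gcd w D') = (\<Prod>l\<in>prime_factors w. c l)"
      using gcd_weight_eq[OF w(2)] unfolding c_def by simp
    finally show "(\<Sum>x\<in>Y t. G t x) \<le> (\<lambda>(u, v, w). real gc * P * (C * exp 2)\<^sup>2 * 4 ^ card (prime_factors D') * ((\<Prod>l\<in>prime_factors w. c l) / real w)) t"
      unfolding tu split_conv .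
  qed
  also have "\<dots> \<le> (\<Sum>t\<in>U \<times> U \<times> Ws. (\<lambda>(u, v, w). real gc * P * (C * exp 2)\<^sup>2 * 4 ^ card (prime_factors D') * ((\<Prod>l\<in>prime_factors w. c l) / real w)) t)"
    using finU finW P0 by (intro sum_mono2) (auto simp: T_def c_def intro!: mult_nonneg_nonneg prod_nonneg divide_nonneg_nonneg)
  also have "\<dots> = real (card U) * (real (card U) * (real gc * P * (C * exp 2)\<^sup>2 * 4 ^ card (prime_factors D') * (\<Sum>w\<in>Ws. (\<Prod>l\<in>prime_factors w. c l) / real w)))"
    unfolding sum.cartesian_product[symmetric] by (simp only: split_conv sum_distrib_left[symmetric] sum_constant) (simp only: mult_ac)
  also have "\<dots> \<le> 2 ^ card (prime_factors D') * (2 ^ card (prime_factors D') * (real gc * P * (C * exp 2)\<^sup>2 * 4 ^ card (prime_factors D') *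
      (17 ^ card (prime_factors D') * ((\<Prod>l\<in>prime_factors gc. 1 + 16 / real l) * (\<Prod>l\<in>N. 1 + 16 / real l)))))"
  proof (intro mult_mono mult_left_mono)
    show cU: "real (card U) \<le> 2 ^ card (prime_factors D')"
      using of_nat_mono[OF card_divisors_squarefree_le[OF gc_props(8)], where ?'a = real] unfolding U_def by simp
    let ?h = "\<lambda>l. 1 + 2 * c l / real l"
    have h1: "?h l \<ge> 1" for l by (simp add: c_def)
    have "(\<Sum>w\<in>Ws. (\<Prod>l\<in>prime_factors w. c l) / real w) \<le> prod ?h (prime_factors D \<union> N)"
    proof (rule multiplicative_sum_le)
      show "finite (prime_factors D \<union> N)" using finN by simp
      show "prime l" if "l \<in> prime_factors D \<union> N" for l using that unfolding N_def by auto
      show "0 \<le> c l" for l by (simp add: c_def)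
      show "w > 0 \<and> prime_factors w \<subseteq> prime_factors D \<union> N" if "w \<in> Ws" for w
        using wpos[OF that] that unfolding Ws_def by blast
    qed (rule finW)
    also have "\<dots> \<le> prod ?h (prime_factors D' \<union> (prime_factors gc \<union> N))"
    proof (rule prod_subset_le[OF _ _ h1])
      have "prime_factors D = prime_factors gc \<union> prime_factors D'"
        by (subst gc_props(5), rule prime_factors_product) (use gc_props(1,10) in auto)
      then show "prime_factors D \<union> N \<subseteq> prime_factors D' \<union> (prime_factors gc \<union> N)" by blast
    qed (use finN in simp)
    also have "\<dots> \<le> prod ?h (prime_factors D') * prod ?h (prime_factors gc \<union> N)"
      by (rule prod_union_le[OF _ _ h1]) (use finN in simp_all)
    also have "\<dots> \<le> prod ?h (prime_factors D') * (prod ?h (prime_factors gc) * prod ?h N)"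
      by (intro mult_left_mono prod_union_le[OF _ _ h1] prod_nonneg) (use finN in \<open>auto simp: c_def intro!: add_nonneg_nonneg\<close>)
    also have "prod ?h (prime_factors D') = (\<Prod>l\<in>prime_factors D'. 17)"
    proof (intro prod.cong refl)
      fix l assume "l \<in> prime_factors D'"
      then have "prime l" "l dvd D'" by auto
      then show "?h l = 17" using prime_gt_0_nat[of l] by (simp add: c_def)
    qed
    also have "\<dots> = 17 ^ card (prime_factors D')" by simp
    also have "prod ?h (prime_factors gc) = (\<Prod>l\<in>prime_factors gc. 1 + 16 / real l)"
    proof (intro prod.cong refl)
      fix l assume "l \<in> prime_factors gc"
      then have "prime l" "l dvd gc" by auto
      then have "\<not> l dvd D'" using gc_props(6) by (metis coprime_common_divisor not_prime_unit)
      then show "?h l = 1 + 16 / real l" by (simp add: c_def)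
    qed
    also have "prod ?h N = (\<Prod>l\<in>N. 1 + 16 / real l)"
    proof (intro prod.cong refl)
      fix l assume "l \<in> N"
      then have "\<not> l dvd D" unfolding N_def by blast
      moreover have "D' dvd D" by (subst gc_props(5)) simp
      ultimately have "\<not> l dvd D'" using dvd_trans by blast
      then show "?h l = 1 + 16 / real l" by (simp add: c_def)
    qed
    finally show "(\<Sum>w\<in>Ws. (\<Prod>l\<in>prime_factors w. c l) / real w) \<le> 17 ^ card (prime_factors D') * ((\<Prod>l\<in>prime_factors gc. 1 + 16 / real l) * (\<Prod>l\<in>N. 1 + 16 / real l))" .
  qed (use P0 card_divisors_squarefree_le[OF gc_props(8), folded U_def] in
      \<open>auto simp: c_def intro!: mult_nonneg_nonneg prod_nonneg sum_nonneg divide_nonneg_nonneg\<close>)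
  also have "\<dots> = (C * exp 2)\<^sup>2 * (real gc * P * (2 * (2 * (4 * 17))) ^ card (prime_factors D') *
      (\<Prod>l\<in>prime_factors gc. 1 + 16 / real l) * (\<Prod>l\<in>N. 1 + 16 / real l))"
    by (simp only: power_mult_distrib) (simp only: mult_ac)
  finally show ?thesis unfolding F_def X_def P_def by (simp add: mult.assoc)
qed

end

text \<open>If \<open>r \<noteq> r'\<close>, equality of the two products forces
  \<open>r dvd r' - 1\<close> and \<open>r' dvd r - 1\<close>, since every other factor on the
  opposite side is prime to the divisor; both cannot hold. With \<open>r = r'\<close> the equation
  modulo \<open>r\<close> leaves \<open>s - s'\<close>, which is smaller than \<open>r\<close> in
  absolute value.\<close>

lemma Delta_eq_0_imp:
  assumes r: "prime r" "prime r'" and s: "s > 0" "s' > 0" and lt: "s < r" "s < r'" "s' < r" "s' < r'"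
    and D: "Delta (r * s) (r' * s') = 0"
  shows "r = r' \<and> s = s'"
proof -
  define f f' where "f = totient s" and "f' = totient s'"
  have ff: "0 < f" "f \<le> s" "0 < f'" "f' \<le> s'" using s by (auto simp: f_def f'_def totient_le)
  have "\<not> r dvd s" "\<not> r' dvd s'" using s lt by (auto dest: dvd_imp_le)
  then have tot: "totient (r * s) = (r - 1) * f" "totient (r' * s') = (r' - 1) * f'"
    unfolding f_def f'_def using r totient_prime_times by blast+
  define A A' where "A = plus_phi (r * s)" and "A' = plus_phi (r' * s')"
  have AA: "A + f = r * (s + f)" "A' + f' = r' * (s' + f')"
    using rform_facts(5)[OF s(1) r(1) lt(1)] rform_facts(5)[OF s(2) r(2) lt(4)] unfolding A_def A'_def f_def f'_def plus_phi_def by simp_all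
  have eq: "r * s * ((r - 1) * f) * A' = r' * s' * ((r' - 1) * f') * A"
    using D unfolding Delta_def tot A_def[symmetric] A'_def[symmetric] by (simp flip: of_nat_mult)
  have nd: "\<not> p dvd t" if "prime p" "0 < t" "t < p" for p t :: nat using that by (auto dest: dvd_imp_le)
  have ndA: "\<not> p dvd a" if "prime p" "a + g = p * b" "0 < g" "g < p" for p a g b :: nat
    using nd[OF that(1,3,4)] that(2) by (metis dvd_add_right_iff dvd_triv_left)
  have A_nd: "\<not> r dvd A" "\<not> r' dvd A'" using ndA AA r ff lt by (meson le_less_trans)+
  have lt1: "r < r'" if "r \<noteq> r'"
  proof -
    have "r dvd r' * s' * ((r' - 1) * f') * A" unfolding eq[symmetric] by simp
    moreover have "\<not> r dvd r'" using that r primes_dvd_imp_eq by blast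
    moreover have "\<not> r dvd s'" "\<not> r dvd f'" using nd r s lt ff by (meson le_less_trans)+
    ultimately have "r dvd r' - 1" using r(1) A_nd by (simp add: prime_dvd_mult_iff)
    moreover have "r' - 1 > 0" using prime_gt_1_nat[OF r(2)] by simp
    ultimately show ?thesis using dvd_imp_le[of r "r' - 1"] by simp
  qed
  have lt2: "r' < r" if "r \<noteq> r'"
  proof -
    have "r' dvd r * s * ((r - 1) * f) * A'" unfolding eq by simp
    moreover have "\<not> r' dvd r" using that r primes_dvd_imp_eq by blast
    moreover have "\<not> r' dvd s" "\<not> r' dvd f" using nd r s lt ff by (meson le_less_trans)+
    ultimately have "r' dvd r - 1" using r(2) A_nd by (simp add: prime_dvd_mult_iff)
    moreover have "r - 1 > 0" using prime_gt_1_nat[OF r(1)] by simp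
    ultimately show ?thesis using dvd_imp_le[of r' "r - 1"] by simp
  qed
  have rr: "r = r'" using lt1 lt2 by fastforce
  have r1: "r - 1 > 0" "r > 0" using prime_gt_1_nat[OF r(1)] by simp_all
  have "(r * (r - 1)) * (s * f * A') = (r * (r - 1)) * (s' * f' * A)" using eq unfolding rr by (simp only: mult_ac)
  then have e2: "s * f * A' = s' * f' * A" using r1 by simp
  have "int (s * f) * (int r * int (s' + f') - int f') = int (s' * f') * (int r * int (s + f) - int f)"
  proof -
    have "int A = int r * int (s + f) - int f" "int A' = int r * int (s' + f') - int f'"
      using AA rr by (metis add_diff_cancel_right' of_nat_add of_nat_mult)+
    then show ?thesis using e2 by (metis of_nat_mult)
  qed
  then have "int r * (int s * int f * int (s' + f') - int s' * int f' * int (s + f)) = int f * int f' * (int s - int s')"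
    by (simp add: algebra_simps)
  then have "int r dvd int f * int f' * (int s - int s')" by (metis dvd_triv_left)
  moreover have "\<not> int r dvd int f" "\<not> int r dvd int f'" using nd[OF r(1)] ff lt by (auto simp: dest!: nd[OF r(1)])
  ultimately have dv: "int r dvd int s - int s'" using r(1) by (simp add: prime_dvd_mult_iff)
  have "\<bar>int s - int s'\<bar> < int r" using lt by linarith
  then have "int s - int s' = 0" using dv dvd_imp_le_int[of "int s - int s'" "int r"] by fastforce
  then show ?thesis using rr by simp
qed

text \<open>Taking difference quotients of the congruence at three distinct roots shows that
  \<open>l\<close> divides the leading coefficient, then the middle one, then the constant
  one.\<close>

lemma quadratic_roots_mod_le:
  fixes a b c :: int and l :: nat
  assumes l: "prime l" and nz: "\<not> (int l dvd a \<and> int l dvd c)" and finS: "finite S"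
    and S: "\<And>r. r \<in> S \<Longrightarrow> int l dvd a * int r * int r + b * int r + c"
  shows "card ((\<lambda>r. r mod l) ` S) \<le> 2"
proof (rule ccontr)
  assume "\<not> ?thesis"
  then have "card ((\<lambda>r. r mod l) ` S) \<ge> 3" by simp
  then obtain T where T: "T \<subseteq> (\<lambda>r. r mod l) ` S" "card T = 3" by (meson obtain_subset_with_card_n)
  then obtain x y z where T3: "T = {x, y, z}" "x \<noteq> y" "x \<noteq> z" "y \<noteq> z" by (auto simp: card_3_iff)
  then obtain p q r where pqr: "p \<in> S" "q \<in> S" "r \<in> S" "x = p mod l" "y = q mod l" "z = r mod l" using T(1) by auto
  have diff: "\<not> int l dvd int u - int v" if "u mod l \<noteq> v mod l" for u v
    using that by (metis cong_iff_dvd_diff cong_int_iff Cong.cong_def)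
  have two: "int l dvd a * (int u + int v) + b" if "u \<in> S" "v \<in> S" "u mod l \<noteq> v mod l" for u v
  proof -
    have "int l dvd (a * int u * int u + b * int u + c) - (a * int v * int v + b * int v + c)"
      by (rule dvd_diff[OF S[OF that(1)] S[OF that(2)]])
    also have "\<dots> = (int u - int v) * (a * (int u + int v) + b)" by (simp add: algebra_simps)
    finally show ?thesis using diff[OF that(3)] l by (simp add: prime_dvd_mult_iff)
  qed
  have ne: "p mod l \<noteq> q mod l" "p mod l \<noteq> r mod l" "q mod l \<noteq> r mod l" using T3 pqr by auto
  have "int l dvd (a * (int p + int q) + b) - (a * (int p + int r) + b)"
    by (rule dvd_diff[OF two[OF pqr(1,2) ne(1)] two[OF pqr(1,3) ne(2)]])
  also have "\<dots> = a * (int q - int r)" by (simp add: algebra_simps)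
  finally have la: "int l dvd a" using diff[OF ne(3)] l by (simp add: prime_dvd_mult_iff)
  have "int l dvd (a * (int p + int q) + b) - a * (int p + int q)" using two[OF pqr(1,2) ne(1)] la by (intro dvd_diff) auto
  then have lb: "int l dvd b" by simp
  have "int l dvd (a * int p * int p + b * int p + c) - (a * int p * int p + b * int p)"
    by (rule dvd_diff[OF S[OF pqr(1)] dvd_add]) (use la lb in simp_all)
  then have "int l dvd c" by simp
  then show False using la nz by blast
qed

section \<open>Averaging over the middle primes\<close>

text \<open>The exponents leave enough room for every modulus that occurs to stay below the levels
\<open>y ^ 14\<close> and \<open>y ^ 194\<close> up to which primes in residue classes are controlled.\<close>
locale scales =
  fixes y :: nat and R Q :: "nat set" and C :: real
  assumes y: "ln (real y) \<ge> 4"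
    and avgR: "avg_primes R (y ^ 14) C" and avgQ: "avg_primes Q (y ^ 194) C"
    and R: "\<And>r. r \<in> R \<Longrightarrow> y ^ 20 < r \<and> r \<le> y ^ 30"
    and Q: "\<And>q. q \<in> Q \<Longrightarrow> y ^ 200 < q \<and> q \<le> y ^ 300"
begin

definition "Z = small_primes y"

lemma y2: "y \<ge> 2"
  using y by (cases "y \<le> 1") (auto simp: le_Suc_eq)

lemma ypow: "a \<le> b \<Longrightarrow> y ^ a \<le> y ^ b"
  using y2 by (intro power_increasing) auto

lemma primeR: "r \<in> R \<Longrightarrow> prime r" and finR: "finite R"
  using avgR unfolding avg_primes_def by blast+

lemma prime_Q: "q \<in> Q \<Longrightarrow> prime q" and fin_Q: "finite Q"
  using avgQ unfolding avg_primes_def by blast+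

lemma prZ: "l \<in> Z \<Longrightarrow> prime l" and finZ: "finite Z" and prodZ: "\<Prod>Z \<le> y ^ 2"
  unfolding Z_def using small_primesD prod_small_primes_le[of y] y2 by auto

lemma Z_le: assumes "l \<in> Z" shows "l \<le> y"
proof -
  have "real l \<le> ln (real y)" using assms small_primes_iff[of y l] y2 unfolding Z_def by simp
  also have "\<dots> \<le> real y" using y2 by (intro ln_le_self) simp
  finally show ?thesis by simp
qed

lemma R_gt: assumes "r \<in> R" "s \<le> y" shows "s < r"
  using R[OF assms(1)] ypow[of 1 20] assms(2) by simp

lemma C_nonneg: "C \<ge> 0"
proof -
  have "0 \<le> C / real (totient 1)" using avg_primesD[OF avgR, of 1 "{}"] y2 by (simp add: Suc_le_eq)
  then show ?thesis by simp
qed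

lemma sigma_props:
  assumes r: "r \<in> R" and s: "squarefree s" "s \<le> y"
  shows "squarefree (r * s)" "r * s \<le> y ^ 31" "s > 0" "s < r" "totient (r * s) = (r - 1) * totient s" "\<not> r dvd s"
proof -
  show s0: "s > 0" using s by (auto intro!: Nat.gr0I)
  show sr: "s < r" using R_gt[OF r s(2)] .
  show nd: "\<not> r dvd s" using s0 sr by (auto dest: dvd_imp_le)
  have "coprime r s" using nd primeR[OF r] by (simp add: prime_imp_coprime)
  then show "squarefree (r * s)" using squarefree_prime[OF primeR[OF r]] s(1) by (rule squarefree_mult_coprime)
  have "r * s \<le> y ^ 30 * y" using R[OF r] s(2) by (intro mult_le_mono) auto
  also have "\<dots> = y ^ 31" by (simp flip: power_Suc2)
  finally show "r * s \<le> y ^ 31" .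
  show "totient (r * s) = (r - 1) * totient s" by (rule totient_prime_times[OF primeR[OF r] nd])
qed

lemma Delta_le:
  assumes "s \<le> y ^ 31" "s' \<le> y ^ 31"
  shows "Delta s s' \<le> y ^ 94"
proof -
  have b: "a * totient a * plus_phi b \<le> y ^ 94" if "a \<le> y ^ 31" "b \<le> y ^ 31" for a b
  proof -
    have "totient a \<le> y ^ 31" using totient_le[of a] that(1) by linarith
    moreover have "plus_phi b \<le> 2 * y ^ 31" unfolding plus_phi_def using totient_le[of b] that(2) by linarith
    ultimately have "a * totient a * plus_phi b \<le> y ^ 31 * y ^ 31 * (2 * y ^ 31)" using that by (intro mult_le_mono) auto
    also have "\<dots> = 2 * y ^ 93" by (simp flip: power_add)
    also have "\<dots> \<le> y * y ^ 93" using y2 by simp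
    finally show ?thesis by (simp flip: power_Suc)
  qed
  show ?thesis unfolding Delta_def using b[OF assms] b[OF assms(2,1)] by linarith
qed

lemma two_forms_sigma:
  assumes r: "r \<in> R" "r' \<in> R" and s: "squarefree s" "s \<le> y" "squarefree s'" "s' \<le> y" and ne: "r * s \<noteq> r' * s'"
  shows "two_forms Q (y ^ 194) C Z (r * s) (r' * s')"
proof
  note p = sigma_props[OF r(1) s(1,2)] and p' = sigma_props[OF r(2) s(3,4)]
  have D: "Delta (r * s) (r' * s') \<le> y ^ 94" using Delta_le p(2) p'(2) by blast
  show "avg_primes Q (y ^ 194) C" by (rule avgQ)
  show "finite Z" by (rule finZ)
  show "prime l" if "l \<in> Z" for l using prZ that .
  show "squarefree (r * s)" "squarefree (r' * s')" by (rule p(1), rule p'(1))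
  show "r * s < q \<and> r' * s' < q \<and> Delta (r * s) (r' * s') < q" if "q \<in> Q" for q
    using Q[OF that] p(2) p'(2) D ypow[of 31 200] ypow[of 94 200] by linarith
  show "Delta (r * s) (r' * s') > 0"
  proof (rule ccontr)
    assume "\<not> Delta (r * s) (r' * s') > 0"
    then have "r = r' \<and> s = s'"
      using Delta_eq_0_imp[OF primeR[OF r(1)] primeR[OF r(2)] p(3) p'(3) p(4) R_gt[OF r(2) s(2)] R_gt[OF r(1) s(4)] p'(4)] by simp
    then show False using ne by simp
  qed
  have "r * s * (r' * s') * Delta (r * s) (r' * s') * \<Prod>Z \<le> y ^ 31 * y ^ 31 * y ^ 94 * y ^ 2"
    using p(2) p'(2) D prodZ by (intro mult_le_mono)
  also have "\<dots> = y ^ 158" by (simp flip: power_add)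
  also have "\<dots> \<le> y ^ 194" by (rule ypow) simp
  finally show "r * s * (r' * s') * Delta (r * s) (r' * s') * \<Prod>Z \<le> y ^ 194" .
qed

definition "gcs s s' = gcd (tgcd s) (tgcd s')"
definition "D1 s s' = gcd s s' div gcs s s'"
definition "SS0 s s' = {l \<in> Z. l dvd totient s \<and> l dvd totient s'}"
text \<open>What survives the averages over \<open>q\<close> and \<open>r\<close>. Here
  \<open>4352 = 272 * 4 * 4\<close>, with one factor 4 from each of the sums over \<open>r\<close>
  and \<open>r'\<close>, and 135 bounds the combined factors at the primes of
  \<open>s * s'\<close>.\<close>

definition "Wt s s' = real (gcs s s') * (\<Prod>l\<in>SS0 s s'. 1 + 1 / real l) *
  (\<Prod>l\<in>prime_factors (s * s'). 1 + 135 / real l) * 4352 ^ card (prime_factors (D1 s s'))"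
text \<open>The conditions on \<open>r\<close> for fixed \<open>r'\<close>. A prime of
  \<open>gcd s s'\<close> divides \<open>Delta (r * s) (r' * s')\<close> for every \<open>r\<close>,
  so such primes are kept apart.\<close>

definition "Er s s' r r' = {l \<in> Z. \<not> l dvd gcd s s' \<and> (l dvd r - 1 \<or>
   l dvd Delta (r * s) (r' * s') \<and> \<not> l dvd totient (r * s) \<and> \<not> l dvd totient (r' * s'))}"
definition "Er' s s' r' = {l \<in> Z. \<not> l dvd gcd s s' \<and> l dvd r' - 1}"

lemma D1_props:
  assumes s: "squarefree s" "squarefree s'"
  shows "gcd s s' = gcs s s' * D1 s s'" "squarefree (D1 s s')" "coprime (gcs s s') (D1 s s')" "D1 s s' > 0" "gcs s s' > 0"
    "gcd s s' > 0"
proof -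
  have "gcs s s' dvd s" "gcs s s' dvd s'"
    unfolding gcs_def tgcd_def using dvd_trans gcd_dvd1 gcd_dvd2 by metis+
  then have "gcs s s' dvd gcd s s'" by simp
  then show e: "gcd s s' = gcs s s' * D1 s s'" unfolding D1_def by simp
  have sq: "squarefree (gcd s s')" by (rule squarefree_mono[OF gcd_dvd1 s(1)])
  show "coprime (gcs s s') (D1 s s')" using squarefree_mult_imp_coprime sq e by metis
  show "squarefree (D1 s s')" by (rule squarefree_mono[OF _ sq]) (simp add: e)
  show "gcd s s' > 0" using sq by (metis gr0I not_squarefree_0)
  then show "D1 s s' > 0" "gcs s s' > 0" unfolding e by simp_all
qed

text \<open>Sorting by the value \<open>d\<close> of the gcd puts \<open>r\<close> into the class of
  1 modulo \<open>d\<close>, so the weight \<open>d\<close> meets the density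
  \<open>1 / \<phi>(d)\<close>. The 4 is 2 for the number of \<open>d\<close> times 2 for the ratio
  \<open>d / \<phi>(d)\<close>; the exponent is \<open>99 = 3 * 33\<close>.\<close>

lemma sum_r_le:
  assumes s: "squarefree s" "s \<le> y" "squarefree s'" "s' \<le> y"
    and E: "\<And>r. r \<in> R \<Longrightarrow> E r \<subseteq> Z" "\<And>r l. r \<in> R \<Longrightarrow> l \<in> E r \<Longrightarrow> \<not> l dvd gcd s s'"
    and k: "\<And>l. l \<in> Z \<Longrightarrow> card ((\<lambda>r. r mod l) ` {r \<in> R. l \<in> E r}) \<le> 3"
  shows "(\<Sum>r\<in>R. 1 / real r * (real (gcd (D1 s s') (r - 1)) * (\<Prod>l\<in>E r. 1 + 33 / real l))) \<le>
    C * exp 99 * 4 ^ card (prime_factors (D1 s s'))"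
proof -
  define D where "D = D1 s s'"
  note dp = D1_props[OF s(1,3)]
  have DD: "D dvd gcd s s'" unfolding D_def by (subst dp(1)) simp
  have D0: "D > 0" unfolding D_def by (rule dp(4))
  have "gcd s s' \<le> s" using s(1) by (intro dvd_imp_le) (auto intro!: Nat.gr0I)
  then have Dy: "D \<le> y" using dvd_imp_le[OF DD dp(6)] s(2) by linarith
  have "(\<Sum>r\<in>R. 1 / real r * (real (gcd D (r - 1)) * (\<Prod>l\<in>E r. 1 + 33 / real l))) \<le>
     (\<Sum>d\<in>{d. d dvd D}. \<Sum>r | r \<in> R \<and> d dvd r - 1. real d * (1 / real r * (\<Prod>l\<in>E r. 1 + 33 / real l)))"
  proof (rule sum_le_fibers[where \<tau> = "\<lambda>r. gcd D (r - 1)" and Y = "\<lambda>d. {r \<in> R. d dvd r - 1}"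
        and G = "\<lambda>d r. real d * (1 / real r * (\<Prod>l\<in>E r. 1 + 33 / real l))"])
    show "finite {d. d dvd D}" using D0 by simp
    show "finite {r \<in> R. d dvd r - 1}" for d using finR by simp
    fix r assume r: "r \<in> R"
    show "gcd D (r - 1) \<in> {d. d dvd D} \<and> r \<in> {p \<in> R. gcd D (r - 1) dvd p - 1} \<and>
       1 / real r * (real (gcd D (r - 1)) * (\<Prod>l\<in>E r. 1 + 33 / real l)) \<le>
       real (gcd D (r - 1)) * (1 / real r * (\<Prod>l\<in>E r. 1 + 33 / real l))"
      using r by (simp add: mult_ac)
  qed (auto intro!: finR mult_nonneg_nonneg prod_nonneg divide_nonneg_nonneg)
  also have "\<dots> \<le> (\<Sum>d\<in>{d. d dvd D}. C * exp 99 * 2 ^ card (prime_factors D))"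
  proof (rule sum_mono)
    fix d assume "d \<in> {d. d dvd D}"
    then have d: "d dvd D" by simp
    have d0: "d > 0" using d D0 by (rule dvd_pos_nat[rotated])
    have dy: "d \<le> y" using dvd_imp_le[OF d D0] Dy by linarith
    have "(\<Sum>r | r \<in> R \<and> d dvd r - 1. 1 / real r * (\<Prod>l\<in>E r. 1 + 33 / real l)) \<le> C * exp (real 3 * 33) / real (totient d)"
    proof (rule avg_primes_exp_prod[OF avgR finZ prZ])
      show "d \<ge> 1" using d0 by simp
      have "d * \<Prod>Z \<le> y * y ^ 2" using dy prodZ by (rule mult_le_mono)
      also have "\<dots> = y ^ 3" by (simp add: eval_nat_numeral)
      also have "\<dots> \<le> y ^ 14" by (rule ypow) simp
      finally show "d * \<Prod>Z \<le> y ^ 14" .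
      show "[q = q'] (mod d)" if "q \<in> {r \<in> R. d dvd r - 1}" "q' \<in> {r \<in> R. d dvd r - 1}" for q q'
      proof -
        have "[p = 1] (mod d)" if "p \<in> R" "d dvd p - 1" for p
          using that prime_ge_1_nat[OF primeR[OF that(1)]] by (simp add: cong_altdef_nat)
        note c1 = this
        have a: "[q = 1] (mod d)" and b: "[q' = 1] (mod d)" using c1[of q] c1[of q'] that by simp_all
        show ?thesis by (rule cong_trans[OF a cong_sym[OF b]])
      qed
      show "E q \<subseteq> Z" if "q \<in> {r \<in> R. d dvd r - 1}" for q using E(1) that by blast
      show "\<not> l dvd d" if "q \<in> {r \<in> R. d dvd r - 1}" "l \<in> E q" for q l
        using E(2)[of q l] that d DD dvd_trans by blast
      show "card ((\<lambda>q. q mod l) ` {q \<in> {r \<in> R. d dvd r - 1}. l \<in> E q}) \<le> 3" if "l \<in> Z" for l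
      proof -
        have "card ((\<lambda>q. q mod l) ` {q \<in> {r \<in> R. d dvd r - 1}. l \<in> E q}) \<le> card ((\<lambda>r. r mod l) ` {r \<in> R. l \<in> E r})"
          using finR by (intro card_mono image_mono finite_imageI) auto
        then show ?thesis using k[OF that] by linarith
      qed
    qed auto
    then have "real d * (\<Sum>r | r \<in> R \<and> d dvd r - 1. 1 / real r * (\<Prod>l\<in>E r. 1 + 33 / real l)) \<le> real d * (C * exp (real 3 * 33) / real (totient d))"
      by (rule mult_left_mono) simp
    also have "\<dots> = C * exp 99 * (real d / real (totient d))" by simp
    also have "\<dots> \<le> C * exp 99 * 2 ^ card (prime_factors D)"
    proof (rule mult_left_mono)
      have "real d / real (totient d) \<le> 2 ^ card (prime_factors d)" by (rule ratio_totient_le[OF d0])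
      also have "\<dots> \<le> 2 ^ card (prime_factors D)"
        using d D0 dvd_prime_factors[of D d] by (intro power_increasing card_mono) auto
      finally show "real d / real (totient d) \<le> 2 ^ card (prime_factors D)" .
    qed (use C_nonneg in simp)
    finally show "(\<Sum>r | r \<in> R \<and> d dvd r - 1. real d * (1 / real r * (\<Prod>l\<in>E r. 1 + 33 / real l))) \<le> C * exp 99 * 2 ^ card (prime_factors D)"
      by (simp only: sum_distrib_left)
  qed
  also have "\<dots> = real (card {d. d dvd D}) * (C * exp 99 * 2 ^ card (prime_factors D))" by simp
  also have "\<dots> \<le> 2 ^ card (prime_factors D) * (C * exp 99 * 2 ^ card (prime_factors D))"
  proof (rule mult_right_mono)
    have "card {d. d dvd D} \<le> 2 ^ card (prime_factors D)" unfolding D_def by (rule card_divisors_squarefree_le[OF dp(2)])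
    from of_nat_mono[OF this, where ?'a = real] show "real (card {d. d dvd D}) \<le> 2 ^ card (prime_factors D)" by simp
  qed (use C_nonneg in simp)
  also have "\<dots> = C * exp 99 * (2 * 2) ^ card (prime_factors D)" by (simp only: power_mult_distrib) (simp only: mult_ac)
  finally show ?thesis unfolding D_def by simp
qed

text \<open>With all else fixed, \<open>Delta\<close> is quadratic in \<open>r\<close> and its
  vanishing modulo \<open>l\<close> leaves at most two classes; \<open>l dvd r - 1\<close> adds a
  third. The restrictions in \<open>Er\<close> on the totients and on \<open>gcd s s'\<close> keep
  the leading and the constant coefficient from vanishing together.\<close>

lemma Er_classes:
  assumes r': "r' \<in> R" and s: "squarefree s" "s \<le> y" "squarefree s'" "s' \<le> y" and l: "l \<in> Z"
  shows "card ((\<lambda>r. r mod l) ` {r \<in> R. l \<in> Er s s' r r'}) \<le> 3"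
proof (cases "l dvd gcd s s'")
  case True
  then show ?thesis by (simp add: Er_def)
next
  case nD: False
  let ?S = "{r \<in> R. l \<in> Er s s' r r'}"
  let ?S2 = "{r \<in> R. l dvd Delta (r * s) (r' * s') \<and> \<not> l dvd totient (r * s) \<and> \<not> l dvd totient (r' * s')}"
  have pl: "prime l" using prZ[OF l] .
  have ge1: "p \<ge> 1" if "p \<in> R" for p using prime_ge_1_nat[OF primeR[OF that]] .
  have c1: "card ((\<lambda>r. r mod l) ` {r \<in> R. l dvd r - 1}) \<le> 1"
  proof (rule card_image_le_1)
    fix p q assume "p \<in> {r \<in> R. l dvd r - 1}" "q \<in> {r \<in> R. l dvd r - 1}"
    then show "p mod l = q mod l" using ge1[of p] ge1[of q] mod_eq_dvd_iff_nat[of 1 p l] mod_eq_dvd_iff_nat[of 1 q l] by simp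
  qed
  define f where "f = totient s"
  define A' where "A' = plus_phi (r' * s')"
  define k where "k = int (r' * s') * int (totient (r' * s'))"
  have c2: "card ((\<lambda>r. r mod l) ` ?S2) \<le> 2"
  proof (cases "?S2 = {}")
    case False
    then obtain r0 where r0: "r0 \<in> R" "\<not> l dvd totient (r0 * s)" "\<not> l dvd totient (r' * s')" by auto
    have nf: "\<not> l dvd f" using r0(2) sigma_props(5)[OF r0(1) s(1,2)] unfolding f_def by auto
    show ?thesis
    proof (rule quadratic_roots_mod_le[OF pl, of "int s * int f * int A'" "k * int f"])
      show "\<not> (int l dvd int s * int f * int A' \<and> int l dvd k * int f)"
      proof
        assume a: "int l dvd int s * int f * int A' \<and> int l dvd k * int f"
        have "l dvd r' * s'" using a nf r0(3) pl unfolding k_def by (auto simp: prime_dvd_mult_iff)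
        then have A'nd: "\<not> l dvd A'" using r0(3) unfolding A'_def plus_phi_def by (simp add: dvd_add_right_iff)
        have "\<not> l dvd r'"
        proof
          assume "l dvd r'"
          then have "l = r'" using pl primeR[OF r'] primes_dvd_imp_eq by blast
          then show False using Z_le[OF l] R_gt[OF r', of y] by simp
        qed
        then have "l dvd s'" using \<open>l dvd r' * s'\<close> pl by (simp add: prime_dvd_mult_iff)
        moreover have "l dvd s" using a nf A'nd pl by (auto simp: prime_dvd_mult_iff)
        ultimately show False using nD by simp
      qed
      show "finite ?S2" using finR by simp
      fix r assume "r \<in> ?S2"
      then have r: "r \<in> R" "l dvd Delta (r * s) (r' * s')" by auto
      have r1: "int (r - 1) = int r - 1" using ge1[OF r(1)] by (simp add: of_nat_diff)
      have ps: "int (plus_phi (r * s)) = int r * int s + (int r - 1) * int f"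
        unfolding plus_phi_def sigma_props(5)[OF r(1) s(1,2)] by (simp add: f_def r1[unfolded One_nat_def])
      have "int l dvd int (r * s * totient (r * s) * A') - int (r' * s' * totient (r' * s') * plus_phi (r * s))"
        using r(2) unfolding Delta_def A'_def by (simp add: dvd_nat_abs_iff)
      also have "\<dots> = int s * int f * int A' * int r * int r + (- (int s * int f * int A') - k * (int s + int f)) * int r + k * int f"
        unfolding sigma_props(5)[OF r(1) s(1,2)] f_def[symmetric] of_nat_mult ps r1 k_def by (simp add: algebra_simps)
      finally show "int l dvd int s * int f * int A' * int r * int r + (- (int s * int f * int A') - k * (int s + int f)) * int r + k * int f" .
    qed
  next
    case True
    then show ?thesis by (simp only: image_empty card.empty)
  qed
  have "card ((\<lambda>r. r mod l) ` ?S) \<le> card ((\<lambda>r. r mod l) ` ({r \<in> R. l dvd r - 1} \<union> ?S2))"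
    using finR by (intro card_mono image_mono finite_imageI) (auto simp: Er_def)
  also have "\<dots> \<le> 1 + 2" by (rule card_image_Un_le[OF _ refl c1 c2]) (use finR in simp)
  finally show ?thesis by simp
qed

end

context scales
begin

text \<open>The weight of \<open>r * s\<close> and \<open>r' * s'\<close> is rewritten in terms of
  \<open>s\<close> and \<open>s'\<close>, with the dependence on \<open>r\<close> and
  \<open>r'\<close> isolated. Neither \<open>r\<close> nor \<open>r'\<close> divides
  \<open>gc\<close>, so common divisors beyond those of \<open>s\<close> and \<open>s'\<close> come
  from \<open>r - 1\<close> and \<open>r' - 1\<close>. The primes of \<open>N\<close> from
  \<open>ln y\<close> on give \<open>exp 3008\<close>, as \<open>3008 = 2 * 16 * 94\<close>.\<close>

lemma weight_sigma_le:
  assumes r: "r \<in> R" "r' \<in> R" and s: "squarefree s" "s \<le> y" "squarefree s'" "s' \<le> y" and ne: "r * s \<noteq> r' * s'"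
  defines "gc \<equiv> gcd (tgcd (r * s)) (tgcd (r' * s'))" and "D \<equiv> gcd (r * s) (r' * s')"
  defines "N \<equiv> {l. prime l \<and> l dvd Delta (r * s) (r' * s') \<and> \<not> l dvd totient (r * s) \<and> \<not> l dvd totient (r' * s') \<and> \<not> l dvd D}"
  shows "real gc * (\<Prod>l | l \<in> Z \<and> l dvd totient (r * s) \<and> l dvd totient (r' * s'). 1 + 1 / real l) *
     (\<Prod>l | l \<in> Z \<and> l dvd r * s * (r' * s'). 1 + 1 / real l) * 272 ^ card (prime_factors (D div gc)) *
     (\<Prod>l\<in>prime_factors gc. 1 + 16 / real l) * (\<Prod>l\<in>N. 1 + 16 / real l) \<le>
   272 * exp 3008 * (real (gcs s s') * (\<Prod>l\<in>SS0 s s'. 1 + 1 / real l) * (\<Prod>l\<in>prime_factors (s * s'). 1 + 135 / real l) * 272 ^ card (prime_factors (D1 s s'))) *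
   ((real (gcd (D1 s s') (r - 1)) * (\<Prod>l\<in>Er s s' r r'. 1 + 33 / real l)) * (real (gcd (D1 s s') (r' - 1)) * (\<Prod>l\<in>Er' s s' r'. 1 + 33 / real l)))"
proof -
  interpret tf: two_forms Q "y ^ 194" C Z "r * s" "r' * s'" by (rule two_forms_sigma[OF r s ne])
  note p = sigma_props[OF r(1) s(1,2)] and p' = sigma_props[OF r(2) s(3,4)]
  note dp = D1_props[OF s(1,3)]
  note gp = tf.gc_props[unfolded tf.gc_def tf.D_def tf.D'_def, folded gc_def D_def]
  let ?f = "\<lambda>l. 1 + 1 / real l" and ?g = "\<lambda>l. 1 + 16 / real l" and ?h = "\<lambda>l. 1 + 33 / real l"
  let ?P0 = "prime_factors (s * s')"
  have ss0: "s * s' > 0" using p(3) p'(3) by simp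
  have small: "\<not> l dvd r" "\<not> l dvd r'" if "l \<in> Z" for l
  proof -
    have "l < r" "l < r'" using Z_le[OF that] R_gt[OF r(1), of y] R_gt[OF r(2), of y] by simp_all
    then show "\<not> l dvd r" "\<not> l dvd r'" using prZ[OF that] primeR r primes_dvd_imp_eq by blast+
  qed
  have pg: "l dvd s \<and> l dvd s' \<and> (l dvd gcs s s' \<or> l dvd D1 s s') \<and> l dvd (r - 1) * totient s \<and> l dvd (r' - 1) * totient s'"
    if l: "prime l" "l dvd gc" for l
  proof -
    have d: "l dvd r * s" "l dvd r' * s'" "l dvd (r - 1) * totient s" "l dvd (r' - 1) * totient s'"
      using l(2) unfolding gc_def tgcd_def p(5) p'(5) by simp_all
    have nr: "\<not> r dvd (r - 1) * totient s" if r: "r \<in> R" and s: "0 < s" "s < r" for r s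
    proof
      assume "r dvd (r - 1) * totient s"
      then have "r dvd r - 1 \<or> r dvd totient s" using primeR[OF r] by (simp add: prime_dvd_mult_iff)
      then show False using s totient_le[of s] prime_gt_1_nat[OF primeR[OF r]] by (auto dest!: dvd_imp_le)
    qed
    have "l \<noteq> r" using nr[OF r(1) p(3,4)] d(3) by auto
    moreover have "l \<noteq> r'" using nr[OF r(2) p'(3,4)] d(4) by auto
    ultimately have "\<not> l dvd r" "\<not> l dvd r'" using l(1) primeR[OF r(1)] primeR[OF r(2)] primes_dvd_imp_eq by blast+
    then have "l dvd s" "l dvd s'" using d(1,2) l(1) by (simp_all add: prime_dvd_mult_iff)
    moreover from this have "l dvd gcs s s' * D1 s s'" by (simp add: dp(1)[symmetric])
    ultimately show ?thesis using d l(1) by (simp add: prime_dvd_mult_iff)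
  qed
  have gcs_dvd: "l dvd gcs s s' \<longleftrightarrow> l dvd s \<and> l dvd totient s \<and> l dvd s' \<and> l dvd totient s'" for l
    unfolding gcs_def tgcd_def by auto
  have sqgc: "squarefree gc" by (rule squarefree_mono[OF gp(4) gp(7)])
  have G: "real gc \<le> real (gcs s s') * (real (gcd (D1 s s') (r - 1)) * real (gcd (D1 s s') (r' - 1)))"
  proof -
    have "gc dvd gcs s s' * (gcd (D1 s s') (r - 1) * gcd (D1 s s') (r' - 1))"
    proof (rule squarefree_dvdI[OF sqgc])
      fix l assume l: "prime l" "l dvd gc"
      show "l dvd gcs s s' * (gcd (D1 s s') (r - 1) * gcd (D1 s s') (r' - 1))"
      proof (cases "l dvd gcs s s'")
        case False
        then have "l dvd D1 s s'" "l dvd r - 1 \<or> l dvd r' - 1"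
          using pg[OF l] l(1) unfolding gcs_dvd by (auto simp: prime_dvd_mult_iff)
        then show ?thesis by auto
      qed simp
    qed
    then have "gc \<le> gcs s s' * (gcd (D1 s s') (r - 1) * gcd (D1 s s') (r' - 1))" using dp(4,5) by (intro dvd_imp_le) auto
    from of_nat_mono[OF this, where ?'a = real] show ?thesis by simp
  qed
  \<comment> \<open>\<open>r\<close> itself divides \<open>D\<close> when \<open>r = r'\<close>;
    this is the extra factor 272.\<close>
  have W: "272 ^ card (prime_factors (D div gc)) \<le> 272 * (272::real) ^ card (prime_factors (D1 s s'))"
  proof -
    have "prime_factors (D div gc) \<subseteq> insert r (prime_factors (D1 s s'))"
    proof
      fix l assume "l \<in> prime_factors (D div gc)"
      then have l: "prime l" "l dvd D div gc" by auto
      have "\<not> l dvd gc" using l(1) l(2) gp(6) gp(5) not_prime_unit[of l] coprime_common_divisor[of gc "D div gc" l] by auto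
      have DgD: "D div gc dvd D" using gp(5) by (metis dvd_triv_right)
      have lD: "l dvd r * s" "l dvd r' * s'"
        using dvd_trans[OF l(2) DgD] unfolding D_def by auto
      show "l \<in> insert r (prime_factors (D1 s s'))"
      proof (cases "l = r")
        case False
        then have "\<not> l dvd r" using l(1) primeR[OF r(1)] primes_dvd_imp_eq by blast
        then have ls: "l dvd s" using lD(1) l(1) by (simp add: prime_dvd_mult_iff)
        then have "l < r'" using dvd_imp_le[OF ls p(3)] s(2) R_gt[OF r(2) s(2)] by linarith
        then have "\<not> l dvd r'" using l(1) primeR[OF r(2)] primes_dvd_imp_eq by blast
        then have ls': "l dvd s'" using lD(2) l(1) by (simp add: prime_dvd_mult_iff)
        have "\<not> l dvd gcs s s'"
        proof
          assume "l dvd gcs s s'"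
          then have "l dvd gc" unfolding gcs_dvd gc_def tgcd_def p(5) p'(5) by simp
          then show False using \<open>\<not> l dvd gc\<close> by simp
        qed
        moreover have "l dvd gcs s s' * D1 s s'" using ls ls' by (simp add: dp(1)[symmetric])
        ultimately have "l dvd D1 s s'" using l(1) by (simp add: prime_dvd_mult_iff)
        then show ?thesis using l(1) dp(4) by (simp add: prime_factors_dvd)
      qed simp
    qed
    then have "card (prime_factors (D div gc)) \<le> card (insert r (prime_factors (D1 s s')))" by (intro card_mono) auto
    also have "\<dots> \<le> Suc (card (prime_factors (D1 s s')))" by (rule card_insert_le_m1) auto
    finally have "(272::real) ^ card (prime_factors (D div gc)) \<le> 272 ^ Suc (card (prime_factors (D1 s s')))"
      by (rule power_increasing) simp
    then show ?thesis by simp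
  qed
  have S0: "prod ?f {l. l \<in> Z \<and> l dvd totient (r * s) \<and> l dvd totient (r' * s')} \<le>
     prod ?f (SS0 s s') * (prod ?f ?P0 * (prod ?f ?P0 * (prod ?f {l \<in> Z. \<not> l dvd gcd s s' \<and> l dvd r - 1} * prod ?f (Er' s s' r'))))"
  proof -
    let ?B = "{l \<in> Z. \<not> l dvd gcd s s' \<and> l dvd r - 1}"
    have fin: "finite (SS0 s s')" "finite ?B" "finite (Er' s s' r')" using finZ by (auto simp: SS0_def Er'_def)
    have "prod ?f {l. l \<in> Z \<and> l dvd totient (r * s) \<and> l dvd totient (r' * s')} \<le> prod ?f (SS0 s s' \<union> (?P0 \<union> (?P0 \<union> (?B \<union> Er' s s' r'))))"
    proof (rule prod_subset_le)
      show "{l. l \<in> Z \<and> l dvd totient (r * s) \<and> l dvd totient (r' * s')} \<subseteq> SS0 s s' \<union> (?P0 \<union> (?P0 \<union> (?B \<union> Er' s s' r')))"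
      proof
        fix l assume "l \<in> {l. l \<in> Z \<and> l dvd totient (r * s) \<and> l dvd totient (r' * s')}"
        then have l: "l \<in> Z" "l dvd (r - 1) * totient s" "l dvd (r' - 1) * totient s'" unfolding p(5) p'(5) by auto
        have "(l dvd r - 1 \<or> l dvd totient s) \<and> (l dvd r' - 1 \<or> l dvd totient s')"
          using l prZ[OF l(1)] by (simp add: prime_dvd_mult_iff)
        moreover have "l \<in> ?P0" if "l dvd gcd s s'" using that prZ[OF l(1)] ss0 by (simp add: prime_factors_dvd)
        ultimately show "l \<in> SS0 s s' \<union> (?P0 \<union> (?P0 \<union> (?B \<union> Er' s s' r')))"
          using l(1) unfolding SS0_def Er'_def by blast
      qed
    qed (use fin in auto)
    also have "\<dots> \<le> prod ?f (SS0 s s') * prod ?f (?P0 \<union> (?P0 \<union> (?B \<union> Er' s s' r')))" using fin by (intro prod_union_le) auto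
    also have "\<dots> \<le> prod ?f (SS0 s s') * (prod ?f ?P0 * prod ?f (?P0 \<union> (?B \<union> Er' s s' r')))"
      using fin by (intro mult_left_mono prod_union_le prod_nonneg) auto
    also have "\<dots> \<le> prod ?f (SS0 s s') * (prod ?f ?P0 * (prod ?f ?P0 * prod ?f (?B \<union> Er' s s' r')))"
      using fin by (intro mult_left_mono prod_union_le prod_nonneg) auto
    also have "\<dots> \<le> prod ?f (SS0 s s') * (prod ?f ?P0 * (prod ?f ?P0 * (prod ?f ?B * prod ?f (Er' s s' r'))))"
      using fin by (intro mult_left_mono prod_union_le prod_nonneg) auto
    finally show ?thesis .
  qed
  have S1: "prod ?f {l. l \<in> Z \<and> l dvd r * s * (r' * s')} \<le> prod ?f ?P0"
  proof (rule prod_subset_le)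
    show "{l. l \<in> Z \<and> l dvd r * s * (r' * s')} \<subseteq> ?P0"
      using prZ small ss0 by (auto simp: prime_factors_dvd prime_dvd_mult_iff)
  qed auto
  have S2: "prod ?g (prime_factors gc) \<le> prod ?g ?P0"
  proof (rule prod_subset_le)
    show "prime_factors gc \<subseteq> ?P0"
    proof
      fix l assume "l \<in> prime_factors gc"
      then have l: "prime l" "l dvd gc" by (simp_all add: in_prime_factors_iff)
      have "l dvd s" using pg[OF l] by simp
      then show "l \<in> ?P0" using l(1) ss0 by (simp add: prime_factors_dvd)
    qed
  qed auto
  have finN: "finite N" unfolding N_def
    by (rule finite_subset[of _ "{l. l dvd Delta (r * s) (r' * s')}"]) (use tf.Delta_pos in auto)
  have S3: "prod ?g N \<le> exp 3008 * prod ?g (N \<inter> Z)"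
  proof -
    have "prod ?g N \<le> prod ?g ({l \<in> N. ln (real y) \<le> real l} \<union> (N \<inter> Z))"
    proof (rule prod_subset_le)
      show "N \<subseteq> {l \<in> N. ln (real y) \<le> real l} \<union> (N \<inter> Z)"
      proof
        fix l assume l: "l \<in> N"
        then have "prime l" by (simp add: N_def)
        then show "l \<in> {l \<in> N. ln (real y) \<le> real l} \<union> (N \<inter> Z)" using l small_primes_iff[of y l] y2 unfolding Z_def by auto
      qed
    qed (use finN in auto)
    also have "\<dots> \<le> prod ?g {l \<in> N. ln (real y) \<le> real l} * prod ?g (N \<inter> Z)" using finN by (intro prod_union_le) auto
    also have "\<dots> \<le> exp (2 * 16 * real 94) * prod ?g (N \<inter> Z)"
    proof (rule mult_right_mono)
      show "prod ?g {l \<in> N. ln (real y) \<le> real l} \<le> exp (2 * 16 * real 94)"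
        by (rule large_prime_prod_le[OF y tf.Delta_pos Delta_le[OF p(2) p'(2)]]) (simp, (use finN in simp), simp add: N_def)
    qed (auto intro!: prod_nonneg)
    finally show ?thesis by simp
  qed
  have gsD: "gcd s s' dvd gcd (r * s) (r' * s')" by (simp add: dvd_trans[OF gcd_dvd1] dvd_trans[OF gcd_dvd2])
  have E: "prod ?f {l \<in> Z. \<not> l dvd gcd s s' \<and> l dvd r - 1} * prod ?g (N \<inter> Z) \<le> prod ?h (Er s s' r r')"
  proof -
    have fin: "finite (Er s s' r r')" using finZ by (simp add: Er_def)
    have "{l \<in> Z. \<not> l dvd gcd s s' \<and> l dvd r - 1} \<subseteq> Er s s' r r'" by (auto simp: Er_def)
    moreover have "N \<inter> Z \<subseteq> Er s s' r r'" unfolding Er_def N_def D_def by (auto dest: dvd_trans[OF _ gsD])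
    ultimately have "prod ?f {l \<in> Z. \<not> l dvd gcd s s' \<and> l dvd r - 1} * prod ?g (N \<inter> Z) \<le> prod ?f (Er s s' r r') * prod ?g (Er s s' r r')"
      using fin by (intro mult_mono prod_subset_le prod_nonneg) auto
    also have "\<dots> = (\<Prod>l\<in>Er s s' r r'. ?f l * ?g l)" by (simp add: prod.distrib)
    also have "\<dots> \<le> prod ?h (Er s s' r r')"
    proof (intro prod_mono conjI)
      fix l assume "l \<in> Er s s' r r'"
      then have "l \<ge> 1" using prZ prime_ge_1_nat unfolding Er_def by blast
      then show "?f l * ?g l \<le> ?h l" by (simp add: field_simps)
    qed auto
    finally show ?thesis .
  qed
  have E': "prod ?f (Er' s s' r') \<le> prod ?h (Er' s s' r')"
    by (intro prod_mono) (auto intro!: divide_right_mono)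
  have K: "prod ?f ?P0 * prod ?f ?P0 * prod ?f ?P0 * prod ?g ?P0 \<le> (\<Prod>l\<in>?P0. 1 + 135 / real l)"
  proof -
    have "prod ?f ?P0 * prod ?f ?P0 * prod ?f ?P0 * prod ?g ?P0 = (\<Prod>l\<in>?P0. ?f l * ?f l * ?f l * ?g l)" by (simp add: prod.distrib)
    also have "\<dots> \<le> (\<Prod>l\<in>?P0. 1 + 135 / real l)"
    proof (intro prod_mono conjI)
      fix l assume "l \<in> ?P0"
      then have "l \<ge> 1" using in_prime_factors_imp_prime prime_ge_1_nat by blast
      then have t: "0 \<le> 1 / real l" "1 / real l \<le> 1" by simp_all
      define t where "t = 1 / real l"
      have t2: "t * t \<le> t" "t * t * t \<le> t" "t * t * t * t \<le> t" "0 \<le> t"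
        unfolding t_def[symmetric]
      proof -
        show t0: "0 \<le> t" using t unfolding t_def by simp
        have t1: "t \<le> 1" using t unfolding t_def by simp
        show a: "t * t \<le> t" using mult_left_le[OF t1 t0] by simp
        show b: "t * t * t \<le> t" using mult_left_le[OF t1, of "t * t"] a t0 by simp
        show "t * t * t * t \<le> t" using mult_left_le[OF t1, of "t * t * t"] b t0 by simp
      qed
      \<comment> \<open>\<open>135 = 19 + 51 + 49 + 16\<close>, as the powers of
        \<open>t \<le> 1\<close> are at most \<open>t\<close>.\<close>
      have "(1 + t) * (1 + t) * (1 + t) * (1 + 16 * t) = 1 + 19 * t + 51 * (t * t) + 49 * (t * t * t) + 16 * (t * t * t * t)"
        by (simp add: algebra_simps)
      also have "\<dots> \<le> 1 + 135 * t" using t2 by linarith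
      finally show "?f l * ?f l * ?f l * ?g l \<le> 1 + 135 / real l" unfolding t_def by simp
    qed auto
    finally show ?thesis .
  qed
  define a1 where "a1 = prod ?f ?P0"
  have a1: "a1 \<ge> 0" unfolding a1_def by (intro prod_nonneg) auto
  have nn: "prod ?f X \<ge> 0" "prod ?g X \<ge> 0" "prod ?h X \<ge> 0" for X by (intro prod_nonneg; simp)+
  have nn135: "0 \<le> (\<Prod>l\<in>?P0. 1 + 135 / real l)" by (intro prod_nonneg) simp
  define B where "B = prod ?f {l \<in> Z. \<not> l dvd gcd s s' \<and> l dvd r - 1}"
  define g1 g2 where "g1 = real (gcd (D1 s s') (r - 1))" and "g2 = real (gcd (D1 s s') (r' - 1))"
  define w where "w = (272::real) ^ card (prime_factors (D1 s s'))"
  have "real gc * prod ?f {l. l \<in> Z \<and> l dvd totient (r * s) \<and> l dvd totient (r' * s')} *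
     prod ?f {l. l \<in> Z \<and> l dvd r * s * (r' * s')} * 272 ^ card (prime_factors (D div gc)) *
     prod ?g (prime_factors gc) * prod ?g N \<le>
     (real (gcs s s') * (g1 * g2)) * (prod ?f (SS0 s s') * (a1 * (a1 * (B * prod ?f (Er' s s' r'))))) * a1 * (272 * w) * prod ?g ?P0 * (exp 3008 * prod ?g (N \<inter> Z))"
    using G S0 S1 W S2 S3 nn unfolding a1_def B_def g1_def g2_def w_def by (intro mult_mono mult_nonneg_nonneg) auto
  also have "\<dots> = 272 * exp 3008 * (real (gcs s s') * prod ?f (SS0 s s') * (a1 * a1 * a1 * prod ?g ?P0) * w) * ((g1 * (B * prod ?g (N \<inter> Z))) * (g2 * prod ?f (Er' s s' r')))"
    by (simp only: mult_ac)
  also have "\<dots> \<le> 272 * exp 3008 * (real (gcs s s') * prod ?f (SS0 s s') * (\<Prod>l\<in>?P0. 1 + 135 / real l) * w) * ((g1 * prod ?h (Er s s' r r')) * (g2 * prod ?h (Er' s s' r')))"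
    using K E E' nn nn135 a1 unfolding a1_def B_def g1_def g2_def w_def by (intro mult_mono mult_nonneg_nonneg order_refl) (assumption | simp)+
  finally show ?thesis unfolding g1_def g2_def w_def .
qed

text \<open>The sum over \<open>r\<close> comes first, with \<open>r'\<close> fixed, since
  \<open>Er\<close> depends on both; \<open>Er'\<close> is what is left for the sum over
  \<open>r'\<close>.\<close>

lemma sum_pairs_sigma_le:
  assumes s: "squarefree s" "s \<le> y" "squarefree s'" "s' \<le> y"
  shows "(\<Sum>r'\<in>R. \<Sum>r\<in>R. if r * s \<noteq> r' * s' then 1 / real r * (1 / real r') *
     (\<Sum>(q, q') | q \<in> Q \<and> q' \<in> Q \<and> collide (q * (r * s)) (q' * (r' * s')).
      real (gcd (plus_phi (q * (r * s))) (plus_phi (q' * (r' * s')))) / (real q * real q') *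
      (\<Prod>l | l \<in> Z \<and> l dvd pair_defect (q * (r * s)) (q' * (r' * s')). 1 + 1 / real l)) else 0) \<le>
    (C * exp 2)\<^sup>2 * (272 * exp 3008) * (C * exp 99)\<^sup>2 * Wt s s'"
proof -
  define T where "T a a' = (\<Sum>(q, q') | q \<in> Q \<and> q' \<in> Q \<and> collide (q * a) (q' * a').
      real (gcd (plus_phi (q * a)) (plus_phi (q' * a'))) / (real q * real q') *
      (\<Prod>l | l \<in> Z \<and> l dvd pair_defect (q * a) (q' * a'). 1 + 1 / real l))" for a a'
  define W0 where "W0 = real (gcs s s') * (\<Prod>l\<in>SS0 s s'. 1 + 1 / real l) *
    (\<Prod>l\<in>prime_factors (s * s'). 1 + 135 / real l) * 272 ^ card (prime_factors (D1 s s'))"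
  define X where "X r r' = real (gcd (D1 s s') (r - 1)) * (\<Prod>l\<in>Er s s' r r'. 1 + 33 / real l)" for r r'
  define X' where "X' r' = real (gcd (D1 s s') (r' - 1)) * (\<Prod>l\<in>Er' s s' r'. 1 + 33 / real l)" for r'
  define c where "c = (C * exp 2)\<^sup>2 * (272 * exp 3008 * W0)"
  define M where "M = C * exp 99 * 4 ^ card (prime_factors (D1 s s'))"
  have W0: "W0 \<ge> 0" unfolding W0_def by (intro mult_nonneg_nonneg prod_nonneg) auto
  then have c: "c \<ge> 0" unfolding c_def by simp
  have X: "X r r' \<ge> 0" "X' r' \<ge> 0" for r r' unfolding X_def X'_def by (auto intro!: mult_nonneg_nonneg prod_nonneg)
  have M0: "M \<ge> 0" unfolding M_def using C_nonneg by simp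
  have T: "T (r * s) (r' * s') \<le> c * (X r r' * X' r')" if r: "r \<in> R" "r' \<in> R" and ne: "r * s \<noteq> r' * s'" for r r'
  proof -
    interpret tf: two_forms Q "y ^ 194" C Z "r * s" "r' * s'" by (rule two_forms_sigma[OF r s ne])
    note tf.two_forms_sum_le[unfolded tf.gc_def tf.D_def tf.D'_def tf.ss_def tf.N_def, folded T_def]
    also note mult_left_mono[OF weight_sigma_le[OF r s ne], of "(C * exp 2)\<^sup>2"]
    finally show ?thesis unfolding c_def W0_def X_def X'_def by (simp only: mult.assoc zero_le_power2 simp_thms)
  qed
  have Xr: "(\<Sum>r\<in>R. 1 / real r * X r r') \<le> M" if "r' \<in> R" for r'
    unfolding X_def M_def by (rule sum_r_le[OF s _ _ Er_classes[OF that s]]) (auto simp: Er_def)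
  have X'r: "(\<Sum>r\<in>R. 1 / real r * X' r) \<le> M"
    unfolding X'_def M_def
  proof (rule sum_r_le[OF s])
    fix l assume l: "l \<in> Z"
    have "card ((\<lambda>r. r mod l) ` {r \<in> R. l \<in> Er' s s' r}) \<le> 1"
    proof (rule card_image_le_1)
      fix p q assume "p \<in> {r \<in> R. l \<in> Er' s s' r}" "q \<in> {r \<in> R. l \<in> Er' s s' r}"
      then show "p mod l = q mod l"
        using prime_ge_1_nat[OF primeR, of p] prime_ge_1_nat[OF primeR, of q] mod_eq_dvd_iff_nat[of 1 p l] mod_eq_dvd_iff_nat[of 1 q l]
        unfolding Er'_def by simp
    qed
    then show "card ((\<lambda>r. r mod l) ` {r \<in> R. l \<in> Er' s s' r}) \<le> 3" by simp
  qed (auto simp: Er'_def)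
  have "(\<Sum>r'\<in>R. \<Sum>r\<in>R. if r * s \<noteq> r' * s' then 1 / real r * (1 / real r') * T (r * s) (r' * s') else 0) \<le>
     (\<Sum>r'\<in>R. c * (1 / real r' * X' r') * (\<Sum>r\<in>R. 1 / real r * X r r'))"
    unfolding sum_distrib_left
  proof (intro sum_mono)
    fix r r' assume r: "r' \<in> R" "r \<in> R"
    have "1 / real r * (1 / real r') * T (r * s) (r' * s') \<le> 1 / real r * (1 / real r') * (c * (X r r' * X' r'))" if "r * s \<noteq> r' * s'"
      by (rule mult_left_mono[OF T[OF r(2,1) that]]) simp
    moreover have "0 \<le> c * (1 / real r' * X' r') * (1 / real r * X r r')" using c X by (intro mult_nonneg_nonneg) auto
    ultimately show "(if r * s \<noteq> r' * s' then 1 / real r * (1 / real r') * T (r * s) (r' * s') else 0) \<le> c * (1 / real r' * X' r') * (1 / real r * X r r')"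
      by (simp add: mult_ac)
  qed
  also have "\<dots> \<le> (\<Sum>r'\<in>R. c * (1 / real r' * X' r') * M)"
    using Xr c X by (intro sum_mono mult_left_mono mult_nonneg_nonneg) auto
  also have "\<dots> = c * M * (\<Sum>r'\<in>R. 1 / real r' * X' r')" by (simp add: sum_distrib_left mult_ac)
  also have "\<dots> \<le> c * M * M" using X'r c M0 by (intro mult_left_mono mult_nonneg_nonneg)
  also have "\<dots> = (C * exp 2)\<^sup>2 * (272 * exp 3008) * (C * exp 99)\<^sup>2 * Wt s s'"
  proof -
    have e: "(272::real) ^ n * (4 ^ n * 4 ^ n) = 4352 ^ n" for n by (simp flip: power_mult_distrib)
    have "c * M * M = (C * exp 2)\<^sup>2 * (272 * exp 3008) * (C * exp 99)\<^sup>2 * (real (gcs s s') * (\<Prod>l\<in>SS0 s s'. 1 + 1 / real l) *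
    (\<Prod>l\<in>prime_factors (s * s'). 1 + 135 / real l) * (272 ^ card (prime_factors (D1 s s')) * (4 ^ card (prime_factors (D1 s s')) * 4 ^ card (prime_factors (D1 s s')))))"
      unfolding c_def M_def W0_def power2_eq_square by (simp only: mult_ac)
    then show ?thesis unfolding e Wt_def .
  qed
  finally show ?thesis unfolding T_def .
qed

end

section \<open>The sum over squarefree parts\<close>

lemma sum_Pow_insert:
  assumes "finite A" "b \<notin> A"
  shows "(\<Sum>U\<in>Pow (insert b A). g U) = (\<Sum>U\<in>Pow A. g U + g (insert b U))"
proof -
  have "(\<Sum>U\<in>Pow (insert b A). g U) = (\<Sum>U\<in>Pow A. g U) + (\<Sum>U\<in>insert b ` Pow A. g U)"
    unfolding Pow_insert using assms by (intro sum.union_disjoint) auto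
  also have "(\<Sum>U\<in>insert b ` Pow A. g U) = (\<Sum>U\<in>Pow A. g (insert b U))"
    using assms(2) by (subst sum.reindex) (auto simp: inj_on_def)
  finally show ?thesis by (simp add: sum.distrib)
qed

text \<open>The weight at \<open>l\<close> sees only the larger elements of \<open>U\<close> and \<open>V\<close>, so the smallest prime can be summed
first with everything else fixed.\<close>
lemma peeling_sum_le:
  fixes w :: "nat \<Rightarrow> nat set \<Rightarrow> nat set \<Rightarrow> bool \<Rightarrow> bool \<Rightarrow> real"
  assumes "finite P" and nn: "\<And>l A B b b'. w l A B b b' \<ge> 0"
    and "\<And>l A B. l \<in> P \<Longrightarrow> w l A B False False + w l A B False True + w l A B True False + w l A B True True \<le> c l"
  shows "(\<Sum>U\<in>Pow P. \<Sum>V\<in>Pow P. \<Prod>l\<in>P. w l (U \<inter> {l<..}) (V \<inter> {l<..}) (l \<in> U) (l \<in> V)) \<le> (\<Prod>l\<in>P. c l)"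
  using assms(1,3)
proof (induction P rule: finite_linorder_min_induct)
  case (insert b A)
  let ?g = "\<lambda>U V. \<Prod>l\<in>A. w l (U \<inter> {l<..}) (V \<inter> {l<..}) (l \<in> U) (l \<in> V)"
  let ?h = "\<lambda>U V. \<Prod>l\<in>insert b A. w l (U \<inter> {l<..}) (V \<inter> {l<..}) (l \<in> U) (l \<in> V)"
  have bA: "b \<notin> A" using insert.hyps(2) by auto
  have g: "?g (insert b U) V = ?g U V" "?g U (insert b V) = ?g U V" for U V
    using insert.hyps(2) by (intro prod.cong refl arg_cong[where f = "\<lambda>X. w _ X _ _ _"]; force)+
  have up: "U \<inter> {b<..} = U" if "U \<subseteq> A" for U using that insert.hyps(2) by auto
  have h: "?h U V = w b (U \<inter> {b<..}) (V \<inter> {b<..}) (b \<in> U) (b \<in> V) * ?g U V" for U V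
    using insert.hyps(1) bA by simp
  have c0: "c b \<ge> 0" using nn insert.prems[of b "{}" "{}"] by (smt (verit) insertI1)
  have four: "(?h U V + ?h U (insert b V)) + (?h (insert b U) V + ?h (insert b U) (insert b V)) \<le> c b * ?g U V"
    if "U \<in> Pow A" "V \<in> Pow A" for U V
  proof -
    have UV: "U \<subseteq> A" "V \<subseteq> A" using that by auto
    then have nb: "b \<notin> U" "b \<notin> V" using bA by auto
    have i: "insert b U \<inter> {b<..} = U" "insert b V \<inter> {b<..} = V" using up[OF UV(1)] up[OF UV(2)] by auto
    have "(?h U V + ?h U (insert b V)) + (?h (insert b U) V + ?h (insert b U) (insert b V)) =
      (w b U V False False + w b U V False True + w b U V True False + w b U V True True) * ?g U V"
      unfolding h g i up[OF UV(1)] up[OF UV(2)] using nb by (simp add: algebra_simps)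
    also have "\<dots> \<le> c b * ?g U V" using insert.prems[of b U V] nn by (intro mult_right_mono prod_nonneg) auto
    finally show ?thesis .
  qed
  have "(\<Sum>U\<in>Pow (insert b A). \<Sum>V\<in>Pow (insert b A). ?h U V) =
     (\<Sum>U\<in>Pow A. \<Sum>V\<in>Pow A. (?h U V + ?h U (insert b V)) + (?h (insert b U) V + ?h (insert b U) (insert b V)))"
    unfolding sum_Pow_insert[OF insert.hyps(1) bA] sum.distrib by simp
  also have "\<dots> \<le> (\<Sum>U\<in>Pow A. \<Sum>V\<in>Pow A. c b * ?g U V)" by (intro sum_mono four)
  also have "\<dots> = c b * (\<Sum>U\<in>Pow A. \<Sum>V\<in>Pow A. ?g U V)" by (simp only: sum_distrib_left)
  also have "\<dots> \<le> c b * (\<Prod>l\<in>A. c l)" using insert.IH insert.prems c0 by (intro mult_left_mono) auto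
  finally show ?case using insert.hyps(1) bA by simp
qed simp

text \<open>For squarefree \<open>s\<close> the totient is the product of \<open>q - 1\<close> over
  its primes, and \<open>l dvd q - 1\<close> forces \<open>q > l\<close>. So whether
  \<open>l\<close> divides the totient is decided by the larger primes of \<open>s\<close>, as the
  summation from the smallest prime upward requires.\<close>

lemma dvd_totient_squarefree_iff:
  assumes s: "squarefree s" and l: "prime (l::nat)"
  shows "l dvd totient s \<longleftrightarrow> (\<exists>q\<in>prime_factors s \<inter> {l<..}. l dvd q - 1)"
proof -
  have s0: "s \<noteq> 0"
  proof
    assume "s = 0"
    then show False using s not_squarefree_0 by blast
  qed
  have "totient s = (\<Prod>q\<in>prime_factors s. q ^ (multiplicity q s - 1) * (q - 1))" by (rule totient_formula1) (use s0 in simp)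
  also have "\<dots> = (\<Prod>q\<in>prime_factors s. q - 1)"
  proof (rule prod.cong[OF refl])
    fix q assume q: "q \<in> prime_factors s"
    then have "multiplicity q s = 1"
      using s s0 squarefree_factorial_semiring'[of s] by auto
    then show "q ^ (multiplicity q s - 1) * (q - 1) = q - 1" by simp
  qed
  finally have e: "totient s = (\<Prod>q\<in>prime_factors s. q - 1)" .
  have "l dvd totient s \<longleftrightarrow> (\<exists>q\<in>prime_factors s. l dvd q - 1)"
    unfolding e using l by (simp add: prime_dvd_prod_iff)
  moreover have "l < q" if "q \<in> prime_factors s" "l dvd q - 1" for q
  proof -
    have "q - 1 > 0" using prime_gt_1_nat[OF in_prime_factors_imp_prime[OF that(1)]] by simp
    then show ?thesis using dvd_imp_le[OF that(2)] by linarith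
  qed
  ultimately show ?thesis by blast
qed

text \<open>\<open>d\<close> and \<open>n div d\<close> pair the divisors across the square root.
  For the pairs with \<open>r * s = r' * s'\<close> this brings the moduli below the level up to
  which \<open>Q\<close> is controlled.\<close>

lemma card_divisors_le_small:
  assumes "n > (0::nat)"
  shows "card {d. d dvd n} \<le> 2 * card {d. d dvd n \<and> d * d \<le> n}"
proof -
  let ?S = "{d. d dvd n \<and> d * d \<le> n}" and ?L = "{d. d dvd n \<and> n < d * d}"
  have fin: "finite {d. d dvd n}" using assms by simp
  have "card ?L \<le> card ?S"
  proof (rule card_inj_on_le[where f = "\<lambda>d. n div d"])
    show "inj_on (\<lambda>d. n div d) ?L"
    proof (rule inj_onI)
      fix a b assume a: "a \<in> ?L" and b: "b \<in> ?L" and e: "n div a = n div b"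
      have "a * (n div a) = b * (n div b)" using a b by simp
      moreover have "n div a > 0" using a assms by (auto simp: div_greater_zero_iff dvd_imp_le intro!: Nat.gr0I)
      ultimately show "a = b" unfolding e by simp
    qed
    show "(\<lambda>d. n div d) ` ?L \<subseteq> ?S"
    proof safe
      fix d assume d: "d dvd n" "n < d * d"
      then obtain k where k: "n = d * k" by (elim dvdE)
      then have "k < d" using d by (auto simp: not_less intro: ccontr)
      moreover have "d > 0" using d by (auto intro!: Nat.gr0I)
      ultimately show "n div d dvd n" "n div d * (n div d) \<le> n" unfolding k by (auto intro: mult_le_mono1)
    qed
    show "finite ?S" using fin by (rule rev_finite_subset) auto
  qed
  moreover have "card {d. d dvd n} \<le> card ?S + card ?L"
  proof -
    have "{d. d dvd n} = ?S \<union> ?L" by auto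
    then show ?thesis by (metis card_Un_le)
  qed
  ultimately show ?thesis by linarith
qed

text \<open>Cauchy--Schwarz over the fibres of \<open>f\<close>: few coincidences mean many
  values.\<close>

lemma card_sq_le_image_pairs:
  assumes "finite T"
  shows "(real (card T))\<^sup>2 \<le> real (card (f ` T)) * real (card {(t, t'). t \<in> T \<and> t' \<in> T \<and> f t = f t'})"
proof -
  define F where "F n = {t \<in> T. f t = n}" for n
  have finF: "finite (F n)" for n unfolding F_def using assms by simp
  have e1: "card T = (\<Sum>n\<in>f ` T. card (F n))"
    unfolding F_def using sum.image_gen[OF assms, of "\<lambda>_. 1::nat" f] by simp
  have "{(t, t'). t \<in> T \<and> t' \<in> T \<and> f t = f t'} = (\<Union>n\<in>f ` T. F n \<times> F n)" unfolding F_def by auto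
  then have e2: "card {(t, t'). t \<in> T \<and> t' \<in> T \<and> f t = f t'} = (\<Sum>n\<in>f ` T. card (F n \<times> F n))"
    using assms finF by (simp only:) (subst card_UN_disjoint, auto simp: F_def)
  have "(\<Sum>n\<in>f ` T. 1 * real (card (F n)))\<^sup>2 \<le> (\<Sum>n\<in>f ` T. 1\<^sup>2) * (\<Sum>n\<in>f ` T. (real (card (F n)))\<^sup>2)"
    by (rule Cauchy_Schwarz_ineq_sum)
  then show ?thesis unfolding e1 e2 by (simp add: card_cartesian_product power2_eq_square)
qed

lemma sum_pairs_if:
  assumes "finite A" "finite B"
  shows "(\<Sum>(a, b) | a \<in> A \<and> b \<in> B \<and> P a b. f a b) = (\<Sum>(a, b)\<in>A \<times> B. if P a b then f a b else (0::real))"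
proof -
  have "(\<Sum>(a, b) | a \<in> A \<and> b \<in> B \<and> P a b. f a b) = (\<Sum>x\<in>{x \<in> A \<times> B. P (fst x) (snd x)}. f (fst x) (snd x))"
    by (intro sum.cong) auto
  also have "\<dots> = (\<Sum>x\<in>A \<times> B. if P (fst x) (snd x) then f (fst x) (snd x) else 0)"
    using assms by (intro sum.inter_filter) simp
  finally show ?thesis by (simp add: case_prod_unfold)
qed

lemma squarefree_prod_primes:
  assumes "\<And>p. p \<in> U \<Longrightarrow> prime (p::nat)"
  shows "squarefree (\<Prod>U)"
  by (rule squarefree_prod_coprime) (auto intro!: primes_coprime squarefree_prime assms)

lemma sum_inverse_squarefree_ge:
  "(\<Sum>s | squarefree s \<and> s \<le> y. 1 / real s) \<ge> ln (real y + 1) / 2"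
proof -
  have "ln (real y + 1) \<le> 2 * sqf_sum (primes_upto y) y"
    by (rule harm_le_sqf_sum) (auto simp: primes_upto_def)
  also have "sqf_sum (primes_upto y) y \<le> (\<Sum>s | squarefree s \<and> s \<le> y. 1 / real s)"
    unfolding sqf_sum_def
  proof (rule sum_le_inj[where f = Prod])
    show "inj_on Prod {U. U \<subseteq> primes_upto y \<and> \<Prod>U \<le> y}"
    proof (rule inj_onI)
      fix U V assume a: "U \<in> {U. U \<subseteq> primes_upto y \<and> \<Prod>U \<le> y}" "V \<in> {U. U \<subseteq> primes_upto y \<and> \<Prod>U \<le> y}" "\<Prod>U = \<Prod>V"
      have f: "finite W" "\<And>p. p \<in> W \<Longrightarrow> prime p" if "W \<in> {U. U \<subseteq> primes_upto y \<and> \<Prod>U \<le> y}" for W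
        using that finite_subset[OF _ finite_primes_upto] prime_of_primes_upto by auto
      have "U = prime_factors (\<Prod>U)" by (rule prime_factors_prod_primes[OF f[OF a(1)], symmetric])
      also have "\<dots> = prime_factors (\<Prod>V)" by (simp only: a(3))
      also have "\<dots> = V" by (rule prime_factors_prod_primes[OF f[OF a(2)]])
      finally show "U = V" .
    qed
    show "finite {s. squarefree s \<and> s \<le> y}" by (rule finite_subset[of _ "{..y}"]) auto
    fix U assume U: "U \<in> {U. U \<subseteq> primes_upto y \<and> \<Prod>U \<le> y}"
    then have "squarefree (\<Prod>U)" using squarefree_prod_primes[of U] unfolding primes_upto_def by blast
    then show "\<Prod>U \<in> {s. squarefree s \<and> s \<le> y}" using U by simp
  qed simp_all
  finally show ?thesis by simp
qed

text \<open>If \<open>l\<close> divides both totients then \<open>k\<close> and \<open>k + totient k\<close> agree modulo \<open>l\<close> for the multiples \<open>k\<close>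
in question, which forces this condition whenever two values coincide.\<close>
definition coupled :: "nat \<Rightarrow> nat \<Rightarrow> bool" where
  "coupled s s' \<longleftrightarrow> (\<forall>l. prime l \<longrightarrow> l dvd totient s \<longrightarrow> l dvd totient s' \<longrightarrow> (l dvd s \<longleftrightarrow> l dvd s'))"

lemma prod_as_restricted:
  assumes "finite P" "A \<subseteq> P"
  shows "prod f A = (\<Prod>l\<in>P. if l \<in> A then f l else (1::real))"
  using prod.inter_restrict[OF assms(1), of f A] assms(2) by (simp add: inf_absorb2)

lemma squarefree_eq_prod:
  assumes "squarefree (s::nat)"
  shows "real s = (\<Prod>l\<in>prime_factors s. real l)"
  by (simp only: of_nat_prod[symmetric] prod_prime_factors_squarefree[OF assms])

lemma inverse_squarefree_eq_prod:
  assumes "squarefree (s::nat)"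
  shows "1 / real s = (\<Prod>l\<in>prime_factors s. 1 / real l)"
  by (subst squarefree_eq_prod[OF assms]) (simp add: prod_dividef)

lemma prod_one_plus_inverse_sq_le:
  assumes "K \<ge> 0" "P \<subseteq> {1..n}"
  shows "(\<Prod>l\<in>P. 1 + K * (1 / real l)\<^sup>2) \<le> exp (2 * K)"
proof -
  have fin: "finite P" using assms(2) by (rule finite_subset) simp
  have "(\<Prod>l\<in>P. 1 + K * (1 / real l)\<^sup>2) \<le> (\<Prod>l\<in>P. exp (K * (1 / real l)\<^sup>2))"
    using assms(1) by (intro prod_mono conjI exp_ge_add_one_self) auto
  also have "\<dots> = exp (K * (\<Sum>l\<in>P. 1 / real l ^ 2))"
    using fin by (simp add: exp_sum sum_distrib_left power_divide)
  also have "\<dots> \<le> exp (K * 2)"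
  proof -
    have "(\<Sum>l\<in>P. 1 / real l ^ 2) \<le> (\<Sum>l=1..n. 1 / real l ^ 2)" using assms(2) by (intro sum_mono2) auto
    also have "\<dots> \<le> 2" by (rule sum_inverse_squares_le)
    finally show ?thesis using assms(1) by (simp add: mult_left_mono)
  qed
  finally show ?thesis by (simp add: mult.commute)
qed

context scales
begin

text \<open>The local factors decide the power of the logarithm. At a prime dividing both totients,
  the gcd weight cancels one of the two \<open>1 / l\<close> of a common prime of \<open>s\<close>
  and \<open>s'\<close>, and with the \<open>1 / l\<close> from \<open>SS0\<close> this already
  makes \<open>1 + 2 / l\<close> to first order. Coupling excludes the primes dividing just one of
  \<open>s\<close>, \<open>s'\<close>, which would add another \<open>2 / l\<close>. At all other
  primes the choices of \<open>s\<close> and \<open>s'\<close> give \<open>1 + 2 / l\<close>. Hence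
  exactly two factors \<open>ln y\<close>.\<close>

theorem coupled_weight_sum_le:
  defines "S \<equiv> {s. squarefree s \<and> s \<le> y}"
  shows "(\<Sum>(s, s')\<in>S \<times> S. if coupled s s' then Wt s s' / (real s * real s') else 0) \<le> (10 * ln (real y))\<^sup>2 * exp 1200000"
proof -
  let ?P = "primes_upto y"
  define sh where "sh l A \<longleftrightarrow> (\<exists>q\<in>A. l dvd q - 1)" for l and A :: "nat set"
  \<comment> \<open>The flags say whether \<open>l\<close> divides \<open>s\<close> and
    \<open>s'\<close>; \<open>sh\<close> tells from the larger primes whether \<open>l\<close>
    divides the totient. The value 0 is the exclusion by coupling.\<close>
  define w where "w l A B b b' = (if b \<and> b' then (if sh l A \<and> sh l B then 1 / real l * (1 + 1 / real l) * (1 + 135 / real l)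
       else 4352 * (1 / real l) * (1 / real l) * (1 + 135 / real l))
     else if b \<or> b' then (if sh l A \<and> sh l B then 0 else 1 / real l * (1 + 135 / real l))
     else if sh l A \<and> sh l B then 1 + 1 / real l else 1)" for l A B b b'
  have w0: "w l A B b b' \<ge> 0" for l A B b b' unfolding w_def by auto
  let ?h = "\<lambda>(U, V). \<Prod>l\<in>?P. w l (U \<inter> {l<..}) (V \<inter> {l<..}) (l \<in> U) (l \<in> V)"
  have sub: "prime_factors s \<subseteq> ?P" if "s \<in> S" for s
  proof
    fix l assume "l \<in> prime_factors s"
    then have "prime l" "l dvd s" "s > 0" by (auto simp: in_prime_factors_iff)
    then show "l \<in> ?P" using dvd_imp_le[of l s] that unfolding S_def primes_upto_def by auto
  qed
  have "(\<Sum>(s, s')\<in>S \<times> S. if coupled s s' then Wt s s' / (real s * real s') else 0) \<le> (\<Sum>UV\<in>Pow ?P \<times> Pow ?P. ?h UV)"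
  proof (rule sum_le_inj[where f = "\<lambda>(s, s'). (prime_factors s, prime_factors s')"])
    show "finite (Pow ?P \<times> Pow ?P)" by simp
    have "inj_on prime_factors S"
    proof (rule inj_onI)
      fix a b assume ab: "a \<in> S" "b \<in> S" and e: "prime_factors a = prime_factors b"
      have "\<Prod>(prime_factors a) = a" "\<Prod>(prime_factors b) = b" using ab prod_prime_factors_squarefree unfolding S_def by blast+
      then show "a = b" unfolding e by (rule trans[OF sym])
    qed
    then show "inj_on (\<lambda>(s, s'). (prime_factors s, prime_factors s')) (S \<times> S)"
      unfolding inj_on_def by auto
    show "0 \<le> ?h UV" for UV unfolding case_prod_unfold by (intro prod_nonneg ballI w0)
    fix x assume "x \<in> S \<times> S"
    then obtain s s' where x: "x = (s, s')" and ss: "s \<in> S" "s' \<in> S" by auto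
    have s: "squarefree s" "squarefree s'" using ss unfolding S_def by auto
    show "(\<lambda>(s, s'). (prime_factors s, prime_factors s')) x \<in> Pow ?P \<times> Pow ?P" using sub ss x by auto
    let ?U = "prime_factors s" and ?V = "prime_factors s'"
    have "Wt s s' / (real s * real s') \<le> (\<Prod>l\<in>?P. w l (?U \<inter> {l<..}) (?V \<inter> {l<..}) (l \<in> ?U) (l \<in> ?V))" if cp: "coupled s s'"
    proof -
      define SS where "SS l \<longleftrightarrow> l dvd totient s \<and> l dvd totient s'" for l
      define G where "G = {l \<in> ?P. l \<in> ?U \<and> l \<in> ?V \<and> SS l}"
      define H where "H = {l \<in> ?P. l \<in> ?U \<and> l \<in> ?V \<and> \<not> SS l}"
      define J where "J = {l \<in> ?P. SS l}"
      note dp = D1_props[OF s]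
      have s0: "s > 0" "s' > 0" using s by (auto intro!: Nat.gr0I)
      have inU: "l \<in> ?U \<longleftrightarrow> l dvd s" "l \<in> ?V \<longleftrightarrow> l dvd s'" if "l \<in> ?P" for l
        using that s0 unfolding primes_upto_def by (auto simp: prime_factors_dvd)
      have gd: "gcs s s' dvd s" "gcs s s' dvd s'" unfolding gcs_def tgcd_def by (simp_all add: gcd_greatest dvd_trans[OF gcd_dvd1] dvd_trans[OF gcd_dvd2])
      have pg: "l dvd gcs s s' \<longleftrightarrow> l dvd s \<and> l dvd s' \<and> SS l" for l unfolding gcs_def tgcd_def SS_def by auto
      have "prime_factors (gcs s s') = G"
      proof (intro equalityI subsetI)
        fix l assume "l \<in> prime_factors (gcs s s')"
        then have l: "prime l" "l dvd gcs s s'" by (simp_all add: in_prime_factors_iff)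
        then have "l dvd s" using pg by simp
        then have "l \<in> ?P" using sub[OF ss(1)] l(1) s0 by (auto simp: prime_factors_dvd)
        then show "l \<in> G" using l pg inU unfolding G_def by simp
      next
        fix l assume "l \<in> G"
        then have "l \<in> ?P" "l dvd gcs s s'" unfolding G_def using inU pg by auto
        then show "l \<in> prime_factors (gcs s s')" using dp(5) by (simp add: prime_factors_dvd primes_upto_def)
      qed
      then have g: "real (gcs s s') = (\<Prod>l\<in>G. real l)"
        using squarefree_eq_prod[OF squarefree_mono[OF gd(1) s(1)]] by simp
      have "prime_factors (D1 s s') \<subseteq> H"
      proof
        fix l assume "l \<in> prime_factors (D1 s s')"
        then have l: "prime l" "l dvd D1 s s'" by (simp_all add: in_prime_factors_iff)
        have nd: "\<not> l dvd gcs s s'" using dp(3) l coprime_common_divisor[of "gcs s s'" "D1 s s'" l] not_prime_unit by blast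
        have "l dvd gcd s s'" unfolding dp(1) using l(2) by simp
        then have ls: "l dvd s" "l dvd s'" by simp_all
        then have "l \<in> ?P" using sub[OF ss(1)] l(1) s0 by (auto simp: prime_factors_dvd)
        then show "l \<in> H" using ls nd pg inU unfolding H_def by simp
      qed
      then have "card (prime_factors (D1 s s')) \<le> card H" unfolding H_def by (intro card_mono) auto
      then have h: "4352 ^ card (prime_factors (D1 s s')) \<le> (\<Prod>l\<in>H. 4352::real)"
        by (simp add: power_increasing)
      have j: "(\<Prod>l\<in>SS0 s s'. 1 + 1 / real l) \<le> (\<Prod>l\<in>J. 1 + 1 / real l)"
      proof (rule prod_subset_le)
        show "SS0 s s' \<subseteq> J" using prZ Z_le unfolding SS0_def J_def SS_def primes_upto_def by auto
      qed (auto simp: J_def)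
      have pu: "prime_factors (s * s') = ?U \<union> ?V" using s0 by (simp add: prime_factors_product)
      have "Wt s s' / (real s * real s') = Wt s s' * (1 / real s) * (1 / real s')" by simp
      also have "\<dots> \<le> (\<Prod>l\<in>G. real l) * (\<Prod>l\<in>J. 1 + 1 / real l) * (\<Prod>l\<in>?U \<union> ?V. 1 + 135 / real l) * (\<Prod>l\<in>H. 4352) *
          (\<Prod>l\<in>?U. 1 / real l) * (\<Prod>l\<in>?V. 1 / real l)"
        unfolding Wt_def g pu inverse_squarefree_eq_prod[OF s(1)] inverse_squarefree_eq_prod[OF s(2)]
        using h j by (intro mult_right_mono mult_mono mult_nonneg_nonneg prod_nonneg order_refl) auto
      also have "\<dots> = (\<Prod>l\<in>?P. (if l \<in> G then real l else 1) * (if l \<in> J then 1 + 1 / real l else 1) *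
          (if l \<in> ?U \<union> ?V then 1 + 135 / real l else 1) * (if l \<in> H then 4352 else 1) * (if l \<in> ?U then 1 / real l else 1) * (if l \<in> ?V then 1 / real l else 1))"
      proof -
        have *: "G \<subseteq> ?P" "J \<subseteq> ?P" "H \<subseteq> ?P" "?U \<subseteq> ?P" "?V \<subseteq> ?P" "?U \<union> ?V \<subseteq> ?P"
          using sub ss unfolding G_def J_def H_def by auto
        show ?thesis
          unfolding prod.distrib *[THEN prod_as_restricted[OF finite_primes_upto]] ..
      qed
      also have "\<dots> \<le> (\<Prod>l\<in>?P. w l (?U \<inter> {l<..}) (?V \<inter> {l<..}) (l \<in> ?U) (l \<in> ?V))"
      proof (intro prod_mono conjI)
        fix l assume l: "l \<in> ?P"
        then have pl: "prime l" unfolding primes_upto_def by simp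
        have l0: "real l > 0" using prime_gt_0_nat[OF pl] by simp
        have sh: "sh l (?U \<inter> {l<..}) \<longleftrightarrow> l dvd totient s" "sh l (?V \<inter> {l<..}) \<longleftrightarrow> l dvd totient s'"
          unfolding sh_def by (rule dvd_totient_squarefree_iff[symmetric, OF s(1) pl], rule dvd_totient_squarefree_iff[symmetric, OF s(2) pl])
        have cpl: "SS l \<Longrightarrow> l \<in> ?U \<longleftrightarrow> l \<in> ?V" using cp pl unfolding coupled_def SS_def inU[OF l] by blast
        have gjh: "l \<in> G \<longleftrightarrow> l \<in> ?U \<and> l \<in> ?V \<and> SS l" "l \<in> H \<longleftrightarrow> l \<in> ?U \<and> l \<in> ?V \<and> \<not> SS l" "l \<in> J \<longleftrightarrow> SS l"
          using l unfolding G_def H_def J_def by auto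
        have ww: "w l (?U \<inter> {l<..}) (?V \<inter> {l<..}) (l \<in> ?U) (l \<in> ?V) = (if l \<in> ?U \<and> l \<in> ?V then (if SS l then 1 / real l * (1 + 1 / real l) * (1 + 135 / real l)
       else 4352 * (1 / real l) * (1 / real l) * (1 + 135 / real l))
     else if l \<in> ?U \<or> l \<in> ?V then (if SS l then 0 else 1 / real l * (1 + 135 / real l))
     else if SS l then 1 + 1 / real l else 1)" unfolding w_def sh SS_def ..
        show "(if l \<in> G then real l else 1) * (if l \<in> J then 1 + 1 / real l else 1) *
          (if l \<in> ?U \<union> ?V then 1 + 135 / real l else 1) * (if l \<in> H then 4352 else 1) * (if l \<in> ?U then 1 / real l else 1) * (if l \<in> ?V then 1 / real l else 1)
          \<le> w l (?U \<inter> {l<..}) (?V \<inter> {l<..}) (l \<in> ?U) (l \<in> ?V)"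
          unfolding ww gjh Un_iff using l0 cpl
          by (cases "l \<in> ?U"; cases "l \<in> ?V"; cases "SS l") simp_all
      qed auto
      finally show ?thesis .
    qed
    moreover have "0 \<le> (\<Prod>l\<in>?P. w l (?U \<inter> {l<..}) (?V \<inter> {l<..}) (l \<in> ?U) (l \<in> ?V))" by (intro prod_nonneg ballI w0)
    ultimately show "(case x of (s, s') \<Rightarrow> if coupled s s' then Wt s s' / (real s * real s') else 0) \<le> ?h ((\<lambda>(s, s'). (prime_factors s, prime_factors s')) x)"
      unfolding x by simp
  qed
  also have "\<dots> = (\<Sum>U\<in>Pow ?P. \<Sum>V\<in>Pow ?P. \<Prod>l\<in>?P. w l (U \<inter> {l<..}) (V \<inter> {l<..}) (l \<in> U) (l \<in> V))"
    by (simp only: sum.cartesian_product)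
  also have "\<dots> \<le> (\<Prod>l\<in>?P. (1 + 1 / real l) * (1 + 1 / real l) * (1 + 600000 * (1 / real l)\<^sup>2))"
  proof (rule peeling_sum_le)
    fix l :: nat and A B :: "nat set" assume "l \<in> ?P"
    define t where "t = 1 / real l"
    have t: "0 \<le> t" "t \<le> 1" unfolding t_def by (auto simp: divide_le_eq)
    have e: "135 / real l = 135 * t" "1 / real l = t" unfolding t_def by simp_all
    have tt: "0 \<le> t * t" "0 \<le> t * t * t" "0 \<le> t * t * t * t" using t by simp_all
    have t3: "t * t * t \<le> t * t" using mult_left_le[OF t(2) tt(1)] by simp
    \<comment> \<open>600000 dominates \<open>270 + 4352 + 587520\<close>, the coefficients of the
      second and third powers of \<open>t\<close> in the case without common totient divisor, where
      \<open>587520 = 4352 * 135\<close>.\<close>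
    have c: "(1 + t) * (1 + t) * (1 + 600000 * t\<^sup>2) = 1 + 2 * t + t * t + 600000 * (t * t) + 1200000 * (t * t * t) + 600000 * (t * t * t * t)"
      by (simp add: algebra_simps power2_eq_square)
    show "w l A B False False + w l A B False True + w l A B True False + w l A B True True \<le> (1 + 1 / real l) * (1 + 1 / real l) * (1 + 600000 * (1 / real l)\<^sup>2)"
    proof (cases "sh l A \<and> sh l B")
      case True
      have "t * (1 + t) * (1 + 135 * t) = t + 136 * (t * t) + 135 * (t * t * t)" by (simp add: algebra_simps)
      then show ?thesis unfolding w_def e c using True tt by simp
    next
      case False
      have "4352 * t * t * (1 + 135 * t) = 4352 * (t * t) + 587520 * (t * t * t)" "t * (1 + 135 * t) = t + 135 * (t * t)" by (simp_all add: algebra_simps)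
      moreover have nss: "(sh l A \<and> sh l B) = False" using False by blast
      have "w l A B False False = 1" "w l A B False True = t * (1 + 135 * t)" "w l A B True False = t * (1 + 135 * t)"
        "w l A B True True = 4352 * t * t * (1 + 135 * t)" unfolding w_def e nss by simp_all
      ultimately show ?thesis unfolding e c using tt t3 by linarith
    qed
  qed (simp_all add: w0)
  also have "\<dots> = (\<Prod>l\<in>?P. 1 + 1 / real l) * (\<Prod>l\<in>?P. 1 + 1 / real l) * (\<Prod>l\<in>?P. 1 + 600000 * (1 / real l)\<^sup>2)"
    by (simp add: prod.distrib)
  also have "\<dots> \<le> (10 * ln (real y)) * (10 * ln (real y)) * exp (2 * 600000)"
    using prod_one_plus_inverse_primes_le[OF y] y
    by (intro mult_mono prod_one_plus_inverse_sq_le[where n = y] mult_nonneg_nonneg prod_nonneg) (auto simp: primes_upto_def Suc_le_eq prime_gt_0_nat)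
  finally show ?thesis by (simp add: power2_eq_square)
qed

text \<open>\<open>Delta\<close> gives nothing here, so the gcd is bounded crudely. One factor
  \<open>y\<close> comes from \<open>tgcd\<close>, one from the harmonic sum over \<open>q'\<close>
  in a class modulo \<open>d\<close>, and four from the mean number of divisors of the linear form
  in \<open>q\<close>.\<close>

lemma diagonal_sum_le:
  assumes r: "r \<in> R" and s: "squarefree s" "s \<le> y"
  shows "(\<Sum>q\<in>Q. \<Sum>q' | q' \<in> Q \<and> q < q'. real (gcd (plus_phi (q * (r * s))) (plus_phi (q' * (r * s)))) / (real q * real q')) \<le>
    602 * 1660 ^ 4 * C * real y ^ 6"
proof -
  define \<sigma> where "\<sigma> = r * s"
  note sp = sigma_props[OF r s, folded \<sigma>_def]
  have \<sigma>0: "\<sigma> > 0" unfolding \<sigma>_def using sp(3,4) by simp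
  have \<sigma>q: "prime q" "\<sigma> < q" "q \<le> y ^ 300" if "q \<in> Q" for q
    using prime_Q[OF that] Q[OF that] sp(2) ypow[of 31 200] by linarith+
  define B where "B q = rform \<sigma> q" for q
  note rf = rform_facts[OF \<sigma>0 \<sigma>q(1,2), folded B_def]
  define H where "H = 301 * real y"
  have lny: "ln (real y) \<le> real y" using y2 by (intro ln_le_self) simp
  have tg: "tgcd \<sigma> \<le> y"
  proof -
    have "\<not> r dvd totient \<sigma>"
    proof
      assume "r dvd totient \<sigma>"
      then have "r dvd r - 1 \<or> r dvd totient s" unfolding sp(5) using primeR[OF r] by (simp add: prime_dvd_mult_iff)
      then show False using sp(3,4) totient_le[of s] prime_gt_1_nat[OF primeR[OF r]] by (auto dest!: dvd_imp_le)
    qed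
    then have "\<not> r dvd tgcd \<sigma>" unfolding tgcd_def by simp
    then have "coprime (tgcd \<sigma>) r" using primeR[OF r] by (simp add: prime_imp_coprime coprime_commute)
    moreover have "tgcd \<sigma> dvd r * s" unfolding tgcd_def \<sigma>_def by simp
    ultimately have "tgcd \<sigma> dvd s" by (simp add: coprime_dvd_mult_right_iff)
    then show ?thesis using dvd_imp_le[OF _ sp(3)] s(2) by (meson le_trans)
  qed
  have inner: "(\<Sum>q' | q' \<in> Q \<and> q < q'. real (gcd (plus_phi (q * \<sigma>)) (plus_phi (q' * \<sigma>))) / (real q * real q')) \<le>
     2 * (real y * H) * (1 / real q * real (card {d \<in> {1..y ^ 166}. d dvd B q}))" if q: "q \<in> Q" for q
  proof -
    have B0: "B q > 0" using rf(3)[OF q q] .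
    have "(\<Sum>q' | q' \<in> Q \<and> q < q'. real (gcd (plus_phi (q * \<sigma>)) (plus_phi (q' * \<sigma>))) / (real q * real q')) \<le>
      (\<Sum>d\<in>{d. d dvd B q}. \<Sum>q' | q' \<in> Q \<and> q < q' \<and> [q = q'] (mod d). real y * real d / real q * (1 / real q'))"
    proof (rule sum_le_fibers[where \<tau> = "\<lambda>q'. gcd (B q) (B q')" and Y = "\<lambda>d. {q'. q' \<in> Q \<and> q < q' \<and> [q = q'] (mod d)}"
          and G = "\<lambda>d q'. real y * real d / real q * (1 / real q')"])
      fix q' assume "q' \<in> {q' \<in> Q. q < q'}"
      then have q': "q' \<in> Q" "q < q'" by auto
      have "gcd (plus_phi (q * \<sigma>)) (plus_phi (q' * \<sigma>)) = tgcd \<sigma> * gcd (B q) (B q')"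
        unfolding rf(1)[OF q q] rf(1)[OF q'(1) q'(1)] by (simp add: gcd_mult_distrib_nat)
      also have "\<dots> \<le> y * gcd (B q) (B q')" using tg by simp
      finally have "real (gcd (plus_phi (q * \<sigma>)) (plus_phi (q' * \<sigma>))) \<le> real y * real (gcd (B q) (B q'))"
        by (metis of_nat_le_iff of_nat_mult)
      then have "real (gcd (plus_phi (q * \<sigma>)) (plus_phi (q' * \<sigma>))) / (real q * real q') \<le> real y * real (gcd (B q) (B q')) / (real q * real q')"
        by (rule divide_right_mono) simp
      moreover have "[q = q'] (mod gcd (B q) (B q'))"
        by (rule rform_cong[OF \<sigma>0 \<sigma>q(1,2)[OF q] \<sigma>q(1,2)[OF q'(1)]]) (simp_all add: B_def)
      ultimately show "gcd (B q) (B q') \<in> {d. d dvd B q} \<and> q' \<in> {u. u \<in> Q \<and> q < u \<and> [q = u] (mod gcd (B q) (B q'))} \<and>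
          real (gcd (plus_phi (q * \<sigma>)) (plus_phi (q' * \<sigma>))) / (real q * real q') \<le> real y * real (gcd (B q) (B q')) / real q * (1 / real q')"
        using q' by simp
    qed (use fin_Q B0 in auto)
    also have "\<dots> \<le> (\<Sum>d\<in>{d. d dvd B q}. real y * H * (1 / real q))"
    proof (rule sum_mono)
      fix d assume "d \<in> {d. d dvd B q}"
      then have d0: "d > 0" using B0 by (auto intro: dvd_pos_nat)
      \<comment> \<open>All integers of the class above \<open>q\<close> may be counted, prime or
        not; the \<open>j\<close>-th of them is at least \<open>d * j\<close>.\<close>
      have "(\<Sum>q' | q' \<in> Q \<and> q < q' \<and> [q = q'] (mod d). 1 / real q') \<le> (\<Sum>j\<in>{1..y ^ 300}. 1 / real d * (1 / real j))"
      proof (rule sum_le_inj[where f = "\<lambda>q'. (q' - q) div d"])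
        have dj: "q' - q = d * ((q' - q) div d) \<and> q < q' \<and> q' \<le> y ^ 300" if "q' \<in> {q' \<in> Q. q < q' \<and> [q = q'] (mod d)}" for q'
        proof -
          have "[q' = q] (mod d)" using that by (auto simp: cong_sym_eq)
          then have "d dvd q' - q" using that by (simp add: cong_altdef_nat)
          then show ?thesis using that \<sigma>q(3) by simp
        qed
        show "inj_on (\<lambda>q'. (q' - q) div d) {q' \<in> Q. q < q' \<and> [q = q'] (mod d)}"
        proof (rule inj_onI)
          fix a b assume a: "a \<in> {q' \<in> Q. q < q' \<and> [q = q'] (mod d)}" and b: "b \<in> {q' \<in> Q. q < q' \<and> [q = q'] (mod d)}"
            and e: "(a - q) div d = (b - q) div d"
          have "a - q = d * ((a - q) div d)" by (rule conjunct1[OF dj[OF a]])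
          also have "\<dots> = d * ((b - q) div d)" by (simp only: e)
          also have "\<dots> = b - q" by (rule sym[OF conjunct1[OF dj[OF b]]])
          finally have "a - q = b - q" .
          then show "a = b" using dj[OF a] dj[OF b] by linarith
        qed
        fix q' assume q': "q' \<in> {q' \<in> Q. q < q' \<and> [q = q'] (mod d)}"
        define j where "j = (q' - q) div d"
        have j: "q' - q = d * j" using dj[OF q'] unfolding j_def by blast
        have j1: "j \<ge> 1" using j dj[OF q'] by (cases j) auto
        have "j \<le> d * j" using d0 by simp
        also have "\<dots> \<le> y ^ 300" using j dj[OF q'] by linarith
        finally show "(q' - q) div d \<in> {1..y ^ 300}" using j1 unfolding j_def[symmetric] by simp
        have "real d * real j \<le> real q'" using j by (metis diff_le_self of_nat_le_iff of_nat_mult)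
        moreover have "0 < real d * real j" using d0 j1 by simp
        ultimately have "1 / real q' \<le> 1 / (real d * real j)" by (intro divide_left_mono) auto
        then show "1 / real q' \<le> 1 / real d * (1 / real ((q' - q) div d))" unfolding j_def by simp
      qed auto
      also have "\<dots> = 1 / real d * harm (y ^ 300)" unfolding harm_def sum_distrib_left[symmetric] by (simp add: inverse_eq_divide)
      also have "\<dots> \<le> 1 / real d * H"
      proof -
        have "harm (y ^ 300) \<le> 1 + ln (real (y ^ 300))" using y2 by (intro harm_le) simp
        also have "\<dots> = 1 + 300 * ln (real y)" using y2 by (simp add: ln_realpow)
        also have "\<dots> \<le> H" unfolding H_def using lny y by linarith
        finally show ?thesis by (intro mult_left_mono) auto
      qed
      finally have "real y * real d / real q * (\<Sum>q' | q' \<in> Q \<and> q < q' \<and> [q = q'] (mod d). 1 / real q') \<le> real y * real d / real q * (1 / real d * H)"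
        by (rule mult_left_mono) simp
      then show "(\<Sum>q' | q' \<in> Q \<and> q < q' \<and> [q = q'] (mod d). real y * real d / real q * (1 / real q')) \<le> real y * H * (1 / real q)"
        using d0 by (simp add: sum_distrib_left)
    qed
    also have "\<dots> = real (card {d. d dvd B q}) * (real y * H * (1 / real q))" by simp
    also have "\<dots> \<le> (2 * real (card {d \<in> {1..y ^ 166}. d dvd B q})) * (real y * H * (1 / real q))"
    proof (rule mult_right_mono)
      \<comment> \<open>The form is at most \<open>y ^ 332\<close>, so a divisor up to its square
        root is at most \<open>y ^ 166\<close>, within the level \<open>y ^ 194\<close>.\<close>
      have "B q \<le> plus_phi (q * \<sigma>)" using rf(1)[OF q q] rf(6)[OF q q] by simp
      also have "\<dots> \<le> 2 * (q * \<sigma>)" unfolding plus_phi_def using totient_le[of "q * \<sigma>"] by linarith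
      also have "\<dots> \<le> y * (y ^ 300 * y ^ 31)" using \<sigma>q(3)[OF q] sp(2) y2 by (intro mult_le_mono) auto
      also have "\<dots> = y ^ 166 * y ^ 166" by (simp flip: power_add power_Suc)
      finally have By: "B q \<le> y ^ 166 * y ^ 166" .
      have "card {d. d dvd B q} \<le> 2 * card {d. d dvd B q \<and> d * d \<le> B q}" by (rule card_divisors_le_small[OF B0])
      also have "card {d. d dvd B q \<and> d * d \<le> B q} \<le> card {d \<in> {1..y ^ 166}. d dvd B q}"
      proof (rule card_mono)
        show "{d. d dvd B q \<and> d * d \<le> B q} \<subseteq> {d \<in> {1..y ^ 166}. d dvd B q}"
        proof
          fix d assume d: "d \<in> {d. d dvd B q \<and> d * d \<le> B q}"
          then have "d \<ge> 1" using B0 by (auto simp: Suc_le_eq intro: dvd_pos_nat)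
          moreover have "d \<le> y ^ 166"
          proof (rule ccontr)
            assume "\<not> d \<le> y ^ 166"
            then have "y ^ 166 * y ^ 166 < d * d" by (intro mult_strict_mono) auto
            then show False using d By by simp
          qed
          ultimately show "d \<in> {d \<in> {1..y ^ 166}. d dvd B q}" using d by simp
        qed
      qed simp
      finally show "real (card {d. d dvd B q}) \<le> 2 * real (card {d \<in> {1..y ^ 166}. d dvd B q})" by linarith
    qed (simp add: H_def)
    finally show ?thesis by (simp add: mult_ac)
  qed
  have "(\<Sum>q\<in>Q. 1 / real q * real (card {d \<in> {1..y ^ 166}. d dvd B q})) = (\<Sum>q\<in>Q. \<Sum>d\<in>{1..y ^ 166}. if d dvd B q then 1 / real q else 0)"
    by (intro sum.cong refl) (simp add: sum.inter_filter[symmetric])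
  also have "\<dots> = (\<Sum>d\<in>{1..y ^ 166}. \<Sum>q\<in>Q. if d dvd B q then 1 / real q else 0)" by (rule sum.swap)
  also have "\<dots> = (\<Sum>d\<in>{1..y ^ 166}. \<Sum>q | q \<in> Q \<and> d dvd B q. 1 / real q)"
    using fin_Q by (intro sum.cong refl sum.inter_filter[symmetric])
  also have "\<dots> \<le> (\<Sum>d\<in>{1..y ^ 166}. C * ((\<Prod>l\<in>prime_factors d. 2) / real d))"
  proof (rule sum_mono)
    fix d assume d: "d \<in> {1..y ^ 166}"
    have "(\<Sum>q | q \<in> Q \<and> d dvd B q. 1 / real q) \<le> C / real (totient d)"
    proof (rule avg_primesD[OF avgQ])
      show "1 \<le> d" "d \<le> y ^ 194" using d ypow[of 166 194] by auto
      show "[q = q'] (mod d)" if "q \<in> {q \<in> Q. d dvd B q}" "q' \<in> {q \<in> Q. d dvd B q}" for q q'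
        using that by (intro rform_cong[OF \<sigma>0 \<sigma>q(1,2) \<sigma>q(1,2)]) (auto simp: B_def)
    qed auto
    also have "\<dots> = C * (real d / real (totient d) / real d)" using d by simp
    also have "\<dots> \<le> C * (2 ^ card (prime_factors d) / real d)"
      using d C_nonneg by (intro mult_left_mono divide_right_mono ratio_totient_le) auto
    finally show "(\<Sum>q | q \<in> Q \<and> d dvd B q. 1 / real q) \<le> C * ((\<Prod>l\<in>prime_factors d. 2) / real d)" by simp
  qed
  also have "\<dots> = C * (\<Sum>d\<in>{1..y ^ 166}. (\<Prod>l\<in>prime_factors d. 2) / real d)" by (simp only: sum_distrib_left)
  also have "\<dots> \<le> C * (\<Prod>l\<in>primes_upto (y ^ 166). 1 + 2 * 2 / real l)"
  proof (intro mult_left_mono multiplicative_sum_le C_nonneg)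
    fix d assume d: "d \<in> {1..y ^ 166}"
    show "d > 0 \<and> prime_factors d \<subseteq> primes_upto (y ^ 166)"
    proof (intro conjI subsetI)
      show "d > 0" using d by simp
      fix l assume "l \<in> prime_factors d"
      then have l: "prime l" "l dvd d" by (simp_all add: in_prime_factors_iff)
      have "l \<le> d" using dvd_imp_le[OF l(2)] d by simp
      then show "l \<in> primes_upto (y ^ 166)" using l(1) d unfolding primes_upto_def by simp
    qed
  next
    show "prime l" if "l \<in> primes_upto (y ^ 166)" for l using that by (rule prime_of_primes_upto)
  qed simp_all
  also have "\<dots> \<le> C * (\<Prod>l\<in>primes_upto (y ^ 166). (1 + 1 / real l) ^ 4)"
  proof (intro mult_left_mono prod_mono conjI C_nonneg)
    fix l show "1 + 2 * 2 / real l \<le> (1 + 1 / real l) ^ 4"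
      using Bernoulli_inequality[of "1 / real l" 4] by (simp add: order_trans[of "-1" 0])
  qed auto
  also have "\<dots> = C * (\<Prod>l\<in>primes_upto (y ^ 166). 1 + 1 / real l) ^ 4" by (simp add: prod_power_distrib)
  also have "\<dots> \<le> C * (1660 * real y) ^ 4"
  proof (intro mult_left_mono power_mono C_nonneg prod_nonneg)
    have l: "ln (real (y ^ 166)) = 166 * ln (real y)" using y2 by (simp add: ln_realpow)
    have "(\<Prod>l\<in>primes_upto (y ^ 166). 1 + 1 / real l) \<le> 10 * ln (real (y ^ 166))"
      by (rule prod_one_plus_inverse_primes_le) (use l y in simp)
    then show "(\<Prod>l\<in>primes_upto (y ^ 166). 1 + 1 / real l) \<le> 1660 * real y" using l lny by linarith
  qed auto
  finally have F: "(\<Sum>q\<in>Q. 1 / real q * real (card {d \<in> {1..y ^ 166}. d dvd B q})) \<le> C * (1660 * real y) ^ 4" .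
  have "(\<Sum>q\<in>Q. \<Sum>q' | q' \<in> Q \<and> q < q'. real (gcd (plus_phi (q * \<sigma>)) (plus_phi (q' * \<sigma>))) / (real q * real q')) \<le>
    (\<Sum>q\<in>Q. 2 * (real y * H) * (1 / real q * real (card {d \<in> {1..y ^ 166}. d dvd B q})))" by (intro sum_mono inner)
  also have "\<dots> = 2 * (real y * H) * (\<Sum>q\<in>Q. 1 / real q * real (card {d \<in> {1..y ^ 166}. d dvd B q}))" by (simp only: sum_distrib_left)
  also have "\<dots> \<le> 2 * (real y * H) * (C * (1660 * real y) ^ 4)" using F by (rule mult_left_mono) (simp add: H_def)
  also have "\<dots> = 602 * 1660 ^ 4 * C * real y ^ 6" unfolding H_def by (simp add: power_mult_distrib eval_nat_numeral mult_ac)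
  finally show ?thesis unfolding \<sigma>_def .
qed

end

section \<open>The lower bound\<close>

lemma sum_triple_product:
  "(\<Sum>x\<in>A \<times> (B \<times> D). f x) = (\<Sum>a\<in>A. \<Sum>b\<in>B. \<Sum>d\<in>D. f (a, b, d))"
  by (simp add: sum.cartesian_product')

context scales
begin

definition "sqf = {s. squarefree s \<and> s \<le> y}"
text \<open>The upper limit ensures \<open>plus_phi (p * m) \<le> X\<close>. The lower one is at
  least \<open>plus_phi m'\<close> for every admissible \<open>m'\<close>, so that \<open>p\<close>
  cannot divide such a coefficient.\<close>

definition "Ps X m = {p. prime p \<and> y ^ 332 < p \<and> p \<le> X div (2 * m)}"
definition "Fs X m m' = {(p, p'). p \<in> Ps X m \<and> p' \<in> Ps X m' \<and> plus_phi (p * m) = plus_phi (p' * m')}"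

lemma finite_sqf: "finite sqf"
  unfolding sqf_def by (rule finite_subset[of _ "{..y}"]) auto

lemma finite_Ps: "finite (Ps X m)"
  unfolding Ps_def by (rule finite_subset[of _ "{..X div (2 * m)}"]) auto

lemma finite_Fs: "finite (Fs X m m')"
  by (rule finite_subset[of _ "Ps X m \<times> Ps X m'"]) (auto simp: Fs_def finite_Ps)

lemma m_props:
  assumes s: "s \<in> sqf" and r: "r \<in> R" and q: "q \<in> Q"
  shows "0 < q * (r * s)" "q * (r * s) \<le> y ^ 331" "totient (q * (r * s)) = (q - 1) * ((r - 1) * totient s)" "0 < r * s" "r * s < q"
proof -
  have s': "squarefree s" "s \<le> y" using s unfolding sqf_def by auto
  note p = sigma_props[OF r s']
  show rs: "0 < r * s" using p(3,4) by simp
  show lt: "r * s < q" using p(2) Q[OF q] ypow[of 31 200] by linarith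
  show "0 < q * (r * s)" using rs lt by simp
  have "q * (r * s) \<le> y ^ 300 * y ^ 31" using Q[OF q] p(2) by (intro mult_le_mono) auto
  then show "q * (r * s) \<le> y ^ 331" by (simp flip: power_add)
  have "\<not> q dvd r * s" using rs lt by (auto dest: dvd_imp_le)
  then show "totient (q * (r * s)) = (q - 1) * ((r - 1) * totient s)"
    using totient_prime_times[OF prime_Q[OF q]] p(5) by simp
qed

lemma Ps_props:
  assumes m: "0 < m" "m \<le> y ^ 331" and p: "p \<in> Ps X m"
  shows "prime p" "y ^ 332 < p" "m < p" "plus_phi m < p" "plus_phi (p * m) + totient m = p * plus_phi m" "totient (p * m) = (p - 1) * totient m"
    "plus_phi (p * m) \<le> X" "p \<le> X div (2 * m)"
proof -
  show pp: "prime p" "y ^ 332 < p" and px: "p \<le> X div (2 * m)" using p unfolding Ps_def by auto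
  show mp: "m < p" using m pp ypow[of 331 332] by linarith
  have "plus_phi m \<le> 2 * m" unfolding plus_phi_def using totient_le[of m] by linarith
  also have "\<dots> \<le> y * y ^ 331" using m y2 by (intro mult_le_mono) auto
  also have "\<dots> = y ^ 332" by (simp flip: power_Suc)
  finally show "plus_phi m < p" using pp by linarith
  show "plus_phi (p * m) + totient m = p * plus_phi m" by (rule rform_facts(5)[OF m(1) pp(1) mp])
  show "totient (p * m) = (p - 1) * totient m" using mp m by (intro totient_prime_times[OF pp(1)]) (auto dest: dvd_imp_le)
  have "p * (2 * m) \<le> X" using px m by (simp add: less_eq_div_iff_mult_less_eq)
  then show "plus_phi (p * m) \<le> X" unfolding plus_phi_def using totient_le[of "p * m"] by (simp add: algebra_simps)
qed

text \<open>Equal totients would give \<open>p * plus_phi m = p' * plus_phi m'\<close> with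
  \<open>p\<close> too large to divide \<open>plus_phi m'\<close>, hence \<open>p = p'\<close> and
  then \<open>m = m'\<close>. So the constants of the two linear forms differ, as the sieve for
  pairs demands.\<close>

lemma Fs_props:
  assumes m: "0 < m" "m \<le> y ^ 331" "0 < m'" "m' \<le> y ^ 331" "m \<noteq> m'" and F: "(p, p') \<in> Fs X m m'"
  shows "p * plus_phi m + totient m' = p' * plus_phi m' + totient m" "totient m \<noteq> totient m'" "collide m m'"
proof -
  have p: "p \<in> Ps X m" "p' \<in> Ps X m'" and e: "plus_phi (p * m) = plus_phi (p' * m')" using F unfolding Fs_def by auto
  note a = Ps_props[OF m(1,2) p(1)] and b = Ps_props[OF m(3,4) p(2)]
  show eq: "p * plus_phi m + totient m' = p' * plus_phi m' + totient m" using a(5) b(5) e by linarith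
  show "totient m \<noteq> totient m'"
  proof
    assume t: "totient m = totient m'"
    then have e2: "p * plus_phi m = p' * plus_phi m'" using eq by simp
    have nd: "\<not> p dvd plus_phi m'"
    proof
      assume "p dvd plus_phi m'"
      moreover have "plus_phi m' > 0" unfolding plus_phi_def using m by simp
      ultimately have pm: "p \<le> plus_phi m'" by (rule dvd_imp_le)
      have "plus_phi m' \<le> 2 * m'" unfolding plus_phi_def using totient_le[of m'] by linarith
      also have "\<dots> \<le> y * y ^ 331" using m y2 by (intro mult_le_mono) auto
      also have "\<dots> = y ^ 332" by (simp flip: power_Suc)
      finally show False using pm a(2) by linarith
    qed
    have "p dvd p' * plus_phi m'" using e2[symmetric] by simp
    then have "p dvd p'" using nd a(1) by (simp add: prime_dvd_mult_iff)
    then have "p = p'" using a(1) b(1) primes_dvd_imp_eq by blast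
    then have "plus_phi m = plus_phi m'" using e2 prime_gt_0_nat[OF a(1)] by simp
    then show False using t m(5) unfolding plus_phi_def by simp
  qed
  show "collide m m'"
  proof -
    have "int (totient m) - int (totient m') = int p * int (plus_phi m) - int p' * int (plus_phi m')"
    proof -
      have "int (p * plus_phi m + totient m') = int (p' * plus_phi m' + totient m)" by (simp only: eq)
      then show ?thesis by (simp only: of_nat_add of_nat_mult)
    qed
    moreover have "int (gcd (plus_phi m) (plus_phi m')) dvd int p * int (plus_phi m) - int p' * int (plus_phi m')"
      by (intro dvd_diff dvd_mult) (simp_all only: int_dvd_int_iff gcd_dvd1 gcd_dvd2)
    ultimately show ?thesis unfolding collide_def by simp
  qed
qed

text \<open>The exponent is \<open>1990 = 2 * 995\<close>: the defect is at most
  \<open>4 * y ^ 993\<close>, hence at most \<open>y ^ 995\<close>.\<close>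

lemma card_Fs_le:
  assumes m: "0 < m" "m \<le> y ^ 331" "0 < m'" "m' \<le> y ^ 331" "m \<noteq> m'" and X: "y ^ 1000 \<le> X"
  shows "real (card (Fs X m m')) \<le> 97 * exp 1990 * (real X / (ln (real y))\<^sup>2) *
    (real (gcd (plus_phi m) (plus_phi m')) / (real m * real m') * (\<Prod>l | l \<in> Z \<and> l dvd pair_defect m m'. 1 + 1 / real l))"
proof (cases "Fs X m m' = {}")
  case False
  then obtain p0 p0' where "(p0, p0') \<in> Fs X m m'" by auto
  then have cc: "totient m \<noteq> totient m'" using Fs_props[OF m] by blast
  have pl: "plus_phi k \<ge> k" "plus_phi k \<le> 2 * k" for k unfolding plus_phi_def using totient_le[of k] by linarith+
  let ?Pr = "\<Prod>l | l \<in> Z \<and> l dvd pair_defect m m'. 1 + 1 / real l"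
  have Pr0: "?Pr \<ge> 0" by (intro prod_nonneg) auto
  have 4: "4 \<le> y * y" using mult_le_mono[OF y2 y2] by simp
  have "real (card (Fs X m m')) \<le> 97 * exp (2 * real 995) * (real (X div (2 * m)) * real (gcd (plus_phi m) (plus_phi m')) / (real (plus_phi m') * (ln (real y))\<^sup>2)) *
     (\<Prod>l | l \<in> small_primes y \<and> l dvd plus_phi m * plus_phi m' * nat \<bar>int (totient m) - int (totient m')\<bar>. 1 + 1 / real l)"
  proof (rule pair_count[OF y _ _ cc])
    show "1 \<le> plus_phi m" "1 \<le> plus_phi m'" using pl(1)[of m] pl(1)[of m'] m by linarith+
    show "finite (Fs X m m')" by (rule finite_Fs)
    show "prime p \<and> prime p' \<and> y < p \<and> y < p' \<and> p \<le> X div (2 * m) \<and> p * plus_phi m + totient m' = p' * plus_phi m' + totient m"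
      if "(p, p') \<in> Fs X m m'" for p p'
    proof -
      have p: "p \<in> Ps X m" "p' \<in> Ps X m'" using that unfolding Fs_def by auto
      show ?thesis using Ps_props(1,2,8)[OF m(1,2) p(1)] Ps_props(1,2)[OF m(3,4) p(2)] Fs_props(1)[OF m that] ypow[of 1 332] by simp
    qed
    have "plus_phi m' * y ^ 8 * (2 * m) \<le> (2 * y ^ 331) * y ^ 8 * (2 * y ^ 331)"
      using pl(2)[of m'] m by (intro mult_le_mono) auto
    also have "\<dots> = 4 * y ^ 670" by (simp flip: power_add)
    also have "\<dots> \<le> y * y * y ^ 670" using 4 by (rule mult_le_mono1)
    also have "\<dots> = y ^ 672" by (simp add: power_add[symmetric] power_Suc[symmetric] mult.assoc del: power_Suc)
    also have "\<dots> \<le> X" using ypow[of 672 1000] X by linarith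
    finally show "plus_phi m' * y ^ 8 \<le> X div (2 * m)" using m by (simp add: less_eq_div_iff_mult_less_eq)
    have "nat \<bar>int (totient m) - int (totient m')\<bar> \<le> y ^ 331" using totient_le[of m] totient_le[of m'] m by linarith
    then have "plus_phi m * plus_phi m' * nat \<bar>int (totient m) - int (totient m')\<bar> \<le> (2 * y ^ 331) * (2 * y ^ 331) * y ^ 331"
      using pl(2)[of m] pl(2)[of m'] m by (intro mult_le_mono) auto
    also have "\<dots> = 4 * y ^ 993" by (simp flip: power_add)
    also have "\<dots> \<le> y * y * y ^ 993" using 4 by (rule mult_le_mono1)
    also have "\<dots> = y ^ 995" by (simp add: power_add[symmetric] power_Suc[symmetric] mult.assoc del: power_Suc)
    finally show "plus_phi m * plus_phi m' * nat \<bar>int (totient m) - int (totient m')\<bar> \<le> y ^ 995" .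
  qed
  also have "\<dots> = 97 * exp 1990 * (real (X div (2 * m)) * real (gcd (plus_phi m) (plus_phi m')) / (real (plus_phi m') * (ln (real y))\<^sup>2)) * ?Pr"
    unfolding pair_defect_def Z_def by simp
  also have "\<dots> \<le> 97 * exp 1990 * ((real X / real m) * real (gcd (plus_phi m) (plus_phi m')) / (real m' * (ln (real y))\<^sup>2)) * ?Pr"
  proof (intro mult_right_mono mult_left_mono frac_le Pr0)
    have "real (X div (2 * m)) \<le> real X / real (2 * m)" by (rule real_div_le)
    also have "\<dots> \<le> real X / real m" using m by (intro divide_left_mono) auto
    finally show "real (X div (2 * m)) \<le> real X / real m" .
    show "real m' \<le> real (plus_phi m')" using pl(1)[of m'] by simp
    show "0 < real m' * (ln (real y))\<^sup>2" using m y by simp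
  qed auto
  also have "\<dots> = 97 * exp 1990 * (real X / (ln (real y))\<^sup>2) * (real (gcd (plus_phi m) (plus_phi m')) / (real m * real m') * ?Pr)"
    by (simp add: mult_ac)
  finally show ?thesis .
qed (auto intro!: mult_nonneg_nonneg divide_nonneg_nonneg prod_nonneg)

lemma coupled_of_Fs:
  assumes s: "s \<in> sqf" "s' \<in> sqf" and r: "r \<in> R" "r' \<in> R" and q: "q \<in> Q" "q' \<in> Q"
    and F: "(p, p') \<in> Fs X (q * (r * s)) (q' * (r' * s'))"
  shows "coupled s s'"
  unfolding coupled_def
proof (intro allI impI)
  fix l assume l: "prime l" "l dvd totient s" "l dvd totient s'"
  have p: "p \<in> Ps X (q * (r * s))" "p' \<in> Ps X (q' * (r' * s'))" and e: "plus_phi (p * (q * (r * s))) = plus_phi (p' * (q' * (r' * s')))"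
    using F unfolding Fs_def by auto
  have key: "l dvd s \<longleftrightarrow> l dvd plus_phi (p * (q * (r * s)))" if s: "s \<in> sqf" and r: "r \<in> R" and q: "q \<in> Q" and p: "p \<in> Ps X (q * (r * s))" and ls: "l dvd totient s"
    for s r q p
  proof -
    note mp = m_props[OF s r q]
    note a = Ps_props[OF mp(1,2) p]
    have "0 < totient s" using mp(4) by simp
    then have "l \<le> totient s" using ls by (intro dvd_imp_le)
    then have ly: "l \<le> y" using totient_le[of s] s unfolding sqf_def by simp
    have "l \<noteq> p" "l \<noteq> q" "l \<noteq> r" using ly a(2) Q[OF q] R[OF r] ypow[of 1 332] ypow[of 1 200] ypow[of 1 20] by auto
    then have nd: "\<not> l dvd p" "\<not> l dvd q" "\<not> l dvd r" using l(1) a(1) prime_Q[OF q] primeR[OF r] primes_dvd_imp_eq by blast+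
    have "l dvd totient (p * (q * (r * s)))" unfolding a(6) mp(3) using ls by simp
    then have "l dvd plus_phi (p * (q * (r * s))) \<longleftrightarrow> l dvd p * (q * (r * s))" unfolding plus_phi_def by (rule dvd_add_left_iff)
    also have "\<dots> \<longleftrightarrow> l dvd s" using nd l(1) by (simp add: prime_dvd_mult_iff)
    finally show ?thesis by simp
  qed
  show "l dvd s \<longleftrightarrow> l dvd s'" using key[OF s(1) r(1) q(1) p(1) l(2)] key[OF s(2) r(2) q(2) p(2) l(3)] e by simp
qed

lemma sum_Q_products_neq:
  assumes s: "s \<in> sqf" "s' \<in> sqf" and r: "r \<in> R" "r' \<in> R" and q: "q \<in> Q" "q' \<in> Q" and ne: "r * s \<noteq> r' * s'"
  shows "q * (r * s) \<noteq> q' * (r' * s')"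
proof
  assume e: "q * (r * s) = q' * (r' * s')"
  then have "q dvd q' * (r' * s')" by (metis dvd_triv_left)
  then have "q dvd q' \<or> q dvd r' * s'" using prime_Q[OF q(1)] by (simp add: prime_dvd_mult_iff)
  moreover have "\<not> q dvd r' * s'"
  proof
    assume "q dvd r' * s'"
    then have "q \<le> r' * s'" using m_props(4)[OF s(2) r(2) q(2)] by (rule dvd_imp_le)
    moreover have "r' * s' < q" by (rule m_props(5)[OF s(2) r(2) q(1)])
    ultimately show False by simp
  qed
  ultimately have "q = q'" using prime_Q q primes_dvd_imp_eq by blast
  then show False using e ne prime_gt_0_nat[OF prime_Q[OF q(1)]] by simp
qed

text \<open>The \<open>(ln y)^2\<close> saved by the sieve cancels against the one in the sum over
  \<open>s\<close> and \<open>s'\<close>, which leaves a constant times \<open>X\<close>;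
  \<open>9700 = 97 * 100\<close> with 100 from \<open>(10 * ln y)^2\<close>.\<close>

lemma off_diagonal_count:
  assumes X: "y ^ 1000 \<le> X"
  defines "J \<equiv> {((s, s'), (r, r'), (q, q')) | s s' r r' q q'. s \<in> sqf \<and> s' \<in> sqf \<and> r \<in> R \<and> r' \<in> R \<and> q \<in> Q \<and> q' \<in> Q \<and> r * s \<noteq> r' * s'}"
  shows "real (card (Sigma J (\<lambda>((s, s'), (r, r'), (q, q')). Fs X (q * (r * s)) (q' * (r' * s'))))) \<le>
    9700 * exp 1990 * ((C * exp 2)\<^sup>2 * (272 * exp 3008) * (C * exp 99)\<^sup>2) * exp 1200000 * real X"
proof -
  define \<kappa> where "\<kappa> = 97 * exp 1990 * (real X / (ln (real y))\<^sup>2)"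
  define K where "K = (C * exp 2)\<^sup>2 * (272 * exp 3008) * (C * exp 99)\<^sup>2"
  \<comment> \<open>The conditions \<open>collide\<close> and \<open>coupled\<close> may be inserted
    into the majorant, because the terms that violate them have an empty \<open>Fs\<close>.\<close>
  define t where "t a a' q q' = (if collide (q * a) (q' * a') then real (gcd (plus_phi (q * a)) (plus_phi (q' * a'))) / (real q * real q') *
      (\<Prod>l | l \<in> Z \<and> l dvd pair_defect (q * a) (q' * a'). 1 + 1 / real l) else 0)" for a a' q q'
  define h where "h s s' r r' q q' = (if coupled s s' then \<kappa> * (1 / (real s * real s')) * (if r * s \<noteq> r' * s' then 1 / real r * (1 / real r') * t (r * s) (r' * s') q q' else 0) else 0)"
    for s s' r r' q q'
  have \<kappa>0: "\<kappa> \<ge> 0" unfolding \<kappa>_def by simp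
  have t0: "t a a' q q' \<ge> 0" for a a' q q' unfolding t_def by (auto intro!: mult_nonneg_nonneg divide_nonneg_nonneg prod_nonneg)
  have h0: "h s s' r r' q q' \<ge> 0" for s s' r r' q q' unfolding h_def using \<kappa>0 t0 by (auto intro!: mult_nonneg_nonneg)
  let ?B = "(sqf \<times> sqf) \<times> (R \<times> R) \<times> (Q \<times> Q)"
  have finB: "finite ?B" using finite_sqf finR fin_Q by simp
  have JB: "J \<subseteq> ?B" unfolding J_def by auto
  have finJ: "finite J" by (rule finite_subset[OF JB finB])
  have "real (card (Sigma J (\<lambda>((s, s'), (r, r'), (q, q')). Fs X (q * (r * s)) (q' * (r' * s'))))) =
     (\<Sum>((s, s'), (r, r'), (q, q'))\<in>J. real (card (Fs X (q * (r * s)) (q' * (r' * s')))))"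
    by (subst card_SigmaI) (auto simp: finJ finite_Fs case_prod_unfold)
  also have "\<dots> \<le> (\<Sum>((s, s'), (r, r'), (q, q'))\<in>J. h s s' r r' q q')"
  proof (rule sum_mono)
    fix x assume "x \<in> J"
    then obtain s s' r r' q q' where x: "x = ((s, s'), (r, r'), (q, q'))" and
      s: "s \<in> sqf" "s' \<in> sqf" and r: "r \<in> R" "r' \<in> R" and q: "q \<in> Q" "q' \<in> Q" and ne: "r * s \<noteq> r' * s'" unfolding J_def by auto
    let ?m = "q * (r * s)" and ?m' = "q' * (r' * s')"
    have "real (card (Fs X ?m ?m')) \<le> h s s' r r' q q'"
    proof (cases "Fs X ?m ?m' = {}")
      case False
      then obtain p p' where F: "(p, p') \<in> Fs X ?m ?m'" by auto
      note a = m_props(1,2)[OF s(1) r(1) q(1)] m_props(1,2)[OF s(2) r(2) q(2)] sum_Q_products_neq[OF s r q ne]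
      have "coupled s s'" by (rule coupled_of_Fs[OF s r q F])
      moreover have "collide ?m ?m'" by (rule Fs_props(3)[OF a F])
      ultimately have "h s s' r r' q q' = \<kappa> * (real (gcd (plus_phi ?m) (plus_phi ?m')) / (real ?m * real ?m') * (\<Prod>l | l \<in> Z \<and> l dvd pair_defect ?m ?m'. 1 + 1 / real l))"
        unfolding h_def t_def using ne by (simp add: mult_ac)
      then show ?thesis using card_Fs_le[OF a X] unfolding \<kappa>_def by simp
    qed (simp add: h0)
    then show "(\<lambda>((s, s'), (r, r'), (q, q')). real (card (Fs X (q * (r * s)) (q' * (r' * s'))))) x \<le> (\<lambda>((s, s'), (r, r'), (q, q')). h s s' r r' q q') x"
      unfolding x by simp
  qed
  also have "\<dots> \<le> (\<Sum>((s, s'), (r, r'), (q, q'))\<in>?B. h s s' r r' q q')"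
    by (rule sum_mono2[OF finB JB]) (auto simp: h0)
  also have "\<dots> = (\<Sum>(s, s')\<in>sqf \<times> sqf. \<Sum>(r, r')\<in>R \<times> R. \<Sum>(q, q')\<in>Q \<times> Q. h s s' r r' q q')"
    by (simp only: sum_triple_product case_prod_unfold fst_conv snd_conv)
  also have "\<dots> \<le> (\<Sum>(s, s')\<in>sqf \<times> sqf. \<kappa> * K * (if coupled s s' then Wt s s' / (real s * real s') else 0))"
  proof (rule sum_mono)
    fix x assume "x \<in> sqf \<times> sqf"
    then obtain s s' where x: "x = (s, s')" and s: "squarefree s" "s \<le> y" "squarefree s'" "s' \<le> y" unfolding sqf_def by auto
    define T where "T r r' = (\<Sum>(q, q')\<in>Q \<times> Q. t (r * s) (r' * s') q q')" for r r'
    have "(\<Sum>(r, r')\<in>R \<times> R. \<Sum>(q, q')\<in>Q \<times> Q. h s s' r r' q q') \<le> \<kappa> * K * (Wt s s' / (real s * real s'))" if c: "coupled s s'"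
    proof -
      have "(\<Sum>(q, q')\<in>Q \<times> Q. h s s' r r' q q') = \<kappa> * (1 / (real s * real s')) * (if r * s \<noteq> r' * s' then 1 / real r * (1 / real r') * T r r' else 0)" for r r'
      proof (cases "r * s \<noteq> r' * s'")
        case True
        define a where "a = \<kappa> * (1 / (real s * real s')) * (1 / real r * (1 / real r'))"
        have "h s s' r r' q q' = a * t (r * s) (r' * s') q q'" for q q' unfolding h_def a_def using c True by (simp add: mult_ac)
        then have "(\<Sum>(q, q')\<in>Q \<times> Q. h s s' r r' q q') = (\<Sum>(q, q')\<in>Q \<times> Q. a * t (r * s) (r' * s') q q')" by simp
        also have "\<dots> = a * T r r'" unfolding T_def by (simp only: sum_distrib_left case_prod_unfold)
        finally show ?thesis using True unfolding a_def by simp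
      next
        case False
        then have "h s s' r r' q q' = 0" for q q' unfolding h_def by simp
        then show ?thesis using False by simp
      qed
      then have "(\<Sum>(r, r')\<in>R \<times> R. \<Sum>(q, q')\<in>Q \<times> Q. h s s' r r' q q') =
         (\<Sum>(r, r')\<in>R \<times> R. \<kappa> * (1 / (real s * real s')) * (if r * s \<noteq> r' * s' then 1 / real r * (1 / real r') * T r r' else 0))" by simp
      also have "\<dots> = \<kappa> * (1 / (real s * real s')) * (\<Sum>(r, r')\<in>R \<times> R. if r * s \<noteq> r' * s' then 1 / real r * (1 / real r') * T r r' else 0)"
        by (simp only: sum_distrib_left case_prod_unfold)
      finally have outer: "(\<Sum>(r, r')\<in>R \<times> R. \<Sum>(q, q')\<in>Q \<times> Q. h s s' r r' q q') =
         \<kappa> * (1 / (real s * real s')) * (\<Sum>(r, r')\<in>R \<times> R. if r * s \<noteq> r' * s' then 1 / real r * (1 / real r') * T r r' else 0)" .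
      have "(\<Sum>(r, r')\<in>R \<times> R. if r * s \<noteq> r' * s' then 1 / real r * (1 / real r') * T r r' else 0) =
         (\<Sum>r\<in>R. \<Sum>r'\<in>R. if r * s \<noteq> r' * s' then 1 / real r * (1 / real r') * T r r' else 0)" by (rule sum.cartesian_product[symmetric])
      also have "\<dots> = (\<Sum>r'\<in>R. \<Sum>r\<in>R. if r * s \<noteq> r' * s' then 1 / real r * (1 / real r') * T r r' else 0)" by (rule sum.swap)
      also have "\<dots> \<le> K * Wt s s'"
        using sum_pairs_sigma_le[OF s] unfolding K_def T_def t_def sum_pairs_if[OF fin_Q fin_Q] .
      finally have inner: "(\<Sum>(r, r')\<in>R \<times> R. if r * s \<noteq> r' * s' then 1 / real r * (1 / real r') * T r r' else 0) \<le> K * Wt s s'" .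
      have "\<kappa> * (1 / (real s * real s')) * (\<Sum>(r, r')\<in>R \<times> R. if r * s \<noteq> r' * s' then 1 / real r * (1 / real r') * T r r' else 0) \<le>
         \<kappa> * (1 / (real s * real s')) * (K * Wt s s')" using inner by (rule mult_left_mono) (use \<kappa>0 in simp)
      also have "\<dots> = \<kappa> * K * (Wt s s' / (real s * real s'))" by simp
      finally show ?thesis unfolding outer .
    qed
    moreover have "(\<Sum>(r, r')\<in>R \<times> R. \<Sum>(q, q')\<in>Q \<times> Q. h s s' r r' q q') = 0" if "\<not> coupled s s'"
      unfolding h_def using that by simp
    ultimately show "(case x of (s, s') \<Rightarrow> \<Sum>(r, r')\<in>R \<times> R. \<Sum>(q, q')\<in>Q \<times> Q. h s s' r r' q q') \<le>
       (case x of (s, s') \<Rightarrow> \<kappa> * K * (if coupled s s' then Wt s s' / (real s * real s') else 0))" unfolding x by simp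
  qed
  also have "\<dots> = \<kappa> * K * (\<Sum>(s, s')\<in>sqf \<times> sqf. if coupled s s' then Wt s s' / (real s * real s') else 0)"
    by (simp only: sum_distrib_left case_prod_unfold)
  also have "\<dots> \<le> \<kappa> * K * ((10 * ln (real y))\<^sup>2 * exp 1200000)"
    using coupled_weight_sum_le \<kappa>0 unfolding sqf_def by (intro mult_left_mono mult_nonneg_nonneg) (auto simp: K_def)
  also have "\<dots> = 9700 * exp 1990 * K * exp 1200000 * real X" unfolding \<kappa>_def using y by (simp add: power_mult_distrib field_simps)
  finally show ?thesis unfolding K_def .
qed

end

context scales
begin

text \<open>\<open>m\<close> and \<open>m'\<close> share \<open>r * s\<close>, so
  \<open>1 / (m * m')\<close> contains \<open>1 / r ^ 2\<close>, and \<open>r > y ^ 20\<close>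
  outweighs the loss \<open>y ^ 6\<close>. There is even room for the full Euler product
  \<open>10 * ln y\<close> in place of the one over the defect.\<close>

lemma diagonal_count:
  assumes X: "y ^ 1000 \<le> X"
  defines "J \<equiv> sqf \<times> R \<times> Sigma Q (\<lambda>q. {q'. q' \<in> Q \<and> q < q'})"
  shows "real (card (Sigma J (\<lambda>(s, r, q, q'). Fs X (q * (r * s)) (q' * (r * s))))) \<le>
    97 * exp 1990 * 20 * (602 * 1660 ^ 4 * C) * C * real X"
proof -
  define L where "L = ln (real y)"
  define \<kappa> where "\<kappa> = 97 * exp 1990 * (real X / L\<^sup>2) * (10 * L)"
  define D where "D = 602 * 1660 ^ 4 * C"
  define G where "G s r q q' = \<kappa> * ((1 / real s ^ 2) * (1 / real r ^ 2)) *
    (real (gcd (plus_phi (q * (r * s))) (plus_phi (q' * (r * s)))) / (real q * real q'))" for s r q q'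
  have L: "L \<ge> 4" unfolding L_def by (rule y)
  have \<kappa>0: "\<kappa> \<ge> 0" unfolding \<kappa>_def using L by simp
  have D0: "D \<ge> 0" unfolding D_def using C_nonneg by simp
  have finS: "finite (Sigma Q (\<lambda>q. {q'. q' \<in> Q \<and> q < q'}))" using fin_Q by simp
  have finJ: "finite J" unfolding J_def using finite_sqf finR finS by simp
  have "real (card (Sigma J (\<lambda>(s, r, q, q'). Fs X (q * (r * s)) (q' * (r * s))))) =
    (\<Sum>(s, r, q, q')\<in>J. real (card (Fs X (q * (r * s)) (q' * (r * s)))))"
    by (subst card_SigmaI) (auto simp: finJ finite_Fs case_prod_unfold)
  also have "\<dots> \<le> (\<Sum>(s, r, q, q')\<in>J. G s r q q')"
  proof (rule sum_mono)
    fix x assume "x \<in> J"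
    then obtain s r q q' where x: "x = (s, r, q, q')" and s: "s \<in> sqf" and r: "r \<in> R" and q: "q \<in> Q" "q' \<in> Q" "q < q'" unfolding J_def by auto
    let ?m = "q * (r * s)" and ?m' = "q' * (r * s)"
    have ne: "?m \<noteq> ?m'" using m_props(4)[OF s r q(1)] q(3) by simp
    note a = m_props(1,2)[OF s r q(1)] m_props(1,2)[OF s r q(2)] ne
    have "(\<Prod>l | l \<in> Z \<and> l dvd pair_defect ?m ?m'. 1 + 1 / real l) \<le> (\<Prod>l\<in>primes_upto y. 1 + 1 / real l)"
      using prZ Z_le by (intro prod_subset_le) (auto simp: primes_upto_def)
    also have "\<dots> \<le> 10 * L" unfolding L_def by (rule prod_one_plus_inverse_primes_le[OF y])
    finally have P: "(\<Prod>l | l \<in> Z \<and> l dvd pair_defect ?m ?m'. 1 + 1 / real l) \<le> 10 * L" .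
    have "real (card (Fs X ?m ?m')) \<le> 97 * exp 1990 * (real X / L\<^sup>2) *
      (real (gcd (plus_phi ?m) (plus_phi ?m')) / (real ?m * real ?m') * (\<Prod>l | l \<in> Z \<and> l dvd pair_defect ?m ?m'. 1 + 1 / real l))"
      unfolding L_def by (rule card_Fs_le[OF a X])
    also have "\<dots> \<le> 97 * exp 1990 * (real X / L\<^sup>2) * (real (gcd (plus_phi ?m) (plus_phi ?m')) / (real ?m * real ?m') * (10 * L))"
      using P by (intro mult_left_mono) auto
    also have "\<dots> = G s r q q'" unfolding G_def \<kappa>_def by (simp add: power2_eq_square mult_ac)
    finally show "(case x of (s, r, q, q') \<Rightarrow> real (card (Fs X (q * (r * s)) (q' * (r * s))))) \<le> (case x of (s, r, q, q') \<Rightarrow> G s r q q')"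
      unfolding x by simp
  qed
  also have "\<dots> = (\<Sum>s\<in>sqf. \<Sum>r\<in>R. \<Sum>q\<in>Q. \<Sum>q' | q' \<in> Q \<and> q < q'. G s r q q')"
  proof -
    have "(\<Sum>q\<in>Q. \<Sum>q' | q' \<in> Q \<and> q < q'. G s r q q') = (\<Sum>(q, q')\<in>Sigma Q (\<lambda>q. {q'. q' \<in> Q \<and> q < q'}). G s r q q')" for s r
      using fin_Q by (intro sum.Sigma) auto
    then show ?thesis unfolding J_def by (simp add: sum.cartesian_product case_prod_unfold)
  qed
  also have "\<dots> \<le> (\<Sum>s\<in>sqf. \<Sum>r\<in>R. \<kappa> * ((1 / real s ^ 2) * (1 / real r ^ 2)) * (D * real y ^ 6))"
  proof (intro sum_mono)
    fix s r assume s: "s \<in> sqf" and r: "r \<in> R"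
    have "(\<Sum>q\<in>Q. \<Sum>q' | q' \<in> Q \<and> q < q'. G s r q q') = \<kappa> * ((1 / real s ^ 2) * (1 / real r ^ 2)) *
      (\<Sum>q\<in>Q. \<Sum>q' | q' \<in> Q \<and> q < q'. real (gcd (plus_phi (q * (r * s))) (plus_phi (q' * (r * s)))) / (real q * real q'))"
      unfolding G_def by (simp only: sum_distrib_left)
    also have "\<dots> \<le> \<kappa> * ((1 / real s ^ 2) * (1 / real r ^ 2)) * (D * real y ^ 6)"
      unfolding D_def using s \<kappa>0 by (intro mult_left_mono diagonal_sum_le r) (auto simp: sqf_def)
    finally show "(\<Sum>q\<in>Q. \<Sum>q' | q' \<in> Q \<and> q < q'. G s r q q') \<le> \<kappa> * ((1 / real s ^ 2) * (1 / real r ^ 2)) * (D * real y ^ 6)" .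
  qed
  also have "\<dots> = \<kappa> * (D * real y ^ 6) * ((\<Sum>s\<in>sqf. 1 / real s ^ 2) * (\<Sum>r\<in>R. 1 / real r ^ 2))"
  proof -
    have "(\<Sum>s\<in>sqf. \<Sum>r\<in>R. \<kappa> * ((1 / real s ^ 2) * (1 / real r ^ 2)) * (D * real y ^ 6)) =
      (\<Sum>s\<in>sqf. \<Sum>r\<in>R. \<kappa> * (D * real y ^ 6) * ((1 / real s ^ 2) * (1 / real r ^ 2)))"
      by (intro sum.cong refl) (simp only: mult_ac)
    also have "\<dots> = \<kappa> * (D * real y ^ 6) * (\<Sum>s\<in>sqf. \<Sum>r\<in>R. (1 / real s ^ 2) * (1 / real r ^ 2))" by (simp only: sum_distrib_left)
    also have "\<dots> = \<kappa> * (D * real y ^ 6) * ((\<Sum>s\<in>sqf. 1 / real s ^ 2) * (\<Sum>r\<in>R. 1 / real r ^ 2))" by (simp only: sum_product)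
    finally show ?thesis .
  qed
  also have "\<dots> \<le> \<kappa> * (D * real y ^ 6) * (2 * (C / real y ^ 20))"
  proof (intro mult_left_mono mult_mono)
    have "sqf \<subseteq> {1..y}" unfolding sqf_def by (auto simp: Suc_le_eq intro!: Nat.gr0I)
    then have "(\<Sum>s\<in>sqf. 1 / real s ^ 2) \<le> (\<Sum>s=1..y. 1 / real s ^ 2)" by (intro sum_mono2) auto
    also have "\<dots> \<le> 2" by (rule sum_inverse_squares_le)
    finally show "(\<Sum>s\<in>sqf. 1 / real s ^ 2) \<le> 2" .
    have "(\<Sum>r\<in>R. 1 / real r ^ 2) \<le> (\<Sum>r\<in>R. 1 / real y ^ 20 * (1 / real r))"
    proof (rule sum_mono)
      fix r assume r: "r \<in> R"
      have "y ^ 20 \<le> r" using R[OF r] by simp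
      then have "real (y ^ 20) \<le> real r" by (simp only: of_nat_le_iff)
      then have yr: "real y ^ 20 \<le> real r" by simp
      have "real r > 0" using prime_gt_0_nat[OF primeR[OF r]] by simp
      then have "1 / (real r * real r) \<le> 1 / (real y ^ 20 * real r)" using yr y2 by (intro divide_left_mono mult_right_mono mult_pos_pos) auto
      then show "1 / real r ^ 2 \<le> 1 / real y ^ 20 * (1 / real r)" by (simp add: power2_eq_square)
    qed
    also have "\<dots> = 1 / real y ^ 20 * (\<Sum>r\<in>R. 1 / real r)" by (simp only: sum_distrib_left)
    also have "\<dots> \<le> 1 / real y ^ 20 * C"
    proof (rule mult_left_mono)
      have "(\<Sum>r\<in>R. 1 / real r) \<le> C / real (totient 1)" by (rule avg_primesD[OF avgR]) (use y2 in auto)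
      then show "(\<Sum>r\<in>R. 1 / real r) \<le> C" by simp
    qed simp
    finally show "(\<Sum>r\<in>R. 1 / real r ^ 2) \<le> C / real y ^ 20" by simp
  qed (use \<kappa>0 D0 in \<open>auto intro!: sum_nonneg\<close>)
  also have "\<dots> = (97 * exp 1990 * 20 * D * C * real X) * (1 / L * (real y ^ 6 / real y ^ 20))"
    unfolding \<kappa>_def using L y2 by (simp add: power2_eq_square field_simps)
  also have "\<dots> \<le> (97 * exp 1990 * 20 * D * C * real X) * 1"
  proof (rule mult_left_mono)
    have "real y ^ 6 \<le> real y ^ 20" using y2 by (intro power_increasing) auto
    then have "real y ^ 6 / real y ^ 20 \<le> 1" using y2 by simp
    then have "1 / L * (real y ^ 6 / real y ^ 20) \<le> 1 * 1" using L by (intro mult_mono) auto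
    then show "1 / L * (real y ^ 6 / real y ^ 20) \<le> 1" by simp
  qed (use D0 C_nonneg in simp)
  finally show ?thesis unfolding D_def by simp
qed

text \<open>Half of the primes guaranteed up to \<open>X div (2 * m)\<close> pay for those up to
  \<open>y ^ 332\<close>. The constant is \<open>16384000 = 1024 * 2000 * 2 * 2 * 2\<close>: the
  bound for the number of primes, \<open>ln X \<le> 2000 * ln y\<close>, rounding, the 2 in
  \<open>2 * m\<close>, and that half.\<close>

lemma card_Ps_ge:
  assumes m: "0 < m" "m \<le> y ^ 331" and X: "y ^ 1000 \<le> X" "ln (real X) \<le> 2000 * ln (real y)" and big: "16384000 \<le> y"
  shows "real (card (Ps X m)) \<ge> real X / (16384000 * ln (real y)) * (1 / real m)"
proof -
  define L where "L = ln (real y)"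
  define n where "n = X div (2 * m)"
  define z where "z = real X / real (2 * m)"
  have L: "L \<ge> 4" unfolding L_def by (rule y)
  have Ly: "L \<le> real y" unfolding L_def using y2 by (intro ln_le_self) simp
  have m0: "real m > 0" using m by simp
  have "1024 * (2 * m) \<le> y * y ^ 331" using m big by (simp add: mult.assoc[symmetric] mult_le_mono)
  also have "\<dots> \<le> X" using ypow[of 332 1000] X(1) by (simp flip: power_Suc)
  finally have mX: "1024 * (2 * m) \<le> X" .
  then have n: "n \<ge> 1024" unfolding n_def using m by (simp add: less_eq_div_iff_mult_less_eq)
  have z: "z \<ge> 1024" 
  proof -
    have "real (1024 * (2 * m)) \<le> real X" using mX by (simp only: of_nat_le_iff)
    then show ?thesis unfolding z_def using m0 by (simp add: pos_le_divide_eq)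
  qed
  have nz: "real n \<ge> z / 2" using real_div_minus_one_le[of "2 * m" X] m z unfolding n_def z_def by simp
  have nX: "n \<le> X" unfolding n_def by simp
  have ln_n: "0 < ln (real n)" "ln (real n) \<le> 2000 * L"
  proof -
    show "0 < ln (real n)" using n by simp
    have "ln (real n) \<le> ln (real X)" using n nX by simp
    then show "ln (real n) \<le> 2000 * L" using X(2) unfolding L_def by linarith
  qed
  have "z / 2 / (1024 * (2000 * L)) \<le> real n / (1024 * ln (real n))"
    using nz z ln_n by (intro frac_le) auto
  also have "\<dots> \<le> real (card (primes_upto n))" by (rule card_primes_ge[OF n])
  also have "\<dots> \<le> real (card (Ps X m) + y ^ 332)"
  proof -
    have "card (primes_upto n) \<le> card (Ps X m \<union> {1..y ^ 332})"
      using finite_Ps by (intro card_mono) (auto simp: primes_upto_def Ps_def n_def Suc_le_eq prime_gt_0_nat)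
    also have "\<dots> \<le> card (Ps X m) + y ^ 332" using card_Un_le[of "Ps X m" "{1..y ^ 332}"] by simp
    finally show ?thesis by (simp only: of_nat_le_iff)
  qed
  finally have lower: "z / (4096000 * L) \<le> real (card (Ps X m)) + real y ^ 332" by simp
  have "16384000 * real m * L * real y ^ 332 \<le> real y * real y ^ 331 * real y * real y ^ 332"
  proof -
    have "real m \<le> real (y ^ 331)" using m(2) by (simp only: of_nat_le_iff)
    then have "real m \<le> real y ^ 331" by simp
    moreover have "16384000 \<le> real y" using big by linarith
    ultimately show ?thesis using Ly L by (intro mult_mono mult_nonneg_nonneg) auto
  qed
  also have "\<dots> = real y ^ (1 + 331 + 1 + 332)" by (simp only: power_add power_one_right)
  also have "\<dots> = real (y ^ 665)" by simp
  also have "\<dots> \<le> real X"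
  proof -
    have "y ^ 665 \<le> y ^ 1000" by (rule ypow) simp
    then have "y ^ 665 \<le> X" using X(1) by (rule order_trans)
    then show ?thesis by (simp only: of_nat_le_iff)
  qed
  finally have "real y ^ 332 \<le> real X / (16384000 * real m * L)" using m0 L by (simp add: pos_le_divide_eq mult_ac)
  moreover have "z / (4096000 * L) = 2 * (real X / (16384000 * real m * L))" unfolding z_def using m0 L by (simp add: field_simps)
  moreover have "real X / (16384000 * real m * L) = real X / (16384000 * L) * (1 / real m)" by simp
  ultimately show ?thesis using lower unfolding L_def by linarith
qed

text \<open>The \<open>ln y\<close> of the sum over \<open>s\<close> cancels the one lost to the
  primes \<open>p\<close>. The constant is \<open>524288000 = 16384000 * 32\<close>, with 2 from the
  sum over \<open>s\<close> and 4 from each of \<open>r\<close> and \<open>q\<close>.\<close>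

lemma tuple_count:
  assumes X: "y ^ 1000 \<le> X" "ln (real X) \<le> 2000 * ln (real y)" and big: "16384000 \<le> y"
    and sums: "(\<Sum>r\<in>R. 1 / real r) \<ge> 1 / 4" "(\<Sum>q\<in>Q. 1 / real q) \<ge> 1 / 4"
  shows "real (card (Sigma (sqf \<times> R \<times> Q) (\<lambda>(s, r, q). Ps X (q * (r * s))))) \<ge> real X / 524288000"
proof -
  define L where "L = ln (real y)"
  have L: "L \<ge> 4" unfolding L_def by (rule y)
  define c where "c = real X / (16384000 * L)"
  have c0: "c \<ge> 0" unfolding c_def using L by simp
  have "(\<Sum>s\<in>sqf. 1 / real s) \<ge> L / 2"
  proof -
    have "L \<le> ln (real y + 1)" unfolding L_def using y2 by simp
    then show ?thesis using sum_inverse_squarefree_ge[of y] unfolding sqf_def by linarith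
  qed
  then have "L / 2 * (1 / 4 * (1 / 4)) \<le> (\<Sum>s\<in>sqf. 1 / real s) * ((\<Sum>r\<in>R. 1 / real r) * (\<Sum>q\<in>Q. 1 / real q))"
    using sums L by (intro mult_mono mult_nonneg_nonneg sum_nonneg) auto
  then have "c * (L / 2 * (1 / 4 * (1 / 4))) \<le> c * ((\<Sum>s\<in>sqf. 1 / real s) * ((\<Sum>r\<in>R. 1 / real r) * (\<Sum>q\<in>Q. 1 / real q)))"
    using c0 by (rule mult_left_mono)
  also have "\<dots> = (\<Sum>s\<in>sqf. \<Sum>r\<in>R. \<Sum>q\<in>Q. c * (1 / real s * (1 / real r * (1 / real q))))"
    by (simp only: sum_product) (simp only: sum_distrib_left)
  also have "\<dots> = (\<Sum>(s, r, q)\<in>sqf \<times> R \<times> Q. c * (1 / real s * (1 / real r * (1 / real q))))"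
    by (simp add: sum.cartesian_product case_prod_unfold)
  also have "\<dots> \<le> (\<Sum>(s, r, q)\<in>sqf \<times> R \<times> Q. real (card (Ps X (q * (r * s)))))"
  proof (rule sum_mono)
    fix x assume "x \<in> sqf \<times> R \<times> Q"
    then obtain s r q where x: "x = (s, r, q)" and s: "s \<in> sqf" "r \<in> R" "q \<in> Q" by auto
    have "c * (1 / real s * (1 / real r * (1 / real q))) \<le> real (card (Ps X (q * (r * s))))"
      using card_Ps_ge[OF m_props(1,2)[OF s] X big] unfolding c_def L_def by (simp add: mult_ac)
    then show "(case x of (s, r, q) \<Rightarrow> c * (1 / real s * (1 / real r * (1 / real q)))) \<le> (case x of (s, r, q) \<Rightarrow> real (card (Ps X (q * (r * s)))))"
      unfolding x by simp
  qed
  also have "\<dots> = real (card (Sigma (sqf \<times> R \<times> Q) (\<lambda>(s, r, q). Ps X (q * (r * s)))))"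
    by (subst card_SigmaI) (auto simp: finite_sqf finR fin_Q finite_Ps case_prod_unfold)
  finally show ?thesis unfolding c_def using L by simp
qed

text \<open>With \<open>N\<close> tuples, Cauchy--Schwarz gives
  \<open>N^2 \<le> im * (N + B * X)\<close>. As no upper bound for \<open>N\<close> is at hand,
  \<open>X \<le> N / \<delta>\<close> is inserted first, one factor \<open>N\<close> is cancelled,
  and only then the lower bound for \<open>N\<close> is used.\<close>

theorem image_lower_bound:
  assumes X: "y ^ 1000 \<le> X" "ln (real X) \<le> 2000 * ln (real y)" and big: "16384000 \<le> y"
    and sums: "(\<Sum>r\<in>R. 1 / real r) \<ge> 1 / 4" "(\<Sum>q\<in>Q. 1 / real q) \<ge> 1 / 4"
    and \<delta>: "\<delta> = 1 / 524288000"
    and B: "B = 9700 * exp 1990 * ((C * exp 2)\<^sup>2 * (272 * exp 3008) * (C * exp 99)\<^sup>2) * exp 1200000 + 2 * (97 * exp 1990 * 20 * (602 * 1660 ^ 4 * C) * C)"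
  shows "real (card {n. n \<le> X \<and> (\<exists>k>0. n = k + totient k)}) \<ge> \<delta>\<^sup>2 / (\<delta> + B) * real X"
proof -
  define T where "T = Sigma (sqf \<times> R \<times> Q) (\<lambda>(s, r, q). Ps X (q * (r * s)))"
  define f where "f = (\<lambda>((s, r, q), p). plus_phi (p * (q * (r * s))))"
  define J1 where "J1 = {((s, s'), (r, r'), (q, q')) | s s' r r' q q'. s \<in> sqf \<and> s' \<in> sqf \<and> r \<in> R \<and> r' \<in> R \<and> q \<in> Q \<and> q' \<in> Q \<and> r * s \<noteq> r' * s'}"
  define A1 where "A1 = Sigma J1 (\<lambda>((s, s'), (r, r'), (q, q')). Fs X (q * (r * s)) (q' * (r' * s')))"
  define J2 where "J2 = sqf \<times> R \<times> Sigma Q (\<lambda>q. {q'. q' \<in> Q \<and> q < q'})"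
  define A2 where "A2 = Sigma J2 (\<lambda>(s, r, q, q'). Fs X (q * (r * s)) (q' * (r * s)))"
  define \<phi>1 where "\<phi>1 = (\<lambda>(((s, s'), (r, r'), (q, q')), (p, p')). (((s::nat, r::nat, q::nat), p::nat), ((s'::nat, r'::nat, q'::nat), p'::nat)))"
  define \<phi>2 where "\<phi>2 = (\<lambda>((s, r, q, q'), (p, p')). (((s::nat, r::nat, q::nat), p::nat), ((s, r, q'::nat), p'::nat)))"
  define \<phi>3 where "\<phi>3 = (\<lambda>((s, r, q, q'), (p, p')). (((s::nat, r::nat, q'::nat), p'::nat), ((s, r, q::nat), p::nat)))"
  have finT: "finite T" unfolding T_def using finite_sqf finR fin_Q finite_Ps by (intro finite_SigmaI) auto
  have finJ1: "finite J1" by (rule finite_subset[of _ "(sqf \<times> sqf) \<times> (R \<times> R) \<times> (Q \<times> Q)"]) (auto simp: J1_def finite_sqf finR fin_Q)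
  have finA1: "finite A1" unfolding A1_def using finJ1 finite_Fs by (intro finite_SigmaI) auto
  have "finite J2" unfolding J2_def using finite_sqf finR fin_Q by simp
  then have finA2: "finite A2" unfolding A2_def using finite_Fs by (intro finite_SigmaI) auto
  let ?coll = "{(t, t'). t \<in> T \<and> t' \<in> T \<and> f t = f t'}"
  \<comment> \<open>By unique factorisation \<open>r * s = r' * s'\<close> gives equal
    \<open>r\<close> and equal \<open>s\<close>. If \<open>q = q'\<close> too, the linear value
    determines \<open>p\<close>, so only identical tuples remain; \<open>\<phi>2\<close> and
    \<open>\<phi>3\<close> cover the two orders of \<open>q\<close> and \<open>q'\<close>.\<close>
  have "?coll \<subseteq> ((\<lambda>t. (t, t)) ` T \<union> \<phi>1 ` A1) \<union> (\<phi>2 ` A2 \<union> \<phi>3 ` A2)"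
  proof
    fix x assume x: "x \<in> ?coll"
    obtain s r q p s' r' q' p' where xe: "x = (((s, r, q), p), ((s', r', q'), p'))" by (metis surj_pair)
    have s: "s \<in> sqf" "s' \<in> sqf" and r: "r \<in> R" "r' \<in> R" and q: "q \<in> Q" "q' \<in> Q"
      and p: "p \<in> Ps X (q * (r * s))" "p' \<in> Ps X (q' * (r' * s'))" and e: "plus_phi (p * (q * (r * s))) = plus_phi (p' * (q' * (r' * s')))"
      using x unfolding xe T_def f_def by auto
    have F: "(p, p') \<in> Fs X (q * (r * s)) (q' * (r' * s'))" "(p', p) \<in> Fs X (q' * (r' * s')) (q * (r * s))" using p e unfolding Fs_def by auto
    show "x \<in> ((\<lambda>t. (t, t)) ` T \<union> \<phi>1 ` A1) \<union> (\<phi>2 ` A2 \<union> \<phi>3 ` A2)"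
    proof (cases "r * s = r' * s'")
      case False
      then have "(((s, s'), (r, r'), (q, q')), (p, p')) \<in> A1" unfolding A1_def J1_def using s r q F(1) by auto
      then have "\<phi>1 (((s, s'), (r, r'), (q, q')), (p, p')) \<in> \<phi>1 ` A1" by (rule imageI)
      then show ?thesis unfolding xe \<phi>1_def by simp
    next
      case eq: True
      have sy: "s \<le> y" "s' \<le> y" "squarefree s" "squarefree s'" using s unfolding sqf_def by auto
      have "r dvd r' * s'" unfolding eq[symmetric] by simp
      moreover have "\<not> r dvd s'" using sigma_props(6)[OF r(1) sy(4,2)] .
      ultimately have "r dvd r'" using primeR[OF r(1)] by (simp add: prime_dvd_mult_iff)
      then have rr: "r' = r" using primeR r primes_dvd_imp_eq by blast
      have ss: "s' = s" using eq prime_gt_0_nat[OF primeR[OF r(1)]] unfolding rr by simp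
      consider "q = q'" | "q < q'" | "q' < q" by linarith
      then show ?thesis
      proof cases
        case 1
        note mp = m_props(1,2)[OF s(1) r(1) q(1)]
        have p2: "p' \<in> Ps X (q * (r * s))" using p(2) unfolding rr ss 1[symmetric] .
        have "p * plus_phi (q * (r * s)) = p' * plus_phi (q * (r * s))"
          using Ps_props(5)[OF mp p(1)] Ps_props(5)[OF mp p2] e unfolding rr ss 1[symmetric] by linarith
        moreover have "plus_phi (q * (r * s)) > 0" unfolding plus_phi_def using mp(1) by simp
        ultimately have "p = p'" by simp
        then have "x = (((s, r, q), p), ((s, r, q), p))" unfolding xe rr ss 1 by simp
        moreover have "((s, r, q), p) \<in> T" unfolding T_def using s r q p by auto
        ultimately show ?thesis by blast
      next
        case 2
        then have "((s, r, q, q'), (p, p')) \<in> A2" unfolding A2_def J2_def using s r q F(1) unfolding rr ss by auto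
        then have "\<phi>2 ((s, r, q, q'), (p, p')) \<in> \<phi>2 ` A2" by (rule imageI)
        then show ?thesis unfolding xe \<phi>2_def rr ss by simp
      next
        case 3
        then have "((s, r, q', q), (p', p)) \<in> A2" unfolding A2_def J2_def using s r q F(2) unfolding rr ss by auto
        then have "\<phi>3 ((s, r, q', q), (p', p)) \<in> \<phi>3 ` A2" by (rule imageI)
        then show ?thesis unfolding xe \<phi>3_def rr ss by simp
      qed
    qed
  qed
  then have "card ?coll \<le> card (((\<lambda>t. (t, t)) ` T \<union> \<phi>1 ` A1) \<union> (\<phi>2 ` A2 \<union> \<phi>3 ` A2))"
    using finT finA1 finA2 by (intro card_mono) auto
  also have "\<dots> \<le> (card T + card A1) + (card A2 + card A2)"
    using finT finA1 finA2 by (intro order_trans[OF card_Un_le] add_mono card_image_le) auto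
  finally have "real (card ?coll) \<le> real ((card T + card A1) + (card A2 + card A2))" by (simp only: of_nat_le_iff)
  also have "\<dots> \<le> real (card T) + B * real X"
    using off_diagonal_count[OF X(1)] diagonal_count[OF X(1)] unfolding A1_def J1_def A2_def J2_def B distrib_right by simp
  finally have coll: "real (card ?coll) \<le> real (card T) + B * real X" .
  define N where "N = real (card T)"
  define im where "im = real (card (f ` T))"
  have N: "\<delta> * real X \<le> N" using tuple_count[OF X big sums] unfolding N_def T_def \<delta> by simp
  have \<delta>0: "\<delta> > 0" unfolding \<delta> by simp
  have B0: "B \<ge> 0" unfolding B using C_nonneg by (simp del: exp_le_cancel_iff)
  have "real X > 0"
  proof -
    have "0 < y ^ 1000" using y2 by simp
    then have "0 < X" using X(1) by linarith
    then show ?thesis by simp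
  qed
  then have N0: "N > 0" using N \<delta>0 mult_pos_pos[of \<delta> "real X"] by linarith
  have im0: "im \<ge> 0" unfolding im_def by simp
  have "N * N \<le> im * (N + B * real X)"
  proof -
    have "N\<^sup>2 \<le> im * real (card ?coll)" unfolding N_def im_def by (rule card_sq_le_image_pairs[OF finT])
    also have "\<dots> \<le> im * (N + B * real X)" using coll im0 unfolding N_def by (intro mult_left_mono)
    finally show ?thesis by (simp add: power2_eq_square)
  qed
  also have "\<dots> \<le> im * (N + B * (N / \<delta>))"
    using N \<delta>0 B0 im0 by (intro mult_left_mono add_left_mono) (auto simp: pos_le_divide_eq mult.commute)
  also have "\<dots> = im * (1 + B / \<delta>) * N" by (simp add: algebra_simps)
  finally have "N \<le> im * (1 + B / \<delta>)" using N0 by simp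
  then have "\<delta> * real X \<le> im * (1 + B / \<delta>)" using N by linarith
  then have "\<delta>\<^sup>2 / (\<delta> + B) * real X \<le> im"
    using \<delta>0 B0 by (simp add: field_simps power2_eq_square)
  also have "im \<le> real (card {n. n \<le> X \<and> (\<exists>k>0. n = k + totient k)})"
  proof -
    have "f ` T \<subseteq> {n. n \<le> X \<and> (\<exists>k>0. n = k + totient k)}"
    proof
      fix n assume "n \<in> f ` T"
      then obtain s r q p where s: "s \<in> sqf" "r \<in> R" "q \<in> Q" and p: "p \<in> Ps X (q * (r * s))" and n: "n = plus_phi (p * (q * (r * s)))"
        unfolding f_def T_def by auto
      note a = Ps_props[OF m_props(1,2)[OF s] p]
      have "0 < p * (q * (r * s))" using prime_gt_0_nat[OF a(1)] m_props(1)[OF s] by simp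
      then show "n \<in> {n. n \<le> X \<and> (\<exists>k>0. n = k + totient k)}" using a(7) unfolding n plus_phi_def by blast
    qed
    then have "card (f ` T) \<le> card {n. n \<le> X \<and> (\<exists>k>0. n = k + totient k)}"
      by (intro card_mono) (auto intro: finite_subset[of _ "{..X}"])
    then show ?thesis unfolding im_def by simp
  qed
  finally show ?thesis .
qed

end

lemma avg_primes_mono:
  assumes "avg_primes Q M C" "C \<le> C'"
  shows "avg_primes Q M C'"
  unfolding avg_primes_def
proof (intro conjI allI impI)
  show "finite Q" "\<forall>q\<in>Q. prime q" using assms(1) unfolding avg_primes_def by blast+
  fix D S assume D: "1 \<le> D" "D \<le> M" "S \<subseteq> Q" "\<forall>q\<in>S. \<forall>q'\<in>S. [q = q'] (mod D)"
  have "(\<Sum>q\<in>S. 1 / real q) \<le> C / real (totient D)" by (rule avg_primesD[OF assms(1) D(1-3)]) (use D(4) in blast)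
  also have "\<dots> \<le> C' / real (totient D)" using assms(2) by (rule divide_right_mono) simp
  finally show "(\<Sum>q\<in>S. 1 / real q) \<le> C' / real (totient D)" .
qed

lemma sum_inverse_primes_powers_ge:
  assumes y: "ln (real y) \<ge> 4" and ab: "real b - real a \<ge> real b / 3" "a \<ge> 1" "b \<ge> 15" "a \<le> b"
  shows "(\<Sum>p | prime p \<and> y ^ a < p \<and> p \<le> y ^ b. 1 / real p) \<ge> 1 / 4"
proof -
  define L where "L = ln (real y)"
  have L: "L \<ge> 4" using y unfolding L_def .
  have y2: "y \<ge> 2" using y by (cases "y \<le> 1") (auto simp: le_Suc_eq)
  have l: "ln (real (y ^ k)) = real k * L" for k unfolding L_def using y2 by (simp add: ln_realpow)
  have "(\<Sum>p | prime p \<and> y ^ a < p \<and> p \<le> y ^ b. 1 / real p) \<ge> (ln (real (y ^ b)) - ln (real (y ^ a)) - 5) / ln (real (y ^ b))"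
  proof (rule sum_inverse_primes_interval_ge)
    show "1 \<le> y ^ a" using y2 by simp
    show "y ^ a \<le> y ^ b" using ab(4) y2 by (intro power_increasing) auto
    have "y ^ 1 \<le> y ^ b" using ab(3) y2 by (intro power_increasing) auto
    then show "2 \<le> y ^ b" using y2 by simp
  qed
  moreover have "1 / 4 \<le> (real b * L - real a * L - 5) / (real b * L)"
  proof -
    have b: "real b \<ge> 15" using ab(3) by simp
    have "real b * L / 3 \<le> real b * L - real a * L" using mult_right_mono[OF ab(1), of L] L by (simp add: left_diff_distrib)
    moreover have "60 \<le> real b * L" using mult_mono[OF b L] b by simp
    ultimately have "real b * L / 4 \<le> real b * L - real a * L - 5" by linarith
    moreover have "real b * L > 0" using b L by simp
    ultimately show ?thesis by (simp add: pos_le_divide_eq)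
  qed
  ultimately show ?thesis unfolding l by linarith
qed

lemma power_sandwich:
  fixes X k :: nat
  assumes "k \<ge> 1"
  shows "\<exists>y. y ^ k \<le> X \<and> X < (Suc y) ^ k"
proof -
  let ?S = "{y. y ^ k \<le> X}"
  have sub: "?S \<subseteq> {..X}"
  proof
    fix y assume "y \<in> ?S"
    moreover have "y \<le> y ^ k" using assms by (cases "y = 0") (auto intro: self_le_power)
    ultimately show "y \<in> {..X}" by auto
  qed
  have fin: "finite ?S" by (rule finite_subset[OF sub]) simp
  have "0 \<in> ?S" using assms by (simp add: power_0_left)
  then have M: "Max ?S \<in> ?S" using fin by (intro Max_in) auto
  have "Suc (Max ?S) \<notin> ?S"
  proof
    assume "Suc (Max ?S) \<in> ?S"
    then have "Suc (Max ?S) \<le> Max ?S" using fin by (intro Max_ge)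
    then show False by simp
  qed
  then show ?thesis using M by (intro exI[of _ "Max ?S"]) auto
qed

theorem N_plus_lower:
  "\<exists>c::real. c > 0 \<and> (\<exists>x0::real. \<forall>x\<ge>x0. real (N_plus x) \<ge> c * x)"
proof -
  \<comment> \<open>\<open>606 = 6 * 100 + 6\<close> belongs to the interval of \<open>q\<close>,
    whose exponents span 100; it also covers the 66 that the interval of \<open>r\<close>
    gives.\<close>
  define C :: real where "C = 606"
  obtain \<delta> B :: real where \<delta>: "\<delta> = 1 / 524288000"
    and B: "B = 9700 * exp 1990 * ((C * exp 2)\<^sup>2 * (272 * exp 3008) * (C * exp 99)\<^sup>2) * exp 1200000 + 2 * (97 * exp 1990 * 20 * (602 * 1660 ^ 4 * C) * C)"
    by blast
  have \<delta>0: "\<delta> > 0" unfolding \<delta> by simp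
  have B0: "B \<ge> 0" unfolding B C_def by (intro add_nonneg_nonneg mult_nonneg_nonneg) auto
  define c where "c = \<delta>\<^sup>2 / (\<delta> + B)"
  have c0: "c > 0" unfolding c_def using \<delta>0 B0 by (simp add: add_pos_nonneg)
  define Y0 :: nat where "Y0 = 16384000"
  have main: "real (card {n. n \<le> X \<and> (\<exists>k>0. n = k + totient k)}) \<ge> c * real X" if XY: "Y0 ^ 1000 \<le> X" for X
  proof -
    \<comment> \<open>\<open>y\<close> is the integer part of the 1000th root of \<open>X\<close>.
      Since \<open>Suc y \<le> y ^ 2\<close>, the upper limit yields
      \<open>ln X \<le> 2000 * ln y\<close>.\<close>
    obtain y where yX: "y ^ 1000 \<le> X" "X < (Suc y) ^ 1000" using power_sandwich[of 1000 X] by auto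
    have yY: "Y0 \<le> y"
    proof (rule ccontr)
      assume "\<not> Y0 \<le> y"
      then have "(Suc y) ^ 1000 \<le> Y0 ^ 1000" by (intro power_mono) auto
      then show False using XY yX(2) by linarith
    qed
    then have big: "16384000 \<le> y" unfolding Y0_def .
    have y1: "real y \<ge> 81" using big by linarith
    have "exp 4 \<le> (81::real)"
    proof -
      have "exp (4::real) = exp 1 ^ 4" by (simp flip: exp_of_nat_mult)
      also have "\<dots> \<le> 3 ^ 4" by (intro power_mono exp_le) simp
      finally show ?thesis by simp
    qed
    then have ly: "ln (real y) \<ge> 4" using y1 by (subst ln_ge_iff) auto
    have "Suc y \<le> y ^ 2"
    proof -
      have "2 * y \<le> y * y" using big by (intro mult_le_mono1) simp
      then show ?thesis using big unfolding power2_eq_square by linarith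
    qed
    then have "(Suc y) ^ 1000 \<le> (y ^ 2) ^ 1000" by (rule power_mono) simp
    also have "\<dots> = y ^ 2000" by (simp add: power_mult[symmetric])
    finally have "X \<le> y ^ 2000" using yX(2) by linarith
    moreover have X0: "X > 0" using yX(1) big by (metis gr0I le_zero_eq power_eq_0_iff not_numeral_le_zero)
    ultimately have "ln (real X) \<le> ln (real (y ^ 2000))" by (subst ln_le_cancel_iff) (use big in auto)
    also have "\<dots> = 2000 * ln (real y)" using y1 by (simp add: ln_realpow)
    finally have lnX: "ln (real X) \<le> 2000 * ln (real y)" .
    define R where "R = {r. prime r \<and> y ^ 20 < r \<and> r \<le> y ^ 30}"
    define Q where "Q = {q. prime q \<and> y ^ 200 < q \<and> q \<le> y ^ 300}"
    interpret scales y R Q C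
    proof
      show "avg_primes R (y ^ 14) C"
        using avg_primes_mono[OF avg_primes_powers[OF ly, of 20 10]] unfolding R_def C_def by simp
      show "avg_primes Q (y ^ 194) C"
        using avg_primes_powers[OF ly, of 200 100] unfolding Q_def C_def by simp
    qed (use ly in \<open>auto simp: R_def Q_def\<close>)
    have "(\<Sum>r\<in>R. 1 / real r) \<ge> 1 / 4" "(\<Sum>q\<in>Q. 1 / real q) \<ge> 1 / 4"
      unfolding R_def Q_def using ly by (intro sum_inverse_primes_powers_ge; simp)+
    from image_lower_bound[OF yX(1) lnX big this \<delta> B] show ?thesis unfolding c_def .
  qed
  \<comment> \<open>The summand 2 ensures that rounding \<open>x\<close> down loses at most half,
    hence the constant \<open>c / 2\<close>.\<close>
  define x0 where "x0 = real (Y0 ^ 1000) + 2"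
  have "real (N_plus x) \<ge> c / 2 * x" if x: "x \<ge> x0" for x
  proof -
    define X where "X = nat \<lfloor>x\<rfloor>"
    have x2: "x \<ge> 2" "real (Y0 ^ 1000) \<le> x" using x unfolding x0_def by (smt (verit) of_nat_0_le_iff)+
    have "Y0 ^ 1000 \<le> X" unfolding X_def using x2(2) by (rule le_nat_floor)
    then have m: "c * real X \<le> real (card {n. n \<le> X \<and> (\<exists>k>0. n = k + totient k)})" by (rule main)
    have "{n::nat. real n \<le> x \<and> (\<exists>k::nat. 0 < k \<and> n = k + totient k)} = {n. n \<le> X \<and> (\<exists>k>0. n = k + totient k)}"
      unfolding X_def using x2 by (auto simp: le_nat_iff le_floor_iff)
    then have e: "N_plus x = card {n. n \<le> X \<and> (\<exists>k>0. n = k + totient k)}" unfolding N_plus_def by simp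
    have "x / 2 \<le> real X" unfolding X_def using x2 by linarith
    then have "c * (x / 2) \<le> c * real X" using c0 by (intro mult_left_mono) auto
    then show ?thesis using m unfolding e by simp
  qed
  then show ?thesis using c0 by (intro exI[of _ "c / 2"] conjI exI[of _ x0]) auto
qed

section \<open>The upper bound\<close>

definition phi_ratio :: "nat \<Rightarrow> real" where
  "phi_ratio k = real (totient k) / real k"

definition sieved_ratio :: "nat \<Rightarrow> nat \<Rightarrow> real" where
  "sieved_ratio z k = (\<Prod>p | p \<in> primes_upto z \<and> p dvd k. 1 - 1 / real p)"

lemma prod_one_minus_ge:
  fixes a :: "'a \<Rightarrow> real"
  assumes "finite A" "\<And>x. x \<in> A \<Longrightarrow> 0 \<le> a x \<and> a x \<le> 1"
  shows "1 - (\<Sum>x\<in>A. a x) \<le> (\<Prod>x\<in>A. 1 - a x) \<and> (\<Prod>x\<in>A. 1 - a x) \<le> 1 \<and> 0 \<le> (\<Prod>x\<in>A. 1 - a x)"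
  using assms
proof (induction A)
  case (insert x A)
  let ?p = "\<Prod>x\<in>A. 1 - a x"
  have a: "0 \<le> a x" "a x \<le> 1" using insert.prems by auto
  have IH: "1 - sum a A \<le> ?p" "?p \<le> 1" "0 \<le> ?p" using insert.IH insert.prems by auto
  have "a x * ?p \<le> a x" using mult_left_le[OF IH(2) a(1)] .
  moreover have "0 \<le> a x * ?p" "a x * ?p \<le> ?p" using a IH mult_right_le_one_le[of ?p "a x"] by (auto simp: mult.commute)
  ultimately show ?case using insert.hyps IH by (simp add: left_diff_distrib)
qed simp

lemma phi_ratio_bounds: "0 \<le> phi_ratio k" "phi_ratio k \<le> 1"
  unfolding phi_ratio_def using totient_le[of k] by (auto simp: divide_le_eq)

text \<open>Both ratios share the factors of the primes up to \<open>z\<close>, which are at most 1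
  in product; the product over the larger primes differs from 1 by at most the sum of their
  reciprocals.\<close>

lemma sieved_ratio_diff:
  assumes "k > 0"
  shows "\<bar>sieved_ratio z k - phi_ratio k\<bar> \<le> (\<Sum>p | prime p \<and> z < p \<and> p dvd k. 1 / real p)"
proof -
  let ?a = "\<lambda>p. 1 - 1 / real p"
  define A where "A = {p. p \<in> primes_upto z \<and> p dvd k}"
  define B where "B = {p. prime p \<and> z < p \<and> p dvd k}"
  have fin: "finite A" "finite B" unfolding A_def B_def using assms by (auto intro: finite_subset[of _ "{p. p dvd k}"])
  have "prime_factors k = A \<union> B" "A \<inter> B = {}" using assms unfolding A_def B_def primes_upto_def by (auto simp: prime_factors_dvd)
  then have e: "phi_ratio k = prod ?a A * prod ?a B"
    unfolding phi_ratio_def using assms totient_formula2[of k] fin by (simp add: prod.union_disjoint)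
  have b: "1 - (\<Sum>p\<in>X. 1 / real p) \<le> prod ?a X \<and> prod ?a X \<le> 1 \<and> 0 \<le> prod ?a X" if "finite X" for X
    by (rule prod_one_minus_ge[OF that]) (auto simp: divide_le_eq)
  have "prod ?a A * (1 - prod ?a B) \<le> 1 * (1 - prod ?a B)" using b[OF fin(1)] b[OF fin(2)] by (intro mult_right_mono) auto
  moreover have "0 \<le> prod ?a A * (1 - prod ?a B)" using b[OF fin(1)] b[OF fin(2)] by simp
  ultimately have "\<bar>prod ?a A - prod ?a A * prod ?a B\<bar> \<le> (\<Sum>p\<in>B. 1 / real p)" using b[OF fin(2)] by (simp add: right_diff_distrib)
  then show ?thesis unfolding e sieved_ratio_def A_def[symmetric] B_def[symmetric] .
qed

lemma sum_inverse_squares_tail_le: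
  assumes "z \<ge> 1" "z \<le> n"
  shows "(\<Sum>j\<in>{z<..n}. 1 / (real j * real j)) \<le> 1 / real z - 1 / real n"
  using assms(2)
proof (induction n rule: dec_induct)
  case (step n)
  have n: "n \<ge> 1" using step assms(1) by linarith
  have "{z<..Suc n} = insert (Suc n) {z<..n}" using step by auto
  then have "(\<Sum>j\<in>{z<..Suc n}. 1 / (real j * real j)) = 1 / (real (Suc n) * real (Suc n)) + (\<Sum>j\<in>{z<..n}. 1 / (real j * real j))" by simp
  also have "\<dots> \<le> 1 / (real n * real (Suc n)) + (1 / real z - 1 / real n)"
    using step.IH n by (intro add_mono divide_left_mono mult_mono) auto
  also have "1 / (real n * real (Suc n)) = 1 / real n - 1 / real (Suc n)"
    using n by (subst diff_frac_eq) (auto simp: mult_ac)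
  finally show ?case by simp
qed simp

text \<open>After exchanging the sums, \<open>p\<close> divides at most \<open>n / p\<close> of the
  numbers and costs \<open>n / p^2\<close> in all; the inverse squares beyond \<open>z\<close> sum
  to at most \<open>1 / z\<close>.\<close>

lemma sum_large_primes_le:
  assumes "z \<ge> 1"
  shows "(\<Sum>k<n. \<Sum>p | prime p \<and> z < p \<and> p dvd Suc k. 1 / real p) \<le> real n / real z"
proof (cases "z \<le> n")
  case True
  have "(\<Sum>k<n. \<Sum>p | prime p \<and> z < p \<and> p dvd Suc k. 1 / real p) \<le> (\<Sum>k<n. \<Sum>p\<in>{z<..n}. if p dvd Suc k then 1 / real p else 0)"
  proof (rule sum_mono)
    fix k assume k: "k \<in> {..<n}"
    have "(\<Sum>p | prime p \<and> z < p \<and> p dvd Suc k. 1 / real p) \<le> (\<Sum>p\<in>{p \<in> {z<..n}. p dvd Suc k}. 1 / real p)"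
    proof (rule sum_mono2)
      show "{p. prime p \<and> z < p \<and> p dvd Suc k} \<subseteq> {p \<in> {z<..n}. p dvd Suc k}" using k by (auto dest: dvd_imp_le)
    qed auto
    also have "\<dots> = (\<Sum>p\<in>{z<..n}. if p dvd Suc k then 1 / real p else 0)" by (rule sum.inter_filter) simp
    finally show "(\<Sum>p | prime p \<and> z < p \<and> p dvd Suc k. 1 / real p) \<le> (\<Sum>p\<in>{z<..n}. if p dvd Suc k then 1 / real p else 0)" .
  qed
  also have "\<dots> = (\<Sum>p\<in>{z<..n}. \<Sum>k<n. if p dvd Suc k then 1 / real p else 0)" by (rule sum.swap)
  also have "\<dots> \<le> (\<Sum>p\<in>{z<..n}. real n * (1 / (real p * real p)))"
  proof (rule sum_mono)
    fix p assume p: "p \<in> {z<..n}"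
    have "card {k \<in> {..<n}. p dvd Suc k} = card {k \<in> {1..n}. p dvd k}"
      by (rule bij_betw_same_card[of Suc], rule bij_betw_byWitness[of _ "\<lambda>k. k - 1"]) auto
    also have "\<dots> = n div p" using p by (intro card_multiples_upto) auto
    finally have c: "card {k \<in> {..<n}. p dvd Suc k} = n div p" .
    have "(\<Sum>k<n. if p dvd Suc k then 1 / real p else 0) = real (n div p) * (1 / real p)"
      unfolding sum.inter_filter[symmetric, OF finite_lessThan] using c by simp
    also have "\<dots> \<le> real n / real p * (1 / real p)" by (intro mult_right_mono real_div_le) simp
    finally show "(\<Sum>k<n. if p dvd Suc k then 1 / real p else 0) \<le> real n * (1 / (real p * real p))" by simp
  qed
  also have "\<dots> = real n * (\<Sum>p\<in>{z<..n}. 1 / (real p * real p))" by (simp only: sum_distrib_left)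
  also have "\<dots> \<le> real n * (1 / real z)"
  proof (rule mult_left_mono)
    have "(\<Sum>p\<in>{z<..n}. 1 / (real p * real p)) \<le> 1 / real z - 1 / real n" by (rule sum_inverse_squares_tail_le[OF assms True])
    also have "\<dots> \<le> 1 / real z" by simp
    finally show "(\<Sum>p\<in>{z<..n}. 1 / (real p * real p)) \<le> 1 / real z" .
  qed simp
  finally show ?thesis by simp
next
  case False
  have "(\<Sum>k<n. \<Sum>p | prime p \<and> z < p \<and> p dvd Suc k. 1 / real p) = (\<Sum>k<n. 0)"
  proof (intro sum.cong refl sum.neutral ballI)
    fix k p assume "k \<in> {..<n}" "p \<in> {p. prime p \<and> z < p \<and> p dvd Suc k}"
    then have "p \<le> Suc k" "z < p" "k < n" by (auto dest: dvd_imp_le)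
    then show "1 / real p = 0" using False by simp
  qed
  then show ?thesis by simp
qed

lemma periodic_mean_tendsto:
  fixes f :: "nat \<Rightarrow> real"
  assumes W: "W > 0" and per: "\<And>k. f (k + W) = f k"
  shows "(\<lambda>n. (\<Sum>k<n. f k) / real n) \<longlonglongrightarrow> (\<Sum>k<W. f k) / real W"
proof -
  define m where "m = (\<Sum>k<W. f k) / real W"
  \<comment> \<open>The deviation from the mean is itself periodic in \<open>n\<close>, hence
    bounded.\<close>
  define e where "e n = (\<Sum>k<n. f k) - real n * m" for n
  have e_per: "e (n + W) = e n" for n
  proof (induction n)
    case 0 then show ?case unfolding e_def m_def using W by simp
  next
    case (Suc n) then show ?case unfolding e_def using per[of n] by (simp add: algebra_simps)
  qed
  have "e n = e (n mod W)" for n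
  proof -
    have "e (a + b * W) = e a" for a b by (induction b) (use e_per in \<open>simp_all add: add.assoc[symmetric] add.commute[of W]\<close>)
    from this[of "n mod W" "n div W"] show ?thesis by (simp add: add.commute)
  qed
  then have bd: "\<bar>e n\<bar> \<le> (\<Sum>i<W. \<bar>e i\<bar>)" for n
    using member_le_sum[of "n mod W" "{..<W}" "\<lambda>i. \<bar>e i\<bar>"] W by simp
  have "(\<lambda>n. e n / real n) \<longlonglongrightarrow> 0"
  proof (rule tendsto_rabs_zero_cancel, rule tendsto_sandwich[OF _ _ tendsto_const])
    show "(\<lambda>n. (\<Sum>i<W. \<bar>e i\<bar>) / real n) \<longlonglongrightarrow> 0" by (rule lim_const_over_n)
  qed (auto intro!: always_eventually divide_right_mono bd)
  then have "(\<lambda>n. e n / real n + m) \<longlonglongrightarrow> 0 + m" by (intro tendsto_add tendsto_const)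
  moreover have "eventually (\<lambda>n. e n / real n + m = (\<Sum>k<n. f k) / real n) sequentially"
    using eventually_gt_at_top[of 0] by eventually_elim (simp add: e_def field_simps)
  ultimately show ?thesis unfolding m_def[symmetric] using tendsto_cong[of _ _ sequentially] by fastforce
qed

text \<open>Uniformly in \<open>n\<close>, the mean is within \<open>L / z\<close> of the mean of a
  periodic function, which converges. So the means form a Cauchy sequence, without any description
  of the limit.\<close>

lemma lipschitz_mean_converges:
  fixes h :: "real \<Rightarrow> real"
  assumes L: "\<And>u v. \<bar>h u - h v\<bar> \<le> L * \<bar>u - v\<bar>"
  shows "\<exists>E. (\<lambda>n. (\<Sum>k<n. h (phi_ratio (Suc k))) / real n) \<longlonglongrightarrow> E"
proof -
  define A where "A n = (\<Sum>k<n. h (phi_ratio (Suc k))) / real n" for n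
  define P where "P z n = (\<Sum>k<n. h (sieved_ratio z (Suc k))) / real n" for z n
  have L0: "L \<ge> 0" using L[of 1 0] by (smt (verit) abs_one mult_cancel_left1 diff_zero)
  have close: "\<bar>A n - P z n\<bar> \<le> L / real z" if z: "z \<ge> 1" and n: "n \<ge> 1" for z n
  proof -
    have "\<bar>A n - P z n\<bar> = \<bar>\<Sum>k<n. h (phi_ratio (Suc k)) - h (sieved_ratio z (Suc k))\<bar> / real n"
      unfolding A_def P_def by (simp add: sum_subtractf diff_divide_distrib[symmetric])
    also have "\<dots> \<le> (\<Sum>k<n. L * (\<Sum>p | prime p \<and> z < p \<and> p dvd Suc k. 1 / real p)) / real n"
    proof (intro divide_right_mono order_trans[OF sum_abs] sum_mono)
      fix k
      have "\<bar>h (phi_ratio (Suc k)) - h (sieved_ratio z (Suc k))\<bar> \<le> L * \<bar>sieved_ratio z (Suc k) - phi_ratio (Suc k)\<bar>"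
        using L[of "phi_ratio (Suc k)" "sieved_ratio z (Suc k)"] by (simp add: abs_minus_commute)
      also have "\<dots> \<le> L * (\<Sum>p | prime p \<and> z < p \<and> p dvd Suc k. 1 / real p)" by (intro mult_left_mono sieved_ratio_diff L0) simp
      finally show "\<bar>h (phi_ratio (Suc k)) - h (sieved_ratio z (Suc k))\<bar> \<le> L * (\<Sum>p | prime p \<and> z < p \<and> p dvd Suc k. 1 / real p)" .
    qed simp
    also have "\<dots> = L * (\<Sum>k<n. \<Sum>p | prime p \<and> z < p \<and> p dvd Suc k. 1 / real p) / real n" by (simp only: sum_distrib_left)
    also have "\<dots> \<le> L * (real n / real z) / real n" by (intro divide_right_mono mult_left_mono sum_large_primes_le L0 z) simp
    also have "\<dots> = L / real z" using n by simp
    finally show ?thesis .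
  qed
  have Pconv: "convergent (P z)" for z
  proof -
    define W where "W = \<Prod>(primes_upto z)"
    have W0: "W > 0" unfolding W_def by (rule prod_primes_pos) (auto simp: primes_upto_def)
    have "sieved_ratio z (Suc (k + W)) = sieved_ratio z (Suc k)" for k
    proof -
      have "p dvd Suc (k + W) \<longleftrightarrow> p dvd Suc k" if "p \<in> primes_upto z" for p
      proof -
        have "p dvd W" unfolding W_def using that by (intro dvd_prodI) auto
        then show ?thesis using dvd_add_left_iff[of p W "Suc k"] by simp
      qed
      then show ?thesis unfolding sieved_ratio_def by (intro prod.cong) auto
    qed
    then show ?thesis unfolding P_def convergent_def using periodic_mean_tendsto[OF W0, of "\<lambda>k. h (sieved_ratio z (Suc k))"] by auto
  qed
  have "Cauchy A"
  proof (rule metric_CauchyI)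
    fix e :: real assume e: "e > 0"
    define z where "z = nat \<lceil>4 * L / e\<rceil> + 1"
    have "4 * L / e \<le> real z" unfolding z_def by linarith
    then have zL: "L / real z \<le> e / 4" unfolding z_def using e by (simp add: field_simps)
    obtain M where M: "\<And>m n. m \<ge> M \<Longrightarrow> n \<ge> M \<Longrightarrow> dist (P z m) (P z n) < e / 4"
      using metric_CauchyD[OF convergent_Cauchy[OF Pconv], of "e / 4" z] e by auto
    have "dist (A m) (A n) < e" if "m \<ge> max 1 M" "n \<ge> max 1 M" for m n
    proof -
      have z1: "z \<ge> 1" unfolding z_def by simp
      have "\<bar>P z m - P z n\<bar> < e / 4" using M[of m n] that unfolding dist_real_def by simp
      moreover have "\<bar>A k - P z k\<bar> \<le> e / 4" if "k \<ge> 1" for k by (rule order_trans[OF close[OF z1 that] zL])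
      then have "\<bar>A m - P z m\<bar> \<le> e / 4" "\<bar>A n - P z n\<bar> \<le> e / 4" using that by simp_all
      ultimately show ?thesis unfolding dist_real_def using e by linarith
    qed
    then show "\<exists>M. \<forall>m\<ge>M. \<forall>n\<ge>M. dist (A m) (A n) < e" by blast
  qed
  then show ?thesis unfolding A_def using Cauchy_convergent convergent_def by blast
qed

lemma mean_floor_tendsto:
  fixes S :: "nat \<Rightarrow> real"
  assumes "(\<lambda>n. S n / real n) \<longlonglongrightarrow> E"
  shows "((\<lambda>x::real. S (nat \<lfloor>x\<rfloor>) / x) \<longlongrightarrow> E) at_top"
proof -
  have f: "filterlim (\<lambda>x::real. nat \<lfloor>x\<rfloor>) at_top at_top"
    unfolding filterlim_at_top
  proof
    fix N :: nat
    show "eventually (\<lambda>x::real. N \<le> nat \<lfloor>x\<rfloor>) at_top"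
      using eventually_ge_at_top[of "real N"] by eventually_elim (simp add: le_nat_iff le_floor_iff)
  qed
  have r: "((\<lambda>x::real. real (nat \<lfloor>x\<rfloor>) / x) \<longlongrightarrow> 1) at_top"
  proof (rule tendsto_sandwich)
    show "((\<lambda>x::real. 1 - 1 / x) \<longlongrightarrow> 1) at_top"
      using tendsto_diff[OF tendsto_const tendsto_divide_0[OF tendsto_const filterlim_at_top_imp_at_infinity[OF filterlim_ident]], of 1 1] by simp
    show "eventually (\<lambda>x::real. 1 - 1 / x \<le> real (nat \<lfloor>x\<rfloor>) / x) at_top"
      using eventually_gt_at_top[of 0]
    proof eventually_elim
      case (elim x)
      have "x - 1 \<le> real (nat \<lfloor>x\<rfloor>)" by linarith
      then have "(x - 1) / x \<le> real (nat \<lfloor>x\<rfloor>) / x" using elim by (intro divide_right_mono) auto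
      then show ?case using elim by (simp add: diff_divide_distrib)
    qed
    show "eventually (\<lambda>x::real. real (nat \<lfloor>x\<rfloor>) / x \<le> 1) at_top"
      using eventually_gt_at_top[of 0] by eventually_elim (simp add: divide_le_eq)
  qed (rule tendsto_const)
  have "((\<lambda>x::real. S (nat \<lfloor>x\<rfloor>) / real (nat \<lfloor>x\<rfloor>) * (real (nat \<lfloor>x\<rfloor>) / x)) \<longlongrightarrow> E * 1) at_top"
    by (intro tendsto_mult r filterlim_compose[OF assms f])
  moreover have "eventually (\<lambda>x::real. S (nat \<lfloor>x\<rfloor>) / real (nat \<lfloor>x\<rfloor>) * (real (nat \<lfloor>x\<rfloor>) / x) = S (nat \<lfloor>x\<rfloor>) / x) at_top"
    using eventually_ge_at_top[of 1]
  proof eventually_elim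
    case (elim x)
    then have "nat \<lfloor>x\<rfloor> \<ge> 1" by (simp add: le_nat_iff le_floor_iff)
    then show ?case using elim by simp
  qed
  ultimately show ?thesis using tendsto_cong[of _ _ "at_top :: real filter"] by fastforce
qed

section \<open>The limit distribution of \<open>totient k / k\<close>\<close>

lemma Phi_upto_eq_sum:
  "Phi_upto x u = (\<Sum>k<nat \<lfloor>x\<rfloor>. of_bool (phi_ratio (Suc k) \<le> u)) / x"
proof -
  have "{k::nat. 0 < k \<and> real k \<le> x \<and> real (totient k) / real k \<le> u} = Suc ` {k \<in> {..<nat \<lfloor>x\<rfloor>}. phi_ratio (Suc k) \<le> u}" (is "?A = ?B")
  proof (intro equalityI subsetI)
    fix k assume k: "k \<in> ?A"
    then obtain j where j: "k = Suc j" by (cases k) auto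
    have "j < nat \<lfloor>x\<rfloor>" using k j by (auto simp: Suc_le_eq[symmetric] le_nat_iff le_floor_iff)
    then show "k \<in> ?B" using k j by (auto simp: phi_ratio_def)
  next
    fix k assume "k \<in> ?B"
    then obtain j where j: "k = Suc j" "Suc j \<le> nat \<lfloor>x\<rfloor>" "phi_ratio (Suc j) \<le> u" by auto
    have "real (Suc j) \<le> x" using j(2) by linarith
    then show "k \<in> ?A" using j by (simp add: phi_ratio_def)
  qed
  then have "card {k::nat. 0 < k \<and> real k \<le> x \<and> real (totient k) / real k \<le> u} = card {k \<in> {..<nat \<lfloor>x\<rfloor>}. phi_ratio (Suc k) \<le> u}"
    by (simp add: card_image)
  also have "\<dots> = (\<Sum>k<nat \<lfloor>x\<rfloor>. of_bool (phi_ratio (Suc k) \<le> u))" by (simp add: Int_def)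
  finally show ?thesis unfolding Phi_upto_def by simp
qed

text \<open>A Lipschitz stand-in for an indicator: 1 up to \<open>a\<close>, 0 from \<open>b\<close>
  on, linear in between.\<close>

definition ramp :: "real \<Rightarrow> real \<Rightarrow> real \<Rightarrow> real" where
  "ramp a b u = max 0 (min 1 ((b - u) / (b - a)))"

lemma ramp_lipschitz:
  assumes "a < b"
  shows "\<bar>ramp a b u - ramp a b v\<bar> \<le> 1 / (b - a) * \<bar>u - v\<bar>"
proof -
  have "\<bar>ramp a b u - ramp a b v\<bar> \<le> \<bar>(b - u) / (b - a) - (b - v) / (b - a)\<bar>" unfolding ramp_def by linarith
  also have "\<dots> = \<bar>(v - u) / (b - a)\<bar>" by (simp add: diff_divide_distrib[symmetric])
  also have "\<dots> = 1 / (b - a) * \<bar>u - v\<bar>" using assms by (simp add: abs_divide abs_minus_commute)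
  finally show ?thesis .
qed

lemma ramp_bounds:
  assumes "a < b"
  shows "0 \<le> ramp a b u" "ramp a b u \<le> 1" "of_bool (u \<le> a) \<le> ramp a b u" "ramp a b u \<le> of_bool (u \<le> b)"
  using assms unfolding ramp_def by (auto simp: field_simps)

lemma ramp_mono:
  assumes "a < b" "a' < b'" "b \<le> a'"
  shows "ramp a b u \<le> ramp a' b' u"
  using ramp_bounds(4)[OF assms(1), of u] ramp_bounds(3)[OF assms(2), of u] ramp_bounds(1)[OF assms(2), of u] assms(3)
  by (cases "u \<le> b") auto

text \<open>Convergence holds at the continuity points of the limit; the exceptional countable set does not
affect the integral.\<close>
theorem Phi_upto_tendsto_off_countable:
  "\<exists>F D. mono F \<and> countable D \<and> (\<forall>u. 0 \<le> F u \<and> F u \<le> 1) \<and> (\<forall>u. u \<notin> D \<longrightarrow> ((\<lambda>x. Phi_upto x u) \<longlongrightarrow> F u) at_top)"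
proof -
  define S where "S a b n = (\<Sum>k<n. ramp a b (phi_ratio (Suc k)))" for a b n
  have "\<exists>E. (\<lambda>n. S a b n / real n) \<longlonglongrightarrow> E" if "a < b" for a b
    unfolding S_def by (rule lipschitz_mean_converges[OF ramp_lipschitz[OF that]])
  then obtain E where E0: "\<And>a b. a < b \<Longrightarrow> (\<lambda>n. S a b n / real n) \<longlonglongrightarrow> E a b" by metis
  have E: "((\<lambda>x. S a b (nat \<lfloor>x\<rfloor>) / x) \<longlongrightarrow> E a b) at_top" if "a < b" for a b by (rule mean_floor_tendsto[OF E0[OF that]])
  have E_mono: "E a b \<le> E a' b'" if "a < b" "a' < b'" "b \<le> a' \<or> a \<le> a' \<and> b = b'" for a b a' b'
  proof (rule LIMSEQ_le[OF E0 E0])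
    have "ramp a b u \<le> ramp a' b' u" for u
      using that(3)
    proof
      assume c: "a \<le> a' \<and> b = b'"
      show ?thesis
      proof (cases "u \<le> a'")
        case True
        then show ?thesis using ramp_bounds(2)[OF that(1), of u] ramp_bounds(3)[OF that(2), of u] by simp
      next
        case False
        show ?thesis
        proof (cases "u \<le> b")
          case True
          have "(b - u) / (b - a) \<le> (b - u) / (b - a')" using True c that by (intro divide_left_mono) auto
          then have "(b - u) / (b - a) \<le> (b' - u) / (b' - a')" using c by simp
          then show ?thesis unfolding ramp_def by (intro max.mono min.mono) auto
        next
          case False
          then show ?thesis using ramp_bounds(4)[OF that(1), of u] ramp_bounds(1)[OF that(2), of u] by simp
        qed
      qed
    qed (use ramp_mono[OF that(1,2)] in blast)
    then show "\<exists>N. \<forall>n\<ge>N. S a b n / real n \<le> S a' b' n / real n"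
      unfolding S_def by (intro exI allI impI divide_right_mono sum_mono) auto
  qed (use that in auto)
  have E01: "0 \<le> E a b" "E a b \<le> 1" if "a < b" for a b
  proof -
    show "0 \<le> E a b" by (rule LIMSEQ_le_const[OF E0[OF that]]) (auto simp: S_def intro!: divide_nonneg_nonneg sum_nonneg ramp_bounds[OF that])
    have "S a b n / real n \<le> 1" for n
    proof -
      have "S a b n \<le> (\<Sum>k<n. 1)" unfolding S_def by (intro sum_mono ramp_bounds[OF that])
      then show ?thesis by (simp add: divide_le_eq)
    qed
    then show "E a b \<le> 1" by (intro LIMSEQ_le_const2[OF E0[OF that]]) auto
  qed
  \<comment> \<open>Ramps starting at \<open>u\<close> bound the upper limit at every
    \<open>u\<close>. The lower limit needs ramps that end at \<open>u\<close>, which only compares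
    with \<open>F\<close> at points to the left; this is where continuity comes in.\<close>
  define F where "F u = (INF b\<in>{u<..}. E u b)" for u
  have bd: "bdd_below (E u ` {u<..})" for u by (rule bdd_belowI[of _ 0]) (auto intro: E01)
  have Fle: "F u \<le> E u b" if "u < b" for u b unfolding F_def using that by (intro cINF_lower bd) auto
  have Fge: "c \<le> F u" if "\<And>b. u < b \<Longrightarrow> c \<le> E u b" for c u unfolding F_def by (rule cINF_greatest) (use that in auto)
  have "mono F"
  proof (rule monoI)
    fix u v :: real assume uv: "u \<le> v"
    show "F u \<le> F v"
    proof (rule Fge)
      fix b assume b: "v < b"
      then have "F u \<le> E u b" using uv by (intro Fle) auto
      also have "\<dots> \<le> E v b" using uv b by (intro E_mono) auto
      finally show "F u \<le> E v b" .
    qed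
  qed
  moreover have "0 \<le> F u \<and> F u \<le> 1" for u
  proof
    show "0 \<le> F u" by (rule Fge) (rule E01(1))
    show "F u \<le> 1" by (rule order_trans[OF Fle E01(2)[of u "u + 1"]]) simp_all
  qed
  moreover have "((\<lambda>x. Phi_upto x u) \<longlongrightarrow> F u) at_top" if cont: "isCont F u" for u
  proof (rule order_tendstoI)
    fix c assume c: "c < F u"
    have "eventually (\<lambda>v. c < F v) (at_left u)"
    proof (rule order_tendstoD(1)[OF _ c])
      show "(F \<longlongrightarrow> F u) (at_left u)" using cont unfolding isCont_def filterlim_at_split by blast
    qed
    moreover have "eventually (\<lambda>v. v < u) (at_left u)" by (simp add: eventually_at_filter)
    ultimately have "eventually (\<lambda>v. c < F v \<and> v < u) (at_left u)" by (rule eventually_conj)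
    then obtain a where a: "a < u" "c < F a" using eventually_happens'[OF trivial_limit_at_left_real] by blast
    then have "c < E a u" using Fle[OF a(1)] by linarith
    then have "eventually (\<lambda>x. c < S a u (nat \<lfloor>x\<rfloor>) / x) at_top" by (rule order_tendstoD(1)[OF E[OF a(1)]])
    then show "eventually (\<lambda>x. c < Phi_upto x u) at_top"
      using eventually_gt_at_top[of 0]
    proof eventually_elim
      case (elim x)
      have "S a u (nat \<lfloor>x\<rfloor>) / x \<le> Phi_upto x u"
        unfolding S_def Phi_upto_eq_sum using elim ramp_bounds(4)[OF a(1)] by (intro divide_right_mono sum_mono) auto
      then show ?case using elim by linarith
    qed
  next
    fix c assume c: "F u < c"
    then obtain b where b: "u < b" "E u b < c" using Fge[of u c] not_less by blast
    have "eventually (\<lambda>x. S u b (nat \<lfloor>x\<rfloor>) / x < c) at_top" by (rule order_tendstoD(2)[OF E[OF b(1)] b(2)])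
    then show "eventually (\<lambda>x. Phi_upto x u < c) at_top"
      using eventually_gt_at_top[of 0]
    proof eventually_elim
      case (elim x)
      have "Phi_upto x u \<le> S u b (nat \<lfloor>x\<rfloor>) / x"
        unfolding S_def Phi_upto_eq_sum using elim ramp_bounds(3)[OF b(1)] by (intro divide_right_mono sum_mono) auto
      then show ?case using elim by linarith
    qed
  qed
  moreover have "countable {u. \<not> isCont F u}" using \<open>mono F\<close> by (rule mono_ctble_discont)
  ultimately show ?thesis by (intro exI[of _ F] exI[of _ "{u. \<not> isCont F u}"]) auto
qed

text \<open>Values are replaced by arguments \<open>k\<close>. Those up to \<open>x / 2\<close> all
  qualify because \<open>totient k \<le> k\<close>. A larger one has \<open>v = x / k - 1\<close> in
  some interval from \<open>t j\<close> to \<open>t (Suc j)\<close>, which confines \<open>k\<close>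
  and gives \<open>phi_ratio k \<le> t (Suc j)\<close>.\<close>

lemma N_plus_partition:
  fixes t :: "nat \<Rightarrow> real"
  assumes x: "x > 0" and t: "t 0 = 0" "1 \<le> t n" "\<And>j. j < n \<Longrightarrow> t j \<le> t (Suc j)"
  shows "real (N_plus x) \<le> x / 2 + (\<Sum>j<n. x / (1 + t j) * Phi_upto (x / (1 + t j)) (t (Suc j)) -
    x / (1 + t (Suc j)) * Phi_upto (x / (1 + t (Suc j))) (t (Suc j)))"
proof -
  define K where "K = {k::nat. 0 < k \<and> real (k + totient k) \<le> x}"
  define A where "A X u = {k::nat. 0 < k \<and> real k \<le> X \<and> phi_ratio k \<le> u}" for X u :: real
  have t0: "0 \<le> t j" if "j \<le> n" for j using that by (induction j) (use t in \<open>auto intro: order_trans\<close>)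
  have fin: "finite {k::nat. real k \<le> X \<and> P k}" for X P
    by (rule finite_subset[of _ "{..nat \<lfloor>X\<rfloor>}"]) (auto simp: le_nat_floor)
  have finA: "finite (A X u)" for X u unfolding A_def by (rule finite_subset[OF _ fin[of X "\<lambda>_. True"]]) auto
  have finK: "finite K" unfolding K_def by (rule finite_subset[OF _ fin[of x "\<lambda>_. True"]]) auto
  have "{n::nat. real n \<le> x \<and> (\<exists>k::nat. 0 < k \<and> n = k + totient k)} = (\<lambda>k. k + totient k) ` K" unfolding K_def by auto
  then have "N_plus x \<le> card K" unfolding N_plus_def using card_image_le[OF finK] by simp
  also have "\<dots> \<le> card ({k. 0 < k \<and> real k \<le> x / 2} \<union> (\<Union>j<n. A (x / (1 + t j)) (t (Suc j)) - A (x / (1 + t (Suc j))) (t (Suc j))))"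
  proof (rule card_mono)
    show "finite ({k::nat. 0 < k \<and> real k \<le> x / 2} \<union> (\<Union>j<n. A (x / (1 + t j)) (t (Suc j)) - A (x / (1 + t (Suc j))) (t (Suc j))))"
      using finA finite_subset[OF _ fin[of "x / 2" "\<lambda>_. True"]] by (auto intro: finite_subset[OF _ fin[of "x / 2" "\<lambda>_. True"]])
    show "K \<subseteq> {k. 0 < k \<and> real k \<le> x / 2} \<union> (\<Union>j<n. A (x / (1 + t j)) (t (Suc j)) - A (x / (1 + t (Suc j))) (t (Suc j)))"
    proof
      fix k assume "k \<in> K"
      then have k: "real k > 0" "real k + real (totient k) \<le> x" unfolding K_def by auto
      define v where "v = x / real k - 1"
      have g: "phi_ratio k \<le> v" unfolding v_def phi_ratio_def using k by (simp add: field_simps)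
      show "k \<in> {k. 0 < k \<and> real k \<le> x / 2} \<union> (\<Union>j<n. A (x / (1 + t j)) (t (Suc j)) - A (x / (1 + t (Suc j))) (t (Suc j)))"
      proof (cases "real k \<le> x / 2")
        case False
        then have "v < 1" unfolding v_def using k by (simp add: field_simps)
        then have ex: "v < t n" using t(2) by linarith
        define i where "i = (LEAST i. v < t i)"
        have i: "v < t i" unfolding i_def using ex by (rule LeastI)
        have i_n: "i \<le> n" unfolding i_def using ex by (rule Least_le)
        have "i \<noteq> 0" using i t(1) g phi_ratio_bounds(1)[of k] by (intro notI) simp
        then obtain j where j: "i = Suc j" by (cases i) auto
        have "\<not> v < t j" using not_less_Least[of j "\<lambda>i. v < t i"] j unfolding i_def by simp
        then have tj: "t j \<le> v" by simp
        have jn: "j < n" using i_n j by simp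
        have p: "1 + t j > 0" "1 + t (Suc j) > 0" using t0[of j] t0[of "Suc j"] jn by auto
        have "real k \<le> x / (1 + t j)" using tj k p unfolding v_def by (simp add: field_simps)
        moreover have "\<not> real k \<le> x / (1 + t (Suc j))" using i k p unfolding v_def j by (simp add: field_simps)
        ultimately have "k \<in> A (x / (1 + t j)) (t (Suc j)) - A (x / (1 + t (Suc j))) (t (Suc j))"
          unfolding A_def using k g i j by simp
        then show ?thesis using jn by blast
      qed (use k in simp)
    qed
  qed
  also have "\<dots> \<le> card {k::nat. 0 < k \<and> real k \<le> x / 2} + (\<Sum>j<n. card (A (x / (1 + t j)) (t (Suc j)) - A (x / (1 + t (Suc j))) (t (Suc j))))"
    by (intro order_trans[OF card_Un_le] add_left_mono card_UN_le) simp
  finally have "real (N_plus x) \<le> real (card {k::nat. 0 < k \<and> real k \<le> x / 2} + (\<Sum>j<n. card (A (x / (1 + t j)) (t (Suc j)) - A (x / (1 + t (Suc j))) (t (Suc j)))))"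
    by (simp only: of_nat_le_iff)
  also have "\<dots> = real (card {k::nat. 0 < k \<and> real k \<le> x / 2}) + (\<Sum>j<n. real (card (A (x / (1 + t j)) (t (Suc j)) - A (x / (1 + t (Suc j))) (t (Suc j)))))" by simp
  also have "\<dots> \<le> x / 2 + (\<Sum>j<n. x / (1 + t j) * Phi_upto (x / (1 + t j)) (t (Suc j)) -
    x / (1 + t (Suc j)) * Phi_upto (x / (1 + t (Suc j))) (t (Suc j)))"
  proof (intro add_mono sum_mono)
    have "card {k::nat. 0 < k \<and> real k \<le> x / 2} \<le> card {1..nat \<lfloor>x / 2\<rfloor>}" by (intro card_mono) (auto simp: le_nat_floor)
    then show "real (card {k::nat. 0 < k \<and> real k \<le> x / 2}) \<le> x / 2" using x by simp linarith
    fix j assume j: "j \<in> {..<n}"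
    have p: "1 + t j > 0" "1 + t (Suc j) > 0" using t0[of j] t0[of "Suc j"] j by auto
    have e: "X * Phi_upto X u = real (card (A X u))" if "X > 0" for X u
      using that unfolding Phi_upto_def A_def phi_ratio_def by simp
    have "x / (1 + t (Suc j)) \<le> x / (1 + t j)" using p x t(3)[of j] j by (intro divide_left_mono) auto
    then have sub: "A (x / (1 + t (Suc j))) (t (Suc j)) \<subseteq> A (x / (1 + t j)) (t (Suc j))" unfolding A_def by auto
    have "real (card (A (x / (1 + t j)) (t (Suc j)) - A (x / (1 + t (Suc j))) (t (Suc j)))) =
       real (card (A (x / (1 + t j)) (t (Suc j)))) - real (card (A (x / (1 + t (Suc j))) (t (Suc j))))"
      using card_mono[OF finA sub] by (simp add: card_Diff_subset[OF finA sub] of_nat_diff)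
    then show "real (card (A (x / (1 + t j)) (t (Suc j)) - A (x / (1 + t (Suc j))) (t (Suc j)))) \<le>
      x / (1 + t j) * Phi_upto (x / (1 + t j)) (t (Suc j)) - x / (1 + t (Suc j)) * Phi_upto (x / (1 + t (Suc j))) (t (Suc j))"
      using e[of "x / (1 + t j)" "t (Suc j)"] e[of "x / (1 + t (Suc j))" "t (Suc j)"] p x by simp
  qed
  finally show ?thesis .
qed

section \<open>Riemann sums and the integral\<close>

lemma mono_weighted_integrable:
  assumes "mono F" "\<And>u. 0 \<le> F u \<and> F u \<le> (1::real)" "0 \<le> a"
  shows "(\<lambda>t. F t / (1 + t)\<^sup>2) integrable_on {a..b}"
proof (rule measurable_bounded_by_integrable_imp_integrable)
  have "(\<lambda>t. F t / (1 + t)\<^sup>2) \<in> borel_measurable borel" using borel_measurable_mono[OF assms(1)] by measurable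
  then have "(\<lambda>t. F t / (1 + t)\<^sup>2) \<in> borel_measurable lebesgue" by (simp add: measurable_completion)
  then show "(\<lambda>t. F t / (1 + t)\<^sup>2) \<in> borel_measurable (lebesgue_on {a..b})" by (rule measurable_restrict_space1)
  show "(\<lambda>t. 1::real) integrable_on {a..b}" by (rule integrable_const_ivl)
  show "norm (F t / (1 + t)\<^sup>2) \<le> 1" if "t \<in> {a..b}" for t
  proof -
    have "1 \<le> (1 + t)\<^sup>2" using that assms(3) by (intro one_le_power) auto
    then show ?thesis using assms(2)[of t] by (simp add: divide_le_eq)
  qed
qed simp

text \<open>Replacing \<open>F (t (Suc j))\<close> by \<open>F (t j)\<close> costs
  \<open>\<delta>\<close> times a telescoping sum of increments of \<open>F\<close>, which is at
  most 1. The last point may exceed 1 by \<open>\<delta>\<close>, and the integral over that excess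
  is at most another \<open>\<delta>\<close>.\<close>

lemma riemann_sum_le_integral:
  fixes t :: "nat \<Rightarrow> real"
  assumes F: "mono F" "\<And>u. 0 \<le> F u \<and> F u \<le> (1::real)"
    and t: "t 0 = 0" "1 \<le> t n" "t n \<le> 1 + \<delta>" "\<And>j. j < n \<Longrightarrow> t j \<le> t (Suc j) \<and> t (Suc j) \<le> t j + \<delta>"
  shows "(\<Sum>j<n. F (t (Suc j)) * (1 / (1 + t j) - 1 / (1 + t (Suc j)))) \<le> integral {0..1} (\<lambda>t. F t / (1 + t)\<^sup>2) + 2 * \<delta>"
proof -
  let ?f = "\<lambda>t. F t / (1 + t)\<^sup>2"
  define w where "w j = 1 / (1 + t j) - 1 / (1 + t (Suc j))" for j
  note int = mono_weighted_integrable[OF F]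
  have t0: "0 \<le> t j" if "j \<le> n" for j using that by (induction j) (use t in \<open>auto intro: order_trans\<close>)
  have d0: "\<delta> \<ge> 0" using t(2,3) by linarith
  have w: "0 \<le> w j" "w j \<le> \<delta>" if "j < n" for j
  proof -
    have p: "0 \<le> t j" "0 \<le> t (Suc j)" "t j \<le> t (Suc j)" using t0[of j] t0[of "Suc j"] t(4)[OF that] that by auto
    have e: "w j = (t (Suc j) - t j) / ((1 + t j) * (1 + t (Suc j)))" unfolding w_def using p by (simp add: field_simps)
    show "0 \<le> w j" unfolding e using p by (intro divide_nonneg_nonneg) auto
    have "(1 + t j) * (1 + t (Suc j)) \<ge> 1 * 1" using p by (intro mult_mono) auto
    then have "w j \<le> (t (Suc j) - t j) / 1" unfolding e using p by (intro divide_left_mono) auto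
    then have "w j \<le> t (Suc j) - t j" by simp
    then show "w j \<le> \<delta>" using t(4)[OF that] by linarith
  qed
  have I: "F a * (1 / (1 + a) - 1 / (1 + b)) \<le> integral {a..b} ?f" if ab: "0 \<le> a" "a \<le> b" for a b
  proof -
    have "((\<lambda>t. 1 / (1 + t)\<^sup>2) has_integral (- 1 / (1 + b)) - (- 1 / (1 + a))) {a..b}"
    proof (rule fundamental_theorem_of_calculus[OF ab(2)])
      fix u assume "u \<in> {a..b}"
      then have "1 + u \<noteq> 0" using ab by auto
      then have "((\<lambda>t. - 1 / (1 + t)) has_real_derivative 1 / (1 + u)\<^sup>2) (at u within {a..b})"
        by (auto intro!: derivative_eq_intros simp: power2_eq_square)
      then show "((\<lambda>t. - 1 / (1 + t)) has_vector_derivative 1 / (1 + u)\<^sup>2) (at u within {a..b})"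
        by (simp add: has_real_derivative_iff_has_vector_derivative)
    qed
    from has_integral_mult_right[OF this, of "F a"]
    have h: "((\<lambda>t. F a * (1 / (1 + t)\<^sup>2)) has_integral F a * (1 / (1 + a) - 1 / (1 + b))) {a..b}" by simp
    show ?thesis
    proof (rule has_integral_le[OF h integrable_integral[OF int[OF ab(1)]]])
      fix u assume "u \<in> {a..b}"
      then have "F a \<le> F u" using monoD[OF F(1)] by simp
      then show "F a * (1 / (1 + u)\<^sup>2) \<le> F u / (1 + u)\<^sup>2" by (simp add: divide_right_mono)
    qed
  qed
  have lower: "(\<Sum>j<m. F (t j) * w j) \<le> integral {0..t m} ?f" if "m \<le> n" for m
    using that
  proof (induction m)
    case 0 then show ?case using t(1) by simp
  next
    case (Suc m)
    have tm: "0 \<le> t m" "t m \<le> t (Suc m)" using t0[of m] t(4)[of m] Suc.prems by auto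
    have "(\<Sum>j<Suc m. F (t j) * w j) \<le> integral {0..t m} ?f + integral {t m..t (Suc m)} ?f"
      using Suc.IH Suc.prems I[OF tm] unfolding w_def by simp
    also have "\<dots> = integral {0..t (Suc m)} ?f" by (rule Henstock_Kurzweil_Integration.integral_combine[OF tm int]) simp
    finally show ?case .
  qed
  have "integral {0..t n} ?f = integral {0..1} ?f + integral {1..t n} ?f"
    by (rule Henstock_Kurzweil_Integration.integral_combine[symmetric, OF _ t(2) int]) auto
  also have "integral {1..t n} ?f \<le> integral {1..t n} (\<lambda>_. 1)"
  proof (rule integral_le[OF int integrable_const_ivl])
    show "?f u \<le> 1" if "u \<in> {1..t n}" for u
    proof -
      have "1 \<le> (1 + u)\<^sup>2" using that by (intro one_le_power) auto
      then show ?thesis using F(2)[of u] by (simp add: divide_le_eq)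
    qed
  qed simp
  also have "\<dots> \<le> \<delta>" using t(2,3) by simp
  finally have up: "integral {0..t n} ?f \<le> integral {0..1} ?f + \<delta>" by simp
  have "(\<Sum>j<n. F (t (Suc j)) * w j) = (\<Sum>j<n. F (t j) * w j) + (\<Sum>j<n. (F (t (Suc j)) - F (t j)) * w j)"
    by (simp add: sum.distrib[symmetric] algebra_simps)
  also have "(\<Sum>j<n. (F (t (Suc j)) - F (t j)) * w j) \<le> (\<Sum>j<n. (F (t (Suc j)) - F (t j)) * \<delta>)"
    using w t(4) monoD[OF F(1)] by (intro sum_mono mult_left_mono) auto
  also have "\<dots> = (F (t n) - F (t 0)) * \<delta>" unfolding sum_distrib_right[symmetric] sum_lessThan_telescope[of "\<lambda>j. F (t j)" n] ..
  also have "\<dots> \<le> 1 * \<delta>" using F(2)[of "t n"] F(2)[of "t 0"] d0 by (intro mult_right_mono) auto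
  finally show ?thesis using lower[of n] up unfolding w_def by simp
qed

theorem N_plus_upper:
  "\<exists>\<epsilon> :: real \<Rightarrow> real. \<epsilon> \<in> o[at_top](\<lambda>_. 1) \<and>
      (\<forall>\<^sub>F x in at_top.
        real (N_plus x) \<le> (1 / 2 + integral {0..1} (\<lambda>t. Phi t / (1 + t)\<^sup>2) + \<epsilon> x) * x)"
proof -
  obtain F D where F: "mono F" "\<And>u. 0 \<le> F u \<and> F u \<le> (1::real)" and D: "countable (D :: real set)"
    and lim: "\<And>u. u \<notin> D \<Longrightarrow> ((\<lambda>x. Phi_upto x u) \<longlongrightarrow> F u) at_top" using Phi_upto_tendsto_off_countable by metis
  have negD: "negligible D"
    using negligible_countable_Union[of "(\<lambda>x. {x}) ` D"] D by auto
  define I where "I = integral {0..1} (\<lambda>t. Phi t / (1 + t)\<^sup>2)"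
  have "I = integral {0..1} (\<lambda>t. F t / (1 + t)\<^sup>2)"
    unfolding I_def
  proof (rule integral_spike[OF negD])
    fix u assume "u \<in> {0..1} - D"
    \<comment> \<open>Off \<open>D\<close> the limit exists, so the total operator
      \<open>Lim\<close> returns it.\<close>
    then have "Phi u = F u" unfolding Phi_def using lim[of u] by (intro tendsto_Lim) auto
    then show "F u / (1 + u)\<^sup>2 = Phi u / (1 + u)\<^sup>2" by simp
  qed
  note I_eq = this
  have ev: "eventually (\<lambda>x. real (N_plus x) / x < 1 / 2 + I + e) at_top" if e: "e > 0" for e
  proof -
    \<comment> \<open>This makes the error \<open>2 * \<delta> = 4 / n\<close> of the Riemann sum at
      most \<open>e / 2\<close>.\<close>
    define n where "n = nat \<lceil>8 / e\<rceil> + 1"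
    have n0: "n > 0" unfolding n_def by simp
    have "8 / e \<le> real n" "real n \<noteq> 8 / e" unfolding n_def by linarith+
    then have ne: "4 * (2 / real n) < 8 * e / 8 + e" using e n0 by (simp add: field_simps)
    \<comment> \<open>An open interval is uncountable, so each cutting point can be chosen off
      \<open>D\<close>; the last one then lands slightly beyond 1.\<close>
    have "\<exists>s. real j / real n < s \<and> s < (real j + 1) / real n \<and> s \<notin> D" for j
    proof -
      have "real j / real n < (real j + 1) / real n" using n0 by (simp add: divide_strict_right_mono)
      then have "uncountable {real j / real n<..<(real j + 1) / real n}" by (simp add: uncountable_open_interval)
      then have "\<not> {real j / real n<..<(real j + 1) / real n} \<subseteq> D" using D countable_subset by blast
      then show ?thesis by auto
    qed
    then obtain s where s: "\<And>j. real j / real n < s j \<and> s j < (real j + 1) / real n \<and> s j \<notin> D" by metis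
    \<comment> \<open>The distribution functions are evaluated only at the points
      \<open>t (Suc j)\<close>, so the first point may be 0 even if 0 lies in
      \<open>D\<close>.\<close>
    define t where "t j = (if j = 0 then 0 else s j)" for j
    define \<delta> where "\<delta> = 2 / real n"
    have lo: "real j / real n \<le> t j" and hi: "t j < (real j + 1) / real n" for j using s[of j] n0 unfolding t_def by (auto simp: less_imp_le)
    have t: "t 0 = 0" "1 \<le> t n" "t n \<le> 1 + \<delta>" "\<And>j. j < n \<Longrightarrow> t j \<le> t (Suc j) \<and> t (Suc j) \<le> t j + \<delta>"
    proof -
      show "t 0 = 0" by (simp add: t_def)
      show "1 \<le> t n" using lo[of n] n0 by simp
      have "1 / real n \<le> 2 / real n" by (simp add: divide_right_mono)
      then show "t n \<le> 1 + \<delta>" using hi[of n] n0 unfolding \<delta>_def by (simp add: add_divide_distrib)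
      show "t j \<le> t (Suc j) \<and> t (Suc j) \<le> t j + \<delta>" for j
        using lo[of j] lo[of "Suc j"] hi[of j] hi[of "Suc j"] unfolding \<delta>_def by (simp add: add_divide_distrib)
    qed
    have tS: "t (Suc j) \<notin> D" for j using s[of "Suc j"] by (simp add: t_def)
    have t0: "0 \<le> t j" for j using lo[of j] by (rule order_trans[rotated]) simp
    define U where "U x = 1 / 2 + (\<Sum>j<n. Phi_upto (x / (1 + t j)) (t (Suc j)) / (1 + t j) -
       Phi_upto (x / (1 + t (Suc j))) (t (Suc j)) / (1 + t (Suc j)))" for x
    have sc: "filterlim (\<lambda>x. x / (1 + t j)) at_top at_top" for j
      unfolding filterlim_at_top
    proof
      fix Z :: real
      show "eventually (\<lambda>x. Z \<le> x / (1 + t j)) at_top"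
        using eventually_ge_at_top[of "Z * (1 + t j)"] by eventually_elim (use t0[of j] in \<open>simp add: pos_le_divide_eq\<close>)
    qed
    have "(U \<longlongrightarrow> 1 / 2 + (\<Sum>j<n. F (t (Suc j)) / (1 + t j) - F (t (Suc j)) / (1 + t (Suc j)))) at_top"
      unfolding U_def
      by (intro tendsto_add tendsto_const tendsto_sum tendsto_diff tendsto_divide filterlim_compose[OF lim[OF tS] sc])
        (use t0 in \<open>simp_all add: add_nonneg_eq_0_iff\<close>)
    moreover have "1 / 2 + (\<Sum>j<n. F (t (Suc j)) / (1 + t j) - F (t (Suc j)) / (1 + t (Suc j))) < 1 / 2 + I + e"
    proof -
      have "(\<Sum>j<n. F (t (Suc j)) / (1 + t j) - F (t (Suc j)) / (1 + t (Suc j))) =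
        (\<Sum>j<n. F (t (Suc j)) * (1 / (1 + t j) - 1 / (1 + t (Suc j))))" by (simp add: right_diff_distrib)
      also have "\<dots> \<le> I + 2 * \<delta>" unfolding I_eq by (rule riemann_sum_le_integral[OF F t])
      also have "\<dots> < I + e" using ne e unfolding \<delta>_def by simp
      finally show ?thesis by simp
    qed
    ultimately have "eventually (\<lambda>x. U x < 1 / 2 + I + e) at_top" by (rule order_tendstoD(2))
    then show ?thesis using eventually_gt_at_top[of 0]
    proof eventually_elim
      case (elim x)
      have "real (N_plus x) / x \<le> (x / 2 + (\<Sum>j<n. x / (1 + t j) * Phi_upto (x / (1 + t j)) (t (Suc j)) -
          x / (1 + t (Suc j)) * Phi_upto (x / (1 + t (Suc j))) (t (Suc j)))) / x"
        using elim t by (intro divide_right_mono N_plus_partition) auto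
      also have "\<dots> = U x" unfolding U_def using elim by (simp add: add_divide_distrib diff_divide_distrib sum_divide_distrib)
      finally show ?case using elim by linarith
    qed
  qed
  \<comment> \<open>Truncating at 0 discards negative deviations, on which the upper estimates say
    nothing; the remainder falls below every positive \<open>a\<close>.\<close>
  define \<epsilon> where "\<epsilon> x = max 0 (real (N_plus x) / x - (1 / 2 + I))" for x
  have "(\<epsilon> \<longlongrightarrow> 0) at_top"
  proof (rule order_tendstoI)
    fix a :: real assume "a < 0"
    then show "eventually (\<lambda>x. a < \<epsilon> x) at_top" unfolding \<epsilon>_def by (simp add: less_max_iff_disj)
  next
    fix a :: real assume "0 < a"
    then show "eventually (\<lambda>x. \<epsilon> x < a) at_top" using ev[of a] unfolding \<epsilon>_def by (auto elim!: eventually_mono)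
  qed
  then have "\<epsilon> \<in> o[at_top](\<lambda>_. 1)" by (intro smalloI_tendsto) auto
  moreover have "\<forall>\<^sub>F x in at_top. real (N_plus x) \<le> (1 / 2 + I + \<epsilon> x) * x"
    using eventually_gt_at_top[of 0]
  proof eventually_elim
    case (elim x)
    have "real (N_plus x) / x \<le> 1 / 2 + I + \<epsilon> x" unfolding \<epsilon>_def by linarith
    then show ?case using elim by (simp add: pos_divide_le_eq)
  qed
  ultimately show ?thesis unfolding I_def by blast
qed

theorem theorem4:
  shows "(\<exists>c::real. c > 0 \<and> (\<exists>x0::real. \<forall>x\<ge>x0. real (N_plus x) \<ge> c * x)) \<and>
    (\<exists>\<epsilon> :: real \<Rightarrow> real. \<epsilon> \<in> o[at_top](\<lambda>_. 1) \<and>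
      (\<forall>\<^sub>F x in at_top.
        real (N_plus x) \<le> (1 / 2 + integral {0..1} (\<lambda>t. Phi t / (1 + t)\<^sup>2) + \<epsilon> x) * x))"
  using N_plus_lower N_plus_upper by (rule conjI)

end
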